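(* Let $n\in\mathbb{N}$. If $\mathcal{R}(Ct_{\mathbb{N}}(n))$ is zero-dimensional, then $Ct^S_{\mathbb{R}}(n+1)=Ct^E_{\mathbb{R}}(n+1)$.
   Context: For a topological space $T$, $\mathcal{R}(T)$ is the topology on the same set whose open sets are exactly the sets $f^{-1}(O)$ with $f:T\to\mathbb{R}$ continuous and $O\subseteq\mathbb{R}$ open; zero-dimensional means having a basis of clopen sets. All domains are bounded-complete $\omega$-algebraic with the Scott topology; $D\to D'$ is the domain of Scott-continuous maps. Kleene–Kreisel: $N(0)=\mathbb{N}_\bot$, $N(k+1)=N(k)\to N(0)$; $n\approx^N_0 m$ iff $n=m\in\mathbb{N}$; $f\approx^N_{k+1}g$ iff $f(a)\approx^N_0 g(b)$ whenever $a\approx^N_k b$; $\bar N(k)=\{x:x\approx^N_kx\}$; $Ct_{\mathbb{N}}(k)=\bar N(k)/\approx^N_k$ with the quotient topology. Extensional hierarchy: $E(0)$ is the ideal completion of $\{\mathbb{R}\}\cup\{[p,q]:p\le q\text{ rational}\}$ under reverse inclusion, $E(k+1)=E(k)\to E(0)$; $\alpha\approx^E_0\beta$ iff $\bigcap\alpha=\bigcap\beta=\{x\}$, $x\in\mathbb{R}$; higher $\approx^E_k$, $\bar E(k)$ analogous; $\rho^E_0(\alpha)=x$ where $\bigcap\alpha=\{x\}$, $\rho^E_{k+1}(f)(\rho^E_k(y))=\rho^E_0(f(y))$; $Ct^E_{\mathbb{R}}(0)=\mathbb{R}$, $Ct^E_{\mathbb{R}}(k+1)=\rho^E_{k+1}[\bar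 E(k+1)]$ (functions $Ct^E_{\mathbb{R}}(k)\to\mathbb{R}$) with the quotient topology. Smoothened intensional hierarchy: $S(0)$ consists of the empty sequence and all finite and infinite sequences $ab_1b_2\dots$ with $a\in\mathbb{Z}$, $b_i\in\{-1,0,1\}$, ordered by extension; for maximal elements $\rho^S_0(ab_1b_2\cdots)=a+\sum_{n\ge1}b_n2^{-n}$; $x_1\sim_0x_2$ iff they have maximal extensions with equal $\rho^S_0$-value; $S(k+1)$ is the set of Scott-continuous $f:S(k)\to S(0)$ with $x_1\sim_kx_2\Rightarrow f(x_1)\sim_0f(x_2)$, ordered pointwise; $f_1\sim_{k+1}f_2$ iff $x_1\sim_kx_2\Rightarrow f_1(x_1)\sim_0f_2(x_2)$. $\bar S(0)$ = maximal elements, $\approx^S_0$ = $\sim_0$ restricted to them; $f\approx^S_{k+1}g$ iff $f(x)\approx^S_0 g(y)$ whenever $x\approx^S_k y$; $\bar S(k)=\{x:x\approx^S_kx\}$; $\rho^S_{k+1}(f)(\rho^S_k(y))=\rho^S_0(f(y))$; $Ct^S_{\mathbb{R}}(0)=\mathbb{R}$, $Ct^S_{\mathbb{R}}(k+1)=\rho^S_{k+1}[\bar S(k+1)]$ (functions $Ct^S_{\mathbb{R}}(k)\to\mathbb{R}$). Equality of $Ct^S_{\mathbb{R}}(n+1)$ and $Ct^E_{\mathbb{R}}(n+1)$ means equality as sets of real-valued functions. *)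

theory Defs
  imports "HOL-Analysis.Analysis"
begin

section \<open>Hereditary functionals\<close>

text \<open>
  HOL has no type indexed by the level k of a hierarchy, so all levels of a hierarchy with base
  type \<open>'b\<close> are subsets of a single type.  \<open>Val b\<close> is the base object b; \<open>Fam e\<close> is a function
  whose graph is the range of the partial enumeration e.  The canonical choice made in \<open>mk_fun\<close>
  gives every graph one representative.  Only graphs with at most continuum many elements
  (predicate \<open>small\<close>) can be represented; see the section on cardinalities for the proof that all
  hierarchies below consist of small sets, so that \<open>lam A\<close> is injective on functions on A.
\<close>

datatype 'b func = Val (val: 'b) | Fam "nat set \<Rightarrow> ('b func \<times> 'b) option"

definition small :: "'a set \<Rightarrow> bool" where
  "small A \<longleftrightarrow> (\<exists>e :: nat set \<Rightarrow> 'a option. ran e = A)"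

definition mk_fun :: "('b func \<times> 'b) set \<Rightarrow> 'b func" where
  "mk_fun G = Fam (SOME e. ran e = G)"

primrec graph_of :: "'b func \<Rightarrow> ('b func \<times> 'b) set" where
  "graph_of (Val b) = {}"
| "graph_of (Fam e) = ran e"

definition app :: "'b func \<Rightarrow> 'b func \<Rightarrow> 'b" where
  "app f a = (THE b. (a, b) \<in> graph_of f)"

definition lam :: "'b func set \<Rightarrow> ('b func \<Rightarrow> 'b) \<Rightarrow> 'b func" where
  "lam A h = mk_fun ((\<lambda>a. (a, h a)) ` A)"

text \<open>The order of the base lifted to all levels: functions are compared pointwise.\<close>

fun func_le :: "('b \<Rightarrow> 'b \<Rightarrow> bool) \<Rightarrow> 'b func \<Rightarrow> 'b func \<Rightarrow> bool" where
  "func_le le (Val x) (Val y) \<longleftrightarrow> le x y"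
| "func_le le (Fam d) (Fam e) \<longleftrightarrow>
     (\<forall>a \<in> fst ` graph_of (Fam d). le (app (Fam d) a) (app (Fam e) a))"
| "func_le le _ _ \<longleftrightarrow> False"

lemma graph_of_mk_fun: "small G \<Longrightarrow> graph_of (mk_fun G) = G"
  unfolding mk_fun_def small_def graph_of.simps by (rule someI_ex [of "\<lambda>e. ran e = G"])

lemma small_image: "small A \<Longrightarrow> small (f ` A)"
  unfolding small_def by (metis ran_map_option)

lemma graph_of_lam: "small A \<Longrightarrow> graph_of (lam A h) = (\<lambda>a. (a, h a)) ` A"
  unfolding lam_def by (intro graph_of_mk_fun small_image)

lemma app_lam: "small A \<Longrightarrow> a \<in> A \<Longrightarrow> app (lam A h) a = h a"
  unfolding app_def by (rule the_equality) (auto simp: graph_of_lam)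

lemma lam_eq_iff:
  assumes "small A" "small B"
  shows "lam A h = lam B g \<longleftrightarrow> A = B \<and> (\<forall>a\<in>A. h a = g a)"
proof
  assume eq: "lam A h = lam B g"
  then have "(\<lambda>a. (a, h a)) ` A = (\<lambda>a. (a, g a)) ` B"
    using graph_of_lam[OF assms(1), of h] graph_of_lam[OF assms(2), of g] by simp
  then show "A = B \<and> (\<forall>a\<in>A. h a = g a)"
    by (auto simp: set_eq_iff image_iff)
next
  assume "A = B \<and> (\<forall>a\<in>A. h a = g a)"
  then show "lam A h = lam B g"
    by (simp add: lam_def cong: image_cong)
qed

lemma func_le_lam:
  assumes "small A"
  shows "func_le le (lam A h) (lam A g) \<longleftrightarrow> (\<forall>a\<in>A. le (h a) (g a))"
proof -
  obtain d e where de: "lam A h = Fam d" "lam A g = Fam e"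
    by (simp add: lam_def mk_fun_def)
  have "fst ` graph_of (lam A h) = A"
    by (simp add: graph_of_lam assms image_image)
  then show ?thesis
    using app_lam[OF assms, of _ h] app_lam[OF assms, of _ g] de by simp
qed

section \<open>Scott topology\<close>

definition directed :: "('a \<Rightarrow> 'a \<Rightarrow> bool) \<Rightarrow> 'a set \<Rightarrow> bool" where
  "directed le X \<longleftrightarrow> X \<noteq> {} \<and> (\<forall>x\<in>X. \<forall>y\<in>X. \<exists>z\<in>X. le x z \<and> le y z)"

definition is_lub :: "'a set \<Rightarrow> ('a \<Rightarrow> 'a \<Rightarrow> bool) \<Rightarrow> 'a set \<Rightarrow> 'a \<Rightarrow> bool" where
  "is_lub D le X s \<longleftrightarrow> s \<in> D \<and> (\<forall>x\<in>X. le x s) \<and> (\<forall>u\<in>D. (\<forall>x\<in>X. le x u) \<longrightarrow> le s u)"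

definition scott_open :: "'a set \<Rightarrow> ('a \<Rightarrow> 'a \<Rightarrow> bool) \<Rightarrow> 'a set \<Rightarrow> bool" where
  "scott_open D le U \<longleftrightarrow> U \<subseteq> D \<and> (\<forall>x\<in>U. \<forall>y\<in>D. le x y \<longrightarrow> y \<in> U) \<and>
     (\<forall>X s. X \<subseteq> D \<and> directed le X \<and> is_lub D le X s \<and> s \<in> U \<longrightarrow> X \<inter> U \<noteq> {})"

definition scott :: "'a set \<Rightarrow> ('a \<Rightarrow> 'a \<Rightarrow> bool) \<Rightarrow> 'a topology" where
  "scott D le = topology (scott_open D le)"

lemma istopology_scott: "istopology (scott_open D le)"
  unfolding istopology_def
proof (intro conjI allI impI)
  fix S T assume S: "scott_open D le S" and T: "scott_open D le T"
  show "scott_open D le (S \<inter> T)"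
    unfolding scott_open_def
  proof (intro conjI allI impI)
    show "S \<inter> T \<subseteq> D" "\<forall>x\<in>S \<inter> T. \<forall>y\<in>D. le x y \<longrightarrow> y \<in> S \<inter> T"
      using S T unfolding scott_open_def by auto
    fix X s assume A: "X \<subseteq> D \<and> directed le X \<and> is_lub D le X s \<and> s \<in> S \<inter> T"
    then obtain x y where "x \<in> X" "x \<in> S" "y \<in> X" "y \<in> T"
      using S T unfolding scott_open_def by (metis IntD1 IntD2 disjoint_iff)
    then obtain z where "z \<in> X" "le x z" "le y z"
      using A unfolding directed_def by metis
    then have "z \<in> X \<inter> (S \<inter> T)"
      using S T A \<open>x \<in> S\<close> \<open>y \<in> T\<close> unfolding scott_open_def by blast
    then show "X \<inter> (S \<inter> T) \<noteq> {}" by blast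
  qed
next
  fix \<K> assume K: "\<forall>K\<in>\<K>. scott_open D le K"
  show "scott_open D le (\<Union>\<K>)"
    unfolding scott_open_def
  proof (intro conjI allI impI)
    show "\<Union>\<K> \<subseteq> D" "\<forall>x\<in>\<Union>\<K>. \<forall>y\<in>D. le x y \<longrightarrow> y \<in> \<Union>\<K>"
      using K unfolding scott_open_def by blast+
    fix X s assume A: "X \<subseteq> D \<and> directed le X \<and> is_lub D le X s \<and> s \<in> \<Union>\<K>"
    then obtain K where "K \<in> \<K>" "s \<in> K" by blast
    then have "X \<inter> K \<noteq> {}"
      using K A unfolding scott_open_def by blast
    then show "X \<inter> \<Union>\<K> \<noteq> {}" using \<open>K \<in> \<K>\<close> by blast
  qed
qed

lemma openin_scott [simp]: "openin (scott D le) = scott_open D le"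
  by (simp add: scott_def istopology_scott topology_inverse')

lemma topspace_scott [simp]: "topspace (scott D le) = D"
proof
  show "topspace (scott D le) \<subseteq> D"
    by (auto simp: topspace_def scott_open_def)
  have "scott_open D le D"
    unfolding scott_open_def directed_def by blast
  then show "D \<subseteq> topspace (scott D le)"
    by (auto simp: topspace_def)
qed

definition scott_maps ::
  "'a set \<Rightarrow> ('a \<Rightarrow> 'a \<Rightarrow> bool) \<Rightarrow> 'b set \<Rightarrow> ('b \<Rightarrow> 'b \<Rightarrow> bool) \<Rightarrow> ('a \<Rightarrow> 'b) set" where
  "scott_maps D le D' le' = {h. continuous_map (scott D le) (scott D' le') h}"

section \<open>Topological notions\<close>

definition quotient_topology :: "'a topology \<Rightarrow> ('a \<times> 'a) set \<Rightarrow> 'a set topology" where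
  "quotient_topology T r =
     topology (\<lambda>U. U \<subseteq> topspace T // r \<and> openin T (\<Union>U))"

definition preimage_open :: "'a topology \<Rightarrow> 'a set \<Rightarrow> bool" where
  "preimage_open T U \<longleftrightarrow> (\<exists>f O'. continuous_map T euclideanreal f \<and> open O' \<and>
     U = {x \<in> topspace T. f x \<in> O'})"

text \<open>The sets \<open>preimage_open T\<close> form a topology when T is hereditarily Lindelof, in
  particular for the spaces of Kleene-Kreisel functionals; see \<open>openin_R_top_CtN\<close> below.\<close>

definition R_top :: "'a topology \<Rightarrow> 'a topology" where
  "R_top T = topology (preimage_open T)"

definition zero_dimensional :: "'a topology \<Rightarrow> bool" where
  "zero_dimensional T \<longleftrightarrow> (\<exists>\<B>. (\<forall>B\<in>\<B>. openin T B \<and> closedin T B) \<and>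
     openin T = arbitrary union_of (\<lambda>B. B \<in> \<B>))"

section \<open>Total objects of a hierarchy\<close>

text \<open>Here D k is the k-th domain of a hierarchy and \<open>r\<close> resp. \<open>v\<close> the equivalence resp. the real
  value on its base.\<close>

primrec tot_rel ::
  "(nat \<Rightarrow> 'b func set) \<Rightarrow> ('b \<Rightarrow> 'b \<Rightarrow> bool) \<Rightarrow> nat \<Rightarrow> 'b func \<Rightarrow> 'b func \<Rightarrow> bool" where
  "tot_rel D r 0 x y \<longleftrightarrow> r (val x) (val y)"
| "tot_rel D r (Suc k) f g \<longleftrightarrow>
     (\<forall>a\<in>D k. \<forall>b\<in>D k. tot_rel D r k a b \<longrightarrow> r (app f a) (app g b))"

definition tot :: "(nat \<Rightarrow> 'b func set) \<Rightarrow> ('b \<Rightarrow> 'b \<Rightarrow> bool) \<Rightarrow> nat \<Rightarrow> 'b func set" where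
  "tot D r k = {x \<in> D k. tot_rel D r k x x}"

text \<open>\<open>rho\<close> sends a total object x of level k + 1 to the function on the image of the total
  objects of level k with graph \<open>{(rho y, v (x y)) | y total}\<close>.\<close>

primrec rho :: "(nat \<Rightarrow> 'b func set) \<Rightarrow> ('b \<Rightarrow> 'b \<Rightarrow> bool) \<Rightarrow> ('b \<Rightarrow> real) \<Rightarrow>
    nat \<Rightarrow> 'b func \<Rightarrow> real func" where
  "rho D r v 0 x = Val (v (val x))"
| "rho D r v (Suc k) f = mk_fun ((\<lambda>y. (rho D r v k y, v (app f y))) ` tot D r k)"

section \<open>The Kleene-Kreisel functionals\<close>

definition N_le :: "nat option \<Rightarrow> nat option \<Rightarrow> bool" where
  "N_le x y \<longleftrightarrow> x = None \<or> x = y"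

primrec N_dom :: "nat \<Rightarrow> nat option func set" where
  "N_dom 0 = range Val"
| "N_dom (Suc k) = lam (N_dom k) ` scott_maps (N_dom k) (func_le N_le) UNIV N_le"

definition N_eq0 :: "nat option \<Rightarrow> nat option \<Rightarrow> bool" where
  "N_eq0 x y \<longleftrightarrow> (\<exists>i. x = Some i \<and> y = Some i)"

abbreviation N_eq :: "nat \<Rightarrow> nat option func \<Rightarrow> nat option func \<Rightarrow> bool" where
  "N_eq \<equiv> tot_rel N_dom N_eq0"

abbreviation N_bar :: "nat \<Rightarrow> nat option func set" where
  "N_bar \<equiv> tot N_dom N_eq0"

definition CtN :: "nat \<Rightarrow> nat option func set topology" where
  "CtN k = quotient_topology (subtopology (scott (N_dom k) (func_le N_le)) (N_bar k))
     {(x, y). x \<in> N_bar k \<and> y \<in> N_bar k \<and> N_eq k x y}"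

section \<open>The extensional hierarchy\<close>

definition E_base :: "real set set" where
  "E_base = {UNIV} \<union> {{real_of_rat p..real_of_rat q} | p q. p \<le> q}"

definition E0 :: "real set set set" where
  "E0 = {\<alpha>. \<alpha> \<subseteq> E_base \<and> directed (\<supseteq>) \<alpha> \<and> (\<forall>X\<in>\<alpha>. \<forall>Y\<in>E_base. X \<subseteq> Y \<longrightarrow> Y \<in> \<alpha>)}"

primrec E_dom :: "nat \<Rightarrow> real set set func set" where
  "E_dom 0 = Val ` E0"
| "E_dom (Suc k) = lam (E_dom k) ` scott_maps (E_dom k) (func_le (\<subseteq>)) E0 (\<subseteq>)"

definition E_eq0 :: "real set set \<Rightarrow> real set set \<Rightarrow> bool" where
  "E_eq0 \<alpha> \<beta> \<longleftrightarrow> (\<exists>x. \<Inter>\<alpha> = {x} \<and> \<Inter>\<beta> = {x})"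

definition E_val :: "real set set \<Rightarrow> real" where
  "E_val \<alpha> = (THE x. \<Inter>\<alpha> = {x})"

abbreviation E_bar :: "nat \<Rightarrow> real set set func set" where
  "E_bar \<equiv> tot E_dom E_eq0"

abbreviation rho_E :: "nat \<Rightarrow> real set set func \<Rightarrow> real func" where
  "rho_E \<equiv> rho E_dom E_eq0 E_val"

primrec CtE :: "nat \<Rightarrow> real func set" where
  "CtE 0 = range Val"
| "CtE (Suc k) = rho_E (Suc k) ` E_bar (Suc k)"

section \<open>The smoothened intensional hierarchy\<close>

text \<open>A finite or infinite sequence is a partial function on an initial segment of nat; index 0
  carries the integer a, index i > 0 the digit \<open>b\<^sub>i\<close>.\<close>

definition S0 :: "(nat \<Rightarrow> int option) set" where
  "S0 = {s. (\<forall>i. s (Suc i) \<noteq> None \<longrightarrow> s i \<noteq> None) \<and>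
            (\<forall>i b. s (Suc i) = Some b \<longrightarrow> b \<in> {-1, 0, 1})}"

definition S0_max :: "(nat \<Rightarrow> int option) set" where
  "S0_max = {s \<in> S0. \<forall>t\<in>S0. s \<subseteq>\<^sub>m t \<longrightarrow> t = s}"

definition S_val :: "(nat \<Rightarrow> int option) \<Rightarrow> real" where
  "S_val s = of_int (the (s 0)) + (\<Sum>n. of_int (the (s (Suc n))) / 2 ^ Suc n)"

definition S_sim0 :: "(nat \<Rightarrow> int option) \<Rightarrow> (nat \<Rightarrow> int option) \<Rightarrow> bool" where
  "S_sim0 x1 x2 \<longleftrightarrow> (\<exists>y1\<in>S0_max. \<exists>y2\<in>S0_max. x1 \<subseteq>\<^sub>m y1 \<and> x2 \<subseteq>\<^sub>m y2 \<and> S_val y1 = S_val y2)"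

fun S_dom :: "nat \<Rightarrow> (nat \<Rightarrow> int option) func set"
  and S_sim :: "nat \<Rightarrow> (nat \<Rightarrow> int option) func \<Rightarrow> (nat \<Rightarrow> int option) func \<Rightarrow> bool" where
  "S_dom 0 = Val ` S0"
| "S_dom (Suc k) = lam (S_dom k) ` {h \<in> scott_maps (S_dom k) (func_le (\<subseteq>\<^sub>m)) S0 (\<subseteq>\<^sub>m).
     \<forall>x1\<in>S_dom k. \<forall>x2\<in>S_dom k. S_sim k x1 x2 \<longrightarrow> S_sim0 (h x1) (h x2)}"
| "S_sim 0 x1 x2 \<longleftrightarrow> S_sim0 (val x1) (val x2)"
| "S_sim (Suc k) f1 f2 \<longleftrightarrow>
     (\<forall>x1\<in>S_dom k. \<forall>x2\<in>S_dom k. S_sim k x1 x2 \<longrightarrow> S_sim0 (app f1 x1) (app f2 x2))"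

definition S_eq0 :: "(nat \<Rightarrow> int option) \<Rightarrow> (nat \<Rightarrow> int option) \<Rightarrow> bool" where
  "S_eq0 x1 x2 \<longleftrightarrow> x1 \<in> S0_max \<and> x2 \<in> S0_max \<and> S_sim0 x1 x2"

abbreviation S_bar :: "nat \<Rightarrow> (nat \<Rightarrow> int option) func set" where
  "S_bar \<equiv> tot S_dom S_eq0"

abbreviation rho_S :: "nat \<Rightarrow> (nat \<Rightarrow> int option) func \<Rightarrow> real func" where
  "rho_S \<equiv> rho S_dom S_eq0 S_val"

primrec CtS :: "nat \<Rightarrow> real func set" where
  "CtS 0 = range Val"
| "CtS (Suc k) = rho_S (Suc k) ` S_bar (Suc k)"

end

theory Submission
  imports Defs
begin

text \<open>Both sides are the hierarchy of sequentially continuous functionals over the reals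
  (\<open>ctf\<close>), where convergence at higher types is continuous convergence. For a hierarchy of domains
  this follows level by level if every compact element extends to a total one and if real-valued
  continuous functions on the total objects can be realised, uniformly for convergent sequences.
  For the extensional hierarchy both hold outright.

  In the smoothened hierarchy a real function has to be represented by a continuous choice of
  digits, and it suffices to separate \<open>g \<le> 0\<close> from \<open>g \<ge> 1\<close> by a clopen set, for each continuous
  \<open>g\<close> on the total objects. The hypothesis and the Lindelof property give such sets for the
  Kleene-Kreisel functionals of level \<open>n\<close>, hence for those of lower levels, which are retracts.
  The total objects of the smoothened hierarchy of level \<open>k > 0\<close> are in turn a retract of the
  Kleene-Kreisel functionals of level \<open>k\<close>: a functional is coded by the digits of its values, and
  an arbitrary sequence of digit functions is retracted onto an extensional functional. The
  induction on \<open>k\<close> yields density, separation and the retraction simultaneously.\<close>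

section \<open>Domains presented by their compact elements\<close>

text \<open>The obstacle is that digits are not determined by values: a functional of the smoothened
  hierarchy must pick digits continuously on all total arguments, and each switch from one digit to
  the next is a locally constant decision. Density is entangled with this. Extending a compact
  element of level \<open>k + 1\<close> to a total one means continuing prescribed digits from
  finitely many neighbourhoods to all total arguments, which already needs separation at level
  \<open>k\<close>. Separation passes through retractions that must not raise the level, since the
  hypothesis concerns level \<open>n\<close> alone. A function into digit sequences takes an
  argument and a digit index, so the index is hidden in the argument as a spare natural number. At
  level 0 there is no such coding, the digit sequences being uncountable; hence level 1 is coded
  separately, by moduli of continuity on compact cylinders, and level 0 is separated directly.
  Realising a whole convergent sequence of functions at once, rather than single functions, is what
  lets each level be built on the previous one.\<close>

locale sdom =
  fixes D :: "'a set" and le :: "'a \<Rightarrow> 'a \<Rightarrow> bool" and K :: "'a set"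
  assumes refl: "x \<in> D \<Longrightarrow> le x x"
    and antisym: "\<lbrakk>x \<in> D; y \<in> D; le x y; le y x\<rbrakk> \<Longrightarrow> x = y"
    and trans: "\<lbrakk>le x y; le y z; x \<in> D; y \<in> D; z \<in> D\<rbrakk> \<Longrightarrow> le x z"
    and countable_K: "countable K"
    and K_sub: "K \<subseteq> D"
    and bot_ex: "\<exists>p\<in>K. \<forall>x\<in>D. le p x"
    and join_ex: "\<lbrakk>p \<in> K; q \<in> K; x \<in> D; le p x; le q x\<rbrakk> \<Longrightarrow>
      \<exists>j\<in>K. le p j \<and> le q j \<and> (\<forall>z\<in>D. le p z \<longrightarrow> le q z \<longrightarrow> le j z)"
    and leI: "\<lbrakk>x \<in> D; y \<in> D; \<And>p. \<lbrakk>p \<in> K; le p x\<rbrakk> \<Longrightarrow> le p y\<rbrakk> \<Longrightarrow> le x y"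
    and ideal_ex: "\<lbrakk>I \<subseteq> K; I \<noteq> {}; \<And>p q. \<lbrakk>p \<in> I; q \<in> I\<rbrakk> \<Longrightarrow> \<exists>u\<in>I. le p u \<and> le q u\<rbrakk> \<Longrightarrow>
      \<exists>s\<in>D. \<forall>p\<in>K. le p s \<longleftrightarrow> (\<exists>q\<in>I. le p q)"
begin

lemma K_D: "p \<in> K \<Longrightarrow> p \<in> D"
  using K_sub by blast

lemma transK: "\<lbrakk>le x y; le y z; x \<in> K; y \<in> D; z \<in> D\<rbrakk> \<Longrightarrow> le x z"
  using trans K_D by blast

lemma fin_join:
  assumes "finite A" "A \<subseteq> K" "x \<in> D" "\<And>a. a \<in> A \<Longrightarrow> le a x"
  shows "\<exists>j\<in>K. (\<forall>a\<in>A. le a j) \<and> (\<forall>z\<in>D. (\<forall>a\<in>A. le a z) \<longrightarrow> le j z)"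
  using assms
proof (induction A rule: finite_induct)
  case empty
  then show ?case using bot_ex by auto
next
  case (insert a A)
  have "\<exists>j\<in>K. (\<forall>a\<in>A. le a j) \<and> (\<forall>z\<in>D. (\<forall>a\<in>A. le a z) \<longrightarrow> le j z)"
    using insert.prems by (intro insert.IH) blast+
  then obtain j where j: "j \<in> K" "\<forall>a\<in>A. le a j" "\<forall>z\<in>D. (\<forall>a\<in>A. le a z) \<longrightarrow> le j z"
    by blast
  have ax: "a \<in> K" "le j x" "le a x" using insert.prems j by blast+
  then obtain i where i: "i \<in> K" "le a i" "le j i" "\<forall>z\<in>D. le a z \<longrightarrow> le j z \<longrightarrow> le i z"
    using join_ex[of a j x] insert.prems(2) j(1) by blast
  have "le b i" if "b \<in> A" for b
    using transK[of b j i] that i j K_D insert.prems(1) by blast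
  then show ?case using i j by (intro bexI[of _ i]) auto
qed

lemma below_directed: "x \<in> D \<Longrightarrow> directed le {p \<in> K. le p x}"
  unfolding directed_def
proof (intro conjI ballI)
  show "x \<in> D \<Longrightarrow> {p \<in> K. le p x} \<noteq> {}" using bot_ex by blast
  fix p q assume "x \<in> D" "p \<in> {p \<in> K. le p x}" "q \<in> {p \<in> K. le p x}"
  then show "\<exists>z\<in>{p \<in> K. le p x}. le p z \<and> le q z" using join_ex[of p q x] by blast
qed

lemma below_lub: "x \<in> D \<Longrightarrow> is_lub D le {p \<in> K. le p x} x"
  unfolding is_lub_def by (auto intro: leI)

text \<open>The compact elements below members of \<open>X\<close> form a directed set. The element
  \<open>t\<close> of their ideal lies above every member of \<open>X\<close>, hence above
  \<open>s\<close>, so \<open>p\<close> is already below one of them.\<close>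

lemma compact_lub:
  assumes X: "X \<subseteq> D" "directed le X" "is_lub D le X s" and p: "p \<in> K" "le p s"
  shows "\<exists>x\<in>X. le p x"
proof -
  let ?I = "{q \<in> K. \<exists>x\<in>X. le q x}"
  have s: "s \<in> D" and ub: "\<And>x. x \<in> X \<Longrightarrow> le x s" using X(3) by (auto simp: is_lub_def)
  have "?I \<noteq> {}" using X bot_ex unfolding directed_def by blast
  moreover have "\<exists>u\<in>?I. le q u \<and> le q' u" if "q \<in> ?I" "q' \<in> ?I" for q q'
  proof -
    obtain x x' where xx: "x \<in> X" "le q x" "x' \<in> X" "le q' x'" "q \<in> K" "q' \<in> K"
      using \<open>q \<in> ?I\<close> \<open>q' \<in> ?I\<close> by blast
    then obtain z where "z \<in> X" "le x z" "le x' z"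
      using X(2) unfolding directed_def by blast
    with xx have z: "z \<in> X" "le q z" "le q' z" "q \<in> K" "q' \<in> K"
      using X(1) transK[of q x z] transK[of q' x' z] by blast+
    then obtain j where "j \<in> K" "le q j" "le q' j" "le j z"
      using join_ex[of q q' z] X(1) by blast
    then show ?thesis using z by blast
  qed
  ultimately obtain t where t: "t \<in> D" "\<And>q. q \<in> K \<Longrightarrow> le q t \<longleftrightarrow> (\<exists>u\<in>?I. le q u)"
    using ideal_ex[of ?I] by auto
  have "le x t" if "x \<in> X" for x
  proof (rule leI)
    fix q assume q: "q \<in> K" "le q x"
    then have "q \<in> ?I" using that by blast
    then show "le q t" using t(2) q(1) K_D refl by blast
  qed (use that X t in auto)
  then have "le s t" using X(3) t(1) by (auto simp: is_lub_def)
  then have "le p t" using p s t(1) transK by blast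
  then obtain u where "u \<in> ?I" "le p u" using t(2) p(1) by blast
  then show ?thesis using X(1) K_D p(1) transK by blast
qed

text \<open>An element is determined by the compact elements below it, so sets of naturals are
  enough to index \<open>D\<close>. This is what makes \<open>lam\<close> faithful at the next
  level.\<close>

lemma small_D: "small D"
proof -
  obtain e :: "'a \<Rightarrow> nat" where e: "inj_on e K"
    using countable_K by (auto simp: countable_def)
  let ?c = "\<lambda>x. e ` {p \<in> K. le p x}"
  have inj: "inj_on ?c D"
  proof (rule inj_onI)
    fix x y assume xy: "x \<in> D" "y \<in> D" "?c x = ?c y"
    then have "{p \<in> K. le p x} = {p \<in> K. le p y}"
      using inj_on_image_eq_iff[OF e, of "{p \<in> K. le p x}" "{p \<in> K. le p y}"] by blast
    then show "x = y" using xy antisym leI[of x y] leI[of y x] by blast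
  qed
  have "ran (\<lambda>s. if s \<in> ?c ` D then Some (inv_into D ?c s) else None) = D" (is "ran ?g = D")
  proof
    show "ran ?g \<subseteq> D" by (auto simp: ran_def inv_into_into split: if_splits)
    show "D \<subseteq> ran ?g"
    proof
      fix x assume "x \<in> D"
      then have "?g (?c x) = Some x" using inv_into_f_f[OF inj] by auto
      then show "x \<in> ran ?g" unfolding ran_def by blast
    qed
  qed
  then show ?thesis unfolding small_def by blast
qed

text \<open>\<open>c n\<close> is the join of the first \<open>n + 1\<close> members of an
  enumeration of the compact elements below \<open>x\<close>. Such sequences turn a failure in every
  neighbourhood of \<open>x\<close> into a failure along a convergent sequence.\<close>

lemma chain_ex:
  assumes x: "x \<in> D"
  obtains c :: "nat \<Rightarrow> 'a" where "\<And>n. c n \<in> K" "\<And>n. le (c n) x"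
    "\<And>p. \<lbrakk>p \<in> K; le p x\<rbrakk> \<Longrightarrow> \<exists>m. \<forall>n\<ge>m. le p (c n)"
proof -
  have ne: "{p \<in> K. le p x} \<noteq> {}" using below_directed[OF x] by (auto simp: directed_def)
  then obtain e :: "nat \<Rightarrow> 'a" where e: "range e = {p \<in> K. le p x}"
    using range_from_nat_into[OF ne countable_subset[OF _ countable_K]] by (metis (no_types, lifting) mem_Collect_eq subsetI)
  then have e': "e i \<in> K" "le (e i) x" for i by auto
  have "\<exists>j. j \<in> K \<and> (\<forall>i\<le>n. le (e i) j) \<and> (\<forall>z\<in>D. (\<forall>i\<le>n. le (e i) z) \<longrightarrow> le j z)" for n
  proof -
    have "\<exists>j\<in>K. (\<forall>a\<in>e ` {..n}. le a j) \<and> (\<forall>z\<in>D. (\<forall>a\<in>e ` {..n}. le a z) \<longrightarrow> le j z)"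
      by (rule fin_join[OF _ _ x]) (use e' in auto)
    then show ?thesis by auto
  qed
  then obtain c where c: "\<And>n. c n \<in> K" "\<And>n. \<forall>i\<le>n. le (e i) (c n)"
    "\<And>n. \<forall>z\<in>D. (\<forall>i\<le>n. le (e i) z) \<longrightarrow> le (c n) z"
    by metis
  show thesis
  proof (rule that[of c])
    show "c n \<in> K" for n by (rule c)
    show "le (c n) x" for n using c(3) x e' by blast
    show "\<exists>m. \<forall>n\<ge>m. le p (c n)" if p: "p \<in> K" "le p x" for p
    proof -
    obtain i where "p = e i" using p e by (metis (mono_tags, lifting) mem_Collect_eq rangeE)
    then show ?thesis using c(2) by blast
    qed
  qed
qed

definition sconv :: "(nat \<Rightarrow> 'a) \<Rightarrow> 'a \<Rightarrow> bool" where
  "sconv xs x \<longleftrightarrow> (\<forall>p\<in>K. le p x \<longrightarrow> (\<forall>\<^sub>F n in sequentially. le p (xs n)))"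

lemma scott_open_above: "p \<in> K \<Longrightarrow> scott_open D le {x \<in> D. le p x}"
  unfolding scott_open_def using transK compact_lub by blast

end

text \<open>Trades the Scott topology for approximation by compact elements, in which all later
  constructions of functions are phrased. From left to right, the up-sets of compact elements are
  open and \<open>x\<close> is the directed supremum of the compact elements below it; conversely
  the condition forces monotonicity and preservation of directed suprema.\<close>

lemma scott_maps_iff:
  assumes "sdom D le K" "sdom B leB KB"
  shows "h \<in> scott_maps D le B leB \<longleftrightarrow> (\<forall>x\<in>D. h x \<in> B) \<and>
    (\<forall>x\<in>D. \<forall>b\<in>KB. leB b (h x) \<longleftrightarrow> (\<exists>p\<in>K. le p x \<and> leB b (h p)))"
    (is "?l \<longleftrightarrow> ?r")
proof
  interpret D: sdom D le K by fact
  interpret B: sdom B leB KB by fact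
  assume ?l
  then have h: "\<And>x. x \<in> D \<Longrightarrow> h x \<in> B"
    and op: "\<And>V. scott_open B leB V \<Longrightarrow> scott_open D le {x \<in> D. h x \<in> V}"
    by (auto simp: scott_maps_def continuous_map_def Pi_iff)
  have op': "scott_open D le {x \<in> D. leB b (h x)}" if "b \<in> KB" for b
  proof -
    have "{x \<in> D. h x \<in> {y \<in> B. leB b y}} = {x \<in> D. leB b (h x)}" using h by auto
    then show ?thesis using op[OF B.scott_open_above[OF that]] by simp
  qed
  show ?r
  proof (intro conjI ballI iffI)
    fix x b assume xb: "x \<in> D" "b \<in> KB" "leB b (h x)"
    then have "{p \<in> K. le p x} \<inter> {x \<in> D. leB b (h x)} \<noteq> {}"
      using op'[OF xb(2), unfolded scott_open_def] D.below_directed[OF xb(1)] D.below_lub[OF xb(1)] D.K_sub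
      by (metis (no_types, lifting) mem_Collect_eq subset_eq)
    then show "\<exists>p\<in>K. le p x \<and> leB b (h p)" by auto
  next
    fix x b assume xb: "x \<in> D" "b \<in> KB" "\<exists>p\<in>K. le p x \<and> leB b (h p)"
    then show "leB b (h x)"
      using op'[of b] D.K_D unfolding scott_open_def by blast
  qed (rule h)
next
  interpret D: sdom D le K by fact
  interpret B: sdom B leB KB by fact
  assume ?r
  then have h: "\<And>x. x \<in> D \<Longrightarrow> h x \<in> B"
    and ap: "\<And>x b. \<lbrakk>x \<in> D; b \<in> KB\<rbrakk> \<Longrightarrow> leB b (h x) \<longleftrightarrow> (\<exists>p\<in>K. le p x \<and> leB b (h p))"
    by auto
  have mono: "leB (h x) (h y)" if "x \<in> D" "y \<in> D" "le x y" for x y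
  proof (rule B.leI)
    fix b assume b: "b \<in> KB" "leB b (h x)"
    then obtain p where "p \<in> K" "le p x" "leB b (h p)" using ap \<open>x \<in> D\<close> by blast
    then show "leB b (h y)" using ap[of y b] b that D.transK[of p x y] by blast
  qed (use h that in auto)
  have "scott_open D le {x \<in> D. h x \<in> V}" if V: "scott_open B leB V" for V
    unfolding scott_open_def
  proof (intro conjI allI impI)
    show "{x \<in> D. h x \<in> V} \<subseteq> D" by auto
    show "\<forall>x\<in>{x \<in> D. h x \<in> V}. \<forall>y\<in>D. le x y \<longrightarrow> y \<in> {x \<in> D. h x \<in> V}"
      using V mono h unfolding scott_open_def by auto
    fix X s assume A: "X \<subseteq> D \<and> directed le X \<and> is_lub D le X s \<and> s \<in> {x \<in> D. h x \<in> V}"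
    have "directed leB (h ` X)"
      unfolding directed_def
    proof (intro conjI ballI)
      show "h ` X \<noteq> {}" using A unfolding directed_def by blast
      fix a b assume "a \<in> h ` X" "b \<in> h ` X"
      then obtain x y where xy: "x \<in> X" "a = h x" "y \<in> X" "b = h y" by blast
      then obtain z where "z \<in> X" "le x z" "le y z" using A unfolding directed_def by blast
      then show "\<exists>c\<in>h ` X. leB a c \<and> leB b c" using xy mono A by blast
    qed
    moreover have "is_lub B leB (h ` X) (h s)"
      unfolding is_lub_def
    proof (intro conjI ballI impI)
      show "h s \<in> B" using A h by blast
      show "leB y (h s)" if "y \<in> h ` X" for y
        using that A mono unfolding is_lub_def by blast
      fix u assume u: "u \<in> B" "\<forall>y\<in>h ` X. leB y u"
      show "leB (h s) u"
      proof (rule B.leI)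
        fix b assume b: "b \<in> KB" "leB b (h s)"
        then obtain p where p: "p \<in> K" "le p s" "leB b (h p)" using ap[of s b] A by blast
        then obtain x where "x \<in> X" "le p x" using D.compact_lub A by blast
        then have "leB b (h x)" "leB (h x) u" "x \<in> D" using ap b p u A by auto
        then show "leB b u" using b u h by (blast intro: B.transK)
      qed (use A h u in auto)
    qed
    moreover have "h ` X \<subseteq> B" using A h by blast
    ultimately have "h ` X \<inter> V \<noteq> {}" using V A unfolding scott_open_def by blast
    then show "X \<inter> {x \<in> D. h x \<in> V} \<noteq> {}" using A by blast
  qed
  then show ?l using h by (auto simp: scott_maps_def continuous_map_def Pi_iff)
qed

section \<open>Hierarchies of domains\<close>

text \<open>Total base objects are those related to themselves by \<open>r\<close>, and \<open>L\<close> is the convergence of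
  total base objects. The object \<open>rep x\<close> lies above \<open>x\<close>, and \<open>low x\<close> is a representative of
  the same value whose compact approximations are eventually below \<open>rep (xs n)\<close> whenever
  \<open>L xs x\<close>.\<close>

locale hier = B: sdom B le KB
  for B :: "'b set" and le :: "'b \<Rightarrow> 'b \<Rightarrow> bool" and KB :: "'b set" +
  fixes D :: "nat \<Rightarrow> 'b func set"
    and s0 :: "'b \<Rightarrow> 'b \<Rightarrow> bool" and sim :: "nat \<Rightarrow> 'b func \<Rightarrow> 'b func \<Rightarrow> bool"
    and r :: "'b \<Rightarrow> 'b \<Rightarrow> bool" and L :: "(nat \<Rightarrow> 'b) \<Rightarrow> 'b \<Rightarrow> bool"
    and rep low :: "'b \<Rightarrow> 'b"
  assumes D_0: "D 0 = Val ` B"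
    and D_Suc: "D (Suc k) = lam (D k) ` {h \<in> scott_maps (D k) (func_le le) B le.
      \<forall>x1\<in>D k. \<forall>x2\<in>D k. sim k x1 x2 \<longrightarrow> s0 (h x1) (h x2)}"
    and s0_refl: "x \<in> B \<Longrightarrow> s0 x x"
    and s0_down: "\<lbrakk>s0 x y; x' \<in> B; y' \<in> B; x \<in> B; y \<in> B; le x' x; le y' y\<rbrakk> \<Longrightarrow> s0 x' y'"
    and s0_closed: "\<lbrakk>x \<in> B; y \<in> B; \<And>b c. \<lbrakk>b \<in> KB; c \<in> KB; le b x; le c y\<rbrakk> \<Longrightarrow> s0 b c\<rbrakk> \<Longrightarrow> s0 x y"
    and sim_down_0: "\<lbrakk>sim 0 (Val x) (Val y); x' \<in> B; y' \<in> B; x \<in> B; y \<in> B; le x' x; le y' y\<rbrakk>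
      \<Longrightarrow> sim 0 (Val x') (Val y')"
    and sim_down_Suc: "\<lbrakk>sim (Suc k) f g; \<And>x. x \<in> D k \<Longrightarrow> {app f' x, app g' x, app f x, app g x} \<subseteq> B \<and>
      le (app f' x) (app f x) \<and> le (app g' x) (app g x)\<rbrakk> \<Longrightarrow> sim (Suc k) f' g'"
    and r_sym: "r x y \<Longrightarrow> r y x"
    and r_trans: "r x y \<Longrightarrow> r y z \<Longrightarrow> r x z"
    and r_up: "\<lbrakk>r x x; le x y; x \<in> B; y \<in> B\<rbrakk> \<Longrightarrow> r x y"
    and r_s0: "\<lbrakk>r x y; x \<in> B; y \<in> B\<rbrakk> \<Longrightarrow> s0 (rep x) (rep y)"
    and rep: "\<lbrakk>x \<in> B; r x x\<rbrakk> \<Longrightarrow> rep x \<in> B \<and> le x (rep x)"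
    and low: "\<lbrakk>x \<in> B; r x x\<rbrakk> \<Longrightarrow> low x \<in> B \<and> r x (low x) \<and> le (low x) (rep x)"
    and L_low: "\<lbrakk>x \<in> B; r x x; \<And>n. xs n \<in> B; \<And>n. r (xs n) (xs n); L xs x; b \<in> KB; le b (low x)\<rbrakk>
      \<Longrightarrow> \<forall>\<^sub>F n in sequentially. le b (rep (xs n))"
    and L_sconv: "\<lbrakk>x \<in> B; r x x; \<And>n. xs n \<in> B; \<And>n. r (xs n) (xs n); B.sconv xs x\<rbrakk> \<Longrightarrow> L xs x"
    and L_join: "\<lbrakk>L xs x; x \<in> B; r x x; \<And>n. xs n \<in> B; \<And>n. r (xs n) (xs n);
      y \<in> B; r y y; \<And>n. ys n \<in> B; \<And>n. r (ys n) (ys n);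
      \<And>n. \<exists>z\<in>B. le (xs n) z \<and> le (ys n) z; \<exists>z\<in>B. le x z \<and> le y z\<rbrakk> \<Longrightarrow> L ys y"
begin

abbreviation fle :: "'b func \<Rightarrow> 'b func \<Rightarrow> bool" (infix "\<sqsubseteq>" 50) where
  "fle \<equiv> func_le le"

text \<open>\<open>u\<close> is a finite set of steps and \<open>g\<close> the least function with
  value above \<open>b\<close> at \<open>p\<close> for each step \<open>(p, b)\<close>. Describing
  \<open>g\<close> by the elements above it spares a formula for suprema of step functions that also
  have to respect \<open>sim\<close>.\<close>

definition presents :: "nat \<Rightarrow> ('b func \<times> 'b) set \<Rightarrow> 'b func \<Rightarrow> bool" where
  "presents k u g \<longleftrightarrow> g \<in> D (Suc k) \<and> (\<forall>z\<in>D (Suc k). g \<sqsubseteq> z \<longleftrightarrow> (\<forall>(p, b)\<in>u. le b (app z p)))"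

primrec K :: "nat \<Rightarrow> 'b func set" where
  "K 0 = Val ` KB"
| "K (Suc k) = {g. \<exists>u. finite u \<and> u \<subseteq> K k \<times> KB \<and> presents k u g}"

definition good :: "nat \<Rightarrow> ('b func \<Rightarrow> 'b) \<Rightarrow> bool" where
  "good k h \<longleftrightarrow> (\<forall>x\<in>D k. h x \<in> B) \<and>
    (\<forall>x\<in>D k. \<forall>b\<in>KB. le b (h x) \<longleftrightarrow> (\<exists>p\<in>K k. p \<sqsubseteq> x \<and> le b (h p))) \<and>
    (\<forall>x\<in>D k. \<forall>y\<in>D k. sim k x y \<longrightarrow> s0 (h x) (h y))"

context
  fixes k assumes X: "sdom (D k) (\<sqsubseteq>) (K k)"
begin

interpretation X: sdom "D k" "(\<sqsubseteq>)" "K k" by (rule X)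

lemma D_Suc': "D (Suc k) = lam (D k) ` {h. good k h}"
  unfolding D_Suc good_def using scott_maps_iff[OF X B.sdom_axioms] by auto

lemma app_lam': "x \<in> D k \<Longrightarrow> app (lam (D k) h) x = h x"
  by (rule app_lam[OF X.small_D])

lemma good_cong: "(\<And>x. x \<in> D k \<Longrightarrow> h x = g x) \<Longrightarrow> good k h \<longleftrightarrow> good k g"
  using X.K_sub unfolding good_def by (auto simp: subset_iff; metis)

lemma good_app: "f \<in> D (Suc k) \<Longrightarrow> good k (app f)"
  unfolding D_Suc' using good_cong[OF app_lam'] by auto

lemma good_lam: "good k h \<Longrightarrow> lam (D k) h \<in> D (Suc k)"
  unfolding D_Suc' by auto

lemma lam_app: "f \<in> D (Suc k) \<Longrightarrow> lam (D k) (app f) = f"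
  unfolding D_Suc' by (auto simp: lam_eq_iff[OF X.small_D X.small_D] app_lam')

lemma fle_iff: "\<lbrakk>f \<in> D (Suc k); g \<in> D (Suc k)\<rbrakk> \<Longrightarrow> f \<sqsubseteq> g \<longleftrightarrow> (\<forall>x\<in>D k. le (app f x) (app g x))"
  using func_le_lam[OF X.small_D, of le "app f" "app g"] lam_app by simp

lemma app_B: "\<lbrakk>f \<in> D (Suc k); x \<in> D k\<rbrakk> \<Longrightarrow> app f x \<in> B"
  using good_app[of f] by (auto simp: good_def)

lemma app_iff: "\<lbrakk>f \<in> D (Suc k); x \<in> D k; b \<in> KB\<rbrakk> \<Longrightarrow>
    le b (app f x) \<longleftrightarrow> (\<exists>p\<in>K k. p \<sqsubseteq> x \<and> le b (app f p))"
  using good_app[of f] by (auto simp: good_def)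

lemma app_sim: "\<lbrakk>f \<in> D (Suc k); x \<in> D k; y \<in> D k; sim k x y\<rbrakk> \<Longrightarrow> s0 (app f x) (app f y)"
  using good_app[of f] by (auto simp: good_def)

lemma app_mono: "\<lbrakk>f \<in> D (Suc k); x \<in> D k; y \<in> D k; x \<sqsubseteq> y\<rbrakk> \<Longrightarrow> le (app f x) (app f y)"
proof (rule B.leI)
  fix b assume *: "f \<in> D (Suc k)" "x \<in> D k" "y \<in> D k" "x \<sqsubseteq> y" "b \<in> KB" "le b (app f x)"
  then obtain p where "p \<in> K k" "p \<sqsubseteq> x" "le b (app f p)" using app_iff by blast
  then show "le b (app f y)" using * app_iff[of f y b] X.transK[of p x y] by blast
qed (auto intro: app_B)

lemma presentsD: "\<lbrakk>presents k u g; (p, b) \<in> u\<rbrakk> \<Longrightarrow> le b (app g p)"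
  using fle_iff app_B B.refl unfolding presents_def by fast

text \<open>The last assumption makes the supremum of the steps preserve \<open>sim\<close>.\<close>

lemma presents_app_ex:
  assumes u: "finite u" "u \<subseteq> K k \<times> KB"
    and bd: "\<And>x. x \<in> D k \<Longrightarrow> \<exists>z\<in>B. \<forall>(p, b)\<in>u. p \<sqsubseteq> x \<longrightarrow> le b z"
    and sm: "\<And>x y i j. \<lbrakk>x \<in> D k; y \<in> D k; sim k x y; i \<in> B; j \<in> B;
      \<And>z. z \<in> B \<Longrightarrow> le i z \<longleftrightarrow> (\<forall>(p, b)\<in>u. p \<sqsubseteq> x \<longrightarrow> le b z);
      \<And>z. z \<in> B \<Longrightarrow> le j z \<longleftrightarrow> (\<forall>(p, b)\<in>u. p \<sqsubseteq> y \<longrightarrow> le b z)\<rbrakk> \<Longrightarrow> s0 i j"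
  shows "\<exists>g. presents k u g \<and> (\<forall>x\<in>D k. \<forall>z\<in>B. le (app g x) z \<longleftrightarrow> (\<forall>(p, b)\<in>u. p \<sqsubseteq> x \<longrightarrow> le b z))"
proof -
  let ?A = "\<lambda>x. {b. \<exists>p. (p, b) \<in> u \<and> p \<sqsubseteq> x}"
  have fA: "finite (?A x)" for x
    by (rule finite_subset[of _ "snd ` u"]) (use u in force)+
  have "\<exists>j. j \<in> KB \<and> (\<forall>z\<in>B. le j z \<longleftrightarrow> (\<forall>(p, b)\<in>u. p \<sqsubseteq> x \<longrightarrow> le b z))" if x: "x \<in> D k" for x
  proof -
    obtain z where z: "z \<in> B" "\<And>p b. (p, b) \<in> u \<Longrightarrow> p \<sqsubseteq> x \<Longrightarrow> le b z" using bd[OF x] by fast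
    have AK: "?A x \<subseteq> KB" using u by blast
    obtain j where j: "j \<in> KB" "\<forall>a\<in>?A x. le a j" "\<forall>z\<in>B. (\<forall>a\<in>?A x. le a z) \<longrightarrow> le j z"
      using B.fin_join[OF fA AK z(1)] z(2) by blast
    have "le j z \<longleftrightarrow> (\<forall>(p, b)\<in>u. p \<sqsubseteq> x \<longrightarrow> le b z)" if "z \<in> B" for z
    proof
      assume jz: "le j z"
      have "le b z" if "(p, b) \<in> u" "p \<sqsubseteq> x" for p b
        using B.transK[of b j z] j jz AK that \<open>z \<in> B\<close> B.K_D by blast
      then show "\<forall>(p, b)\<in>u. p \<sqsubseteq> x \<longrightarrow> le b z" by blast
    qed (use j that in blast)
    then show ?thesis using j(1) by blast
  qed
  then obtain J where J: "\<And>x. x \<in> D k \<Longrightarrow> J x \<in> KB"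
    "\<And>x z. \<lbrakk>x \<in> D k; z \<in> B\<rbrakk> \<Longrightarrow> le (J x) z \<longleftrightarrow> (\<forall>(p, b)\<in>u. p \<sqsubseteq> x \<longrightarrow> le b z)"
    by metis
  have JB: "J x \<in> B" if "x \<in> D k" for x using J(1)[OF that] B.K_D by blast
  have Jb: "le b (J x)" if "x \<in> D k" "(p, b) \<in> u" "p \<sqsubseteq> x" for x p b
    using J(2)[of x "J x"] that JB B.refl by fast
  have Jmono: "le (J x) (J y)" if "x \<in> D k" "y \<in> D k" "x \<sqsubseteq> y" for x y
  proof -
    have "le b (J y)" if "(p, b) \<in> u" "p \<sqsubseteq> x" for p b
      using Jb[of y p b] that u \<open>x \<in> D k\<close> \<open>y \<in> D k\<close> \<open>x \<sqsubseteq> y\<close> X.transK[of p x y] by blast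
    then show ?thesis using J(2)[of x "J y"] that JB by blast
  qed
  have gJ: "good k J"
    unfolding good_def
  proof (intro conjI ballI impI)
    show "J x \<in> B" if "x \<in> D k" for x using JB that .
    show "s0 (J x) (J y)" if "x \<in> D k" "y \<in> D k" "sim k x y" for x y
      using sm[OF that] JB that J(2) by blast
    fix x b assume xb: "x \<in> D k" "b \<in> KB"
    show "le b (J x) \<longleftrightarrow> (\<exists>p\<in>K k. p \<sqsubseteq> x \<and> le b (J p))"
    proof
      assume bJ: "le b (J x)"
      \<comment> \<open>The join \<open>q\<close> of the step arguments below \<open>x\<close> is a
        compact element below \<open>x\<close> at which the same steps apply, so the value at
        \<open>x\<close> is already attained at \<open>q\<close>.\<close>
      let ?P = "{p. (\<exists>b. (p, b) \<in> u) \<and> p \<sqsubseteq> x}"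
      have "finite ?P" by (rule finite_subset[of _ "fst ` u"]) (use u in force)+
      then obtain q where q: "q \<in> K k" "\<forall>a\<in>?P. a \<sqsubseteq> q" "\<forall>z\<in>D k. (\<forall>a\<in>?P. a \<sqsubseteq> z) \<longrightarrow> q \<sqsubseteq> z"
        using X.fin_join[of ?P x] u xb by blast
      have "le (J x) (J q)"
        using J(2)[of x "J q"] JB Jb[of q] q X.K_D xb by blast
      then have "le b (J q)" using bJ xb q(1) JB X.K_D B.transK[of b "J x" "J q"] by blast
      then show "\<exists>p\<in>K k. p \<sqsubseteq> x \<and> le b (J p)" using q xb by blast
    next
      assume "\<exists>p\<in>K k. p \<sqsubseteq> x \<and> le b (J p)"
      then show "le b (J x)" using Jmono xb X.K_D JB B.transK by metis
    qed
  qed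
  have "lam (D k) J \<sqsubseteq> z \<longleftrightarrow> (\<forall>(p, b)\<in>u. le b (app z p))" if z: "z \<in> D (Suc k)" for z
  proof -
    have "lam (D k) J \<sqsubseteq> z \<longleftrightarrow> (\<forall>x\<in>D k. le (J x) (app z x))"
      using fle_iff[OF good_lam[OF gJ] z] app_lam' by simp
    also have "\<dots> \<longleftrightarrow> (\<forall>(p, b)\<in>u. le b (app z p))"
    proof
      assume *: "\<forall>x\<in>D k. le (J x) (app z x)"
      have "le b (app z p)" if pb: "(p, b) \<in> u" for p b
      proof -
        have p: "p \<in> D k" "b \<in> KB" using pb u X.K_D by auto
        then have "le b (J p)" using Jb pb X.refl by blast
        then show ?thesis using * p JB app_B[OF z] B.transK by blast
      qed
      then show "\<forall>(p, b)\<in>u. le b (app z p)" by blast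
    next
      assume *: "\<forall>(p, b)\<in>u. le b (app z p)"
      show "\<forall>x\<in>D k. le (J x) (app z x)"
      proof
        fix x assume x: "x \<in> D k"
        have "le b (app z x)" if "(p, b) \<in> u" "p \<sqsubseteq> x" for p b
          using app_iff[OF z x, of b] * u that by blast
        then show "le (J x) (app z x)" using J(2)[OF x app_B[OF z x]] by blast
      qed
    qed
    finally show ?thesis .
  qed
  then have "presents k u (lam (D k) J)"
    unfolding presents_def using good_lam[OF gJ] by blast
  moreover have "\<forall>x\<in>D k. \<forall>z\<in>B. le (app (lam (D k) J) x) z \<longleftrightarrow> (\<forall>(p, b)\<in>u. p \<sqsubseteq> x \<longrightarrow> le b z)"
    using J(2) app_lam' by simp
  ultimately show ?thesis by blast
qed

lemmas presents_ex = presents_app_ex[THEN ex_forward[OF _ conjunct1]]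

text \<open>The function \<open>f\<close> bounds all the steps, so their suprema exist pointwise and
  lie below values of \<open>f\<close>; as \<open>s0\<close> is closed downwards, they inherit the
  \<open>sim\<close> condition from \<open>f\<close>.\<close>

lemma presents_bdd_app:
  assumes u: "finite u" "u \<subseteq> K k \<times> KB" and f: "f \<in> D (Suc k)" "\<And>p b. (p, b) \<in> u \<Longrightarrow> le b (app f p)"
  shows "\<exists>g. presents k u g \<and> (\<forall>x\<in>D k. \<forall>z\<in>B. le (app g x) z \<longleftrightarrow> (\<forall>(p, b)\<in>u. p \<sqsubseteq> x \<longrightarrow> le b z))"
proof (rule presents_app_ex[OF u])
  have b: "\<forall>(p, b)\<in>u. p \<sqsubseteq> x \<longrightarrow> le b (app f x)" if "x \<in> D k" for x
  proof -
    have "le b (app f x)" if "(p, b) \<in> u" "p \<sqsubseteq> x" for p b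
      using app_iff[OF f(1) \<open>x \<in> D k\<close>, of b] f(2)[of p b] that u by blast
    then show ?thesis by blast
  qed
  show "\<exists>z\<in>B. \<forall>(p, b)\<in>u. p \<sqsubseteq> x \<longrightarrow> le b z" if "x \<in> D k" for x
    using b[OF that] app_B[OF f(1) that] by blast
  fix x y i j assume *: "x \<in> D k" "y \<in> D k" "sim k x y" "i \<in> B" "j \<in> B"
      "\<And>z. z \<in> B \<Longrightarrow> le i z \<longleftrightarrow> (\<forall>(p, b)\<in>u. p \<sqsubseteq> x \<longrightarrow> le b z)"
      "\<And>z. z \<in> B \<Longrightarrow> le j z \<longleftrightarrow> (\<forall>(p, b)\<in>u. p \<sqsubseteq> y \<longrightarrow> le b z)"
  then have "le i (app f x)" "le j (app f y)" using b app_B[OF f(1)] by blast+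
  then show "s0 i j" using s0_down[OF app_sim[OF f(1) *(1-3)] *(4,5)] * app_B[OF f(1)] by blast
qed

lemmas presents_bdd = presents_bdd_app[THEN ex_forward[OF _ conjunct1]]

lemma presents_unique: "\<lbrakk>presents k u f; presents k u g\<rbrakk> \<Longrightarrow> f = g"
proof -
  assume *: "presents k u f" "presents k u g"
  then have m: "f \<in> D (Suc k)" "g \<in> D (Suc k)" by (auto simp: presents_def)
  have rf: "f \<sqsubseteq> f" "g \<sqsubseteq> g" using m fle_iff[OF m(1,1)] fle_iff[OF m(2,2)] app_B B.refl by auto
  have "f \<sqsubseteq> z \<longleftrightarrow> (\<forall>(p, b)\<in>u. le b (app z p))" "g \<sqsubseteq> z \<longleftrightarrow> (\<forall>(p, b)\<in>u. le b (app z p))"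
    if "z \<in> D (Suc k)" for z using * that unfolding presents_def by simp_all
  then have "f \<sqsubseteq> g" "g \<sqsubseteq> f" using rf m by simp_all
  then have "\<forall>x\<in>D k. app f x = app g x"
    using fle_iff[OF m] fle_iff[OF m(2,1)] by (auto intro!: B.antisym app_B m)
  then have "lam (D k) (app f) = lam (D k) (app g)" by (simp add: lam_def cong: image_cong)
  then show ?thesis using m lam_app by simp
qed

lemma presents_app:
  assumes "finite u" "u \<subseteq> K k \<times> KB" "presents k u g" "x \<in> D k" "z \<in> B"
  shows "le (app g x) z \<longleftrightarrow> (\<forall>(p, b)\<in>u. p \<sqsubseteq> x \<longrightarrow> le b z)"
proof -
  have "g \<in> D (Suc k)" using assms(3) by (simp add: presents_def)
  then obtain f where "presents k u f"
    "\<forall>x\<in>D k. \<forall>z\<in>B. le (app f x) z \<longleftrightarrow> (\<forall>(p, b)\<in>u. p \<sqsubseteq> x \<longrightarrow> le b z)"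
    using presents_bdd_app[OF assms(1,2), of g] presentsD[OF assms(3)] by blast
  then show ?thesis using presents_unique[OF assms(3)] assms(4,5) by blast
qed

text \<open>Single steps below a function already detect the order, and bounded finite sets of steps
  have suprema by \<open>presents_bdd\<close>. Directed suprema are formed pointwise; that they
  still respect \<open>sim\<close> is where \<open>s0_closed\<close> enters.\<close>

lemma sdom_Suc: "sdom (D (Suc k)) (\<sqsubseteq>) (K (Suc k))"
proof
  show "x \<sqsubseteq> x" if "x \<in> D (Suc k)" for x using that fle_iff app_B B.refl by blast
  show "x = y" if "x \<in> D (Suc k)" "y \<in> D (Suc k)" "x \<sqsubseteq> y" "y \<sqsubseteq> x" for x y
  proof -
    have "\<forall>a\<in>D k. app x a = app y a"
      using that fle_iff[of x y] fle_iff[of y x] app_B[of x] app_B[of y] B.antisym by blast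
    then have "lam (D k) (app x) = lam (D k) (app y)" by (simp add: lam_def cong: image_cong)
    then show ?thesis using that lam_app by simp
  qed
  show "x \<sqsubseteq> z" if "x \<sqsubseteq> y" "y \<sqsubseteq> z" "x \<in> D (Suc k)" "y \<in> D (Suc k)" "z \<in> D (Suc k)" for x y z
  proof -
    have "le (app x a) (app z a)" if "a \<in> D k" for a
      using that \<open>x \<sqsubseteq> y\<close> \<open>y \<sqsubseteq> z\<close> \<open>x \<in> D (Suc k)\<close> \<open>y \<in> D (Suc k)\<close> \<open>z \<in> D (Suc k)\<close>
        fle_iff[of x y] fle_iff[of y z] app_B[of x a] app_B[of y a] app_B[of z a]
        B.trans[of "app x a" "app y a" "app z a"] by blast
    then show ?thesis using that fle_iff by blast
  qed
  have "countable {u. finite u \<and> u \<subseteq> K k \<times> KB}"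
    using countable_Collect_finite_subset[of "K k \<times> KB"] X.countable_K B.countable_K by auto
  then have "countable ((\<lambda>u. THE g. presents k u g) ` {u. finite u \<and> u \<subseteq> K k \<times> KB})"
    by (rule countable_image)
  moreover have "K (Suc k) \<subseteq> (\<lambda>u. THE g. presents k u g) ` {u. finite u \<and> u \<subseteq> K k \<times> KB}"
  proof
    fix g assume "g \<in> K (Suc k)"
    then obtain u where u: "finite u" "u \<subseteq> K k \<times> KB" "presents k u g" by auto
    then have "(THE g. presents k u g) = g" using presents_unique by blast
    then show "g \<in> (\<lambda>u. THE g. presents k u g) ` {u. finite u \<and> u \<subseteq> K k \<times> KB}" using u by blast
  qed
  ultimately show "countable (K (Suc k))" using countable_subset by blast
  show sub: "K (Suc k) \<subseteq> D (Suc k)" by (auto simp: presents_def)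
  obtain b where b: "b \<in> KB" "\<forall>x\<in>B. le b x" using B.bot_ex by blast
  have "\<exists>g. presents k {} g"
  proof (rule presents_ex)
    show "\<exists>z\<in>B. \<forall>(p, b)\<in>{}. p \<sqsubseteq> x \<longrightarrow> le b z" for x using b B.K_D by auto
    fix x y i j assume *: "x \<in> D k" "y \<in> D k" "i \<in> B" "j \<in> B"
      "\<And>z. z \<in> B \<Longrightarrow> le i z \<longleftrightarrow> (\<forall>(p, b)\<in>{}. p \<sqsubseteq> x \<longrightarrow> le b z)"
      "\<And>z. z \<in> B \<Longrightarrow> le j z \<longleftrightarrow> (\<forall>(p, b)\<in>{}. p \<sqsubseteq> y \<longrightarrow> le b z)" "sim k x y"
    then have "i = b" "j = b" using b B.K_D by (auto intro: B.antisym)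
    then show "s0 i j" using s0_refl b B.K_D by blast
  qed auto
  then obtain g where "presents k {} g" by blast
  then show "\<exists>p\<in>K (Suc k). \<forall>x\<in>D (Suc k). p \<sqsubseteq> x"
    by (auto simp: presents_def intro!: bexI[of _ g] exI[of _ "{}"])
  show "\<exists>j\<in>K (Suc k). p \<sqsubseteq> j \<and> q \<sqsubseteq> j \<and> (\<forall>z\<in>D (Suc k). p \<sqsubseteq> z \<longrightarrow> q \<sqsubseteq> z \<longrightarrow> j \<sqsubseteq> z)"
    if pq: "p \<in> K (Suc k)" "q \<in> K (Suc k)" "x \<in> D (Suc k)" "p \<sqsubseteq> x" "q \<sqsubseteq> x" for p q x
  proof -
    obtain u v where u: "finite u" "u \<subseteq> K k \<times> KB" "presents k u p"
      and v: "finite v" "v \<subseteq> K k \<times> KB" "presents k v q" using pq by auto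
    have "\<exists>g. presents k (u \<union> v) g"
      by (rule presents_bdd[of _ x]) (use u v pq in \<open>auto simp: presents_def\<close>)
    then obtain g where g: "presents k (u \<union> v) g" by blast
    then have gg: "g \<in> D (Suc k)" "\<And>z. z \<in> D (Suc k) \<Longrightarrow> g \<sqsubseteq> z \<longleftrightarrow> p \<sqsubseteq> z \<and> q \<sqsubseteq> z"
      using u(3) v(3) unfolding presents_def by blast+
    moreover have "g \<sqsubseteq> g" using gg fle_iff app_B B.refl by blast
    moreover have "g \<in> K (Suc k)" using u v g by auto
    ultimately show ?thesis by blast
  qed
  show "x \<sqsubseteq> y" if xy: "x \<in> D (Suc k)" "y \<in> D (Suc k)"
    and K: "\<And>p. \<lbrakk>p \<in> K (Suc k); p \<sqsubseteq> x\<rbrakk> \<Longrightarrow> p \<sqsubseteq> y" for x y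
    unfolding fle_iff[OF xy]
  proof
    fix a assume a: "a \<in> D k"
    show "le (app x a) (app y a)"
    proof (rule B.leI)
      fix b assume b: "b \<in> KB" "le b (app x a)"
      then obtain p where p: "p \<in> K k" "p \<sqsubseteq> a" "le b (app x p)" using app_iff xy a by blast
      have "\<exists>g. presents k {(p, b)} g"
        by (rule presents_bdd[of _ x]) (use b p xy in auto)
      then obtain g where g: "presents k {(p, b)} g" by blast
      then have "g \<in> K (Suc k)" "g \<sqsubseteq> x" using b p xy by (auto simp: presents_def)
      then have "g \<sqsubseteq> y" by (rule K)
      then have "le b (app y p)" using g xy by (auto simp: presents_def)
      then show "le b (app y a)" using app_iff xy a b p by blast
    qed (use xy a app_B in auto)
  qed
  fix I assume I: "I \<subseteq> K (Suc k)" "I \<noteq> {}" "\<And>p q. \<lbrakk>p \<in> I; q \<in> I\<rbrakk> \<Longrightarrow> \<exists>u\<in>I. p \<sqsubseteq> u \<and> q \<sqsubseteq> u"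
  have ID: "f \<in> D (Suc k)" if "f \<in> I" for f using that I(1) sub by blast
  let ?Q = "\<lambda>x. {b \<in> KB. \<exists>f\<in>I. le b (app f x)}"
  have "\<exists>s. s \<in> B \<and> (\<forall>b\<in>KB. le b s \<longleftrightarrow> (\<exists>f\<in>I. le b (app f x)))" if x: "x \<in> D k" for x
  proof -
    have "\<exists>s\<in>B. \<forall>p\<in>KB. le p s \<longleftrightarrow> (\<exists>q\<in>?Q x. le p q)"
    proof (rule B.ideal_ex)
      obtain f where "f \<in> I" using I(2) by blast
      then show "?Q x \<noteq> {}" using b app_B[OF ID x] by blast
      fix c d assume "c \<in> ?Q x" "d \<in> ?Q x"
      then obtain f g where fg: "f \<in> I" "g \<in> I" "le c (app f x)" "le d (app g x)" "c \<in> KB" "d \<in> KB"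
        by blast
      then obtain h where h: "h \<in> I" "f \<sqsubseteq> h" "g \<sqsubseteq> h" using I(3) by blast
      then have "le (app f x) (app h x)" "le (app g x) (app h x)" using fle_iff ID fg x by blast+
      then have "le c (app h x)" "le d (app h x)"
        using fg h x ID app_B B.transK by blast+
      then obtain j where "j \<in> KB" "le c j" "le d j" "le j (app h x)"
        using B.join_ex[of c d "app h x"] fg app_B[OF ID x] h by blast
      then show "\<exists>u\<in>?Q x. le c u \<and> le d u" using h by blast
    qed auto
    then obtain s where s: "s \<in> B" "\<forall>p\<in>KB. le p s \<longleftrightarrow> (\<exists>q\<in>?Q x. le p q)" by blast
    have "(\<exists>q\<in>?Q x. le p q) \<longleftrightarrow> (\<exists>f\<in>I. le p (app f x))" if p: "p \<in> KB" for p
    proof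
      assume "\<exists>q\<in>?Q x. le p q"
      then obtain q f where "q \<in> KB" "f \<in> I" "le q (app f x)" "le p q" by blast
      then show "\<exists>f\<in>I. le p (app f x)" using B.transK[OF _ _ p, of q "app f x"] app_B[OF ID x] B.K_D by blast
    next
      assume "\<exists>f\<in>I. le p (app f x)"
      then show "\<exists>q\<in>?Q x. le p q" using p B.refl B.K_D by blast
    qed
    then show ?thesis using s by blast
  qed
  then obtain h where hB: "\<And>x. x \<in> D k \<Longrightarrow> h x \<in> B"
    and h: "\<And>x b. \<lbrakk>x \<in> D k; b \<in> KB\<rbrakk> \<Longrightarrow> le b (h x) \<longleftrightarrow> (\<exists>f\<in>I. le b (app f x))" by metis
  have "good k h"
    unfolding good_def
  proof (intro conjI ballI impI)
    show "h x \<in> B" if "x \<in> D k" for x using hB that .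
    fix x b assume xb: "x \<in> D k" "b \<in> KB"
    show "le b (h x) \<longleftrightarrow> (\<exists>p\<in>K k. p \<sqsubseteq> x \<and> le b (h p))"
      using h[OF xb] h[OF X.K_D xb(2)] app_iff[OF ID xb] by blast
  next
    fix x y assume xy: "x \<in> D k" "y \<in> D k" "sim k x y"
    show "s0 (h x) (h y)"
    proof (rule s0_closed)
      fix b c assume bc: "b \<in> KB" "c \<in> KB" "le b (h x)" "le c (h y)"
      then obtain f g where fg: "f \<in> I" "g \<in> I" "le b (app f x)" "le c (app g y)" using h xy by blast
      then obtain f' where h: "f' \<in> I" "f \<sqsubseteq> f'" "g \<sqsubseteq> f'" using I(3) by blast
      then have "le (app f x) (app f' x)" "le (app g y) (app f' y)" using fle_iff ID fg xy by blast+
      then have "le b (app f' x)" "le c (app f' y)"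
        using fg h xy ID app_B bc B.transK by blast+
      then show "s0 b c"
        using s0_down[OF app_sim[OF ID xy]] h bc app_B[OF ID] xy B.K_D by blast
    qed (use hB xy in auto)
  qed
  then have m: "lam (D k) h \<in> D (Suc k)" by (rule good_lam)
  have "g \<sqsubseteq> lam (D k) h \<longleftrightarrow> (\<exists>f\<in>I. g \<sqsubseteq> f)" if g: "g \<in> K (Suc k)" for g
  proof
    assume gh: "g \<sqsubseteq> lam (D k) h"
    obtain u where u: "finite u" "u \<subseteq> K k \<times> KB" "presents k u g" using g by auto
    have "\<exists>f\<in>I. le b (app f p)" if "(p, b) \<in> u" for p b
    proof -
      have "le b (app (lam (D k) h) p)" using that gh u m unfolding presents_def by blast
      then show ?thesis using that u h X.K_D app_lam' by auto
    qed
    \<comment> \<open>Directedness of \<open>I\<close> provides one member that handles finitely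
      many steps at once.\<close>
    moreover have "\<exists>f\<in>I. \<forall>(p, b)\<in>w. le b (app f p)" if "finite w" "w \<subseteq> u" for w
      using that
    proof (induction w rule: finite_induct)
      case (insert a w)
      obtain p b where a: "a = (p, b)" by force
      obtain f where f: "f \<in> I" "\<forall>(p, b)\<in>w. le b (app f p)" using insert by auto
      obtain g where g: "g \<in> I" "le b (app g p)" using calculation insert.prems a by blast
      obtain h where h: "h \<in> I" "f \<sqsubseteq> h" "g \<sqsubseteq> h" using I(3) f(1) g(1) by blast
      have *: "le c (app h q)" if "f' \<in> I" "f' \<sqsubseteq> h" "le c (app f' q)" "(q, c) \<in> u" for c q f'
      proof -
        have q: "q \<in> D k" "c \<in> KB" using that u(2) X.K_D by blast+
        have "le (app f' q) (app h q)" using fle_iff[OF ID ID, of f' h] that h(1) q by blast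
        then show ?thesis using B.transK[of c "app f' q" "app h q"] that q app_B[OF ID] h(1) by blast
      qed
      have "\<forall>(p, b)\<in>insert a w. le b (app h p)"
        using *[OF f(1) h(2)] *[OF g(1) h(3)] f(2) g(2) insert.prems a by blast
      then show ?case using h(1) by blast
    qed (use I in auto)
    ultimately obtain f where "f \<in> I" "\<forall>(p, b)\<in>u. le b (app f p)" using u(1) by blast
    then show "\<exists>f\<in>I. g \<sqsubseteq> f" using u(3) ID unfolding presents_def by blast
  next
    assume "\<exists>f\<in>I. g \<sqsubseteq> f"
    then obtain f where f: "f \<in> I" "g \<sqsubseteq> f" by blast
    obtain u where u: "finite u" "u \<subseteq> K k \<times> KB" "presents k u g" using g by auto
    have "le b (app (lam (D k) h) p)" if "(p, b) \<in> u" for p b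
    proof -
      have "le b (app f p)" using f u(3) ID that unfolding presents_def by blast
      moreover have "p \<in> D k" "b \<in> KB" using that u X.K_D by blast+
      ultimately show ?thesis using h app_lam'[of p h] f by auto
    qed
    then show "g \<sqsubseteq> lam (D k) h" using u m unfolding presents_def by blast
  qed
  then show "\<exists>s\<in>D (Suc k). \<forall>p\<in>K (Suc k). p \<sqsubseteq> s \<longleftrightarrow> (\<exists>q\<in>I. p \<sqsubseteq> q)" using m by blast
qed

end

lemma sdom_D: "sdom (D k) (\<sqsubseteq>) (K k)"
proof (induction k)
  case 0
  show ?case
  proof
    show "countable (K 0)" using B.countable_K by simp
    fix I assume I: "I \<subseteq> K 0" "I \<noteq> {}" "\<And>p q. \<lbrakk>p \<in> I; q \<in> I\<rbrakk> \<Longrightarrow> \<exists>u\<in>I. p \<sqsubseteq> u \<and> q \<sqsubseteq> u"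
    have "\<exists>s\<in>B. \<forall>p\<in>KB. le p s \<longleftrightarrow> (\<exists>q\<in>val ` I. le p q)"
    proof (rule B.ideal_ex)
      show "val ` I \<subseteq> KB" using I(1) by auto
      show "val ` I \<noteq> {}" using I(2) by auto
      fix p q assume "p \<in> val ` I" "q \<in> val ` I"
      then obtain p' q' where "Val p' \<in> I" "Val q' \<in> I" "p = p'" "q = q'" using I(1) by fastforce
      then obtain u where "u \<in> I" "Val p \<sqsubseteq> u" "Val q \<sqsubseteq> u" using I(3) by blast
      moreover then obtain u' where "u = Val u'" using I(1) by auto
      ultimately show "\<exists>u\<in>val ` I. le p u \<and> le q u" by force
    qed
    then obtain s where s: "s \<in> B" "\<forall>p\<in>KB. le p s \<longleftrightarrow> (\<exists>q\<in>val ` I. le p q)" by blast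
    have "Val p \<sqsubseteq> Val s \<longleftrightarrow> (\<exists>q\<in>I. Val p \<sqsubseteq> q)" if "p \<in> KB" for p
      using s(2) that I(1) by (auto simp: image_iff) (metis func.sel(1) func_le.simps(1) K.simps(1) imageE subsetD)+
    then show "\<exists>s\<in>D 0. \<forall>p\<in>K 0. p \<sqsubseteq> s \<longleftrightarrow> (\<exists>q\<in>I. p \<sqsubseteq> q)"
      using s(1) by (intro bexI[of _ "Val s"]) (auto simp: D_0)
  next
    show "\<exists>p\<in>K 0. \<forall>x\<in>D 0. p \<sqsubseteq> x" using B.bot_ex by (auto simp: D_0)
    show "x \<sqsubseteq> y" if "x \<in> D 0" "y \<in> D 0" "\<And>p. \<lbrakk>p \<in> K 0; p \<sqsubseteq> x\<rbrakk> \<Longrightarrow> p \<sqsubseteq> y" for x y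
    proof -
      obtain a b where ab: "x = Val a" "y = Val b" "a \<in> B" "b \<in> B" using \<open>x \<in> D 0\<close> \<open>y \<in> D 0\<close> by (auto simp: D_0)
      have "le p b" if "p \<in> KB" "le p a" for p
        using \<open>\<And>p. \<lbrakk>p \<in> K 0; p \<sqsubseteq> x\<rbrakk> \<Longrightarrow> p \<sqsubseteq> y\<close>[of "Val p"] that ab by simp
      then show ?thesis using B.leI ab by simp
    qed
    show "\<exists>j\<in>K 0. p \<sqsubseteq> j \<and> q \<sqsubseteq> j \<and> (\<forall>z\<in>D 0. p \<sqsubseteq> z \<longrightarrow> q \<sqsubseteq> z \<longrightarrow> j \<sqsubseteq> z)"
      if "p \<in> K 0" "q \<in> K 0" "x \<in> D 0" "p \<sqsubseteq> x" "q \<sqsubseteq> x" for p q x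
      using that B.join_ex by (fastforce simp: D_0)
  qed (use B.K_sub in \<open>auto simp: D_0 intro: B.refl B.antisym B.trans\<close>)
next
  case (Suc k)
  then show "sdom (D (Suc k)) (\<sqsubseteq>) (K (Suc k))" by (rule sdom_Suc)
qed

end

sublocale hier \<subseteq> X: sdom "D k" "func_le le" "K k" for k
  by (rule sdom_D)

context hier
begin

lemmas fleS = fle_iff[OF sdom_D]
lemmas appB = app_B[OF sdom_D]
lemmas appI = app_iff[OF sdom_D]
lemmas appM = app_mono[OF sdom_D]
lemmas appS = app_sim[OF sdom_D]
lemmas app_lamS = app_lam'[OF sdom_D]
lemmas good_lamS = good_lam[OF sdom_D]
lemmas presents_exS = presents_ex[OF sdom_D]
lemmas presents_bddS = presents_bdd[OF sdom_D]
lemmas presents_appS = presents_app[OF sdom_D]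
lemmas presents_leS = presentsD[OF sdom_D]

lemma sim_down:
  assumes "sim k f g" "f' \<in> D k" "g' \<in> D k" "f \<in> D k" "g \<in> D k" "f' \<sqsubseteq> f" "g' \<sqsubseteq> g"
  shows "sim k f' g'"
proof (cases k)
  case 0
  then show ?thesis using assms sim_down_0 by (auto simp: D_0)
next
  case (Suc m)
  show ?thesis unfolding Suc
    by (rule sim_down_Suc[of m f g]) (use assms Suc fleS[of _ m] appB[of _ m] in auto)
qed

section \<open>Total objects, their equivalence and their convergence\<close>

abbreviation T :: "nat \<Rightarrow> 'b func set" where "T \<equiv> tot D r"
abbreviation eqv :: "nat \<Rightarrow> 'b func \<Rightarrow> 'b func \<Rightarrow> bool" where "eqv \<equiv> tot_rel D r"

lemma eqv_sym: "eqv k x y \<Longrightarrow> eqv k y x"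
  by (induction k arbitrary: x y) (auto intro: r_sym)

lemma eqv_refl2: "eqv k x y \<Longrightarrow> eqv k y y"
proof (induction k arbitrary: x y)
  case 0
  then show ?case using r_trans[OF r_sym, of "val x" "val y" "val y"] by simp
next
  case (Suc k)
  have "r (app y u) (app y w)" if uw: "u \<in> D k" "w \<in> D k" "eqv k u w" for u w
  proof -
    have "eqv k u u" by (rule Suc.IH[OF eqv_sym[OF uw(3)]])
    then have "r (app x u) (app y u)" "r (app x u) (app y w)" using Suc.prems uw by auto
    then show ?thesis using r_trans[OF r_sym] by blast
  qed
  then show ?case by simp
qed

lemma eqv_trans:
  assumes "eqv k x y" "eqv k y z"
  shows "eqv k x z"
proof (cases k)
  case 0
  then show ?thesis using assms r_trans[of "val x" "val y" "val z"] by simp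
next
  case (Suc m)
  have "r (app x a) (app z b)" if ab: "a \<in> D m" "b \<in> D m" "eqv m a b" for a b
  proof -
    have "r (app x a) (app y b)" "r (app y b) (app z b)"
      using assms ab eqv_refl2[OF ab(3)] Suc by auto
    then show ?thesis by (rule r_trans)
  qed
  then show ?thesis using Suc by simp
qed

lemma T_D: "x \<in> T k \<Longrightarrow> x \<in> D k" and T_eqv: "x \<in> T k \<Longrightarrow> eqv k x x"
  by (auto simp: tot_def)

lemma eqv_T: "\<lbrakk>eqv k x y; x \<in> D k; y \<in> D k\<rbrakk> \<Longrightarrow> x \<in> T k \<and> y \<in> T k"
  unfolding tot_def using eqv_trans eqv_sym by blast

lemma T_app: "\<lbrakk>f \<in> T (Suc k); y \<in> T k\<rbrakk> \<Longrightarrow> app f y \<in> B \<and> r (app f y) (app f y)"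
  using appB[OF T_D T_D] T_D[of y k] T_eqv[of f "Suc k"] T_eqv[of y k] by simp

lemma T_appB: "\<lbrakk>f \<in> T (Suc k); y \<in> T k\<rbrakk> \<Longrightarrow> app f y \<in> B"
  and T_appr: "\<lbrakk>f \<in> T (Suc k); y \<in> T k\<rbrakk> \<Longrightarrow> r (app f y) (app f y)"
  using T_app by blast+

lemma eqv_app: "\<lbrakk>eqv (Suc k) f g; eqv k x y; x \<in> T k; y \<in> T k\<rbrakk> \<Longrightarrow> r (app f x) (app g y)"
  using T_D by auto

lemma eqvI:
  assumes "f \<in> T (Suc k)" "g \<in> T (Suc k)" "\<And>y. y \<in> T k \<Longrightarrow> r (app f y) (app g y)"
  shows "eqv (Suc k) f g"
proof -
  have "r (app f a) (app g b)" if "a \<in> D k" "b \<in> D k" "eqv k a b" for a b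
    using r_trans[OF eqv_app[OF T_eqv[OF assms(1)] that(3)] assms(3)[of b]] eqv_T that by blast
  then show ?thesis by simp
qed

lemma T_up: "\<lbrakk>x \<in> T k; y \<in> D k; x \<sqsubseteq> y\<rbrakk> \<Longrightarrow> eqv k x y"
proof (cases k)
  case 0
  then show "\<lbrakk>x \<in> T k; y \<in> D k; x \<sqsubseteq> y\<rbrakk> \<Longrightarrow> eqv k x y" using r_up by (auto simp: tot_def D_0)
next
  case (Suc m)
  assume *: "x \<in> T k" "y \<in> D k" "x \<sqsubseteq> y"
  have "r (app x a) (app y b)" if ab: "a \<in> D m" "b \<in> D m" "eqv m a b" for a b
  proof -
    have t: "a \<in> T m" "b \<in> T m" using eqv_T[OF ab(3,1,2)] by auto
    have x: "x \<in> T (Suc m)" "y \<in> D (Suc m)" "x \<sqsubseteq> y" using * Suc by auto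
    have "le (app x b) (app y b)" using fleS[OF T_D[OF x(1)] x(2)] x(3) ab(2) by blast
    then have "r (app x b) (app y b)" using r_up[OF T_appr[OF x(1) t(2)]] T_appB[OF x(1) t(2)] appB[OF x(2) ab(2)] by blast
    then show ?thesis using r_trans[OF eqv_app[OF T_eqv[OF x(1)] ab(3) t]] by blast
  qed
  then show ?thesis using Suc by simp
qed

text \<open>Bounded pairs of total objects are equivalent, but the relation can be stronger:
  \<open>L_join\<close> lets values at joinable arguments be exchanged without disturbing
  convergence, even in the smoothened hierarchy, where equivalent arguments may receive different
  digits.\<close>

definition joinable :: "nat \<Rightarrow> 'b func \<Rightarrow> 'b func \<Rightarrow> bool" where
  "joinable k x y \<longleftrightarrow> (\<exists>z\<in>D k. x \<sqsubseteq> z \<and> y \<sqsubseteq> z)"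

lemma joinable_eqv: "\<lbrakk>joinable k x y; x \<in> T k; y \<in> T k\<rbrakk> \<Longrightarrow> eqv k x y"
  unfolding joinable_def using eqv_trans[OF T_up eqv_sym[OF T_up]] by blast

lemma joinable_app: "\<lbrakk>f \<in> D (Suc k); joinable k x y; x \<in> D k; y \<in> D k\<rbrakk> \<Longrightarrow>
    \<exists>z\<in>B. le (app f x) z \<and> le (app f y) z"
  unfolding joinable_def using appM appB by blast

text \<open>Convergence in the Scott topology, and continuous convergence of total objects.\<close>

definition scv :: "nat \<Rightarrow> (nat \<Rightarrow> 'b func) \<Rightarrow> 'b func \<Rightarrow> bool" where
  "scv k xs x \<longleftrightarrow> x \<in> D k \<and> (\<forall>n. xs n \<in> D k) \<and>
    (\<forall>p\<in>K k. p \<sqsubseteq> x \<longrightarrow> (\<forall>\<^sub>F n in sequentially. p \<sqsubseteq> xs n))"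

text \<open>The reindexing \<open>i\<close> decouples the two sequences: the arguments may accompany
  an arbitrary selection of the \<open>fs\<close>, as it arises in arguments by
  contradiction.\<close>

primrec conv :: "nat \<Rightarrow> (nat \<Rightarrow> 'b func) \<Rightarrow> 'b func \<Rightarrow> bool" where
  "conv 0 xs x \<longleftrightarrow> x \<in> T 0 \<and> (\<forall>n. xs n \<in> T 0) \<and> L (\<lambda>n. val (xs n)) (val x)"
| "conv (Suc k) fs f \<longleftrightarrow> f \<in> T (Suc k) \<and> (\<forall>n. fs n \<in> T (Suc k)) \<and>
    (\<forall>ys y i. conv k ys y \<longrightarrow> filterlim i at_top sequentially \<longrightarrow>
      L (\<lambda>n. app (fs (i n)) (ys n)) (app f y))"

lemma conv_T: "conv k xs x \<Longrightarrow> x \<in> T k \<and> xs n \<in> T k"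
  by (cases k) auto

lemma conv_app: "\<lbrakk>conv (Suc k) fs f; conv k ys y\<rbrakk> \<Longrightarrow> L (\<lambda>n. app (fs n) (ys n)) (app f y)"
  using filterlim_ident[of sequentially] by (simp; blast)

text \<open>A compact \<open>b\<close> below \<open>app f y\<close> is already below the value at
  some compact \<open>p\<close> below \<open>y\<close>. Then the single step \<open>(p, b)\<close>
  lies below \<open>f\<close>, and both \<open>p\<close> and this step are eventually below the
  members of the two sequences.\<close>

lemma scv_app:
  assumes f: "scv (Suc k) fs f" and y: "scv k ys y"
  shows "B.sconv (\<lambda>n. app (fs n) (ys n)) (app f y)"
  unfolding B.sconv_def
proof (intro ballI impI)
  fix b assume b: "b \<in> KB" "le b (app f y)"
  have fD: "f \<in> D (Suc k)" "\<And>n. fs n \<in> D (Suc k)" and yD: "y \<in> D k" "\<And>n. ys n \<in> D k"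
    using f y by (auto simp: scv_def)
  obtain p where p: "p \<in> K k" "p \<sqsubseteq> y" "le b (app f p)" using b appI[OF fD(1) yD(1)] by blast
  obtain g where g: "presents k {(p, b)} g"
    using presents_bddS[of "{(p, b)}" k f] p b fD(1) by auto
  then have "g \<in> K (Suc k)" "g \<sqsubseteq> f" using p b fD(1) by (auto simp: presents_def)
  then have "\<forall>\<^sub>F n in sequentially. g \<sqsubseteq> fs n" using f by (auto simp: scv_def)
  moreover have "\<forall>\<^sub>F n in sequentially. p \<sqsubseteq> ys n" using y p by (auto simp: scv_def)
  ultimately show "\<forall>\<^sub>F n in sequentially. le b (app (fs n) (ys n))"
  proof eventually_elim
    case (elim n)
    then have "le b (app (fs n) p)" using g fD(2) by (auto simp: presents_def)
    then show ?case using appI[OF fD(2) yD(2) b(1)] p(1) elim(2) by blast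
  qed
qed

lemma scv_const: "x \<in> D k \<Longrightarrow> scv k (\<lambda>_. x) x"
  by (simp add: scv_def)

text \<open>The second clause has to produce equivalent total objects: a function defined from its
  values on total objects respects \<open>sim\<close> only if related compact arguments can be
  completed to equivalent ones.\<close>

definition dens :: "nat \<Rightarrow> bool" where
  "dens k \<longleftrightarrow> (\<forall>p\<in>K k. \<exists>y\<in>T k. p \<sqsubseteq> y) \<and>
    (\<forall>p\<in>K k. \<forall>q\<in>K k. sim k p q \<longrightarrow> (\<exists>y\<in>T k. \<exists>z\<in>T k. p \<sqsubseteq> y \<and> q \<sqsubseteq> z \<and> eqv k y z))"

definition cont :: "nat \<Rightarrow> ('b func \<Rightarrow> 'b) \<Rightarrow> bool" where
  "cont k F \<longleftrightarrow> (\<forall>y\<in>T k. F y \<in> B) \<and> (\<forall>y\<in>T k. \<forall>z\<in>T k. eqv k y z \<longrightarrow> r (F y) (F z)) \<and>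
    (\<forall>ys y. y \<in> T k \<longrightarrow> (\<forall>n. ys n \<in> T k) \<longrightarrow> scv k ys y \<longrightarrow> L (\<lambda>n. F (ys n)) (F y))"

lemma cont_app: "f \<in> T (Suc k) \<Longrightarrow> cont k (app f)"
  unfolding cont_def using T_app eqv_app[OF T_eqv]
  by (auto intro!: L_sconv scv_app[OF scv_const] T_D)

lemma contD: "\<lbrakk>cont k F; y \<in> T k\<rbrakk> \<Longrightarrow> F y \<in> B \<and> r (F y) (F y)"
  unfolding cont_def using T_eqv by blast

text \<open>A predicate \<open>Q p b\<close>, read as: on all arguments above \<open>p\<close> the value is above \<open>b\<close>,
  determines a total object with values \<open>F\<close>.\<close>

lemma realize_Q:
  assumes d: "dens k" and F: "cont k F"
    and Q: "\<And>p b y. \<lbrakk>p \<in> K k; b \<in> KB; Q p b; y \<in> T k; p \<sqsubseteq> y\<rbrakk> \<Longrightarrow> le b (rep (F y))"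
    and Q_mono: "\<And>p q b c. \<lbrakk>p \<in> K k; q \<in> K k; b \<in> KB; c \<in> KB; Q p b; p \<sqsubseteq> q; le c b\<rbrakk> \<Longrightarrow> Q q c"
    and Q_join: "\<And>p b c j. \<lbrakk>p \<in> K k; b \<in> KB; c \<in> KB; j \<in> KB; Q p b; Q p c;
      \<And>z. \<lbrakk>z \<in> B; le b z; le c z\<rbrakk> \<Longrightarrow> le j z\<rbrakk> \<Longrightarrow> Q p j"
    and Q_bot: "\<And>p b. \<lbrakk>p \<in> K k; b \<in> KB; \<And>z. z \<in> B \<Longrightarrow> le b z\<rbrakk> \<Longrightarrow> Q p b"
    and Q_low: "\<And>y b. \<lbrakk>y \<in> T k; b \<in> KB; le b (low (F y))\<rbrakk> \<Longrightarrow> \<exists>p\<in>K k. p \<sqsubseteq> y \<and> Q p b"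
  shows "\<exists>f\<in>T (Suc k). (\<forall>x\<in>D k. \<forall>b\<in>KB. le b (app f x) \<longleftrightarrow> (\<exists>p\<in>K k. p \<sqsubseteq> x \<and> Q p b)) \<and>
    (\<forall>y\<in>T k. le (low (F y)) (app f y) \<and> r (app f y) (F y))"
proof -
  have rF: "rep (F y) \<in> B" if "y \<in> T k" for y using contD[OF F that] rep by blast
  have "\<exists>s. s \<in> B \<and> (\<forall>b\<in>KB. le b s \<longleftrightarrow> (\<exists>p\<in>K k. p \<sqsubseteq> x \<and> Q p b))" if x: "x \<in> D k" for x
  proof -
    let ?I = "{b \<in> KB. \<exists>p\<in>K k. p \<sqsubseteq> x \<and> Q p b}"
    have "\<exists>s\<in>B. \<forall>p\<in>KB. le p s \<longleftrightarrow> (\<exists>q\<in>?I. le p q)"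
    proof (rule B.ideal_ex)
      obtain b where "b \<in> KB" "\<forall>z\<in>B. le b z" using B.bot_ex by blast
      moreover obtain p where "p \<in> K k" "p \<sqsubseteq> x" using X.bot_ex x by blast
      ultimately show "?I \<noteq> {}" using Q_bot by blast
      fix b c assume "b \<in> ?I" "c \<in> ?I"
      then obtain p q where pq: "p \<in> K k" "p \<sqsubseteq> x" "Q p b" "q \<in> K k" "q \<sqsubseteq> x" "Q q c" "b \<in> KB" "c \<in> KB"
        by blast
      then obtain u where u: "u \<in> K k" "p \<sqsubseteq> u" "q \<sqsubseteq> u" "u \<sqsubseteq> x" using X.join_ex[of p k q x] x by blast
      then have Qu: "Q u b" "Q u c" using Q_mono[of p u b b] Q_mono[of q u c c] pq B.refl B.K_D by blast+
      \<comment> \<open>Density makes \<open>b\<close> and \<open>c\<close> consistent: both lie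
        below \<open>rep (F y)\<close> for a total \<open>y\<close> above \<open>u\<close>.\<close>
      obtain y where y: "y \<in> T k" "u \<sqsubseteq> y" using d u unfolding dens_def by blast
      then obtain j where j: "j \<in> KB" "le b j" "le c j" "\<forall>z\<in>B. le b z \<longrightarrow> le c z \<longrightarrow> le j z"
        using B.join_ex[OF pq(7,8) rF[OF y(1)]] Q[OF u(1) pq(7) Qu(1) y] Q[OF u(1) pq(8) Qu(2) y] by blast
      then have "Q u j" using Q_join[OF u(1) pq(7,8) j(1) Qu] by blast
      then show "\<exists>z\<in>?I. le b z \<and> le c z" using j u by blast
    qed auto
    then obtain s where s: "s \<in> B" "\<forall>p\<in>KB. le p s \<longleftrightarrow> (\<exists>q\<in>?I. le p q)" by blast
    have "(\<exists>q\<in>?I. le b q) \<longleftrightarrow> (\<exists>p\<in>K k. p \<sqsubseteq> x \<and> Q p b)" if "b \<in> KB" for b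
    proof
      assume "\<exists>q\<in>?I. le b q"
      then obtain c p where "c \<in> KB" "le b c" "p \<in> K k" "p \<sqsubseteq> x" "Q p c" by blast
      then show "\<exists>p\<in>K k. p \<sqsubseteq> x \<and> Q p b" using Q_mono[of p p c b] that X.refl X.K_D by blast
    qed (use that B.refl B.K_D in blast)
    then show ?thesis using s by blast
  qed
  then obtain h where hB: "\<And>x. x \<in> D k \<Longrightarrow> h x \<in> B"
    and h: "\<And>x b. \<lbrakk>x \<in> D k; b \<in> KB\<rbrakk> \<Longrightarrow> le b (h x) \<longleftrightarrow> (\<exists>p\<in>K k. p \<sqsubseteq> x \<and> Q p b)" by metis
  have "good k h"
    unfolding good_def
  proof (intro conjI ballI impI)
    show "h x \<in> B" if "x \<in> D k" for x using hB that .
    fix x b assume xb: "x \<in> D k" "b \<in> KB"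
    show "le b (h x) \<longleftrightarrow> (\<exists>p\<in>K k. p \<sqsubseteq> x \<and> le b (h p))"
    proof
      assume "le b (h x)"
      then obtain p where "p \<in> K k" "p \<sqsubseteq> x" "Q p b" using h xb by blast
      then show "\<exists>p\<in>K k. p \<sqsubseteq> x \<and> le b (h p)" using h[of p b] xb X.K_D X.refl by blast
    next
      assume "\<exists>p\<in>K k. p \<sqsubseteq> x \<and> le b (h p)"
      then obtain p q where "p \<in> K k" "p \<sqsubseteq> x" "q \<in> K k" "q \<sqsubseteq> p" "Q q b" using h xb X.K_D by blast
      then show "le b (h x)" using h[OF xb] X.transK[of q p x k] X.K_D xb by blast
    qed
  next
    fix x1 x2 assume xy: "x1 \<in> D k" "x2 \<in> D k" "sim k x1 x2"
    show "s0 (h x1) (h x2)"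
    proof (rule s0_closed)
      fix b c assume bc: "b \<in> KB" "c \<in> KB" "le b (h x1)" "le c (h x2)"
      then obtain p q where pq: "p \<in> K k" "p \<sqsubseteq> x1" "Q p b" "q \<in> K k" "q \<sqsubseteq> x2" "Q q c"
        using h[OF xy(1)] h[OF xy(2)] by blast
      then have "sim k p q" using sim_down[OF xy(3) X.K_D X.K_D xy(1,2)] by blast
      \<comment> \<open>Related compact elements extend to equivalent total objects, where
        \<open>F\<close> takes equivalent values; their representatives are related by
        \<open>r_s0\<close>.\<close>
      then obtain y z where yz: "y \<in> T k" "z \<in> T k" "p \<sqsubseteq> y" "q \<sqsubseteq> z" "eqv k y z"
        using d pq unfolding dens_def by blast
      then have "r (F y) (F z)" using F unfolding cont_def by blast
      then have "s0 (rep (F y)) (rep (F z))" using r_s0 contD[OF F] yz by blast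
      moreover have "le b (rep (F y))" "le c (rep (F z))" using Q pq bc yz by blast+
      ultimately show "s0 b c" using s0_down[OF _ B.K_D B.K_D rF rF] bc yz by blast
    qed (use hB xy in auto)
  qed
  then have m: "lam (D k) h \<in> D (Suc k)" by (rule good_lamS)
  have lowh: "le (low (F y)) (h y)" if y: "y \<in> T k" for y
  proof (rule B.leI)
    fix b assume "b \<in> KB" "le b (low (F y))"
    then show "le b (h y)" using h[OF T_D[OF y]] Q_low[OF y] by blast
  qed (use hB[OF T_D[OF y]] low contD[OF F y] in auto)
  have rh: "r (h y) (F y)" if y: "y \<in> T k" for y
  proof -
    have l: "low (F y) \<in> B" "r (F y) (low (F y))" using low contD[OF F y] by blast+
    then have "r (low (F y)) (low (F y))" using r_sym r_trans by blast
    then have "r (low (F y)) (h y)" using r_up lowh[OF y] l hB T_D[OF y] by blast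
    then show ?thesis using l r_sym r_trans by blast
  qed
  have "r (h a) (h b)" if "a \<in> D k" "b \<in> D k" "eqv k a b" for a b
  proof -
    have ab: "a \<in> T k" "b \<in> T k" using eqv_T that by blast+
    then have "r (F a) (F b)" using F that unfolding cont_def by blast
    then show ?thesis using r_trans[OF rh[OF ab(1)] r_trans[OF _ r_sym[OF rh[OF ab(2)]]]] by blast
  qed
  then have "lam (D k) h \<in> T (Suc k)" using m by (simp add: tot_def app_lamS)
  then show ?thesis
    using h lowh rh T_D by (intro bexI[of _ "lam (D k) h"]) (auto simp: app_lamS)
qed

text \<open>\<open>Q\<close> is the largest predicate that only asserts bounds below
  \<open>rep (F y)\<close>. If no neighbourhood of \<open>y\<close> had the bound \<open>b\<close>,
  total objects approaching \<open>y\<close> along a chain of compact elements would violate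
  \<open>L_low\<close>.\<close>

lemma realize_one:
  assumes d: "dens k" and F: "cont k F"
  defines "Q \<equiv> \<lambda>p b. \<forall>y\<in>T k. p \<sqsubseteq> y \<longrightarrow> le b (rep (F y))"
  shows "\<exists>f\<in>T (Suc k). (\<forall>x\<in>D k. \<forall>b\<in>KB. le b (app f x) \<longleftrightarrow> (\<exists>p\<in>K k. p \<sqsubseteq> x \<and> Q p b)) \<and>
    (\<forall>y\<in>T k. le (low (F y)) (app f y) \<and> r (app f y) (F y))"
    and "\<And>y b. \<lbrakk>y \<in> T k; b \<in> KB; le b (low (F y))\<rbrakk> \<Longrightarrow> \<exists>p\<in>K k. p \<sqsubseteq> y \<and> Q p b"
proof -
  have rF: "rep (F y) \<in> B" if "y \<in> T k" for y using contD[OF F that] rep by blast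
  show Q_low: "\<exists>p\<in>K k. p \<sqsubseteq> y \<and> Q p b" if y: "y \<in> T k" and b: "b \<in> KB" "le b (low (F y))" for y b
  proof (rule ccontr)
    assume "\<not> ?thesis"
    then have neg: "\<exists>z\<in>T k. p \<sqsubseteq> z \<and> \<not> le b (rep (F z))" if "p \<in> K k" "p \<sqsubseteq> y" for p
      using that unfolding Q_def by blast
    obtain c :: "nat \<Rightarrow> _" where c: "\<And>n. c n \<in> K k" "\<And>n. c n \<sqsubseteq> y"
      "\<And>p. \<lbrakk>p \<in> K k; p \<sqsubseteq> y\<rbrakk> \<Longrightarrow> \<exists>m. \<forall>n\<ge>m. p \<sqsubseteq> c n"
      using X.chain_ex[OF T_D[OF y]] by metis
    obtain z where z: "\<And>n. z n \<in> T k" "\<And>n. c n \<sqsubseteq> z n" "\<And>n. \<not> le b (rep (F (z n)))"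
      using neg[OF c(1,2)] by metis
    have "scv k z y"
      unfolding scv_def
    proof (intro conjI allI ballI impI)
      fix p assume p: "p \<in> K k" "p \<sqsubseteq> y"
      then obtain m where "\<forall>n\<ge>m. p \<sqsubseteq> c n" using c(3) by blast
      then have "\<forall>n\<ge>m. p \<sqsubseteq> z n" using z(1,2) c(1) T_D X.K_D X.transK p(1) by blast
      then show "\<forall>\<^sub>F n in sequentially. p \<sqsubseteq> z n" unfolding eventually_sequentially by blast
    qed (use y z T_D in auto)
    then have "L (\<lambda>n. F (z n)) (F y)" using F y z unfolding cont_def by blast
    then have "\<forall>\<^sub>F n in sequentially. le b (rep (F (z n)))"
      using L_low[of "F y" "\<lambda>n. F (z n)"] contD[OF F] y z b by blast
    then show False using z(3) by simp
  qed
  show "\<exists>f\<in>T (Suc k). (\<forall>x\<in>D k. \<forall>b\<in>KB. le b (app f x) \<longleftrightarrow> (\<exists>p\<in>K k. p \<sqsubseteq> x \<and> Q p b)) \<and>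
    (\<forall>y\<in>T k. le (low (F y)) (app f y) \<and> r (app f y) (F y))"
  proof (rule realize_Q[OF d F])
    fix p q b c assume *: "p \<in> K k" "q \<in> K k" "b \<in> KB" "c \<in> KB" "Q p b" "p \<sqsubseteq> q" "le c b"
    show "Q q c"
      unfolding Q_def
    proof (intro ballI impI)
      fix y assume y: "y \<in> T k" "q \<sqsubseteq> y"
      then have "p \<sqsubseteq> y" using * X.transK X.K_D T_D by blast
      then have "le b (rep (F y))" using * y unfolding Q_def by blast
      then show "le c (rep (F y))" using * B.transK B.K_D rF y by blast
    qed
  next
    fix p b c j assume "p \<in> K k" "b \<in> KB" "c \<in> KB" "j \<in> KB" "Q p b" "Q p c"
      "\<And>z. \<lbrakk>z \<in> B; le b z; le c z\<rbrakk> \<Longrightarrow> le j z"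
    then show "Q p j" unfolding Q_def using rF by blast
  qed (use rF Q_low in \<open>auto simp: Q_def\<close>)
qed

text \<open>Each \<open>fs n\<close> comes from the largest predicate for \<open>Fs n\<close>, while
  \<open>f\<close> comes from the bounds valid for \<open>F\<close> and for almost all
  \<open>Fs n\<close>; this smaller predicate forces \<open>fs\<close> to converge to
  \<open>f\<close> in the Scott sense. The last two clauses hold because functions bounded by the
  prescribed values lie below the largest realisations: \<open>fs n\<close> itself, and
  \<open>fH\<close> above \<open>f\<close>.\<close>

lemma realize:
  assumes d: "dens k" and Fs: "\<And>n. cont k (Fs n)" and F: "cont k F"
    and lim: "\<And>ys y i. \<lbrakk>y \<in> T k; \<And>n. ys n \<in> T k; scv k ys y; filterlim i at_top sequentially\<rbrakk>
      \<Longrightarrow> L (\<lambda>n. Fs (i n) (ys n)) (F y)"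
  obtains fs f where "\<And>n. fs n \<in> T (Suc k)" "f \<in> T (Suc k)" "scv (Suc k) fs f"
    "\<And>n y. y \<in> T k \<Longrightarrow> le (low (Fs n y)) (app (fs n) y)"
    "\<And>y. y \<in> T k \<Longrightarrow> le (low (F y)) (app f y)"
    "\<And>n y. y \<in> T k \<Longrightarrow> r (app (fs n) y) (Fs n y)"
    "\<And>y. y \<in> T k \<Longrightarrow> r (app f y) (F y)"
    "\<And>n g. \<lbrakk>g \<in> D (Suc k); \<And>y. y \<in> T k \<Longrightarrow> le (app g y) (Fs n y)\<rbrakk> \<Longrightarrow> joinable (Suc k) g (fs n)"
    "\<And>g. \<lbrakk>g \<in> D (Suc k); \<And>y. y \<in> T k \<Longrightarrow> le (app g y) (F y)\<rbrakk> \<Longrightarrow> joinable (Suc k) g f"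
proof -
  have rF: "rep (G y) \<in> B" if "y \<in> T k" "cont k G" for y G using contD[OF that(2,1)] rep by blast
  define QQ where "QQ = (\<lambda>G p b. \<forall>y\<in>T k. p \<sqsubseteq> y \<longrightarrow> le b (rep (G y)))"
  have ex: "\<exists>f\<in>T (Suc k). (\<forall>x\<in>D k. \<forall>b\<in>KB. le b (app f x) \<longleftrightarrow> (\<exists>p\<in>K k. p \<sqsubseteq> x \<and> QQ G p b)) \<and>
    (\<forall>y\<in>T k. le (low (G y)) (app f y) \<and> r (app f y) (G y))" if "cont k G" for G
    using realize_one(1)[OF d that] unfolding QQ_def .
  then have "\<forall>n. \<exists>f\<in>T (Suc k). (\<forall>x\<in>D k. \<forall>b\<in>KB. le b (app f x) \<longleftrightarrow> (\<exists>p\<in>K k. p \<sqsubseteq> x \<and> QQ (Fs n) p b)) \<and>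
    (\<forall>y\<in>T k. le (low (Fs n y)) (app f y) \<and> r (app f y) (Fs n y))" using Fs by blast
  then obtain fs where fs: "\<And>n. fs n \<in> T (Suc k)"
    "\<And>n x b. \<lbrakk>x \<in> D k; b \<in> KB\<rbrakk> \<Longrightarrow> le b (app (fs n) x) \<longleftrightarrow> (\<exists>p\<in>K k. p \<sqsubseteq> x \<and> QQ (Fs n) p b)"
    "\<And>n y. y \<in> T k \<Longrightarrow> le (low (Fs n y)) (app (fs n) y)" "\<And>n y. y \<in> T k \<Longrightarrow> r (app (fs n) y) (Fs n y)"
    by metis
  obtain fH where fH: "fH \<in> T (Suc k)"
    "\<And>x b. \<lbrakk>x \<in> D k; b \<in> KB\<rbrakk> \<Longrightarrow> le b (app fH x) \<longleftrightarrow> (\<exists>p\<in>K k. p \<sqsubseteq> x \<and> QQ F p b)"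
    using ex[OF F] by blast
  define Q where "Q = (\<lambda>p b. QQ F p b \<and> (\<exists>m. \<forall>n\<ge>m. QQ (Fs n) p b))"
  have QQ_mono: "QQ G q c"
    if *: "cont k G" "p \<in> K k" "q \<in> K k" "b \<in> KB" "c \<in> KB" "QQ G p b" "p \<sqsubseteq> q" "le c b" for G p q b c
    unfolding QQ_def
  proof (intro ballI impI)
    fix y assume y: "y \<in> T k" "q \<sqsubseteq> y"
    then have "p \<sqsubseteq> y" using * X.transK X.K_D T_D by blast
    then have "le b (rep (G y))" using * y unfolding QQ_def by blast
    then show "le c (rep (G y))" using * B.transK B.K_D rF y by blast
  qed
  have QQ_join: "QQ G p j" if "cont k G" "QQ G p b" "QQ G p c" "\<And>z. \<lbrakk>z \<in> B; le b z; le c z\<rbrakk> \<Longrightarrow> le j z"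
    for G p b c j
    using that rF unfolding QQ_def by blast
  have "\<exists>f\<in>T (Suc k). (\<forall>x\<in>D k. \<forall>b\<in>KB. le b (app f x) \<longleftrightarrow> (\<exists>p\<in>K k. p \<sqsubseteq> x \<and> Q p b)) \<and>
    (\<forall>y\<in>T k. le (low (F y)) (app f y) \<and> r (app f y) (F y))"
  proof (rule realize_Q[OF d F])
    show "le b (rep (F y))" if "Q p b" "y \<in> T k" "p \<sqsubseteq> y" for p b y
      using that unfolding Q_def QQ_def by blast
    show "Q q c" if "p \<in> K k" "q \<in> K k" "b \<in> KB" "c \<in> KB" "Q p b" "p \<sqsubseteq> q" "le c b" for p q b c
      using that QQ_mono[OF F] QQ_mono[OF Fs] unfolding Q_def by meson
    show "Q p b" if "p \<in> K k" "b \<in> KB" "\<And>z. z \<in> B \<Longrightarrow> le b z" for p b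
      using that rF F Fs unfolding Q_def QQ_def by blast
    show "Q p j" if *: "p \<in> K k" "b \<in> KB" "c \<in> KB" "j \<in> KB" "Q p b" "Q p c"
      "\<And>z. \<lbrakk>z \<in> B; le b z; le c z\<rbrakk> \<Longrightarrow> le j z" for p b c j
    proof -
      obtain m m' where "\<forall>n\<ge>m. QQ (Fs n) p b" "\<forall>n\<ge>m'. QQ (Fs n) p c" using *(5,6) unfolding Q_def by blast
      then have "\<forall>n\<ge>max m m'. QQ (Fs n) p j" using QQ_join[OF Fs, of _ p b c j] *(7) by simp
      moreover have "QQ F p j" using *(5,6) QQ_join[OF F _ _ *(7)] unfolding Q_def by blast
      ultimately show ?thesis unfolding Q_def by blast
    qed
    fix y b assume y: "y \<in> T k" and b: "b \<in> KB" "le b (low (F y))"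
    obtain p0 where p0: "p0 \<in> K k" "p0 \<sqsubseteq> y" "QQ F p0 b"
      using realize_one(2)[OF d F y b] unfolding QQ_def by blast
    show "\<exists>p\<in>K k. p \<sqsubseteq> y \<and> Q p b"
    proof (rule ccontr)
      assume no: "\<not> ?thesis"
      have neg: "\<exists>z\<in>T k. \<exists>n\<ge>m. p \<sqsubseteq> z \<and> \<not> le b (rep (Fs n z))"
        if p: "p \<in> K k" "p \<sqsubseteq> y" "p0 \<sqsubseteq> p" for p m
      proof -
        have "QQ F p b" using QQ_mono[OF F p0(1) p(1) b(1) b(1) p0(3) p(3)] B.refl B.K_D b by blast
        then show ?thesis using no p unfolding Q_def QQ_def by blast
      qed
      obtain c :: "nat \<Rightarrow> _" where c: "\<And>n. c n \<in> K k" "\<And>n. c n \<sqsubseteq> y"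
        "\<And>p. \<lbrakk>p \<in> K k; p \<sqsubseteq> y\<rbrakk> \<Longrightarrow> \<exists>m. \<forall>n\<ge>m. p \<sqsubseteq> c n"
        using X.chain_ex[OF T_D[OF y]] by metis
      \<comment> \<open>Starting the chain above \<open>p0\<close> secures the bound for
        \<open>F\<close>, so a failure of \<open>Q\<close> can only come from \<open>Fs n\<close>
        with arbitrarily large \<open>n\<close>.\<close>
      obtain m0 where m0: "\<forall>n\<ge>m0. p0 \<sqsubseteq> c n" using c(3)[OF p0(1,2)] by blast
      have "\<forall>n. \<exists>z i. z \<in> T k \<and> i \<ge> n \<and> c (n + m0) \<sqsubseteq> z \<and> \<not> le b (rep (Fs i z))"
        using neg[OF c(1,2)] m0 by (metis le_add2)
      then obtain z i where z: "\<And>n. z n \<in> T k" "\<And>n. i n \<ge> n" "\<And>n. c (n + m0) \<sqsubseteq> z n"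
        "\<And>n. \<not> le b (rep (Fs (i n) (z n)))" by metis
      have "scv k z y"
        unfolding scv_def
      proof (intro conjI allI ballI impI)
        fix p assume p: "p \<in> K k" "p \<sqsubseteq> y"
        then obtain m where m: "\<forall>n\<ge>m. p \<sqsubseteq> c n" using c(3) by blast
        have "p \<sqsubseteq> z n" if "n \<ge> m" for n
          using m that X.transK[OF _ z(3) p(1), of n] c(1) z(1) T_D X.K_D by simp
        then show "\<forall>\<^sub>F n in sequentially. p \<sqsubseteq> z n" unfolding eventually_sequentially by blast
      qed (use y z T_D in auto)
      moreover have "filterlim i at_top sequentially"
        using filterlim_at_top_mono[OF filterlim_ident, of i] z(2) by simp
      ultimately have "L (\<lambda>n. Fs (i n) (z n)) (F y)" using lim y z by blast
      then have "\<forall>\<^sub>F n in sequentially. le b (rep (Fs (i n) (z n)))"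
        using L_low[of "F y" "\<lambda>n. Fs (i n) (z n)"] contD[OF F] contD[OF Fs] y z b by blast
      then show False using z(4) by simp
    qed
  qed
  then obtain f where f: "f \<in> T (Suc k)"
    "\<And>x b. \<lbrakk>x \<in> D k; b \<in> KB\<rbrakk> \<Longrightarrow> le b (app f x) \<longleftrightarrow> (\<exists>p\<in>K k. p \<sqsubseteq> x \<and> Q p b)"
    "\<And>y. y \<in> T k \<Longrightarrow> le (low (F y)) (app f y)" "\<And>y. y \<in> T k \<Longrightarrow> r (app f y) (F y)"
    by blast
  have below: "g \<sqsubseteq> f'" if g: "g \<in> D (Suc k)" "\<And>y. y \<in> T k \<Longrightarrow> le (app g y) (G y)" and G: "cont k G"
    and f': "f' \<in> T (Suc k)" "\<And>x b. \<lbrakk>x \<in> D k; b \<in> KB\<rbrakk> \<Longrightarrow> le b (app f' x) \<longleftrightarrow> (\<exists>p\<in>K k. p \<sqsubseteq> x \<and> QQ G p b)"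
    for g f' G
    unfolding fleS[OF g(1) T_D[OF f'(1)]]
  proof
    fix x assume x: "x \<in> D k"
    show "le (app g x) (app f' x)"
    proof (rule B.leI)
      fix b assume b: "b \<in> KB" "le b (app g x)"
      then obtain p where p: "p \<in> K k" "p \<sqsubseteq> x" "le b (app g p)" using appI g(1) x by blast
      have "le b (rep (G y))" if y: "y \<in> T k" "p \<sqsubseteq> y" for y
      proof -
        have "le b (app g y)" using appI[OF g(1) T_D[OF y(1)] b(1)] p y by blast
        moreover have "G y \<in> B" "le (G y) (rep (G y))" using contD[OF G y(1)] rep by blast+
        ultimately show ?thesis
          using B.transK[of b "app g y" "G y"] B.transK[of b "G y" "rep (G y)"] g(2)[OF y(1)] b(1)
            rF[OF y(1) G] appB[OF g(1) T_D[OF y(1)]] by blast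
      qed
      then have "QQ G p b" unfolding QQ_def by blast
      then show "le b (app f' x)" using f'(2)[OF x b(1)] p by blast
    qed (use appB[OF g(1) x] appB[OF T_D[OF f'(1)] x] in auto)
  qed
  have ffH: "f \<sqsubseteq> fH"
    unfolding fleS[OF T_D[OF f(1)] T_D[OF fH(1)]]
    by (rule ballI, rule B.leI)
      (use f(2) fH(2) appB[OF T_D[OF f(1)]] appB[OF T_D[OF fH(1)]] in \<open>auto simp: Q_def\<close>)
  have "scv (Suc k) fs f"
    unfolding scv_def
  proof (intro conjI allI ballI impI)
    fix g assume g: "g \<in> K (Suc k)" "g \<sqsubseteq> f"
    then obtain u where u: "finite u" "u \<subseteq> K k \<times> KB" "presents k u g" by auto
    have "\<forall>\<^sub>F n in sequentially. le b (app (fs n) p)" if pb: "(p, b) \<in> u" for p b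
    proof -
      have pk: "p \<in> K k" "b \<in> KB" using u pb by auto
      have "le b (app f p)" using u(3) g(2) pb T_D[OF f(1)] by (auto simp: presents_def)
      then obtain q m where q: "q \<in> K k" "q \<sqsubseteq> p" "\<forall>n\<ge>m. QQ (Fs n) q b"
        using f(2)[OF X.K_D[OF pk(1)] pk(2)] unfolding Q_def by blast
      then have "\<forall>n\<ge>m. le b (app (fs n) p)" using fs(2)[OF X.K_D[OF pk(1)] pk(2)] by blast
      then show ?thesis unfolding eventually_sequentially by blast
    qed
    then have "\<forall>\<^sub>F n in sequentially. \<forall>(p, b)\<in>u. le b (app (fs n) p)"
      using u(1) by (auto simp: eventually_ball_finite_distrib split: prod.splits)
    then show "\<forall>\<^sub>F n in sequentially. g \<sqsubseteq> fs n"
      by (rule eventually_mono) (use u(3) T_D[OF fs(1)] in \<open>auto simp: presents_def\<close>)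
  qed (use fs(1) f(1) T_D in auto)
  note sc = this
  show thesis
  proof (rule that[OF fs(1) f(1) sc])
    fix n g assume "g \<in> D (Suc k)" "\<And>y. y \<in> T k \<Longrightarrow> le (app g y) (Fs n y)"
    then have "g \<sqsubseteq> fs n" using below[OF _ _ Fs fs(1) fs(2)] by blast
    then show "joinable (Suc k) g (fs n)" unfolding joinable_def using T_D[OF fs(1)] X.refl by blast
  next
    fix g assume "g \<in> D (Suc k)" "\<And>y. y \<in> T k \<Longrightarrow> le (app g y) (F y)"
    then have "g \<sqsubseteq> fH" using below[OF _ _ F fH] by blast
    then show "joinable (Suc k) g f" unfolding joinable_def using T_D[OF fH(1)] ffH by blast
  qed (use fs f in auto)
qed

section \<open>Comparison of Scott convergence with continuous convergence\<close>

definition conv_ok :: "nat \<Rightarrow> bool" where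
  "conv_ok k \<longleftrightarrow> (\<forall>ys y. y \<in> T k \<longrightarrow> (\<forall>n. ys n \<in> T k) \<longrightarrow> scv k ys y \<longrightarrow> conv k ys y) \<and>
    (\<forall>ys y. conv k ys y \<longrightarrow> (\<exists>ys' y'. y' \<in> T k \<and> (\<forall>n. ys' n \<in> T k) \<and> scv k ys' y' \<and>
      (\<forall>n. joinable k (ys n) (ys' n)) \<and> joinable k y y'))"

lemma scv_conv: "\<lbrakk>conv_ok k; y \<in> T k; \<And>n. ys n \<in> T k; scv k ys y\<rbrakk> \<Longrightarrow> conv k ys y"
  unfolding conv_ok_def by blast

lemma conv_scv:
  assumes "conv_ok k" "conv k ys y"
  obtains ys' y' where "y' \<in> T k" "\<And>n. ys' n \<in> T k" "scv k ys' y'"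
    "\<And>n. joinable k (ys n) (ys' n)" "joinable k y y'"
  using assms unfolding conv_ok_def by blast

lemma joinable_sym: "joinable k x y \<Longrightarrow> joinable k y x"
  unfolding joinable_def by blast

lemma scv_sub: "\<lbrakk>scv k ys y; filterlim i at_top sequentially\<rbrakk> \<Longrightarrow> scv k (\<lambda>n. ys (i n)) y"
  unfolding scv_def by (auto intro: eventually_compose_filterlim)

text \<open>The arguments are replaced by joinable ones that converge in the Scott topology, where
  application is continuous by \<open>scv_app\<close>; \<open>L_join\<close> transports the limit
  back.\<close>

lemma scv_conv_Suc:
  assumes ok: "conv_ok k" and f: "f \<in> T (Suc k)" "\<And>n. fs n \<in> T (Suc k)" "scv (Suc k) fs f"
  shows "conv (Suc k) fs f"
  unfolding conv.simps
proof (intro conjI allI impI)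
  fix ys y i assume y: "conv k ys y" and i: "filterlim (i :: nat \<Rightarrow> nat) at_top sequentially"
  obtain ys' y' where y': "y' \<in> T k" "\<And>n. ys' n \<in> T k" "scv k ys' y'"
    "\<And>n. joinable k (ys n) (ys' n)" "joinable k y y'"
    by (rule conv_scv[OF ok y], rule that)
  have t: "y \<in> T k" "\<And>n. ys n \<in> T k" using conv_T[OF y] by auto
  have "L (\<lambda>n. app (fs (i n)) (ys' n)) (app f y')"
  proof (rule L_sconv)
    show "B.sconv (\<lambda>n. app (fs (i n)) (ys' n)) (app f y')" by (rule scv_app[OF scv_sub[OF f(3) i] y'(3)])
  qed (auto intro: T_appB[OF f(1)] T_appr[OF f(1)] T_appB[OF f(2)] T_appr[OF f(2)] y')
  then show "L (\<lambda>n. app (fs (i n)) (ys n)) (app f y)"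
  proof (rule L_join)
    show "\<exists>z\<in>B. le (app (fs (i n)) (ys' n)) z \<and> le (app (fs (i n)) (ys n)) z" for n
      using joinable_app[OF T_D[OF f(2)] joinable_sym[OF y'(4)]] T_D t y' by blast
    show "\<exists>z\<in>B. le (app f y') z \<and> le (app f y) z"
      using joinable_app[OF T_D[OF f(1)] joinable_sym[OF y'(5)]] T_D t y' by blast
  qed (auto intro: T_appB[OF f(1)] T_appr[OF f(1)] T_appB[OF f(2)] T_appr[OF f(2)] y' t)
qed (use f in auto)

lemma conv_const_Suc: "\<lbrakk>conv_ok k; f \<in> T (Suc k)\<rbrakk> \<Longrightarrow> conv (Suc k) (\<lambda>_. f) f"
  by (rule scv_conv_Suc) (auto intro: scv_const T_D)

text \<open>Conversely to \<open>L_sconv\<close>, raising the members of the sequence to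
  \<open>rep\<close> and replacing the limit by \<open>low\<close> turns \<open>L\<close> into Scott
  convergence, by \<open>L_low\<close>.\<close>

lemma conv_ok_0: "conv_ok 0"
  unfolding conv_ok_def
proof (intro conjI allI impI)
  fix ys y assume *: "y \<in> T 0" "\<forall>n. ys n \<in> T 0" "scv 0 ys y"
  have v: "x = Val (val x)" "val x \<in> B" "r (val x) (val x)" if "x \<in> T 0" for x
    using that by (auto simp: tot_def D_0)
  have "\<forall>\<^sub>F n in sequentially. le p (val (ys n))" if p: "p \<in> KB" "le p (val y)" for p
  proof -
    have "Val p \<sqsubseteq> y" using v(1)[OF *(1)] p by (metis func_le.simps(1))
    then have "\<forall>\<^sub>F n in sequentially. Val p \<sqsubseteq> ys n" using * p by (auto simp: scv_def)
    then show ?thesis by (rule eventually_mono) (metis *(2) v(1) func_le.simps(1))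
  qed
  then have "L (\<lambda>n. val (ys n)) (val y)"
    using v(2,3) * by (intro L_sconv) (auto simp: B.sconv_def)
  then show "conv 0 ys y" using * by simp
next
  fix ys y assume *: "conv 0 ys y"
  have v: "x = Val (val x)" "val x \<in> B" "r (val x) (val x)" if "x \<in> T 0" for x
    using that by (auto simp: tot_def D_0)
  have t: "y \<in> T 0" "\<And>n. ys n \<in> T 0" "L (\<lambda>n. val (ys n)) (val y)" using * by auto
  let ?ys = "\<lambda>n. Val (rep (val (ys n)))" and ?y = "Val (low (val y))"
  have T: "?y \<in> T 0" "\<And>n. ?ys n \<in> T 0"
  proof -
    have "r (low (val y)) (low (val y))" using low[OF v(2,3)[OF t(1)]] r_trans[OF r_sym] by blast
    then show "?y \<in> T 0" using low[OF v(2,3)[OF t(1)]] by (simp add: tot_def D_0)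
    show "?ys n \<in> T 0" for n
      using rep[OF v(2,3)[OF t(2)]] r_up[OF v(3)[OF t(2)] _ v(2)[OF t(2)]] r_trans[OF r_sym]
      by (simp add: tot_def D_0) blast
  qed
  have "scv 0 ?ys ?y"
    using T_D T L_low[OF v(2,3)[OF t(1)] v(2,3)[OF t(2)] t(3)] by (auto simp: scv_def)
  moreover have "joinable 0 (ys n) (?ys n)" for n
  proof -
    obtain a where a: "ys n = Val a" using v(1)[OF t(2)] by blast
    have "rep a \<in> B" "le a (rep a)" using rep v(2,3)[OF t(2)[of n]] a by auto
    then show ?thesis
      unfolding joinable_def D_0 using a B.refl by (intro bexI[of _ "?ys n"]) auto
  qed
  moreover have "joinable 0 y ?y"
  proof -
    obtain a where a: "y = Val a" using v(1)[OF t(1)] by blast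
    have "rep a \<in> B" "le a (rep a)" "le (low a) (rep a)"
      using rep[of a] low[of a] v(2,3)[OF t(1)] a by auto
    then show ?thesis
      unfolding joinable_def D_0 using a B.refl by (intro bexI[of _ "Val (rep a)"]) auto
  qed
  ultimately show "\<exists>ys' y'. y' \<in> T 0 \<and> (\<forall>n. ys' n \<in> T 0) \<and> scv 0 ys' y' \<and>
      (\<forall>n. joinable 0 (ys n) (ys' n)) \<and> joinable 0 y y'"
    using T by (intro exI[of _ ?ys] exI[of _ ?y]) blast
qed

text \<open>A continuously convergent sequence meets the assumptions of \<open>realize\<close> with
  its own values as the prescribed functions; the realisations converge in the Scott topology and
  are joinable with the given functionals.\<close>

lemma conv_ok_Suc:
  assumes d: "dens k" and ok: "conv_ok k"
  shows "conv_ok (Suc k)"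
  unfolding conv_ok_def
proof (intro conjI allI impI)
  show "conv (Suc k) fs f" if "f \<in> T (Suc k)" "\<forall>n. fs n \<in> T (Suc k)" "scv (Suc k) fs f" for fs f
    using scv_conv_Suc[OF ok] that by blast
  fix fs f assume f: "conv (Suc k) fs f"
  then have t: "f \<in> T (Suc k)" "\<And>n. fs n \<in> T (Suc k)" by auto
  have "\<exists>fs' f'. (\<forall>n. fs' n \<in> T (Suc k)) \<and> f' \<in> T (Suc k) \<and> scv (Suc k) fs' f' \<and>
    (\<forall>n. joinable (Suc k) (fs n) (fs' n)) \<and> joinable (Suc k) f f'"
  proof (rule realize[OF d cont_app[OF t(2)] cont_app[OF t(1)]])
    show "L (\<lambda>n. app (fs (i n)) (ys n)) (app f y)"
      if "y \<in> T k" "\<And>n. ys n \<in> T k" "scv k ys y" "filterlim i at_top sequentially" for ys y i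
      using f scv_conv[OF ok that(1-3)] that(4) by auto
    fix gs g assume "\<And>n. gs n \<in> T (Suc k)" "g \<in> T (Suc k)" "scv (Suc k) gs g"
     "\<And>n h. \<lbrakk>h \<in> D (Suc k); \<And>y. y \<in> T k \<Longrightarrow> le (app h y) (app (fs n) y)\<rbrakk> \<Longrightarrow> joinable (Suc k) h (gs n)"
     "\<And>h. \<lbrakk>h \<in> D (Suc k); \<And>y. y \<in> T k \<Longrightarrow> le (app h y) (app f y)\<rbrakk> \<Longrightarrow> joinable (Suc k) h g"
    moreover have "\<And>n y. y \<in> T k \<Longrightarrow> le (app (fs n) y) (app (fs n) y)"
      "\<And>y. y \<in> T k \<Longrightarrow> le (app f y) (app f y)" using T_app t B.refl by blast+
    ultimately show ?thesis using T_D[OF t(2)] T_D[OF t(1)] by (intro exI[of _ gs] exI[of _ g]) blast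
  qed
  then show "\<exists>ys' y'. y' \<in> T (Suc k) \<and> (\<forall>n. ys' n \<in> T (Suc k)) \<and> scv (Suc k) ys' y' \<and>
      (\<forall>n. joinable (Suc k) (fs n) (ys' n)) \<and> joinable (Suc k) f y'" by blast
qed

lemma conv_okI: "(\<And>j. j < k \<Longrightarrow> dens j) \<Longrightarrow> conv_ok k"
  by (induction k) (auto intro: conv_ok_0 conv_ok_Suc)

end

section \<open>The three hierarchies as instances\<close>

text \<open>With \<open>sim\<close> constantly false the restriction in \<open>D_Suc\<close>
  disappears. Base values are discrete, so representatives need no adjustment and \<open>rep\<close>
  and \<open>low\<close> are identities.\<close>

interpretation N: hier UNIV N_le UNIV N_dom "\<lambda>_ _. True" "\<lambda>_ _ _. False" N_eq0
  "\<lambda>xs x. \<forall>\<^sub>F n in sequentially. xs n = x" "\<lambda>x. x" "\<lambda>x. x"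
proof -
  interpret B: sdom UNIV N_le UNIV
  proof
    fix I :: "nat option set"
    assume I: "I \<noteq> {}" "\<And>p q. \<lbrakk>p \<in> I; q \<in> I\<rbrakk> \<Longrightarrow> \<exists>u\<in>I. N_le p u \<and> N_le q u"
    show "\<exists>s\<in>UNIV. \<forall>p\<in>UNIV. N_le p s \<longleftrightarrow> (\<exists>q\<in>I. N_le p q)"
    proof (cases "\<exists>i. Some i \<in> I")
      case True
      then obtain i where i: "Some i \<in> I" by blast
      have "q = None \<or> q = Some i" if "q \<in> I" for q
        using I(2)[OF i that] by (auto simp: N_le_def)
      then show ?thesis using i by (intro bexI[of _ "Some i"]) (auto simp: N_le_def)
    next
      case False
      then have "I = {None}" using I(1) by (metis ex_in_conv not_None_eq singletonI subsetI subset_singletonD)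
      then show ?thesis by (auto simp: N_le_def)
    qed
  qed (auto simp: N_le_def)
  show "hier UNIV N_le UNIV N_dom (\<lambda>_ _. True) (\<lambda>_ _ _. False) N_eq0
      (\<lambda>xs x. \<forall>\<^sub>F n in sequentially. xs n = x) (\<lambda>x. x) (\<lambda>x. x)"
  proof
    show "\<forall>\<^sub>F n in sequentially. xs n = x"
      if "N_eq0 x x" "B.sconv xs x" for xs x
    proof -
      have "\<forall>\<^sub>F n in sequentially. N_le x (xs n)" using that(2) by (auto simp: B.sconv_def N_le_def)
      then show ?thesis by (rule eventually_mono) (use that(1) in \<open>auto simp: N_le_def N_eq0_def\<close>)
    qed
    show "\<forall>\<^sub>F n in sequentially. ys n = y"
      if "\<forall>\<^sub>F n in sequentially. xs n = x" "N_eq0 x x" "\<And>n. N_eq0 (ys n) (ys n)" "N_eq0 y y"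
        "\<And>n. \<exists>z\<in>UNIV. N_le (xs n) z \<and> N_le (ys n) z" "\<exists>z\<in>UNIV. N_le x z \<and> N_le y z" for xs ys x y
      using that(1)
    proof eventually_elim
      case (elim n)
      show ?case using that(2,4,6) that(3,5)[of n] elim by (auto simp: N_eq0_def N_le_def)
    qed
    show "\<forall>\<^sub>F n in sequentially. N_le b (xs n)"
      if "\<forall>\<^sub>F n in sequentially. xs n = x" "N_le b x" for xs x b
      using that(1) by (rule eventually_mono) (use that(2) in simp)
  qed (auto simp: N_eq0_def N_le_def scott_maps_def)
qed

section \<open>Ideals of rational intervals\<close>

lemma E_base_interval: "X \<in> E_base \<Longrightarrow> X = UNIV \<or> (\<exists>p q. p \<le> q \<and> X = {real_of_rat p..real_of_rat q})"
  by (auto simp: E_base_def)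

lemma E_base_ne: "X \<in> E_base \<Longrightarrow> X \<noteq> {}"
  by (auto simp: E_base_def of_rat_less_eq)

lemma E_base_Int:
  assumes "X \<in> E_base" "Y \<in> E_base" "X \<inter> Y \<noteq> {}"
  shows "X \<inter> Y \<in> E_base"
proof -
  consider "X = UNIV" | "Y = UNIV" | p q p' q' where "X = {real_of_rat p..real_of_rat q}"
    "Y = {real_of_rat p'..real_of_rat q'}" using assms(1,2) E_base_interval by metis
  then show ?thesis
  proof cases
    case 3
    then have eq: "X \<inter> Y = {real_of_rat (max p p')..real_of_rat (min q q')}"
      by (auto simp: max_def min_def of_rat_less_eq)
    then have "real_of_rat (max p p') \<le> real_of_rat (min q q')" using assms(3) by auto
    then have "max p p' \<le> min q q'" by (simp only: of_rat_less_eq)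
    then show ?thesis unfolding eq E_base_def by blast
  qed (use assms in auto)
qed

lemma E0I:
  assumes "\<alpha> \<subseteq> E_base" "UNIV \<in> \<alpha>" "\<And>X Y. \<lbrakk>X \<in> \<alpha>; Y \<in> \<alpha>\<rbrakk> \<Longrightarrow> X \<inter> Y \<in> \<alpha>"
    "\<And>X Y. \<lbrakk>X \<in> \<alpha>; Y \<in> E_base; X \<subseteq> Y\<rbrakk> \<Longrightarrow> Y \<in> \<alpha>"
  shows "\<alpha> \<in> E0"
proof -
  have "\<exists>Z\<in>\<alpha>. Z \<subseteq> X \<and> Z \<subseteq> Y" if "X \<in> \<alpha>" "Y \<in> \<alpha>" for X Y
    using assms(3)[OF that] by (intro bexI[of _ "X \<inter> Y"]) auto
  then show ?thesis using assms(1,2,4) unfolding E0_def directed_def by blast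
qed

lemma
  assumes "\<alpha> \<in> E0"
  shows E0_base: "\<alpha> \<subseteq> E_base" and E0_UNIV: "UNIV \<in> \<alpha>"
    and E0_Int: "\<And>X Y. \<lbrakk>X \<in> \<alpha>; Y \<in> \<alpha>\<rbrakk> \<Longrightarrow> X \<inter> Y \<in> \<alpha>"
    and E0_up: "\<And>X Y. \<lbrakk>X \<in> \<alpha>; Y \<in> E_base; X \<subseteq> Y\<rbrakk> \<Longrightarrow> Y \<in> \<alpha>"
proof -
  show b: "\<alpha> \<subseteq> E_base" and u: "\<And>X Y. \<lbrakk>X \<in> \<alpha>; Y \<in> E_base; X \<subseteq> Y\<rbrakk> \<Longrightarrow> Y \<in> \<alpha>"
    using assms by (auto simp: E0_def)
  obtain X where "X \<in> \<alpha>" using assms by (auto simp: E0_def directed_def)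
  then show "UNIV \<in> \<alpha>" using u[of X UNIV] by (auto simp: E_base_def)
  fix X Y assume XY: "X \<in> \<alpha>" "Y \<in> \<alpha>"
  have "\<exists>Z\<in>\<alpha>. Z \<subseteq> X \<and> Z \<subseteq> Y" using assms XY unfolding E0_def directed_def by blast
  then obtain Z where Z: "Z \<in> \<alpha>" "Z \<subseteq> X \<inter> Y" by blast
  then have "Z \<noteq> {}" using b E_base_ne by blast
  then have "X \<inter> Y \<in> E_base" using XY Z b E_base_Int[of X Y] by blast
  then show "X \<inter> Y \<in> \<alpha>" using u[OF Z(1) _ Z(2)] by blast
qed

definition E_principal :: "real set \<Rightarrow> real set set" where
  "E_principal X = {Y \<in> E_base. X \<subseteq> Y}"

lemma E_principal_E0: "X \<in> E_base \<Longrightarrow> E_principal X \<in> E0"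
proof -
  assume X: "X \<in> E_base"
  then have "X \<noteq> {}" by (rule E_base_ne)
  then have "Y \<inter> Z \<in> E_principal X" if "Y \<in> E_principal X" "Z \<in> E_principal X" for Y Z
    using that E_base_Int[of Y Z] by (auto simp: E_principal_def)
  then show ?thesis by (intro E0I) (auto simp: E_principal_def E_base_def)
qed

lemma E_principal_le: "\<lbrakk>X \<in> E_base; \<alpha> \<in> E0\<rbrakk> \<Longrightarrow> E_principal X \<subseteq> \<alpha> \<longleftrightarrow> X \<in> \<alpha>"
  using E0_up by (auto simp: E_principal_def)

lemma E_val_eq: "\<Inter>\<alpha> = {x} \<Longrightarrow> E_val \<alpha> = x"
  by (simp add: E_val_def)

lemma E_eq0_iff: "E_eq0 \<alpha> \<beta> \<longleftrightarrow> \<Inter>\<alpha> = {E_val \<alpha>} \<and> \<Inter>\<beta> = {E_val \<beta>} \<and> E_val \<alpha> = E_val \<beta>"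
  unfolding E_eq0_def using E_val_eq by metis

lemma E0_small_interval:
  assumes a: "\<alpha> \<in> E0" "\<Inter>\<alpha> = {x}" and e: "e > 0"
  obtains X where "X \<in> \<alpha>" "X \<subseteq> {x - e<..<x + e}"
proof -
  have x: "x \<in> X" if "X \<in> \<alpha>" for X using a(2) that by auto
  have iv: "y \<in> X" if "X \<in> E_base" "a \<in> X" "b \<in> X" "a \<le> y" "y \<le> b" for X a b y
    using that by (auto simp: E_base_def)
  have "x - e \<notin> \<Inter>\<alpha>" "x + e \<notin> \<Inter>\<alpha>" using a(2) e by auto
  then obtain X Y where XY: "X \<in> \<alpha>" "x - e \<notin> X" "Y \<in> \<alpha>" "x + e \<notin> Y" by blast
  then have m: "X \<in> E_base" "Y \<in> E_base" "X \<inter> Y \<in> \<alpha>" using E0_base E0_Int a(1) by blast+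
  have "z > x - e" if "z \<in> X" for z using iv[OF m(1) that x[OF XY(1)], of "x - e"] e XY by fastforce
  moreover have "z < x + e" if "z \<in> Y" for z using iv[OF m(2) x[OF XY(3)] that, of "x + e"] e XY by fastforce
  ultimately have "X \<inter> Y \<subseteq> {x - e<..<x + e}" by fastforce
  then show thesis using m(3) that by blast
qed

text \<open>Every interval of the larger ideal meets arbitrarily short intervals around
  \<open>x\<close>, and it is closed. Hence enlarging a total ideal does not change its
  value.\<close>

lemma E0_val_mem:
  assumes "\<alpha> \<in> E0" "\<Inter>\<alpha> = {x}" "\<beta> \<in> E0" "\<alpha> \<subseteq> \<beta>" "Y \<in> \<beta>"
  shows "x \<in> Y"
proof -
  have "closed Y" using assms(3,5) E0_base by (auto simp: E_base_def)
  moreover have "\<exists>y\<in>Y. dist y x < e" if "e > 0" for e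
  proof -
    obtain X where X: "X \<in> \<alpha>" "X \<subseteq> {x - e<..<x + e}" by (rule E0_small_interval[OF assms(1,2) \<open>e > 0\<close>])
    then have "X \<inter> Y \<in> E_base" using E0_Int[OF assms(3)] E0_base[OF assms(3)] assms(4,5) by blast
    then obtain y where y: "y \<in> X" "y \<in> Y" using E_base_ne by blast
    then have "x - e < y" "y < x + e" using X(2) by auto
    then have "dist y x < e" by (simp add: dist_real_def abs_less_iff)
    then show ?thesis using y(2) by blast
  qed
  ultimately show ?thesis using closed_approachable by blast
qed

text \<open>The largest ideal with value \<open>x\<close>; it serves as \<open>rep\<close> of every
  total ideal with that value.\<close>

definition E_rep :: "real \<Rightarrow> real set set" where
  "E_rep x = {X \<in> E_base. x \<in> X}"

text \<open>The members of \<open>E_base\<close> that are neighbourhoods of \<open>x\<close>: lying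
  in such an interval is stable under small changes of \<open>x\<close>, whereas \<open>x\<close>
  may be an end point of a member of \<open>E_rep x\<close>.\<close>

definition E_low :: "real \<Rightarrow> real set set" where
  "E_low x = {X \<in> E_base. x \<in> interior X}"

lemma E_rep_E0: "E_rep x \<in> E0"
proof (rule E0I)
  show "X \<inter> Y \<in> E_rep x" if "X \<in> E_rep x" "Y \<in> E_rep x" for X Y
    using that E_base_Int[of X Y] by (auto simp: E_rep_def)
qed (auto simp: E_rep_def E_base_def)

lemma E_low_E0: "E_low x \<in> E0"
proof (rule E0I)
  show "X \<inter> Y \<in> E_low x" if "X \<in> E_low x" "Y \<in> E_low x" for X Y
  proof -
    have "x \<in> X \<inter> Y" using that interior_subset by (auto simp: E_low_def)
    then show ?thesis using that E_base_Int[of X Y] by (auto simp: E_low_def)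
  qed
  show "Y \<in> E_low x" if "X \<in> E_low x" "Y \<in> E_base" "X \<subseteq> Y" for X Y
    using that interior_mono by (auto simp: E_low_def)
qed (auto simp: E_low_def E_base_def)

lemma E_low_le: "E_low x \<subseteq> E_rep x"
  using interior_subset by (auto simp: E_low_def E_rep_def)

lemma Inter_E_low: "\<Inter>(E_low x) = {x}" and Inter_E_rep: "\<Inter>(E_rep x) = {x}"
proof -
  have 1: "x \<in> \<Inter>(E_rep x)" by (auto simp: E_rep_def)
  have 2: "y = x" if y: "y \<in> \<Inter>(E_low x)" for y
  proof (rule ccontr)
    assume ne: "y \<noteq> x"
    let ?e = "\<bar>y - x\<bar>"
    obtain p where p: "x - ?e < real_of_rat p" "real_of_rat p < x"
      using of_rat_dense[of "x - ?e" x] ne by auto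
    obtain q where q: "x < real_of_rat q" "real_of_rat q < x + ?e"
      using of_rat_dense[of x "x + ?e"] ne by auto
    have "p \<le> q" using p q by (smt (verit) of_rat_less_eq)
    then have "{real_of_rat p..real_of_rat q} \<in> E_low x" using p q by (auto simp: E_low_def E_base_def)
    then show False using y p q by force
  qed
  show "\<Inter>(E_low x) = {x}" "\<Inter>(E_rep x) = {x}" using 1 2 E_low_le[of x] by auto
qed

lemma E_val_rep [simp]: "E_val (E_rep x) = x" and E_val_low [simp]: "E_val (E_low x) = x"
  by (rule E_val_eq[OF Inter_E_rep], rule E_val_eq[OF Inter_E_low])

text \<open>Convergence of total ideals is convergence of their real values. Here \<open>low\<close>
  and \<open>rep\<close> must differ, since an interval that contains the limit only as an end point
  need not contain the nearby values.\<close>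

interpretation E: hier E0 "(\<subseteq>)" "E_principal ` E_base" E_dom "\<lambda>_ _. True" "\<lambda>_ _ _. False" E_eq0
  "\<lambda>xs x. (\<lambda>n. E_val (xs n)) \<longlonglongrightarrow> E_val x" "\<lambda>x. E_rep (E_val x)" "\<lambda>x. E_low (E_val x)"
proof -
  let ?K = "E_principal ` E_base"
  interpret B: sdom E0 "(\<subseteq>)" ?K
  proof
    have "E_base = {UNIV} \<union> (\<lambda>(p, q). {real_of_rat p..real_of_rat q}) ` {(p, q). p \<le> q}"
      by (auto simp: E_base_def)
    then have "countable E_base" by (metis countable_Un countable_finite countable_image countableI_type finite.simps)
    then show "countable ?K" by (rule countable_image)
    show "?K \<subseteq> E0" using E_principal_E0 by auto
    have "E_principal UNIV \<subseteq> \<alpha>" if "\<alpha> \<in> E0" for \<alpha> using E_principal_le[of UNIV] that E0_UNIV by (simp add: E_base_def)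
    then show "\<exists>p\<in>?K. \<forall>x\<in>E0. p \<subseteq> x" by (auto simp: E_base_def)
    show "\<exists>j\<in>?K. p \<subseteq> j \<and> q \<subseteq> j \<and> (\<forall>z\<in>E0. p \<subseteq> z \<longrightarrow> q \<subseteq> z \<longrightarrow> j \<subseteq> z)"
      if pq: "p \<in> ?K" "q \<in> ?K" "x \<in> E0" "p \<subseteq> x" "q \<subseteq> x" for p q x
    proof -
      obtain X Y where XY: "X \<in> E_base" "p = E_principal X" "Y \<in> E_base" "q = E_principal Y" using pq by auto
      then have "X \<in> x" "Y \<in> x" using pq E_principal_le[OF _ pq(3)] by auto
      then have "X \<inter> Y \<in> x" by (rule E0_Int[OF pq(3)])
      then have b: "X \<inter> Y \<in> E_base" using pq E0_base by blast
      then have "E_principal (X \<inter> Y) \<subseteq> z \<longleftrightarrow> X \<in> z \<and> Y \<in> z" if "z \<in> E0" for z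
        using E_principal_le that E0_Int[OF that] E0_up[OF that] XY by (metis inf_le1 inf_le2)
      then show ?thesis using XY b E_principal_le E_principal_E0
        by (intro bexI[of _ "E_principal (X \<inter> Y)"]) (auto simp: E_principal_def)
    qed
    show "x \<subseteq> y" if xy: "x \<in> E0" "y \<in> E0" and p: "\<And>p. \<lbrakk>p \<in> ?K; p \<subseteq> x\<rbrakk> \<Longrightarrow> p \<subseteq> y" for x y
    proof
      fix X assume X: "X \<in> x"
      then have b: "X \<in> E_base" using E0_base[OF xy(1)] by blast
      show "X \<in> y" using p[of "E_principal X"] E_principal_le[OF b xy(1)] E_principal_le[OF b xy(2)] X b by blast
    qed
    fix I assume I: "I \<subseteq> ?K" "I \<noteq> {}" "\<And>p q. \<lbrakk>p \<in> I; q \<in> I\<rbrakk> \<Longrightarrow> \<exists>u\<in>I. p \<subseteq> u \<and> q \<subseteq> u"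
    then have IE: "\<alpha> \<in> E0" if "\<alpha> \<in> I" for \<alpha> using that E_principal_E0 by auto
    have s: "\<Union>I \<in> E0"
    proof (rule E0I)
      show "UNIV \<in> \<Union>I" using I(2) IE E0_UNIV by blast
      show "X \<inter> Y \<in> \<Union>I" if "X \<in> \<Union>I" "Y \<in> \<Union>I" for X Y
      proof -
        obtain a b where ab: "a \<in> I" "b \<in> I" "X \<in> a" "Y \<in> b" using \<open>X \<in> \<Union>I\<close> \<open>Y \<in> \<Union>I\<close> by blast
        then obtain c where c: "c \<in> I" "a \<subseteq> c" "b \<subseteq> c" using I(3) by blast
        then have "X \<inter> Y \<in> c" using E0_Int[OF IE] ab by blast
        then show ?thesis using c(1) by blast
      qed
    qed (use IE E0_base E0_up in blast)+
    have "p \<subseteq> \<Union>I \<longleftrightarrow> (\<exists>q\<in>I. p \<subseteq> q)" if "p \<in> ?K" for p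
      using that E_principal_le s IE by auto
    then show "\<exists>s\<in>E0. \<forall>p\<in>?K. p \<subseteq> s \<longleftrightarrow> (\<exists>q\<in>I. p \<subseteq> q)" using s by blast
  qed auto
  have total: "E_eq0 x x \<longleftrightarrow> \<Inter>x = {E_val x}" for x using E_eq0_iff by blast
  have up: "E_eq0 x y" if "E_eq0 x x" "x \<subseteq> y" "x \<in> E0" "y \<in> E0" for x y
  proof -
    have "\<Inter>y \<subseteq> {E_val x}" using that(1,2) total by blast
    moreover have "E_val x \<in> Y" if "Y \<in> y" for Y
      using E0_val_mem[OF \<open>x \<in> E0\<close> _ \<open>y \<in> E0\<close> \<open>x \<subseteq> y\<close> that] \<open>E_eq0 x x\<close> total by blast
    ultimately have "\<Inter>y = {E_val x}" by blast
    then show ?thesis using that(1) total unfolding E_eq0_def by auto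
  qed
  show "hier E0 (\<subseteq>) ?K E_dom (\<lambda>_ _. True) (\<lambda>_ _ _. False) E_eq0
      (\<lambda>xs x. (\<lambda>n. E_val (xs n)) \<longlonglongrightarrow> E_val x) (\<lambda>x. E_rep (E_val x)) (\<lambda>x. E_low (E_val x))"
  proof
    show "E_dom (Suc k) = lam (E_dom k) ` {h \<in> scott_maps (E_dom k) (func_le (\<subseteq>)) E0 (\<subseteq>).
      \<forall>x1\<in>E_dom k. \<forall>x2\<in>E_dom k. False \<longrightarrow> True}" for k by simp
    show "E_eq0 x y \<Longrightarrow> E_eq0 y x" for x y by (auto simp: E_eq0_def)
    show "E_eq0 x y \<Longrightarrow> E_eq0 y z \<Longrightarrow> E_eq0 x z" for x y z by (auto simp: E_eq0_def)
    show "E_rep (E_val x) \<in> E0 \<and> x \<subseteq> E_rep (E_val x)" if "x \<in> E0" "E_eq0 x x" for x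
      using that E_rep_E0 total E0_base unfolding E_rep_def by blast
    show "E_low (E_val x) \<in> E0 \<and> E_eq0 x (E_low (E_val x)) \<and> E_low (E_val x) \<subseteq> E_rep (E_val x)"
      if "E_eq0 x x" for x
      using that E_low_E0 E_low_le total[of x] Inter_E_low[of "E_val x"] unfolding E_eq0_def by auto
    show "\<forall>\<^sub>F n in sequentially. b \<subseteq> E_rep (E_val (xs n))"
      if L: "(\<lambda>n. E_val (xs n)) \<longlonglongrightarrow> E_val x" and b: "b \<in> ?K" "b \<subseteq> E_low (E_val x)" for xs x b
    proof -
      obtain X where X: "X \<in> E_base" "b = E_principal X" using b(1) by blast
      then have "E_val x \<in> interior X" using E_principal_le[OF X(1) E_low_E0] b by (auto simp: E_low_def)
      then have "\<forall>\<^sub>F n in sequentially. E_val (xs n) \<in> interior X"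
        using topological_tendstoD[OF L] by blast
      then show ?thesis
      proof eventually_elim
        case (elim n)
        then show ?case using X E_principal_le[OF X(1) E_rep_E0] interior_subset by (auto simp: E_rep_def)
      qed
    qed
    show "(\<lambda>n. E_val (xs n)) \<longlonglongrightarrow> E_val x"
      if x: "x \<in> E0" "E_eq0 x x" "\<And>n. xs n \<in> E0" "\<And>n. E_eq0 (xs n) (xs n)" and sc: "B.sconv xs x" for x xs
    proof (rule tendstoI)
      fix e :: real assume "e > 0"
      then obtain X where X: "X \<in> x" "X \<subseteq> {E_val x - e<..<E_val x + e}"
        using E0_small_interval[of x "E_val x" e] x total by blast
      have "X \<in> E_base" using X(1) x(1) E0_base by blast
      then have *: "E_principal X \<in> ?K" "E_principal X \<subseteq> x" using X(1) x(1) E_principal_le by auto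
      have "\<forall>\<^sub>F n in sequentially. E_principal X \<subseteq> xs n" using sc * unfolding B.sconv_def by blast
      then show "\<forall>\<^sub>F n in sequentially. dist (E_val (xs n)) (E_val x) < e"
      proof eventually_elim
        case (elim n)
        then have "E_val (xs n) \<in> X" using E_principal_le[OF \<open>X \<in> E_base\<close> x(3)] x(4)[of n] total by blast
        then have "E_val x - e < E_val (xs n)" "E_val (xs n) < E_val x + e" using X(2) by auto
        then show ?case by (simp add: dist_real_def abs_less_iff)
      qed
    qed
    show "(\<lambda>n. E_val (ys n)) \<longlonglongrightarrow> E_val y"
      if L: "(\<lambda>n. E_val (xs n)) \<longlonglongrightarrow> E_val x"
        and x: "x \<in> E0" "E_eq0 x x" "\<And>n. xs n \<in> E0" "\<And>n. E_eq0 (xs n) (xs n)"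
        and y: "y \<in> E0" "E_eq0 y y" "\<And>n. ys n \<in> E0" "\<And>n. E_eq0 (ys n) (ys n)"
        and j: "\<And>n. \<exists>z\<in>E0. xs n \<subseteq> z \<and> ys n \<subseteq> z" "\<exists>z\<in>E0. x \<subseteq> z \<and> y \<subseteq> z" for xs x ys y
    proof -
      have v: "E_val u = E_val w" if "u \<in> E0" "E_eq0 u u" "w \<in> E0" "E_eq0 w w" "\<exists>z\<in>E0. u \<subseteq> z \<and> w \<subseteq> z" for u w
        using that up[of u] up[of w] E_eq0_iff by metis
      have "E_val (ys n) = E_val (xs n)" for n using v[OF y(3,4) x(3,4)] j(1)[of n] by blast
      moreover have "E_val y = E_val x" using v[OF y(1,2) x(1,2)] j(2) by blast
      ultimately show ?thesis using L by simp
    qed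
  qed (use up in auto)
qed

section \<open>Signed binary sequences\<close>

lemma S0_down: "\<lbrakk>s \<in> S0; s j \<noteq> None; i \<le> j\<rbrakk> \<Longrightarrow> s i \<noteq> None"
proof (induction j)
  case (Suc j)
  then show ?case by (cases "i = Suc j") (auto simp: S0_def)
qed auto

lemma S0_digit: "\<lbrakk>s \<in> S0; s (Suc i) = Some b\<rbrakk> \<Longrightarrow> b \<in> {-1, 0, 1}"
  by (auto simp: S0_def)

lemma map_leD: "\<lbrakk>s \<subseteq>\<^sub>m t; s i \<noteq> None\<rbrakk> \<Longrightarrow> t i = s i"
  by (metis domIff map_le_def)

lemma S0_comparable: "\<lbrakk>s \<in> S0; t \<in> S0; s \<subseteq>\<^sub>m x; t \<subseteq>\<^sub>m x\<rbrakk> \<Longrightarrow> s \<subseteq>\<^sub>m t \<or> t \<subseteq>\<^sub>m s"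
proof (rule ccontr)
  assume *: "s \<in> S0" "t \<in> S0" "s \<subseteq>\<^sub>m x" "t \<subseteq>\<^sub>m x" "\<not> (s \<subseteq>\<^sub>m t \<or> t \<subseteq>\<^sub>m s)"
  then obtain i j where "s i \<noteq> None" "s i \<noteq> t i" "t j \<noteq> None" "s j \<noteq> t j"
    unfolding map_le_def by (metis domIff)
  moreover have "s i = t i" if "s i \<noteq> None" "t i \<noteq> None" for i
    using map_leD[OF *(3) that(1)] map_leD[OF *(4) that(2)] by simp
  ultimately show False using S0_down[OF *(1), of i j] S0_down[OF *(2), of j i] by (meson nle_le)
qed

lemma S0_restrict: "s \<in> S0 \<Longrightarrow> s |` {..<n} \<in> S0"
  by (auto simp: S0_def restrict_map_def)

lemma S0_max_iff: "s \<in> S0_max \<longleftrightarrow> s \<in> S0 \<and> (\<forall>i. s i \<noteq> None)"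
proof (intro iffI conjI allI notI)
  fix i assume s: "s \<in> S0_max" and "s i = None"
  define n where "n = (LEAST i. s i = None)"
  have n: "s n = None" using \<open>s i = None\<close> unfolding n_def by (rule LeastI)
  have lt: "s i \<noteq> None" if "i < n" for i using not_less_Least[of i] that unfolding n_def by blast
  have sS: "s \<in> S0" using s by (simp add: S0_max_def)
  have gt: "s i = None" if "i > n" for i using S0_down[OF sS, of i n] n that by fastforce
  have "s(n \<mapsto> 0) \<in> S0"
    using sS lt gt n by (auto simp: S0_def)
  moreover have "s \<subseteq>\<^sub>m s(n \<mapsto> 0)" using n by (auto simp: map_le_def)
  ultimately have "s(n \<mapsto> 0) = s" using s by (auto simp: S0_max_def)
  then show False using n by (metis fun_upd_same option.distinct(1))
next
  assume "s \<in> S0 \<and> (\<forall>i. s i \<noteq> None)"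
  then show "s \<in> S0_max" unfolding S0_max_def map_le_def by (auto simp: fun_eq_iff domIff)
qed (auto simp: S0_max_def)

definition dval :: "(nat \<Rightarrow> int) \<Rightarrow> nat \<Rightarrow> real" where
  "dval d n = of_int (d 0) + (\<Sum>i<n. of_int (d (Suc i)) / 2 ^ Suc i)"

text \<open>The centre of the interval of radius \<open>1 / 2 ^ n\<close> that contains the values
  of all continuations of the first \<open>n + 1\<close> entries of \<open>x\<close>.\<close>

definition pval :: "(nat \<Rightarrow> int option) \<Rightarrow> nat \<Rightarrow> real" where
  "pval x = dval (\<lambda>i. the (x i))"

lemma dval_cong: "(\<And>i. i \<le> n \<Longrightarrow> d i = e i) \<Longrightarrow> dval d n = dval e n"
  unfolding dval_def by (auto intro!: sum.cong)

lemma dval_Suc: "dval d (Suc n) = dval d n + of_int (d (Suc n)) / 2 ^ Suc n"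
  by (simp add: dval_def)

lemma pval_cong: "(\<And>i. i \<le> n \<Longrightarrow> x i = y i) \<Longrightarrow> pval x n = pval y n"
  unfolding pval_def by (auto intro: dval_cong)

lemma S_val_bound:
  assumes "x \<in> S0_max"
  shows "\<bar>S_val x - pval x n\<bar> \<le> 1 / 2 ^ n"
proof -
  let ?f = "\<lambda>i. of_int (the (x (Suc i))) / 2 ^ Suc i :: real"
  have f: "\<bar>?f i\<bar> \<le> 1 / 2 ^ Suc i" for i
  proof -
    obtain b where b: "x (Suc i) = Some b" using assms S0_max_iff by blast
    then have "b \<in> {-1, 0, 1}" using assms S0_max_iff S0_digit by blast
    then show ?thesis using b by (auto simp: field_simps)
  qed
  have h: "(\<lambda>i. 1 / 2 ^ Suc i :: real) sums 1"
    using power_half_series by (simp add: power_one_over)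
  have h2: "(\<lambda>i. 1 / 2 ^ Suc (i + n) :: real) sums (1 / 2 ^ n)"
    using sums_mult[OF h, of "1 / 2 ^ n"] by (simp add: power_add ac_simps)
  have sf: "summable ?f"
    by (rule summable_comparison_test'[OF sums_summable[OF h]]) (use f in auto)
  have "S_val x - pval x n = (\<Sum>i. ?f (i + n))"
    using suminf_split_initial_segment[OF sf, of n] by (simp add: S_val_def pval_def dval_def)
  also have "\<bar>\<dots>\<bar> \<le> (\<Sum>i. 1 / 2 ^ Suc (i + n))"
    using norm_suminf_le[of "\<lambda>i. ?f (i + n)" "\<lambda>i. 1 / 2 ^ Suc (i + n)"] f[of "_ + n"] sums_summable[OF h2]
    by (simp only: real_norm_def)
  also have "\<dots> = 1 / 2 ^ n" using h2 by (simp add: sums_iff)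
  finally show ?thesis .
qed

lemma half_power_less: "e > 0 \<Longrightarrow> \<exists>n. 1 / 2 ^ n < (e :: real)"
  using real_arch_pow_inv[of e "1/2"] by (auto simp: power_one_over)

lemma S_val_eqI:
  assumes "x \<in> S0_max" "\<And>n. \<bar>r - pval x n\<bar> \<le> 1 / 2 ^ n"
  shows "S_val x = r"
proof (rule ccontr)
  assume "S_val x \<noteq> r"
  then obtain n where n: "1 / 2 ^ n < \<bar>S_val x - r\<bar> / 2" using half_power_less[of "\<bar>S_val x - r\<bar> / 2"] by auto
  have "\<bar>S_val x - r\<bar> \<le> \<bar>S_val x - pval x n\<bar> + \<bar>r - pval x n\<bar>" by simp
  then show False using S_val_bound[OF assms(1), of n] assms(2)[of n] n by simp
qed

section \<open>Separation of functions by locally constant ones\<close>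

text \<open>A space is given by its convergent sequences \<open>cv\<close>.\<close>

definition scont :: "((nat \<Rightarrow> 'a) \<Rightarrow> 'a \<Rightarrow> bool) \<Rightarrow> ('a \<Rightarrow> real) \<Rightarrow> bool" where
  "scont cv g \<longleftrightarrow> (\<forall>xs x. cv xs x \<longrightarrow> (\<lambda>n. g (xs n)) \<longlonglongrightarrow> g x)"

text \<open>Sequential continuity into a discrete space; a predicate with this property is a clopen
  set.\<close>

definition sdisc :: "((nat \<Rightarrow> 'a) \<Rightarrow> 'a \<Rightarrow> bool) \<Rightarrow> ('a \<Rightarrow> 'c) \<Rightarrow> bool" where
  "sdisc cv f \<longleftrightarrow> (\<forall>xs x. cv xs x \<longrightarrow> (\<forall>\<^sub>F n in sequentially. f (xs n) = f x))"

text \<open>A sequential form of strong zero-dimensionality: a clopen set lies between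
  \<open>g \<le> 0\<close> and \<open>g < 1\<close>. The gap leaves room for the overlap of
  neighbouring digits.\<close>

definition sepa :: "'a set \<Rightarrow> ((nat \<Rightarrow> 'a) \<Rightarrow> 'a \<Rightarrow> bool) \<Rightarrow> bool" where
  "sepa X cv \<longleftrightarrow> (\<forall>g. scont cv g \<longrightarrow>
    (\<exists>u. sdisc cv u \<and> (\<forall>x\<in>X. (g x \<le> 0 \<longrightarrow> u x) \<and> (u x \<longrightarrow> g x < 1))))"

lemma scontD: "\<lbrakk>scont cv g; cv xs x\<rbrakk> \<Longrightarrow> (\<lambda>n. g (xs n)) \<longlonglongrightarrow> g x"
  by (simp add: scont_def)

lemma sdiscD: "\<lbrakk>sdisc cv f; cv xs x\<rbrakk> \<Longrightarrow> \<forall>\<^sub>F n in sequentially. f (xs n) = f x"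
  by (simp add: sdisc_def)

lemma sdisc_const: "sdisc cv (\<lambda>_. c)"
  by (simp add: sdisc_def)

lemma sdisc_comp2:
  assumes "sdisc cv f" "sdisc cv g"
  shows "sdisc cv (\<lambda>x. h (f x) (g x))"
  unfolding sdisc_def
proof (intro allI impI)
  fix xs x assume "cv xs x"
  from sdiscD[OF assms(1) this] sdiscD[OF assms(2) this]
  show "\<forall>\<^sub>F n in sequentially. h (f (xs n)) (g (xs n)) = h (f x) (g x)" by eventually_elim simp
qed

lemma sdisc_comp: "sdisc cv f \<Longrightarrow> sdisc cv (\<lambda>x. h (f x))"
  by (rule sdisc_comp2[where g = f and h = "\<lambda>a _. h a"])

lemma sdisc_if:
  assumes "sdisc cv P" "sdisc cv f" "sdisc cv g"
  shows "sdisc cv (\<lambda>x. if P x then f x else g x)"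
  using sdisc_comp2[OF assms(1) sdisc_comp2[OF assms(2,3), of Pair], of "\<lambda>p (a, b). if p then a else b"]
  by (simp add: if_distrib)

text \<open>The guard on \<open>A\<close> hides all but finitely many coordinates from
  \<open>h\<close>, so an arbitrary \<open>h\<close> preserves local constancy.\<close>

lemma sdisc_fin:
  assumes "finite A" "\<And>a. a \<in> A \<Longrightarrow> sdisc cv (u a)"
  shows "sdisc cv (\<lambda>x. h (\<lambda>a. if a \<in> A then u a x else c))"
  unfolding sdisc_def
proof (intro allI impI)
  fix xs x assume "cv xs x"
  then have "\<forall>\<^sub>F n in sequentially. \<forall>a\<in>A. u a (xs n) = u a x"
    using assms by (auto simp: eventually_ball_finite_distrib dest: sdiscD)
  then show "\<forall>\<^sub>F n in sequentially. h (\<lambda>a. if a \<in> A then u a (xs n) else c) = h (\<lambda>a. if a \<in> A then u a x else c)"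
    by (rule eventually_mono) (intro arg_cong[where f = h], auto)
qed

lemma sdisc_ex:
  assumes "finite A" "\<And>a. a \<in> A \<Longrightarrow> sdisc cv (u a)"
  shows "sdisc cv (\<lambda>x. \<exists>a\<in>A. u a x)"
  using sdisc_fin[OF assms, where h = "\<lambda>v. \<exists>a\<in>A. v a" and c = False] by simp

text \<open>Only the finitely many predicates up to the least witness at the limit have to
  stabilise.\<close>

lemma sdisc_least:
  assumes u: "\<And>n. sdisc cv (u n)" and ex: "\<And>xs x. cv xs x \<Longrightarrow> \<exists>n. u n x"
  shows "sdisc cv (\<lambda>x. LEAST n :: nat. u n x)"
  unfolding sdisc_def
proof (intro allI impI)
  fix xs x assume cv: "cv xs x"
  define n where "n = (LEAST n. u n x)"
  have n: "u n x" unfolding n_def by (rule LeastI_ex[OF ex[OF cv]])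
  have lt: "\<not> u i x" if "i < n" for i using not_less_Least[of i] that unfolding n_def by blast
  have "\<forall>\<^sub>F m in sequentially. \<forall>i\<in>{..n}. u i (xs m) = u i x"
    using sdiscD[OF u cv] by (simp add: eventually_ball_finite_distrib)
  then show "\<forall>\<^sub>F m in sequentially. (LEAST n. u n (xs m)) = (LEAST n. u n x)"
  proof eventually_elim
    case (elim m)
    have "u n (xs m)" "\<And>i. u i (xs m) \<Longrightarrow> n \<le> i" using elim n lt by (auto simp: not_less[symmetric])
    then have "(LEAST n. u n (xs m)) = n" by (intro Least_equality) auto
    then show ?case by (simp add: n_def)
  qed
qed

lemma sdisc_scont: "sdisc cv f \<Longrightarrow> scont cv f"
  unfolding sdisc_def scont_def by (auto intro: tendsto_eventually)

lemma sepa_between: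
  assumes "sepa X cv" "scont cv g" "a < b"
  obtains u where "sdisc cv u" "\<And>x. \<lbrakk>x \<in> X; g x \<le> a\<rbrakk> \<Longrightarrow> u x" "\<And>x. \<lbrakk>x \<in> X; u x\<rbrakk> \<Longrightarrow> g x < b"
proof -
  have "scont cv (\<lambda>x. (g x - a) / (b - a))"
    using assms(2,3) unfolding scont_def by (auto intro!: tendsto_intros)
  then have "\<exists>u. sdisc cv u \<and> (\<forall>x\<in>X. ((g x - a) / (b - a) \<le> 0 \<longrightarrow> u x) \<and> (u x \<longrightarrow> (g x - a) / (b - a) < 1))"
    using assms(1) unfolding sepa_def by (elim allE impE)
  then obtain u where u: "sdisc cv u"
    "\<And>x. x \<in> X \<Longrightarrow> ((g x - a) / (b - a) \<le> 0 \<longrightarrow> u x) \<and> (u x \<longrightarrow> (g x - a) / (b - a) < 1)"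
    by blast
  show thesis
  proof (rule that[OF u(1)])
    show "u x" if "x \<in> X" "g x \<le> a" for x using u(2)[OF that(1)] that assms(3) by (simp add: divide_le_0_iff)
    show "g x < b" if "x \<in> X" "u x" for x using u(2)[OF that(1)] that assms(3) by simp
  qed
qed

text \<open>A real-valued function on a separated space is represented by digit functions which are
  locally constant. The digits are chosen one after another, keeping the error of the first
  \<open>j + 1\<close> of them below \<open>c / 2 ^ j\<close>; as \<open>c \<ge> 3/4\<close>, the ranges of remainders for
  which two neighbouring digits are admissible overlap, and \<open>sepa\<close> decides between the two.\<close>

lemma lift:
  assumes sp: "sepa X cv" and cvX: "\<And>xs x. cv xs x \<Longrightarrow> x \<in> X" and g: "scont cv g"
    and c: "3/4 \<le> c" "c \<le> 1"
    and s: "\<And>y. y \<in> X \<Longrightarrow> s y \<in> S0" "\<And>j. sdisc cv (\<lambda>y. s y j)"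
      "\<And>y j. \<lbrakk>y \<in> X; s y j \<noteq> None\<rbrakk> \<Longrightarrow> \<bar>g y - pval (s y) j\<bar> \<le> c / 2 ^ j"
  obtains F where "\<And>y. y \<in> X \<Longrightarrow> F y \<in> S0_max" "\<And>y. y \<in> X \<Longrightarrow> s y \<subseteq>\<^sub>m F y"
    "\<And>y. y \<in> X \<Longrightarrow> S_val (F y) = g y" "\<And>y j. y \<in> X \<Longrightarrow> \<bar>g y - pval (F y) j\<bar> \<le> c / 2 ^ j"
    "\<And>j. sdisc cv (\<lambda>y. F y j)"
proof -
  define P where "P = (\<lambda>n q. (\<forall>j\<le>n. sdisc cv (\<lambda>y. q y j :: int)) \<and> (\<forall>y\<in>X. \<forall>j\<le>n.
    (s y j \<noteq> None \<longrightarrow> s y j = Some (q y j)) \<and> (j > 0 \<longrightarrow> q y j \<in> {-1, 0, 1}) \<and>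
    \<bar>g y - dval (q y) j\<bar> \<le> c / 2 ^ j))"
  have "\<exists>q. P 0 q"
  proof -
    \<comment> \<open>Rounding finds an integer at distance at most \<open>1/2\<close>; the clopen
      test accepts errors below \<open>3/4\<close>, which is within the allowance \<open>c\<close>
      for the integer part.\<close>
    have "\<exists>u. sdisc cv u \<and> (\<forall>x\<in>X. (\<bar>g x - of_int m\<bar> \<le> 1/2 \<longrightarrow> u x) \<and> (u x \<longrightarrow> \<bar>g x - of_int m\<bar> < 3/4))" for m
    proof -
      have sc: "scont cv (\<lambda>x. \<bar>g x - of_int m\<bar>)" using g unfolding scont_def by (auto intro!: tendsto_intros)
      show ?thesis by (rule sepa_between[OF sp sc, of "1/2" "3/4"]) auto
    qed
    then obtain W where W: "\<And>m. sdisc cv (W m)"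
      "\<And>m x. \<lbrakk>x \<in> X; \<bar>g x - of_int m\<bar> \<le> 1/2\<rbrakk> \<Longrightarrow> W m x" "\<And>m x. \<lbrakk>x \<in> X; W m x\<rbrakk> \<Longrightarrow> \<bar>g x - of_int m\<bar> < 3/4"
      by metis
    define a where "a = (\<lambda>x. int_decode (LEAST n. W (int_decode n) x))"
    have ex: "\<exists>n. W (int_decode n) x" if "x \<in> X" for x
      using W(2)[OF that, of "round (g x)"] of_int_round_abs_le[of "g x"] int_encode_inverse
      by (metis abs_minus_commute)
    have Wa: "W (a x) x" if "x \<in> X" for x
      unfolding a_def using LeastI_ex[OF ex[OF that]] .
    have sa: "sdisc cv a"
      unfolding a_def by (rule sdisc_comp, rule sdisc_least, rule W(1)) (use ex cvX in blast)
    define q where "q = (\<lambda>y (j::nat). case s y 0 of Some b \<Rightarrow> b | None \<Rightarrow> a y)"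
    have "sdisc cv (\<lambda>y. q y 0)"
      unfolding q_def by (rule sdisc_comp2[OF s(2)[of 0] sa, where h = "\<lambda>o' d. case o' of Some b \<Rightarrow> b | None \<Rightarrow> d"])
    moreover have "(s y 0 \<noteq> None \<longrightarrow> s y 0 = Some (q y 0)) \<and> \<bar>g y - dval (q y) 0\<bar> \<le> c / 2 ^ 0" if y: "y \<in> X" for y
    proof (cases "s y 0")
      case None
      then show ?thesis using W(3)[OF y Wa[OF y]] c by (simp add: q_def dval_def)
    next
      case (Some b)
      then show ?thesis using s(3)[OF y, of 0] by (simp add: q_def dval_def pval_def)
    qed
    ultimately show ?thesis by (auto simp: P_def)
  qed
  moreover have "\<exists>q'. P (Suc n) q' \<and> (\<forall>y. \<forall>j\<le>n. q' y j = q y j)" if q: "P n q" for n q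
  proof -
    \<comment> \<open>The remainder, rescaled to the range from \<open>- c\<close> to
      \<open>c\<close>; a further digit \<open>b\<close> changes it to
      \<open>2 * r - b\<close>.\<close>
    define r where "r = (\<lambda>y. 2 ^ n * (g y - dval (q y) n))"
    have "scont cv (\<lambda>y. dval (q y) n)"
    proof -
      have "sdisc cv (\<lambda>y. dval (\<lambda>j. if j \<in> {..n} then q y j else 0) n)"
        by (rule sdisc_fin) (use q in \<open>auto simp: P_def\<close>)
      moreover have "dval (\<lambda>j. if j \<in> {..n} then q y j else 0) n = dval (q y) n" for y
        by (rule dval_cong) auto
      ultimately show ?thesis using sdisc_scont by simp
    qed
    then have sr: "scont cv r" "scont cv (\<lambda>y. - r y)"
      using g unfolding r_def scont_def by (auto intro!: tendsto_intros)
    \<comment> \<open>Digit 1 is admissible for \<open>r > 1/8\<close>, as then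
      \<open>2 * r - 1\<close> lies between \<open>- 3/4\<close> and
      \<open>2 * c - 1 \<le> c\<close>; digit 0 is admissible up to
      \<open>\<bar>r\<bar> \<le> 3/8\<close>, as \<open>3/4 \<le> c\<close>. So either decision is
      right between \<open>1/8\<close> and \<open>3/8\<close>, and likewise on the negative side
      with \<open>V\<close>.\<close>
    obtain U where U: "sdisc cv U" "\<And>x. \<lbrakk>x \<in> X; - r x \<le> - 3/8\<rbrakk> \<Longrightarrow> U x" "\<And>x. \<lbrakk>x \<in> X; U x\<rbrakk> \<Longrightarrow> - r x < - 1/8"
      by (rule sepa_between[OF sp sr(2), of "- 3/8" "- 1/8"]) auto
    obtain V where V: "sdisc cv V" "\<And>x. \<lbrakk>x \<in> X; r x \<le> - 3/8\<rbrakk> \<Longrightarrow> V x" "\<And>x. \<lbrakk>x \<in> X; V x\<rbrakk> \<Longrightarrow> r x < - 1/8"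
      by (rule sepa_between[OF sp sr(1), of "- 3/8" "- 1/8"]) auto
    define b :: "_ \<Rightarrow> int" where "b = (\<lambda>y. case s y (Suc n) of Some b \<Rightarrow> b
      | None \<Rightarrow> if U y then 1 else if V y then -1 else 0)"
    have sb: "sdisc cv b"
      unfolding b_def by (rule sdisc_comp2[OF s(2), where h = "\<lambda>o' d. case o' of Some b \<Rightarrow> b | None \<Rightarrow> d"],
        rule sdisc_if[OF U(1) sdisc_const sdisc_if[OF V(1) sdisc_const sdisc_const]])
    define q' where "q' = (\<lambda>y. (q y)(Suc n := b y))"
    have qq: "q' y j = q y j" if "j \<le> n" for y j using that by (simp add: q'_def)
    have qS: "q' y (Suc n) = b y" for y by (simp add: q'_def)
    have dv: "dval (q' y) j = dval (q y) j" if "j \<le> n" for y j using that qq by (intro dval_cong) auto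
    have "(s y (Suc n) \<noteq> None \<longrightarrow> s y (Suc n) = Some (b y)) \<and> b y \<in> {-1, 0, 1} \<and>
      \<bar>g y - dval (q' y) (Suc n)\<bar> \<le> c / 2 ^ Suc n" if y: "y \<in> X" for y
    proof (cases "s y (Suc n)")
      case None
      have "\<bar>g y - dval (q y) n\<bar> \<le> c / 2 ^ n" using q y unfolding P_def by blast
      then have rb: "\<bar>r y\<bar> \<le> c"
        unfolding r_def abs_mult by (simp add: field_simps)
      have "\<bar>2 * r y - of_int (b y)\<bar> \<le> c"
        using rb c U(2,3)[OF y] V(2,3)[OF y] None unfolding b_def by (auto simp: abs_le_iff; linarith)
      moreover have "g y - dval (q' y) (Suc n) = (2 * r y - of_int (b y)) / 2 ^ Suc n"
        by (simp add: dval_Suc dv qS r_def field_simps)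
      ultimately have "\<bar>g y - dval (q' y) (Suc n)\<bar> \<le> c / 2 ^ Suc n"
        by (simp add: divide_right_mono)
      then show ?thesis using None by (auto simp: b_def)
    next
      case (Some d)
      have "the (s y i) = q' y i" if "i \<le> Suc n" for i
      proof -
        have "s y i \<noteq> None" using S0_down[OF s(1)[OF y], of "Suc n" i] Some that by simp
        moreover have "s y i = Some (q y i)" if "i \<le> n" using q y that calculation unfolding P_def by blast
        ultimately show ?thesis using that Some unfolding q'_def b_def
          by (cases "i = Suc n") auto
      qed
      then have "dval (q' y) (Suc n) = pval (s y) (Suc n)" unfolding pval_def by (intro dval_cong) simp
      then show ?thesis using s(3)[OF y, of "Suc n"] Some S0_digit[OF s(1)[OF y] Some] by (simp add: b_def)
    qed
    moreover have "sdisc cv (\<lambda>y. q' y j)" if "j \<le> Suc n" for j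
      using that q qq qS sb by (cases "j = Suc n") (auto simp: P_def le_Suc_eq)
    ultimately have "P (Suc n) q'"
      using q qq qS dv unfolding P_def by (auto simp: le_Suc_eq)
    then show ?thesis using qq by blast
  qed
  ultimately obtain Q where Q: "\<And>n. P n (Q n)" "\<And>n y j. j \<le> n \<Longrightarrow> Q (Suc n) y j = Q n y j"
    using dependent_nat_choice[of P "\<lambda>n q q'. \<forall>y. \<forall>j\<le>n. q' y j = q y j"] by metis
  have QQ: "Q n y j = Q j y j" if "j \<le> n" for n y j
    using that by (induction rule: dec_induct) (auto simp: Q(2))
  define F where "F = (\<lambda>y j. Some (Q j y j))"
  have pF: "pval (F y) n = dval (Q n y) n" for y n
    unfolding pval_def F_def by (rule dval_cong) (use QQ[of _ n y] in simp)
  have QP: "(s y j \<noteq> None \<longrightarrow> s y j = Some (Q j y j)) \<and> (j > 0 \<longrightarrow> Q j y j \<in> {-1, 0, 1})" if "y \<in> X" for y j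
  proof -
    have "\<forall>y\<in>X. \<forall>i\<le>j. (s y i \<noteq> None \<longrightarrow> s y i = Some (Q j y i)) \<and> (i > 0 \<longrightarrow> Q j y i \<in> {-1, 0, 1}) \<and>
      \<bar>g y - dval (Q j y) i\<bar> \<le> c / 2 ^ i" using Q(1)[of j] unfolding P_def by (rule conjunct2)
    then show ?thesis using that by simp
  qed
  have "F y \<in> S0_max" if "y \<in> X" for y
  proof -
    have "Q (Suc i) y (Suc i) \<in> {-1, 0, 1}" for i using QP[OF that, of "Suc i"] by blast
    then show ?thesis unfolding S0_max_iff S0_def F_def by simp
  qed
  moreover have sF: "s y \<subseteq>\<^sub>m F y" if "y \<in> X" for y
    using QP[OF that] unfolding map_le_def F_def domIff by blast
  moreover have bF: "\<bar>g y - pval (F y) j\<bar> \<le> c / 2 ^ j" if "y \<in> X" for y j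
    using Q(1)[of j] that unfolding pF P_def by blast
  moreover have "S_val (F y) = g y" if y: "y \<in> X" for y
  proof (rule S_val_eqI)
    show "\<bar>g y - pval (F y) n\<bar> \<le> 1 / 2 ^ n" for n
      using bF[OF y, of n] c(2) by (smt (verit) divide_right_mono zero_le_power)
  qed (use calculation y in blast)
  moreover have "sdisc cv (\<lambda>y. F y j)" for j
    using Q(1)[of j] unfolding F_def P_def by (auto intro: sdisc_comp)
  ultimately show thesis using that by blast
qed

text \<open>The limit is represented with the smaller error \<open>3/4\<close>, which leaves
  \<open>1/4\<close> for the distance between \<open>gs n\<close> and \<open>g\<close>. While that
  distance is certified to be small, the digits of \<open>F\<close> are admissible for
  \<open>gs n\<close> with \<open>c = 1\<close>, so \<open>lift\<close> can be told to start with
  them; convergence certifies longer and longer prefixes.\<close>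

lemma lift_param:
  assumes sp: "sepa X cv" and cvX: "\<And>xs x. cv xs x \<Longrightarrow> x \<in> X" "\<And>xs x n. cv xs x \<Longrightarrow> xs n \<in> X"
    and gs: "\<And>n. scont cv (gs n)" and g: "scont cv g"
    and lim: "\<And>xs x (i :: nat \<Rightarrow> nat). \<lbrakk>cv xs x; filterlim i at_top sequentially\<rbrakk> \<Longrightarrow> (\<lambda>n. gs (i n) (xs n)) \<longlonglongrightarrow> g x"
  obtains Fs F where "\<And>n y. y \<in> X \<Longrightarrow> Fs n y \<in> S0_max" "\<And>y. y \<in> X \<Longrightarrow> F y \<in> S0_max"
    "\<And>n y. y \<in> X \<Longrightarrow> S_val (Fs n y) = gs n y" "\<And>y. y \<in> X \<Longrightarrow> S_val (F y) = g y"
    "\<And>n j. sdisc cv (\<lambda>y. Fs n y j)" "\<And>j. sdisc cv (\<lambda>y. F y j)"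
    "\<And>xs x i j. \<lbrakk>cv xs x; filterlim i at_top sequentially\<rbrakk> \<Longrightarrow>
      \<forall>\<^sub>F n in sequentially. Fs (i n) (xs n) j = F x j"
proof -
  obtain F where F: "\<And>y. y \<in> X \<Longrightarrow> F y \<in> S0_max" "\<And>y. y \<in> X \<Longrightarrow> S_val (F y) = g y"
    "\<And>y j. y \<in> X \<Longrightarrow> \<bar>g y - pval (F y) j\<bar> \<le> 3/4 / 2 ^ j" "\<And>j. sdisc cv (\<lambda>y. F y j)"
    by (rule lift[OF sp cvX(1) g, where c = "3/4" and s = "\<lambda>_ _. None"]) (auto simp: S0_def sdisc_const)
  have "\<exists>u. sdisc cv u \<and> (\<forall>x\<in>X. (\<bar>gs n x - g x\<bar> \<le> 1/8 / 2^l \<longrightarrow> u x) \<and> (u x \<longrightarrow> \<bar>gs n x - g x\<bar> < 1/4 / 2^l))" for n l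
  proof -
    have sc: "scont cv (\<lambda>x. \<bar>gs n x - g x\<bar>)" using g gs[of n] unfolding scont_def by (auto intro!: tendsto_intros)
    show ?thesis by (rule sepa_between[OF sp sc, of "1/8 / 2^l" "1/4 / 2^l"]) (auto simp: field_simps)
  qed
  then obtain W where W: "\<And>n l. sdisc cv (W n l)"
    "\<And>n l x. \<lbrakk>x \<in> X; \<bar>gs n x - g x\<bar> \<le> 1/8 / 2^l\<rbrakk> \<Longrightarrow> W n l x"
    "\<And>n l x. \<lbrakk>x \<in> X; W n l x\<rbrakk> \<Longrightarrow> \<bar>gs n x - g x\<bar> < 1/4 / 2^l" by metis
  \<comment> \<open>A certificate at precision \<open>l\<close> covers all digits up to
    \<open>l\<close>, so \<open>s n y\<close> is a prefix of \<open>F y\<close>. Bounding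
    \<open>l\<close> by \<open>n\<close> keeps the condition a finite disjunction, hence locally
    constant.\<close>
  define s where "s = (\<lambda>n y j. if \<exists>l\<in>{j..n}. W n l y then F y j else None)"
  have "\<exists>G. (\<forall>y\<in>X. G y \<in> S0_max \<and> s n y \<subseteq>\<^sub>m G y \<and> S_val (G y) = gs n y) \<and> (\<forall>j. sdisc cv (\<lambda>y. G y j))" for n
  proof (rule lift[OF sp cvX(1) gs[of n], where c = 1 and s = "s n"])
    show "s n y \<in> S0" if "y \<in> X" for y
    proof -
      have "F y \<in> S0" using F(1)[OF that] S0_max_iff by blast
      moreover have "\<exists>l\<in>{i..n}. W n l y" if "\<exists>l\<in>{Suc i..n}. W n l y" for i
        using that by (meson Suc_leD atLeastAtMost_iff)
      ultimately show ?thesis unfolding S0_def s_def by (auto split: if_splits)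
    qed
    show "sdisc cv (\<lambda>y. s n y j)" for j
      unfolding s_def by (intro sdisc_if sdisc_ex W(1) F(4) sdisc_const) auto
    fix y j assume y: "y \<in> X" and ne: "s n y j \<noteq> None"
    then obtain l where l: "j \<le> l" "l \<le> n" "W n l y" unfolding s_def by (auto split: if_splits)
    have "s n y i = F y i" if "i \<le> j" for i using l that unfolding s_def by (auto; meson atLeastAtMost_iff order_trans)
    then have "pval (s n y) j = pval (F y) j" by (rule pval_cong)
    moreover have "(1/4 / 2^l :: real) \<le> 1/4 / 2^j" using l(1) by (intro divide_left_mono power_increasing) auto
    moreover have "(1 :: real) / 2^j = 1/4 / 2^j + 3/4 / 2^j" by (simp add: field_simps)
    ultimately show "\<bar>gs n y - pval (s n y) j\<bar> \<le> 1 / 2 ^ j"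
      using F(3)[OF y, of j] W(3)[OF y l(3)] by linarith
  qed auto
  then obtain Fs where Fs: "\<And>n y. y \<in> X \<Longrightarrow> Fs n y \<in> S0_max" "\<And>n y. y \<in> X \<Longrightarrow> s n y \<subseteq>\<^sub>m Fs n y"
    "\<And>n y. y \<in> X \<Longrightarrow> S_val (Fs n y) = gs n y" "\<And>n j. sdisc cv (\<lambda>y. Fs n y j)" by metis
  have "\<forall>\<^sub>F n in sequentially. Fs (i n) (xs n) j = F x j"
    if cv: "cv xs x" and i: "filterlim i at_top sequentially" for xs x i j
  proof -
    have "(\<lambda>n. gs (i n) (xs n) - g (xs n)) \<longlonglongrightarrow> g x - g x"
      by (intro tendsto_diff lim[OF cv i] scontD[OF g cv])
    then have "\<forall>\<^sub>F n in sequentially. dist (gs (i n) (xs n) - g (xs n)) 0 < 1/8 / 2^j"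
      by (intro tendstoD) auto
    moreover have "\<forall>\<^sub>F n in sequentially. j \<le> i n" using i by (simp add: filterlim_at_top)
    moreover note sdiscD[OF F(4)[of j] cv]
    ultimately show ?thesis
    proof eventually_elim
      case (elim n)
      have x: "xs n \<in> X" using cvX(2)[OF cv] .
      have "W (i n) j (xs n)" using elim(1) W(2)[OF x] by simp
      then have "s (i n) (xs n) j = F (xs n) j" using elim(2) unfolding s_def by auto
      moreover have "F (xs n) j \<noteq> None" using F(1)[OF x] S0_max_iff by blast
      ultimately show ?case using map_leD[OF Fs(2)[OF x, of "i n"], of j] elim(3) by simp
    qed
  qed
  then show thesis using that[OF Fs(1) F(1) Fs(3) F(2) Fs(4) F(4)] by blast
qed

text \<open>This is \<open>lift\<close> over a one-point space, where separation is trivial.\<close>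

lemma S_ext_ex:
  assumes "s \<in> S0" "\<And>j. s j \<noteq> None \<Longrightarrow> \<bar>r - pval s j\<bar> \<le> 1 / 2 ^ j"
  shows "\<exists>y\<in>S0_max. s \<subseteq>\<^sub>m y \<and> S_val y = r"
proof -
  have "sepa {()} (\<lambda>_ _. True)"
    proof -
    have "\<exists>u. sdisc (\<lambda>_ _. True) u \<and> (\<forall>x\<in>{()}. (g x \<le> 0 \<longrightarrow> u x) \<and> (u x \<longrightarrow> g x < 1))" for g :: "unit \<Rightarrow> real"
      by (rule exI[of _ "\<lambda>x. g x \<le> 0"]) (auto simp: sdisc_def)
    then show ?thesis by (simp add: sepa_def)
  qed
  note sp = this
  show ?thesis
    by (rule lift[OF sp, where g = "\<lambda>_. r" and c = 1 and s = "\<lambda>_. s"])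
      (use assms in \<open>auto simp: scont_def sdisc_const\<close>)
qed

text \<open>For \<open>x\<close> in \<open>S0\<close>, membership in the set of values of maximal
  extensions of \<open>x\<close>, expressed by the intervals of its prefixes;
  \<open>S_ext_ex\<close> provides the extension.\<close>

definition fits :: "(nat \<Rightarrow> int option) \<Rightarrow> real \<Rightarrow> bool" where
  "fits x r \<longleftrightarrow> (\<forall>j. x j \<noteq> None \<longrightarrow> \<bar>r - pval x j\<bar> \<le> 1 / 2 ^ j)"

lemma pval_map_le: "\<lbrakk>x \<in> S0; x \<subseteq>\<^sub>m y; x j \<noteq> None\<rbrakk> \<Longrightarrow> pval y j = pval x j"
  by (rule pval_cong) (metis S0_down map_leD)

lemma fits_mono: "\<lbrakk>fits y r; x \<subseteq>\<^sub>m y; x \<in> S0\<rbrakk> \<Longrightarrow> fits x r"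
  unfolding fits_def by (metis map_leD pval_map_le)

lemma fits_max: "x \<in> S0_max \<Longrightarrow> fits x r \<longleftrightarrow> S_val x = r"
  using S_val_bound[of x] S_val_eqI[of x r] S0_max_iff unfolding fits_def by blast

lemma S_sim0_iff: "\<lbrakk>x \<in> S0; y \<in> S0\<rbrakk> \<Longrightarrow> S_sim0 x y \<longleftrightarrow> (\<exists>r. fits x r \<and> fits y r)"
proof
  assume "x \<in> S0" "y \<in> S0" "S_sim0 x y"
  then obtain a b where "a \<in> S0_max" "b \<in> S0_max" "x \<subseteq>\<^sub>m a" "y \<subseteq>\<^sub>m b" "S_val a = S_val b"
    unfolding S_sim0_def by blast
  then show "\<exists>r. fits x r \<and> fits y r" using fits_mono[of a] fits_mono[of b] fits_max \<open>x \<in> S0\<close> \<open>y \<in> S0\<close> by metis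
next
  assume "x \<in> S0" "y \<in> S0" "\<exists>r. fits x r \<and> fits y r"
  then show "S_sim0 x y" unfolding S_sim0_def using S_ext_ex[of x] S_ext_ex[of y] unfolding fits_def by metis
qed

text \<open>Helly's theorem on the line, for an arbitrary family: the supremum of the left end
  points serves.\<close>

lemma interval_helly:
  fixes l u :: "'i \<Rightarrow> real"
  assumes "\<And>i j. \<lbrakk>i \<in> I; j \<in> I\<rbrakk> \<Longrightarrow> l i \<le> u j"
  shows "\<exists>r. \<forall>i\<in>I. l i \<le> r \<and> r \<le> u i"
proof (cases "I = {}")
  case False
  then obtain j where "j \<in> I" by blast
  then have "bdd_above (l ` I)" using assms by (intro bdd_aboveI2) blast
  then show ?thesis using assms False by (intro exI[of _ "SUP i\<in>I. l i"]) (auto intro: cSUP_upper cSUP_least)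
qed auto

lemma finite_dom_restrict: "finite (dom (s |` {..<n :: nat}))"
  by (rule finite_subset[of _ "{..<n}"]) (auto simp: restrict_map_def split: if_splits)

lemma restrict_le: "s |` A \<subseteq>\<^sub>m s"
  by (auto simp: map_le_def restrict_map_def)

lemma S0_ext: "x \<in> S0 \<Longrightarrow> \<exists>y\<in>S0_max. x \<subseteq>\<^sub>m y"
proof (intro bexI)
  show "x \<in> S0 \<Longrightarrow> (\<lambda>i. Some (case x i of Some b \<Rightarrow> b | None \<Rightarrow> 0)) \<in> S0_max"
    unfolding S0_max_iff by (auto simp: S0_def split: option.splits)
qed (auto simp: map_le_def)

text \<open>By \<open>interval_helly\<close> a common value exists once any two of the intervals
  given by digits of \<open>x\<close> and \<open>y\<close> meet, and any two of them are visible in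
  finite prefixes.\<close>

lemma S_sim0_closed:
  assumes x: "x \<in> S0" "y \<in> S0"
    and s: "\<And>b c. \<lbrakk>b \<in> S0; finite (dom b); c \<in> S0; finite (dom c); b \<subseteq>\<^sub>m x; c \<subseteq>\<^sub>m y\<rbrakk> \<Longrightarrow> S_sim0 b c"
  shows "S_sim0 x y"
proof -
  let ?I = "{(z, j). z \<in> {x, y} \<and> z j \<noteq> None}"
  have "\<exists>r. \<forall>i\<in>?I. pval (fst i) (snd i) - 1 / 2 ^ snd i \<le> r \<and> r \<le> pval (fst i) (snd i) + 1 / 2 ^ snd i"
  proof (rule interval_helly)
    fix i j assume "i \<in> ?I" "j \<in> ?I"
    then obtain z m w n where zw: "i = (z, m)" "j = (w, n)" "z \<in> {x, y}" "w \<in> {x, y}" "z m \<noteq> None" "w n \<noteq> None" by auto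
    \<comment> \<open>The successor keeps the digits at both \<open>m\<close> and \<open>n\<close>
      in the restriction to \<open>{..<N}\<close>.\<close>
    define N where "N = Suc (max m n)"
    have "S_sim0 (x |` {..<N}) (y |` {..<N})" using s finite_dom_restrict restrict_le S0_restrict x by blast
    then obtain r where r: "fits (x |` {..<N}) r" "fits (y |` {..<N}) r"
      using S_sim0_iff S0_restrict x by metis
    have "\<bar>r - pval z j\<bar> \<le> 1 / 2 ^ j" if "z \<in> {x, y}" "z j \<noteq> None" "j < N" for z j
    proof -
      have "pval (z |` {..<N}) j = pval z j" by (rule pval_cong) (use that in auto)
      moreover have "(z |` {..<N}) j \<noteq> None" using that by simp
      ultimately show ?thesis using r that unfolding fits_def by (metis insert_iff singletonD)
    qed
    then have "\<bar>r - pval z m\<bar> \<le> 1 / 2 ^ m" "\<bar>r - pval w n\<bar> \<le> 1 / 2 ^ n"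
      using zw unfolding N_def by (metis less_Suc_eq_le max.cobounded1 max.cobounded2)+
    then show "pval (fst i) (snd i) - 1 / 2 ^ snd i \<le> pval (fst j) (snd j) + 1 / 2 ^ snd j"
      by (simp add: zw)
  qed
  then obtain r where r: "\<forall>i\<in>?I. pval (fst i) (snd i) - 1 / 2 ^ snd i \<le> r \<and> r \<le> pval (fst i) (snd i) + 1 / 2 ^ snd i" ..
  have "fits z r" if "z \<in> {x, y}" for z
    unfolding fits_def
  proof (intro allI impI)
    fix j assume "z j \<noteq> None"
    then have "(z, j) \<in> ?I" using that by auto
    then show "\<bar>r - pval z j\<bar> \<le> 1 / 2 ^ j" using bspec[OF r, of "(z, j)"] by (simp add: abs_le_iff)
  qed
  then show ?thesis using S_sim0_iff x by blast
qed

abbreviation S0_fin :: "(nat \<Rightarrow> int option) set" where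
  "S0_fin \<equiv> {s \<in> S0. finite (dom s)}"

lemma sdom_S0: "sdom S0 (\<subseteq>\<^sub>m) S0_fin"
proof
  show "x \<subseteq>\<^sub>m x" for x :: "nat \<Rightarrow> int option" by simp
  show "x = y" if "x \<subseteq>\<^sub>m y" "y \<subseteq>\<^sub>m x" for x y :: "nat \<Rightarrow> int option" using that by (rule map_le_antisym)
  show "x \<subseteq>\<^sub>m z" if "x \<subseteq>\<^sub>m y" "y \<subseteq>\<^sub>m z" for x y z :: "nat \<Rightarrow> int option" using that by (rule map_le_trans)
  show "countable S0_fin"
  proof -
    have "countable (range (\<lambda>l. map_of l :: nat \<Rightarrow> int option))" by simp
    moreover have "S0_fin \<subseteq> range (\<lambda>l. map_of l)"
    proof
      fix s assume "s \<in> S0_fin"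
      then show "s \<in> range (\<lambda>l. map_of l)" 
        using map_of_map_restrict[of "\<lambda>i. the (s i)" "sorted_list_of_set (dom s)"]
        by (intro range_eqI[of _ _ "map (\<lambda>i. (i, the (s i))) (sorted_list_of_set (dom s))"])
          (auto simp: restrict_map_def fun_eq_iff domIff)
    qed
    ultimately show ?thesis by (rule countable_subset[rotated])
  qed
  show "S0_fin \<subseteq> S0" by blast
  show "\<exists>p\<in>S0_fin. \<forall>x\<in>S0. p \<subseteq>\<^sub>m x" by (intro bexI[of _ Map.empty]) (auto simp: S0_def)
  show "\<exists>j\<in>S0_fin. p \<subseteq>\<^sub>m j \<and> q \<subseteq>\<^sub>m j \<and> (\<forall>z\<in>S0. p \<subseteq>\<^sub>m z \<longrightarrow> q \<subseteq>\<^sub>m z \<longrightarrow> j \<subseteq>\<^sub>m z)"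
    if "p \<in> S0_fin" "q \<in> S0_fin" "p \<subseteq>\<^sub>m x" "q \<subseteq>\<^sub>m x" for p q x
    using S0_comparable[of p q x] that by auto
  show "x \<subseteq>\<^sub>m y" if "x \<in> S0" and p: "\<And>p. \<lbrakk>p \<in> S0_fin; p \<subseteq>\<^sub>m x\<rbrakk> \<Longrightarrow> p \<subseteq>\<^sub>m y" for x y
    unfolding map_le_def
  proof
    fix i assume i: "i \<in> dom x"
    have "x |` {..<Suc i} \<subseteq>\<^sub>m y"
      using p[of "x |` {..<Suc i}"] S0_restrict \<open>x \<in> S0\<close> finite_dom_restrict restrict_le by blast
    then have "y i = (x |` {..<Suc i}) i" by (rule map_leD) (use i in auto)
    then show "x i = y i" by simp
  qed
  fix I assume I: "I \<subseteq> S0_fin" "I \<noteq> {}" "\<And>p q. \<lbrakk>p \<in> I; q \<in> I\<rbrakk> \<Longrightarrow> \<exists>u\<in>I. p \<subseteq>\<^sub>m u \<and> q \<subseteq>\<^sub>m u"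
  define s where "s = (\<lambda>i. if \<exists>q\<in>I. q i \<noteq> None then (SOME q. q \<in> I \<and> q i \<noteq> None) i else None)"
  have eq: "p i = q i" if "p \<in> I" "q \<in> I" "p i \<noteq> None" "q i \<noteq> None" for p q i
    using I(3)[OF that(1,2)] map_leD that(3,4) by metis
  have s: "s i = q i" if "q \<in> I" "q i \<noteq> None" for q i
  proof -
    have ex: "\<exists>q. q \<in> I \<and> q i \<noteq> None" using that by blast
    have "(SOME q. q \<in> I \<and> q i \<noteq> None) i = q i"
      using someI_ex[OF ex] eq[of "SOME q. q \<in> I \<and> q i \<noteq> None" q i] that by blast
    then show ?thesis using ex unfolding s_def by auto
  qed
  have s': "\<exists>q\<in>I. q i \<noteq> None" if "s i \<noteq> None" for i using that unfolding s_def by (auto split: if_splits)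
  have qs: "q \<subseteq>\<^sub>m s" if "q \<in> I" for q using s that unfolding map_le_def by (metis domIff)
  have "s \<in> S0"
    unfolding S0_def mem_Collect_eq
  proof (intro conjI allI impI)
    fix i assume "s (Suc i) \<noteq> None"
    then obtain q where q: "q \<in> I" "q (Suc i) \<noteq> None" using s' by blast
    then have "q i \<noteq> None" using I(1) S0_down[of q "Suc i" i] by auto
    then show "s i \<noteq> None" using s q by auto
  next
    fix i b assume b: "s (Suc i) = Some b"
    then obtain q where q: "q \<in> I" "q (Suc i) \<noteq> None" using s'[of "Suc i"] by auto
    then have "q (Suc i) = Some b" using s b by auto
    then show "b \<in> {-1, 0, 1}" using S0_digit q I(1) by blast
  qed
  moreover have "p \<subseteq>\<^sub>m s \<longleftrightarrow> (\<exists>q\<in>I. p \<subseteq>\<^sub>m q)" if p: "p \<in> S0_fin" for p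
  proof
    assume ps: "p \<subseteq>\<^sub>m s"
    show "\<exists>q\<in>I. p \<subseteq>\<^sub>m q"
    proof (cases "dom p = {}")
      case True
      then show ?thesis using I(2) by (auto simp: map_le_def)
    next
      case False
      \<comment> \<open>Domains of sequences are initial segments, so a member of \<open>I\<close>
        that is defined at the last index of \<open>p\<close> is defined on all of
        \<open>dom p\<close>.\<close>
      define m where "m = Max (dom p)"
      have m: "p m \<noteq> None" "\<And>i. p i \<noteq> None \<Longrightarrow> i \<le> m"
        using p False Max_in[of "dom p"] Max_ge[of "dom p"] unfolding m_def by (blast intro: domI)+
      then have "s m \<noteq> None" using map_leD[OF ps] by metis
      then obtain q where q: "q \<in> I" "q m \<noteq> None" using s' by blast
      have "p i = q i" if "p i \<noteq> None" for i
      proof -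
        have "q i \<noteq> None" using S0_down[of q m i] q I(1) m(2)[OF that] by blast
        then show ?thesis using s[OF q(1)] map_leD[OF ps that] by metis
      qed
      then show ?thesis using q(1) unfolding map_le_def by (metis domIff)
    qed
  next
    assume "\<exists>q\<in>I. p \<subseteq>\<^sub>m q"
    then show "p \<subseteq>\<^sub>m s" using qs map_le_trans by blast
  qed
  ultimately show "\<exists>s\<in>S0. \<forall>p\<in>S0_fin. p \<subseteq>\<^sub>m s \<longleftrightarrow> (\<exists>q\<in>I. p \<subseteq>\<^sub>m q)" by blast
qed

lemma S_eq0_iff: "S_eq0 x y \<longleftrightarrow> x \<in> S0_max \<and> y \<in> S0_max \<and> S_val x = S_val y"
proof -
  have "S_sim0 x y \<longleftrightarrow> S_val x = S_val y" if xy: "x \<in> S0_max" "y \<in> S0_max"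
  proof -
    have "x \<in> S0" "y \<in> S0" using xy by (auto simp: S0_max_def)
    then show ?thesis using S_sim0_iff fits_max xy by auto
  qed
  then show ?thesis unfolding S_eq0_def by blast
qed

lemma S0_max_le: "\<lbrakk>x \<in> S0_max; x \<subseteq>\<^sub>m y; y \<in> S0\<rbrakk> \<Longrightarrow> y = x"
  by (auto simp: S0_max_def)

text \<open>Total base elements are maximal, so there is nothing to adjust in \<open>rep\<close> and
  \<open>low\<close>. \<open>L\<close> is convergence digit by digit, which is stronger than
  convergence of the values.\<close>

interpretation S: hier S0 "(\<subseteq>\<^sub>m)" S0_fin S_dom S_sim0 S_sim S_eq0
  "\<lambda>xs x. \<forall>i. \<forall>\<^sub>F n in sequentially. xs n i = x i" "\<lambda>x. x" "\<lambda>x. x"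
proof -
  interpret B: sdom S0 "(\<subseteq>\<^sub>m)" S0_fin by (rule sdom_S0)
  have down: "S_sim0 x' y'" if "S_sim0 x y" "x' \<subseteq>\<^sub>m x" "y' \<subseteq>\<^sub>m y" for x y x' y'
    using that unfolding S_sim0_def by (meson map_le_trans)
  show "hier S0 (\<subseteq>\<^sub>m) S0_fin S_dom S_sim0 S_sim S_eq0
    (\<lambda>xs x. \<forall>i. \<forall>\<^sub>F n in sequentially. xs n i = x i) (\<lambda>x. x) (\<lambda>x. x)"
  proof
    show "S_sim0 x x" if "x \<in> S0" for x
      using S0_ext[OF that] unfolding S_sim0_def by blast
    show "S_sim0 x' y'" if "S_sim0 x y" "x' \<subseteq>\<^sub>m x" "y' \<subseteq>\<^sub>m y" for x y x' y' using down that .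
    show "S_sim 0 (Val x') (Val y')" if "S_sim 0 (Val x) (Val y)" "x' \<subseteq>\<^sub>m x" "y' \<subseteq>\<^sub>m y" for x y x' y'
      using down[of x y] that by simp
    show "S_sim (Suc k) f' g'" if "S_sim (Suc k) f g"
      "\<And>x. x \<in> S_dom k \<Longrightarrow> {app f' x, app g' x, app f x, app g x} \<subseteq> S0 \<and>
       app f' x \<subseteq>\<^sub>m app f x \<and> app g' x \<subseteq>\<^sub>m app g x" for k f g f' g'
      using that down by (simp; blast)
    show "\<forall>\<^sub>F n in sequentially. b \<subseteq>\<^sub>m xs n"
      if L: "\<forall>i. \<forall>\<^sub>F n in sequentially. xs n i = x i" and b: "b \<in> S0_fin" "b \<subseteq>\<^sub>m x" for xs b and x :: "nat \<Rightarrow> int option"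
    proof -
      have "\<forall>\<^sub>F n in sequentially. \<forall>i\<in>dom b. xs n i = x i"
        using b(1) L by (simp add: eventually_ball_finite_distrib)
      then show ?thesis by (rule eventually_mono) (use b(2) in \<open>auto simp: map_le_def\<close>)
    qed
    show "\<forall>i. \<forall>\<^sub>F n in sequentially. xs n i = x i" if x: "x \<in> S0" "S_eq0 x x" and c: "B.sconv xs x" for xs x
    proof
      fix i
      have "x i \<noteq> None" using x(2) S0_max_iff by (auto simp: S_eq0_iff)
      have "x |` {..<Suc i} \<in> S0_fin" "x |` {..<Suc i} \<subseteq>\<^sub>m x"
        using S0_restrict x(1) finite_dom_restrict restrict_le by blast+
      then have "\<forall>\<^sub>F n in sequentially. x |` {..<Suc i} \<subseteq>\<^sub>m xs n" using c unfolding B.sconv_def by blast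
      then show "\<forall>\<^sub>F n in sequentially. xs n i = x i"
      proof eventually_elim
        case (elim n)
        show ?case using map_leD[OF elim, of i] \<open>x i \<noteq> None\<close> by simp
      qed
    qed
    show "\<forall>i. \<forall>\<^sub>F n in sequentially. ys n i = y i"
      if L: "\<forall>i. \<forall>\<^sub>F n in sequentially. xs n i = x i"
        and x: "S_eq0 x x" "\<And>n. S_eq0 (xs n) (xs n)" and y: "S_eq0 y y" "\<And>n. S_eq0 (ys n) (ys n)"
        and j: "\<And>n. \<exists>z\<in>S0. xs n \<subseteq>\<^sub>m z \<and> ys n \<subseteq>\<^sub>m z" "\<exists>z\<in>S0. x \<subseteq>\<^sub>m z \<and> y \<subseteq>\<^sub>m z" for xs x ys y
    proof -
      have eq: "u = w" if "S_eq0 u u" "S_eq0 w w" "\<exists>z\<in>S0. u \<subseteq>\<^sub>m z \<and> w \<subseteq>\<^sub>m z" for u w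
        using that S0_max_le S_eq0_iff by metis
      have "ys n = xs n" for n using eq[OF y(2) x(2)] j(1)[of n] by blast
      moreover have "y = x" using eq[OF y(1) x(1)] j(2) by blast
      ultimately show ?thesis using L by simp
    qed
    show "S_sim0 x y" if "x \<in> S0" "y \<in> S0" "\<And>b c. \<lbrakk>b \<in> S0_fin; c \<in> S0_fin; b \<subseteq>\<^sub>m x; c \<subseteq>\<^sub>m y\<rbrakk> \<Longrightarrow> S_sim0 b c" for x y
      by (rule S_sim0_closed[OF that(1,2)]) (use that(3) in blast)
    show "S_eq0 x y" if "S_eq0 x x" "x \<subseteq>\<^sub>m y" "y \<in> S0" for x y
      using that S0_max_le S_eq0_iff by metis
    show "S_sim0 x y" if "S_eq0 x y" for x y using that by (simp add: S_eq0_def)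
  qed (auto simp: S_eq0_iff)
qed

section \<open>Density of the total objects\<close>

context hier
begin

lemma conv_const: "\<lbrakk>conv_ok k; y \<in> T k\<rbrakk> \<Longrightarrow> conv k (\<lambda>_. y) y"
  by (rule scv_conv) (auto intro: scv_const T_D)

lemma le_app:
  assumes "p \<sqsubseteq> f" "p \<in> D (Suc m)" "f \<in> D (Suc m)" "x \<in> D m" "y \<in> D m" "x \<sqsubseteq> y"
  shows "le (app p x) (app f y)"
  using B.trans[OF appM[OF assms(2,4,5,6)], of "app f y"] fleS[OF assms(2,3)] assms appB by blast

text \<open>If the values were consistent at every compact argument, the steps of \<open>p\<close>
  and \<open>q\<close> together would satisfy the conditions of \<open>presents_ex\<close> and
  present a common upper bound. The assumption \<open>sm\<close> takes care of the
  \<open>sim\<close> condition.\<close>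

lemma incompatible_at:
  assumes pq: "p \<in> K (Suc m)" "q \<in> K (Suc m)" "\<not> (\<exists>z\<in>D (Suc m). p \<sqsubseteq> z \<and> q \<sqsubseteq> z)"
    and sm: "\<And>x y i j. \<lbrakk>x \<in> D m; y \<in> D m; sim m x y; i \<in> B; j \<in> B;
      \<And>z. z \<in> B \<Longrightarrow> le i z \<longleftrightarrow> le (app p x) z \<and> le (app q x) z;
      \<And>z. z \<in> B \<Longrightarrow> le j z \<longleftrightarrow> le (app p y) z \<and> le (app q y) z\<rbrakk> \<Longrightarrow> s0 i j"
  shows "\<exists>x\<in>K m. \<not> (\<exists>z\<in>B. le (app p x) z \<and> le (app q x) z)"
proof (rule ccontr)
  assume "\<not> ?thesis"
  then have bd: "\<exists>z\<in>B. le (app p x) z \<and> le (app q x) z" if "x \<in> K m" for x using that by blast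
  obtain u where u: "finite u" "u \<subseteq> K m \<times> KB" "presents m u p" using pq(1) by auto
  obtain v where v: "finite v" "v \<subseteq> K m \<times> KB" "presents m v q" using pq(2) by auto
  have uv: "(\<forall>(c, b)\<in>u \<union> v. c \<sqsubseteq> x \<longrightarrow> le b z) \<longleftrightarrow> le (app p x) z \<and> le (app q x) z"
    if "x \<in> D m" "z \<in> B" for x z
    using presents_appS[OF u that] presents_appS[OF v that] by blast
  have "\<exists>g. presents m (u \<union> v) g"
  proof (rule presents_exS)
    fix x assume x: "x \<in> D m"
    let ?P = "{p. (\<exists>b. (p, b) \<in> u \<union> v) \<and> p \<sqsubseteq> x}"
    have "finite ?P" by (rule finite_subset[of _ "fst ` (u \<union> v)"]) (use u v in force)+
    moreover have "?P \<subseteq> K m" using u(2) v(2) by blast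
    ultimately obtain c where c: "c \<in> K m" "\<forall>a\<in>?P. a \<sqsubseteq> c" using X.fin_join[of ?P m x] x by blast
    obtain z where z: "z \<in> B" "le (app p c) z" "le (app q c) z" using bd[OF c(1)] by blast
    then have "\<forall>(a, b)\<in>u \<union> v. a \<sqsubseteq> c \<longrightarrow> le b z" using uv[OF X.K_D[OF c(1)] z(1)] by blast
    then show "\<exists>z\<in>B. \<forall>(p, b)\<in>u \<union> v. p \<sqsubseteq> x \<longrightarrow> le b z" using c(2) z(1) by blast
  next
    fix x y i j assume *: "x \<in> D m" "y \<in> D m" "sim m x y" "i \<in> B" "j \<in> B"
      "\<And>z. z \<in> B \<Longrightarrow> le i z \<longleftrightarrow> (\<forall>(p, b)\<in>u \<union> v. p \<sqsubseteq> x \<longrightarrow> le b z)"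
      "\<And>z. z \<in> B \<Longrightarrow> le j z \<longleftrightarrow> (\<forall>(p, b)\<in>u \<union> v. p \<sqsubseteq> y \<longrightarrow> le b z)"
    show "s0 i j" by (rule sm[OF *(1-5)]) (use *(6,7) uv[OF *(1)] uv[OF *(2)] in metis)+
  qed (use u v in auto)
  then obtain g where g: "presents m (u \<union> v) g" by blast
  then have gD: "g \<in> D (Suc m)" by (simp add: presents_def)
  have "\<forall>(c, b)\<in>u. le b (app g c)" "\<forall>(c, b)\<in>v. le b (app g c)" using presents_leS[OF g] by blast+
  then have "p \<sqsubseteq> g" "q \<sqsubseteq> g" using u(3) v(3) gD unfolding presents_def by blast+
  then show False using pq(3) gD by blast
qed

text \<open>A realisation of \<open>F\<close> lies above a compact function as soon as
  \<open>F\<close> obeys its finitely many steps on total arguments. The alternative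
  \<open>f = g\<close> yields the first clause of \<open>dens\<close>, and pointwise related
  \<open>F\<close> and \<open>G\<close> yield equivalent extensions.\<close>

lemma dens_SucI:
  assumes d: "dens k"
    and F: "\<And>f g u w. \<lbrakk>finite u; u \<subseteq> K k \<times> KB; presents k u f; finite w; w \<subseteq> K k \<times> KB; presents k w g;
      f = g \<or> sim (Suc k) f g\<rbrakk> \<Longrightarrow> \<exists>F G. cont k F \<and> cont k G \<and> (\<forall>y\<in>T k. r (F y) (G y)) \<and>
      (\<forall>(p, b)\<in>u. \<forall>y\<in>T k. p \<sqsubseteq> y \<longrightarrow> le b (rep (F y))) \<and> (\<forall>(p, b)\<in>w. \<forall>y\<in>T k. p \<sqsubseteq> y \<longrightarrow> le b (rep (G y)))"
  shows "dens (Suc k)"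
proof -
  have real: "\<exists>h\<in>T (Suc k). f \<sqsubseteq> h \<and> (\<forall>y\<in>T k. r (app h y) (F y))"
    if u: "u \<subseteq> K k \<times> KB" "presents k u f" and c: "cont k F"
      and b: "\<forall>(p, b)\<in>u. \<forall>y\<in>T k. p \<sqsubseteq> y \<longrightarrow> le b (rep (F y))" for u f F
  proof -
    obtain h where h: "h \<in> T (Suc k)" "\<And>x b. \<lbrakk>x \<in> D k; b \<in> KB\<rbrakk> \<Longrightarrow>
        le b (app h x) \<longleftrightarrow> (\<exists>p\<in>K k. p \<sqsubseteq> x \<and> (\<forall>y\<in>T k. p \<sqsubseteq> y \<longrightarrow> le b (rep (F y))))"
      "\<forall>y\<in>T k. r (app h y) (F y)" using realize_one(1)[OF d c] by blast
    have "le b (app h p)" if pb: "(p, b) \<in> u" for p b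
    proof -
      have "p \<in> K k" "b \<in> KB" using u pb by auto
      then show ?thesis using h(2)[of p b] X.K_D X.refl pb b by blast
    qed
    then have "f \<sqsubseteq> h" using u(2) T_D[OF h(1)] unfolding presents_def by blast
    then show ?thesis using h by blast
  qed
  have ex: "\<exists>y\<in>T (Suc k). \<exists>z\<in>T (Suc k). f \<sqsubseteq> y \<and> g \<sqsubseteq> z \<and> eqv (Suc k) y z"
    if fg: "f \<in> K (Suc k)" "g \<in> K (Suc k)" "f = g \<or> sim (Suc k) f g" for f g
  proof -
    obtain u where u: "finite u" "u \<subseteq> K k \<times> KB" "presents k u f" using fg(1) by auto
    obtain w where w: "finite w" "w \<subseteq> K k \<times> KB" "presents k w g" using fg(2) by auto
    obtain F G where FG: "cont k F" "cont k G" "\<forall>y\<in>T k. r (F y) (G y)"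
      "\<forall>(p, b)\<in>u. \<forall>y\<in>T k. p \<sqsubseteq> y \<longrightarrow> le b (rep (F y))" "\<forall>(p, b)\<in>w. \<forall>y\<in>T k. p \<sqsubseteq> y \<longrightarrow> le b (rep (G y))"
      using F[OF u w fg(3)] by blast
    obtain h where h: "h \<in> T (Suc k)" "f \<sqsubseteq> h" "\<forall>y\<in>T k. r (app h y) (F y)"
      using real[OF u(2,3) FG(1,4)] by blast
    obtain h' where h': "h' \<in> T (Suc k)" "g \<sqsubseteq> h'" "\<forall>y\<in>T k. r (app h' y) (G y)"
      using real[OF w(2,3) FG(2,5)] by blast
    have "eqv (Suc k) h h'"
    proof (rule eqvI[OF h(1) h'(1)])
      fix y assume "y \<in> T k"
      then show "r (app h y) (app h' y)"
        using r_trans[OF r_trans[OF bspec[OF h(3)] bspec[OF FG(3)]] r_sym[OF bspec[OF h'(3)]]] by blast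
    qed
    then show ?thesis using h h' by blast
  qed
  show ?thesis unfolding dens_def using ex by blast
qed

lemma presents_Un: "\<lbrakk>presents k u g; presents k w g\<rbrakk> \<Longrightarrow> presents k (u \<union> w) g"
  unfolding presents_def by (simp add: ball_Un)

end

lemma tendsto_Max:
  assumes "finite I" "I \<noteq> {}" "\<And>i. i \<in> I \<Longrightarrow> ((\<lambda>n. f i n :: real) \<longlongrightarrow> g i) F"
  shows "((\<lambda>n. Max ((\<lambda>i. f i n) ` I)) \<longlongrightarrow> Max (g ` I)) F"
  using assms by (induction I rule: finite_ne_induct) (auto intro!: tendsto_max)

lemma tendsto_Min:
  assumes "finite I" "I \<noteq> {}" "\<And>i. i \<in> I \<Longrightarrow> ((\<lambda>n. f i n :: real) \<longlongrightarrow> g i) F"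
  shows "((\<lambda>n. Min ((\<lambda>i. f i n) ` I)) \<longlongrightarrow> Min (g ` I)) F"
  using assms by (induction I rule: finite_ne_induct) (auto intro!: tendsto_min)

text \<open>The function is a maximum of minima of functions adjusted to two of the sets only.\<close>

lemma lattice_select:
  fixes l u :: "'i \<Rightarrow> real"
  assumes I: "finite I" and lu: "\<And>i. i \<in> I \<Longrightarrow> l i \<le> u i"
    and w: "\<And>i j. \<lbrakk>i \<in> I; j \<in> I; u j < l i\<rbrakk> \<Longrightarrow> \<exists>w. scont cv w \<and> (\<forall>y y'. R y y' \<longrightarrow> w y = w y') \<and>
      (\<forall>y. A i y \<longrightarrow> w y \<ge> 1) \<and> (\<forall>y. A j y \<longrightarrow> w y \<le> (0 :: real))"
  shows "\<exists>g. scont cv g \<and> (\<forall>y y'. R y y' \<longrightarrow> g y = g y') \<and> (\<forall>i\<in>I. \<forall>y. A i y \<longrightarrow> l i \<le> g y \<and> g y \<le> u i)"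
proof (cases "I = {}")
  case True
  then show ?thesis by (intro exI[of _ "\<lambda>_. 0"]) (auto simp: scont_def)
next
  case False
  define P where "P = (\<lambda>i j W. i \<in> I \<longrightarrow> j \<in> I \<longrightarrow> scont cv W \<and> (\<forall>y y'. R y y' \<longrightarrow> W y = W y') \<and>
      (\<forall>y. A i y \<longrightarrow> W y \<ge> l i) \<and> (\<forall>y. A j y \<longrightarrow> W y \<le> u j))"
  have "\<forall>i j. \<exists>W. P i j W"
  proof (intro allI)
    fix i j
    show "\<exists>W. P i j W"
    proof (cases "i \<in> I \<and> j \<in> I \<and> u j < l i")
      case True
      then obtain v where v: "scont cv v" "\<And>y y'. R y y' \<Longrightarrow> v y = v y'" "\<And>y. A i y \<Longrightarrow> v y \<ge> 1" "\<And>y. A j y \<Longrightarrow> v y \<le> 0"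
        using w by blast
      have "scont cv (\<lambda>y. u j + (l i - u j) * v y)"
        using v(1) unfolding scont_def by (auto intro!: tendsto_intros)
      moreover have "u j + (l i - u j) * v y \<ge> l i" if "A i y" for y
      proof -
        have "(l i - u j) * 1 \<le> (l i - u j) * v y" by (rule mult_left_mono[OF v(3)[OF that]]) (use True in simp)
        then show ?thesis unfolding mult_1_right by linarith
      qed
      moreover have "u j + (l i - u j) * v y \<le> u j" if "A j y" for y
        using mult_nonneg_nonpos[of "l i - u j" "v y"] v(4)[OF that] True by simp
      ultimately show ?thesis
        unfolding P_def using v(2) by (intro exI[of _ "\<lambda>y. u j + (l i - u j) * v y"]) auto
    next
      case False
      \<comment> \<open>For \<open>i\<close> and \<open>j\<close> in \<open>I\<close> this case
        means \<open>l i \<le> u j\<close>, so a constant meets both demands.\<close>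
      then show ?thesis unfolding P_def by (intro exI[of _ "\<lambda>_. l i"]) (auto simp: scont_def)
    qed
  qed
  then obtain W where "\<And>i j. P i j (W i j)" by metis
  then have W: "\<And>i j. \<lbrakk>i \<in> I; j \<in> I\<rbrakk> \<Longrightarrow> scont cv (W i j)"
    "\<And>i j y y'. \<lbrakk>i \<in> I; j \<in> I; R y y'\<rbrakk> \<Longrightarrow> W i j y = W i j y'"
    "\<And>i j y. \<lbrakk>i \<in> I; j \<in> I; A i y\<rbrakk> \<Longrightarrow> l i \<le> W i j y" "\<And>i j y. \<lbrakk>i \<in> I; j \<in> I; A j y\<rbrakk> \<Longrightarrow> W i j y \<le> u j"
    unfolding P_def by blast+
  \<comment> \<open>On \<open>A i\<close> the minimum for \<open>i\<close> itself is at least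
    \<open>l i\<close>, and every one of the minima has an entry with second index \<open>i\<close>,
    which is at most \<open>u i\<close>.\<close>
  define g where "g = (\<lambda>y. Max ((\<lambda>i. Min ((\<lambda>j. W i j y) ` I)) ` I))"
  have "scont cv g"
    using W(1) unfolding g_def scont_def by (auto intro!: tendsto_Max[OF I False] tendsto_Min[OF I False])
  moreover have "g y = g y'" if "R y y'" for y y'
    unfolding g_def using W(2) that by (auto intro!: arg_cong[where f = Max] arg_cong[where f = Min] image_cong)
  moreover have "l i \<le> g y \<and> g y \<le> u i" if i: "i \<in> I" "A i y" for i y
  proof
    have "l i \<le> Min ((\<lambda>j. W i j y) ` I)" using W(3) i I False by auto
    also have "\<dots> \<le> g y" unfolding g_def using I i by (intro Max_ge) auto
    finally show "l i \<le> g y" .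
    have "Min ((\<lambda>j. W i' j y) ` I) \<le> u i" if "i' \<in> I" for i'
      using W(4)[OF that i] I i by (meson Min_le finite_imageI image_eqI order_trans)
    then show "g y \<le> u i" unfolding g_def using I False by auto
  qed
  ultimately show ?thesis by blast
qed

subsection \<open>The Kleene-Kreisel functionals\<close>

lemma N_T0: "y \<in> N.T 0 \<longleftrightarrow> (\<exists>i. y = Val (Some i))"
  by (auto simp: tot_def N_eq0_def)

text \<open>Equivalent objects take equal values, so a constant sequence also converges to the other
  representatives of its point. Hence sequentially continuous functions from these objects to the
  naturals or the reals are automatically extensional.\<close>

lemma N_eqv_conv:
  assumes "N.conv_ok k" "N.eqv k x y" "x \<in> N.T k" "y \<in> N.T k"
  shows "N.conv k (\<lambda>_. x) y"
proof (cases k)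
  case 0
  then show ?thesis using assms by (auto simp: N_eq0_def)
next
  case (Suc m)
  have "\<forall>\<^sub>F n in sequentially. app x (ys n) = app y z" if "N.conv m ys z" for ys z
  proof -
    have z: "z \<in> N.T m" using N.conv_T[OF that] by blast
    have "N_eq0 (app x z) (app y z)" using N.eqv_app[of m x y z z] assms(2) N.T_eqv[OF z] z Suc by blast
    moreover have "\<forall>\<^sub>F n in sequentially. app x (ys n) = app x z"
      using N.conv_app[of m "\<lambda>_. x" x] N.conv_const[OF assms(1,3)] that Suc by blast
    ultimately show ?thesis by (auto simp: N_eq0_def)
  qed
  then show ?thesis using assms Suc by simp
qed

text \<open>Two incompatible functions disagree at some compact argument \<open>x\<close>.
  Evaluation at a total \<open>y0\<close> above \<open>x\<close> reads a natural number that tells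
  them apart, and evaluation at a fixed total argument is locally constant.\<close>

lemma N_test:
  assumes d: "\<And>j. j < k \<Longrightarrow> N.dens j" and pq: "p \<in> N.K k" "q \<in> N.K k"
    "\<not> (\<exists>z\<in>N_dom k. N.fle p z \<and> N.fle q z)"
  shows "\<exists>w. sdisc (N.conv k) w \<and> (\<forall>y\<in>N.T k. (N.fle p y \<longrightarrow> w y) \<and> (N.fle q y \<longrightarrow> \<not> w y))"
proof (cases k)
  case 0
  then obtain a b where ab: "p = Val a" "q = Val b" using pq by auto
  then have "\<not> N_le a b" "\<not> N_le b a" using pq(3) 0 by (force simp: N_le_def)+
  then show ?thesis
    using ab 0 by (intro exI[of _ "\<lambda>y. val y = a"]) (auto simp: sdisc_def N_T0 N_le_def eventually_mono)
next
  case (Suc m)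
  obtain x where x: "x \<in> N.K m" "\<not> (\<exists>z. N_le (app p x) z \<and> N_le (app q x) z)"
    using N.incompatible_at[of p m q] pq Suc by auto
  obtain y0 where y0: "y0 \<in> N.T m" "N.fle x y0" using d[of m] x(1) Suc unfolding N.dens_def by blast
  have ok: "N.conv_ok m" using d Suc by (intro N.conv_okI) auto
  have le: "N_le (app c x) (app f y0)" if "c \<in> N.K k" "f \<in> N.T k" "N.fle c f" for c f
    using N.le_app[OF that(3)] N.X.K_D N.T_D that x y0 Suc by blast
  have "sdisc (N.conv k) (\<lambda>f. app f y0 = app p x)"
    unfolding sdisc_def
  proof (intro allI impI)
    fix fs f assume "N.conv k fs f"
    then have "\<forall>\<^sub>F n in sequentially. app (fs n) y0 = app f y0"
      using N.conv_app[OF _ N.conv_const[OF ok y0(1)]] Suc by blast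
    then show "\<forall>\<^sub>F n in sequentially. (app (fs n) y0 = app p x) = (app f y0 = app p x)"
      by (rule eventually_mono) simp
  qed
  moreover have "app f y0 = app p x" if "f \<in> N.T k" "N.fle p f" for f
    using le[OF pq(1) that] x(2) unfolding N_le_def by metis
  moreover have "app f y0 \<noteq> app p x" if "f \<in> N.T k" "N.fle q f" for f
    using le[OF pq(2) that] x(2) unfolding N_le_def by metis
  ultimately show ?thesis by blast
qed

text \<open>Given finitely many steps of a compact function, \<open>F y\<close> takes the value of a
  step whose argument passes the tests of \<open>N_test\<close> against all incompatible step
  arguments, and 0 if there is none. This is a function of finitely many locally constant
  tests.\<close>

lemma N_dens: "N.dens k"
proof (induction k rule: less_induct)
  case (less k)
  show ?case
  proof (cases k)
    case 0
    have "\<exists>y\<in>N.T 0. N.fle p y" if p: "p \<in> N.K 0" for p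
    proof -
      obtain a where a: "p = Val a" using p by auto
      then show ?thesis
        using N_T0[of "Val (Some (case a of None \<Rightarrow> 0 | Some i \<Rightarrow> i))"]
        by (intro bexI[of _ "Val (Some (case a of None \<Rightarrow> 0 | Some i \<Rightarrow> i))"]) (auto simp: N_le_def split: option.splits)
    qed
    then show ?thesis unfolding 0 N.dens_def by blast
  next
    case (Suc m)
    have d: "N.dens m" and dj: "\<And>j. j < m \<Longrightarrow> N.dens j" using less Suc by auto
    have ok: "N.conv_ok m" by (rule N.conv_okI[OF dj])
    let ?nub = "\<lambda>p q. \<not> (\<exists>z\<in>N_dom m. N.fle p z \<and> N.fle q z)"
    define R where "R = (\<lambda>p q w. p \<in> N.K m \<longrightarrow> q \<in> N.K m \<longrightarrow> ?nub p q \<longrightarrow> sdisc (N.conv m) w \<and>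
      (\<forall>y\<in>N.T m. (N.fle p y \<longrightarrow> w y) \<and> (N.fle q y \<longrightarrow> \<not> w y)))"
    have "\<forall>p q. \<exists>w. R p q w" unfolding R_def using N_test[OF dj] by blast
    then obtain w where "\<And>p q. R p q (w p q)" by metis
    then have w: "\<And>p q. \<lbrakk>p \<in> N.K m; q \<in> N.K m; ?nub p q\<rbrakk> \<Longrightarrow> sdisc (N.conv m) (w p q)"
      "\<And>p q y. \<lbrakk>p \<in> N.K m; q \<in> N.K m; ?nub p q; y \<in> N.T m; N.fle p y\<rbrakk> \<Longrightarrow> w p q y"
      "\<And>p q y. \<lbrakk>p \<in> N.K m; q \<in> N.K m; ?nub p q; y \<in> N.T m; N.fle q y\<rbrakk> \<Longrightarrow> \<not> w p q y"
      unfolding R_def by blast+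
    have "\<exists>F. N.cont m F \<and> (\<forall>(p, b)\<in>u. \<forall>y\<in>N.T m. N.fle p y \<longrightarrow> N_le b (F y))"
      if u: "finite u" "u \<subseteq> N.K m \<times> UNIV" "N.presents m u g" for u g
    proof -
      let ?P = "{(p, q). p \<in> fst ` u \<and> q \<in> fst ` u \<and> ?nub p q}"
      define sel where "sel = (\<lambda>W pb. pb \<in> u \<and> snd pb \<noteq> None \<and> (\<forall>q. (fst pb, q) \<in> ?P \<longrightarrow> W (fst pb, q)))"
      define H where "H = (\<lambda>W :: _ \<Rightarrow> bool. if \<exists>pb. sel W pb then snd (SOME pb. sel W pb) else Some (0 :: nat))"
      define F where "F = (\<lambda>y. H (\<lambda>pq. if pq \<in> ?P then w (fst pq) (snd pq) y else False))"
      have "finite ?P" by (rule finite_subset[of _ "fst ` u \<times> fst ` u"]) (use u(1) in auto)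
      then have sF: "sdisc (N.conv m) F"
        unfolding F_def
      proof (rule sdisc_fin)
        fix pq assume "pq \<in> ?P"
        then obtain p q where "pq = (p, q)" "p \<in> fst ` u" "q \<in> fst ` u" "?nub p q" by blast
        moreover then have "p \<in> N.K m" "q \<in> N.K m" using u(2) by auto
        ultimately show "sdisc (N.conv m) (w (fst pq) (snd pq))" using w(1)[of p q] by simp
      qed
      have F0: "\<exists>i. F y = Some i" for y
      proof -
        have "\<exists>i. H W = Some i" for W
        proof (cases "\<exists>pb. sel W pb")
          case True
          then have "sel W (SOME pb. sel W pb)" by (rule someI_ex)
          then show ?thesis using True by (auto simp: H_def sel_def)
        qed (simp add: H_def)
        then show ?thesis by (simp add: F_def)
      qed
      have "N.cont m F"
        unfolding N.cont_def
      proof (intro conjI ballI allI impI)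
        fix y z assume "y \<in> N.T m" "z \<in> N.T m" "N.eqv m y z"
        then have "N.conv m (\<lambda>_. y) z" using N_eqv_conv[OF ok] by blast
        then have "F y = F z" using sdiscD[OF sF] by force
        then show "N_eq0 (F y) (F z)" using F0[of z] by (auto simp: N_eq0_def)
      next
        fix ys y assume "y \<in> N.T m" "\<forall>n. ys n \<in> N.T m" "N.scv m ys y"
        then show "\<forall>\<^sub>F n in sequentially. F (ys n) = F y" using sdiscD[OF sF N.scv_conv[OF ok]] by blast
      qed auto
      moreover have "N_le b (F y)" if pb: "(p, b) \<in> u" and y: "y \<in> N.T m" "N.fle p y" for p b y
      proof (cases b)
        case None
        then show ?thesis by (simp add: N_le_def)
      next
        case (Some i)
        define W where "W = (\<lambda>pq. if pq \<in> ?P then w (fst pq) (snd pq) y else False)"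
        have uK: "a \<in> N.K m" if "(a, c) \<in> u" for a c using that u(2) by auto
        have "sel W (p, b)"
          unfolding sel_def W_def using pb Some w(2)[OF _ _ _ y] uK by auto
        \<comment> \<open>A competing selected step cannot have an argument incompatible with
          \<open>p\<close>, as \<open>y\<close> lies above \<open>p\<close> and so fails the test of
          \<open>p'\<close> against \<open>p\<close>. Compatible arguments have a bound
          \<open>z\<close>, where \<open>app g z\<close> is above both values, so these are
          equal.\<close>
        moreover have "snd pb' = b" if s: "sel W pb'" for pb'
        proof -
          obtain p' b' where p': "pb' = (p', b')" "(p', b') \<in> u" "b' \<noteq> None" using s by (cases pb') (auto simp: sel_def)
          have "\<not> ?nub p' p"
          proof
            assume n: "?nub p' p"
            then have "(p', p) \<in> ?P" using p'(2) pb by force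
            then have "w p' p y" using s p' by (auto simp: sel_def W_def)
            then show False using w(3)[OF uK[OF p'(2)] uK[OF pb] n y] by blast
          qed
          then obtain z where z: "z \<in> N_dom m" "N.fle p' z" "N.fle p z" by blast
          have g: "g \<in> N_dom (Suc m)" using u(3) unfolding N.presents_def by blast
          have "N_le b (app g z)" "N_le b' (app g z)"
            using N.presents_leS[OF u(3) pb] N.presents_leS[OF u(3) p'(2)] z N.appM[OF g] N.X.K_D uK[OF pb] uK[OF p'(2)]
              N.B.trans by blast+
          then show ?thesis using Some p' by (auto simp: N_le_def)
        qed
        ultimately have "H W = b" unfolding H_def using someI_ex[of "sel W"] by (metis (mono_tags, lifting))
        then show ?thesis by (simp add: F_def W_def N_le_def)
      qed
      ultimately show ?thesis by blast
    qed
    note ex = this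
    have "N.dens (Suc m)"
    proof (rule N.dens_SucI[OF d])
      fix f g u v assume u: "finite u" "u \<subseteq> N.K m \<times> UNIV" "N.presents m u f"
        and v: "finite v" "v \<subseteq> N.K m \<times> UNIV" "N.presents m v g" and fg: "f = g \<or> False"
      have "N.presents m (u \<union> v) g" using u(3) v(3) fg N.presents_Un by blast
      then obtain F where F: "N.cont m F" "\<forall>(p, b)\<in>u \<union> v. \<forall>y\<in>N.T m. N.fle p y \<longrightarrow> N_le b (F y)"
        using ex[of "u \<union> v" g] u v by auto
      then show "\<exists>F G. N.cont m F \<and> N.cont m G \<and> (\<forall>y\<in>N.T m. N_eq0 (F y) (G y)) \<and>
        (\<forall>(p, b)\<in>u. \<forall>y\<in>N.T m. N.fle p y \<longrightarrow> N_le b (F y)) \<and>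
        (\<forall>(p, b)\<in>v. \<forall>y\<in>N.T m. N.fle p y \<longrightarrow> N_le b (G y))"
        using N.contD[OF F(1)] by (intro exI[of _ F]) auto
    qed
    then show ?thesis unfolding Suc .
  qed
qed

lemma N_conv_ok: "N.conv_ok k"
  by (rule N.conv_okI[OF N_dens])

subsection \<open>The extensional hierarchy\<close>

lemma E_T0: "y \<in> E.T 0 \<longleftrightarrow> (\<exists>\<alpha>\<in>E0. y = Val \<alpha> \<and> \<Inter>\<alpha> = {E_val \<alpha>})"
proof -
  have "y \<in> E.T 0 \<longleftrightarrow> (\<exists>\<alpha>\<in>E0. y = Val \<alpha> \<and> E_eq0 \<alpha> \<alpha>)"
    unfolding tot_def E_dom.simps tot_rel.simps mem_Collect_eq by (metis func.sel(1) imageE imageI)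
  then show ?thesis using E_eq0_iff by simp
qed

text \<open>Ideals without a common bound contain disjoint closed intervals, and a linear function
  separates these.\<close>

lemma E_incompatible:
  assumes a: "\<alpha> \<in> E0" "\<beta> \<in> E0" "\<not> (\<exists>\<gamma>\<in>E0. \<alpha> \<subseteq> \<gamma> \<and> \<beta> \<subseteq> \<gamma>)"
  obtains \<phi> where "continuous_on UNIV \<phi>"
    "\<And>\<gamma>. \<lbrakk>\<Inter>\<gamma> = {E_val \<gamma>}; \<alpha> \<subseteq> \<gamma>\<rbrakk> \<Longrightarrow> \<phi> (E_val \<gamma>) \<ge> (1 :: real)"
    "\<And>\<gamma>. \<lbrakk>\<Inter>\<gamma> = {E_val \<gamma>}; \<beta> \<subseteq> \<gamma>\<rbrakk> \<Longrightarrow> \<phi> (E_val \<gamma>) \<le> 0"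
proof -
  have "\<exists>X\<in>\<alpha>. \<exists>Y\<in>\<beta>. X \<inter> Y = {}"
  proof (rule ccontr)
    assume "\<not> ?thesis"
    then have ne: "X \<inter> Y \<noteq> {}" if "X \<in> \<alpha>" "Y \<in> \<beta>" for X Y using that by blast
    let ?g = "{Z \<in> E_base. \<exists>X\<in>\<alpha>. \<exists>Y\<in>\<beta>. X \<inter> Y \<subseteq> Z}"
    have "?g \<in> E0"
    proof (rule E0I)
      show "UNIV \<in> ?g" using E0_UNIV[OF a(1)] E0_UNIV[OF a(2)] by (auto simp: E_base_def)
      fix Z W assume "Z \<in> ?g" "W \<in> ?g"
      then obtain X Y X' Y' where *: "X \<in> \<alpha>" "Y \<in> \<beta>" "X' \<in> \<alpha>" "Y' \<in> \<beta>" "X \<inter> Y \<subseteq> Z" "X' \<inter> Y' \<subseteq> W"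
        "Z \<in> E_base" "W \<in> E_base" by blast
      then have m: "X \<inter> X' \<in> \<alpha>" "Y \<inter> Y' \<in> \<beta>" using E0_Int a by blast+
      have "Z \<inter> W \<noteq> {}" using ne[OF m] *(5,6) by blast
      then have "Z \<inter> W \<in> E_base" using E_base_Int *(7,8) by blast
      moreover have "(X \<inter> X') \<inter> (Y \<inter> Y') \<subseteq> Z \<inter> W" using *(5,6) by blast
      ultimately show "Z \<inter> W \<in> ?g" using m by blast
    qed blast+
    moreover have "\<alpha> \<subseteq> ?g" "\<beta> \<subseteq> ?g"
      using E0_base[OF a(1)] E0_base[OF a(2)] E0_UNIV[OF a(1)] E0_UNIV[OF a(2)] by blast+
    ultimately show False using a(3) by blast
  qed
  then obtain X Y where XY: "X \<in> \<alpha>" "Y \<in> \<beta>" "X \<inter> Y = {}" by blast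
  then have b: "X \<in> E_base" "Y \<in> E_base" using E0_base a by blast+
  have "X \<noteq> UNIV" "Y \<noteq> UNIV" using XY(3) E_base_ne[OF b(1)] E_base_ne[OF b(2)] by auto
  then obtain p q p' q' where iv: "X = {real_of_rat p..real_of_rat q}" "p \<le> q"
    "Y = {real_of_rat p'..real_of_rat q'}" "p' \<le> q'" using b E_base_interval by metis
  define a1 b1 a2 b2 where ab: "a1 = real_of_rat p" "b1 = real_of_rat q" "a2 = real_of_rat p'" "b2 = real_of_rat q'"
  have le: "a1 \<le> b1" "a2 \<le> b2" using iv by (auto simp: ab of_rat_less_eq)
  have "\<exists>\<phi>. continuous_on UNIV \<phi> \<and> (\<forall>t\<in>X. \<phi> t \<ge> (1 :: real)) \<and> (\<forall>t\<in>Y. \<phi> t \<le> 0)"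
  proof (cases "b1 < a2")
    case True
    then show ?thesis
      by (intro exI[of _ "\<lambda>t. (a2 - t) / (a2 - b1)"])
        (auto simp: iv ab[symmetric] divide_le_0_iff le_divide_eq intro!: continuous_intros)
  next
    case False
    have "max a1 a2 \<notin> X \<inter> Y" using XY(3) by blast
    then have "b2 < a1" using le False by (auto simp: iv ab[symmetric] max_def split: if_splits)
    then show ?thesis
      by (intro exI[of _ "\<lambda>t. (t - b2) / (a1 - b2)"])
        (auto simp: iv ab[symmetric] divide_le_0_iff le_divide_eq intro!: continuous_intros)
  qed
  then obtain \<phi> where \<phi>: "continuous_on UNIV \<phi>" "\<forall>t\<in>X. \<phi> t \<ge> (1 :: real)" "\<forall>t\<in>Y. \<phi> t \<le> 0" by blast
  show thesis by (rule that[OF \<phi>(1)]) (use \<phi>(2,3) XY in blast)+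
qed

text \<open>As in \<open>N_test\<close>, functions are evaluated at a total object above a compact
  witness. The test depends only on the real value found there, which makes it continuous and
  extensional.\<close>

lemma E_test:
  assumes d: "\<And>j. j < k \<Longrightarrow> E.dens j" and pq: "p \<in> E.K k" "q \<in> E.K k"
    "\<not> (\<exists>z\<in>E_dom k. E.fle p z \<and> E.fle q z)"
  shows "\<exists>w. scont (E.conv k) w \<and> (\<forall>y\<in>E.T k. \<forall>z\<in>E.T k. E.eqv k y z \<longrightarrow> w y = w z) \<and>
    (\<forall>y\<in>E.T k. (E.fle p y \<longrightarrow> w y \<ge> 1) \<and> (E.fle q y \<longrightarrow> w y \<le> (0 :: real)))"
proof (cases k)
  case 0
  then obtain a b where ab: "p = Val a" "q = Val b" "a \<in> E0" "b \<in> E0" using pq E_principal_E0 by auto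
  then have "\<not> (\<exists>c\<in>E0. a \<subseteq> c \<and> b \<subseteq> c)" using pq(3) 0 by auto
  then obtain \<phi> where \<phi>: "continuous_on UNIV \<phi>"
    "\<And>c. \<lbrakk>\<Inter>c = {E_val c}; a \<subseteq> c\<rbrakk> \<Longrightarrow> \<phi> (E_val c) \<ge> (1 :: real)"
    "\<And>c. \<lbrakk>\<Inter>c = {E_val c}; b \<subseteq> c\<rbrakk> \<Longrightarrow> \<phi> (E_val c) \<le> 0" using E_incompatible[OF ab(3,4)] by metis
  have "scont (E.conv k) (\<lambda>y. \<phi> (E_val (val y)))"
    unfolding scont_def 0 using continuous_on_tendsto_compose[OF \<phi>(1)] by auto
  then show ?thesis
    using ab 0 \<phi>(2,3) by (intro exI[of _ "\<lambda>y. \<phi> (E_val (val y))"]) (auto simp: E_T0 E_eq0_iff)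
next
  case (Suc m)
  obtain x where x: "x \<in> E.K m" "\<not> (\<exists>z\<in>E0. app p x \<subseteq> z \<and> app q x \<subseteq> z)"
    using E.incompatible_at[of p m q] pq Suc by auto
  obtain y0 where y0: "y0 \<in> E.T m" "E.fle x y0" using d[of m] x(1) Suc unfolding E.dens_def by blast
  have ok: "E.conv_ok m" using d Suc by (intro E.conv_okI) auto
  have le: "app c x \<subseteq> app f y0" if "c \<in> E.K k" "f \<in> E.T k" "E.fle c f" for c f
    using E.le_app[OF that(3)] E.X.K_D E.T_D that x y0 Suc by blast
  have "app p x \<in> E0" "app q x \<in> E0" using E.appB E.X.K_D pq x(1) Suc by blast+
  then obtain \<phi> where \<phi>: "continuous_on UNIV \<phi>"
    "\<And>c. \<lbrakk>\<Inter>c = {E_val c}; app p x \<subseteq> c\<rbrakk> \<Longrightarrow> \<phi> (E_val c) \<ge> (1 :: real)"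
    "\<And>c. \<lbrakk>\<Inter>c = {E_val c}; app q x \<subseteq> c\<rbrakk> \<Longrightarrow> \<phi> (E_val c) \<le> 0" using E_incompatible[OF _ _ x(2)] by metis
  have v: "\<Inter>(app f y0) = {E_val (app f y0)}" if "f \<in> E.T k" for f
    using E.T_appr[of f m y0] y0(1) that Suc E_eq0_iff by blast
  have "scont (E.conv k) (\<lambda>f. \<phi> (E_val (app f y0)))"
    unfolding scont_def
  proof (intro allI impI)
    fix fs f assume "E.conv k fs f"
    then have "(\<lambda>n. E_val (app (fs n) y0)) \<longlonglongrightarrow> E_val (app f y0)"
      using E.conv_app[OF _ E.conv_const[OF ok y0(1)]] Suc by blast
    then show "(\<lambda>n. \<phi> (E_val (app (fs n) y0))) \<longlonglongrightarrow> \<phi> (E_val (app f y0))"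
      using continuous_on_tendsto_compose[OF \<phi>(1)] by simp
  qed
  moreover have "\<phi> (E_val (app f y0)) = \<phi> (E_val (app g y0))" if "E.eqv k f g" for f g
  proof -
    have "E_eq0 (app f y0) (app g y0)"
      using E.eqv_app[OF _ E.T_eqv[OF y0(1)] y0(1) y0(1)] that Suc by blast
    then show ?thesis using E_eq0_iff by simp
  qed
  moreover have "\<phi> (E_val (app f y0)) \<ge> 1" if "f \<in> E.T k" "E.fle p f" for f
    by (rule \<phi>(2)[OF v[OF that(1)] le[OF pq(1) that]])
  moreover have "\<phi> (E_val (app f y0)) \<le> 0" if "f \<in> E.T k" "E.fle q f" for f
    by (rule \<phi>(3)[OF v[OF that(1)] le[OF pq(2) that]])
  ultimately show ?thesis by (intro exI[of _ "\<lambda>f. \<phi> (E_val (app f y0))"]) simp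
qed

lemma E_cont_rep:
  assumes "E.conv_ok k" "scont (E.conv k) g" "\<And>y z. \<lbrakk>y \<in> E.T k; z \<in> E.T k; E.eqv k y z\<rbrakk> \<Longrightarrow> g y = g z"
  shows "E.cont k (\<lambda>y. E_rep (g y))"
  unfolding E.cont_def
  using E_rep_E0 assms(3) E.scv_conv[OF assms(1)] scontD[OF assms(2)] by (auto simp: E_eq0_iff Inter_E_rep)

text \<open>Every step with a bounded interval demands lower and upper bounds for a real function on
  the arguments above \<open>p\<close>. Disjoint intervals occur only for incompatible arguments, so
  \<open>E_test\<close> and \<open>lattice_select\<close> provide the function.\<close>

lemma E_dens: "E.dens k"
proof (induction k rule: less_induct)
  case (less k)
  show ?case
  proof (cases k)
    case 0
    have "\<exists>y\<in>E.T 0. E.fle p y" if p: "p \<in> E.K 0" for p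
    proof -
      obtain X where X: "p = Val (E_principal X)" "X \<in> E_base" using p by auto
      then obtain x where "x \<in> X" using E_base_ne by blast
      then have "X \<in> E_rep x" using X by (simp add: E_rep_def)
      then show ?thesis using X E_principal_le[OF X(2) E_rep_E0] E_rep_E0 Inter_E_rep
        by (intro bexI[of _ "Val (E_rep x)"]) (auto simp: E_T0)
    qed
    then show ?thesis unfolding 0 E.dens_def by blast
  next
    case (Suc m)
    have d: "E.dens m" and dj: "\<And>j. j < m \<Longrightarrow> E.dens j" using less Suc by auto
    have ok: "E.conv_ok m" by (rule E.conv_okI[OF dj])
    have ex: "\<exists>F. E.cont m F \<and> (\<forall>(p, b)\<in>u. \<forall>y\<in>E.T m. E.fle p y \<longrightarrow> b \<subseteq> E_rep (E_val (F y)))"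
      if u: "finite u" "u \<subseteq> E.K m \<times> E_principal ` E_base" "E.presents m u g" for u g
    proof -
      \<comment> \<open>Steps with value given by \<open>UNIV\<close> impose no bound and are left
        out. An interval determines its rational end points, so \<open>I\<close> is finite.\<close>
      define I where "I = {(p, a, b). a \<le> b \<and> (p, E_principal {real_of_rat a..real_of_rat b}) \<in> u}"
      have prc: "E_principal X = E_principal Y \<Longrightarrow> X = Y" if "X \<in> E_base" "Y \<in> E_base" for X Y
        using E_principal_le E_principal_E0 that by (metis E_principal_def mem_Collect_eq order_refl subset_antisym)
      have bs: "{real_of_rat a..real_of_rat b} \<in> E_base" if "a \<le> b" for a b using that by (auto simp: E_base_def)
      have "inj_on (\<lambda>(p, a, b). (p, E_principal {real_of_rat a..real_of_rat b})) I"
      proof (rule inj_onI)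
        fix i j assume ij: "i \<in> I" "j \<in> I" "(\<lambda>(p, a, b). (p, E_principal {real_of_rat a..real_of_rat b})) i =
          (\<lambda>(p, a, b). (p, E_principal {real_of_rat a..real_of_rat b})) j"
        obtain p a b q c e where pq: "i = (p, a, b)" "j = (q, c, e)" by (metis prod_cases3)
        then have *: "a \<le> b" "c \<le> e" "p = q"
          "E_principal {real_of_rat a..real_of_rat b} = E_principal {real_of_rat c..real_of_rat e}"
          using ij by (auto simp: I_def)
        then have "{real_of_rat a..real_of_rat b} = {real_of_rat c..real_of_rat e}" using prc bs by blast
        then have "a = c \<and> b = e" using *(1,2) by (simp add: Icc_eq_Icc of_rat_less_eq)
        then show "i = j" using pq * by simp
      qed
      moreover have "(\<lambda>(p, a, b). (p, E_principal {real_of_rat a..real_of_rat b})) ` I \<subseteq> u"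
        by (auto simp: I_def)
      ultimately have finI: "finite I" using u(1) finite_subset inj_on_finite by metis
      have "\<exists>h. scont (E.conv m) h \<and> (\<forall>y y'. y \<in> E.T m \<and> y' \<in> E.T m \<and> E.eqv m y y' \<longrightarrow> h y = h y') \<and>
        (\<forall>i\<in>I. \<forall>y. y \<in> E.T m \<and> E.fle (fst i) y \<longrightarrow>
          real_of_rat (fst (snd i)) \<le> h y \<and> h y \<le> real_of_rat (snd (snd i)))"
      proof (rule lattice_select[OF finI])
        show "real_of_rat (fst (snd i)) \<le> real_of_rat (snd (snd i))" if "i \<in> I" for i
          using that by (auto simp: I_def of_rat_less_eq)
        fix i j assume ij: "i \<in> I" "j \<in> I" "real_of_rat (snd (snd j)) < real_of_rat (fst (snd i))"
        obtain p a b q c e where pq: "i = (p, a, b)" "j = (q, c, e)" by (metis prod_cases3)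
        let ?X = "{real_of_rat a..real_of_rat b}" and ?Y = "{real_of_rat c..real_of_rat e}"
        have m: "(p, E_principal ?X) \<in> u" "(q, E_principal ?Y) \<in> u" "?X \<in> E_base" "?Y \<in> E_base"
          using ij pq bs by (auto simp: I_def)
        then have K: "p \<in> E.K m" "q \<in> E.K m" using u(2) by auto
        have "\<not> (\<exists>z\<in>E_dom m. E.fle p z \<and> E.fle q z)"
        proof
          assume "\<exists>z\<in>E_dom m. E.fle p z \<and> E.fle q z"
          then obtain z where z: "z \<in> E_dom m" "E.fle p z" "E.fle q z" by blast
          have g: "g \<in> E_dom (Suc m)" using u(3) unfolding E.presents_def by blast
          have "E_principal ?X \<subseteq> app g z" "E_principal ?Y \<subseteq> app g z"
            using E.presents_leS[OF u(3) m(1)] E.presents_leS[OF u(3) m(2)] z E.appM[OF g] E.X.K_D K by blast+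
          then have "?X \<inter> ?Y \<in> app g z"
            using E_principal_le[OF _ E.appB[OF g z(1)]] m(3,4) E0_Int[OF E.appB[OF g z(1)]] by blast
          then have "?X \<inter> ?Y \<noteq> {}" using E0_base[OF E.appB[OF g z(1)]] E_base_ne by blast
          then show False using ij(3) pq by auto
        qed
        then show "\<exists>w. scont (E.conv m) w \<and> (\<forall>y y'. y \<in> E.T m \<and> y' \<in> E.T m \<and> E.eqv m y y' \<longrightarrow> w y = w y') \<and>
          (\<forall>y. y \<in> E.T m \<and> E.fle (fst i) y \<longrightarrow> 1 \<le> w y) \<and>
          (\<forall>y. y \<in> E.T m \<and> E.fle (fst j) y \<longrightarrow> w y \<le> 0)"
          using E_test[OF dj K] pq by auto
      qed
      then obtain h where h: "scont (E.conv m) h" "\<And>y y'. \<lbrakk>y \<in> E.T m; y' \<in> E.T m; E.eqv m y y'\<rbrakk> \<Longrightarrow> h y = h y'"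
        "\<And>p a b y. \<lbrakk>(p, a, b) \<in> I; y \<in> E.T m; E.fle p y\<rbrakk> \<Longrightarrow> real_of_rat a \<le> h y \<and> h y \<le> real_of_rat b"
        by force
      have "b \<subseteq> E_rep (h y)" if pb: "(p, b) \<in> u" and y: "y \<in> E.T m" "E.fle p y" for p b y
      proof -
        obtain X where X: "X \<in> E_base" "b = E_principal X" using pb u(2) by blast
        have "h y \<in> X"
        proof (cases "X = UNIV")
          case False
          then obtain a c where "a \<le> c" "X = {real_of_rat a..real_of_rat c}" using E_base_interval[OF X(1)] by blast
          then show ?thesis using h(3)[of p a c y] y pb X(2) by (auto simp: I_def)
        qed simp
        then show ?thesis using X E_principal_le[OF X(1) E_rep_E0] by (simp add: E_rep_def)
      qed
      then show ?thesis using E_cont_rep[OF ok h(1,2)] by (intro exI[of _ "\<lambda>y. E_rep (h y)"]) auto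
    qed
    have "E.dens (Suc m)"
    proof (rule E.dens_SucI[OF d])
      fix f g u v assume u: "finite u" "u \<subseteq> E.K m \<times> E_principal ` E_base" "E.presents m u f"
        and v: "finite v" "v \<subseteq> E.K m \<times> E_principal ` E_base" "E.presents m v g" and fg: "f = g \<or> False"
      have "E.presents m (u \<union> v) g" using u(3) v(3) fg E.presents_Un by blast
      then obtain F where F: "E.cont m F" "\<forall>(p, b)\<in>u \<union> v. \<forall>y\<in>E.T m. E.fle p y \<longrightarrow> b \<subseteq> E_rep (E_val (F y))"
        using ex[of "u \<union> v" g] u v by auto
      then show "\<exists>F G. E.cont m F \<and> E.cont m G \<and> (\<forall>y\<in>E.T m. E_eq0 (F y) (G y)) \<and>
        (\<forall>(p, b)\<in>u. \<forall>y\<in>E.T m. E.fle p y \<longrightarrow> b \<subseteq> E_rep (E_val (F y))) \<and>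
        (\<forall>(p, b)\<in>v. \<forall>y\<in>E.T m. E.fle p y \<longrightarrow> b \<subseteq> E_rep (E_val (G y)))"
        using E.contD[OF F(1)] by (intro exI[of _ F]) auto
    qed
    then show ?thesis unfolding Suc .
  qed
qed

lemma E_conv_ok: "E.conv_ok k"
  by (rule E.conv_okI[OF E_dens])

section \<open>Real-valued hierarchies\<close>

fun ctf :: "nat \<Rightarrow> real func set"
  and ctf_conv :: "nat \<Rightarrow> (nat \<Rightarrow> real func) \<Rightarrow> real func \<Rightarrow> bool" where
  "ctf 0 = range Val"
| "ctf (Suc k) = lam (ctf k) ` {h. \<forall>cs c. (\<forall>n. cs n \<in> ctf k) \<longrightarrow> c \<in> ctf k \<longrightarrow> ctf_conv k cs c \<longrightarrow>
     (\<lambda>n. h (cs n)) \<longlonglongrightarrow> h c}"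
| "ctf_conv 0 cs c \<longleftrightarrow> (\<lambda>n. val (cs n)) \<longlonglongrightarrow> val c"
| "ctf_conv (Suc k) Fs F \<longleftrightarrow> (\<forall>cs c i. (\<forall>n. cs n \<in> ctf k) \<longrightarrow> c \<in> ctf k \<longrightarrow> ctf_conv k cs c \<longrightarrow>
     filterlim i at_top sequentially \<longrightarrow> (\<lambda>n. app (Fs (i n)) (cs n)) \<longlonglongrightarrow> app F c)"

lemma small_subset: "\<lbrakk>small A; B \<subseteq> A\<rbrakk> \<Longrightarrow> small B"
  unfolding small_def
proof (elim exE)
  fix e :: "nat set \<Rightarrow> _" assume e: "ran e = A" and B: "B \<subseteq> A"
  have "ran (\<lambda>s. if the (e s) \<in> B then e s else None) = B"
  proof
    show "ran (\<lambda>s. if the (e s) \<in> B then e s else None) \<subseteq> B" by (auto simp: ran_def split: if_splits)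
    show "B \<subseteq> ran (\<lambda>s. if the (e s) \<in> B then e s else None)"
    proof
      fix b assume b: "b \<in> B"
      then obtain s where "e s = Some b" using e B unfolding ran_def by blast
      then show "b \<in> ran (\<lambda>s. if the (e s) \<in> B then e s else None)"
        using b by (intro ranI[of _ s]) simp
    qed
  qed
  then show "\<exists>e :: nat set \<Rightarrow> _. ran e = B" by blast
qed

locale real_hier = hier +
  fixes v :: "'a \<Rightarrow> real"
  assumes r_v: "\<lbrakk>x \<in> B; y \<in> B; r x x; r y y\<rbrakk> \<Longrightarrow> r x y \<longleftrightarrow> v x = v y"
    and L_v: "\<lbrakk>L xs x; x \<in> B; r x x; \<And>n. xs n \<in> B; \<And>n. r (xs n) (xs n)\<rbrakk> \<Longrightarrow> (\<lambda>n. v (xs n)) \<longlonglongrightarrow> v x"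
begin

abbreviation rh :: "nat \<Rightarrow> 'a func \<Rightarrow> real func" where "rh \<equiv> rho D r v"

text \<open>Beyond surjectivity and extensionality, convergent sequences must lift: this is what
  allows the continuity of functionals on \<open>ctf k\<close> to be tested on representatives and
  conversely.\<close>

definition char :: "nat \<Rightarrow> bool" where
  "char k \<longleftrightarrow> rh k ` T k = ctf k \<and>
    (\<forall>ys y. conv k ys y \<longrightarrow> ctf_conv k (\<lambda>n. rh k (ys n)) (rh k y)) \<and>
    (\<forall>cs c. (\<forall>n. cs n \<in> ctf k) \<longrightarrow> c \<in> ctf k \<longrightarrow> ctf_conv k cs c \<longrightarrow>
      (\<exists>ys y. conv k ys y \<and> (\<forall>n. rh k (ys n) = cs n) \<and> rh k y = c)) \<and>
    (\<forall>x\<in>T k. \<forall>y\<in>T k. rh k x = rh k y \<longleftrightarrow> eqv k x y)"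

text \<open>Realising one function at a time would identify the sets of functionals but not their
  convergence, on which the next level depends; hence a whole convergent sequence is realised by
  convergent representatives.\<close>

definition param_realizable :: "nat \<Rightarrow> bool" where
  "param_realizable k \<longleftrightarrow> (\<forall>Gs G. (\<forall>n. scont (conv k) (Gs n)) \<longrightarrow> scont (conv k) G \<longrightarrow>
    (\<forall>n. \<forall>y\<in>T k. \<forall>z\<in>T k. eqv k y z \<longrightarrow> Gs n y = Gs n z) \<longrightarrow>
    (\<forall>y\<in>T k. \<forall>z\<in>T k. eqv k y z \<longrightarrow> G y = G z) \<longrightarrow>
    (\<forall>ys y i. conv k ys y \<longrightarrow> filterlim i at_top sequentially \<longrightarrow> (\<lambda>n. Gs (i n) (ys n)) \<longlonglongrightarrow> G y) \<longrightarrow>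
    (\<exists>fs f. conv (Suc k) fs f \<and> (\<forall>n. \<forall>y\<in>T k. v (app (fs n) y) = Gs n y) \<and> (\<forall>y\<in>T k. v (app f y) = G y)))"

lemma rh_ctf: "\<lbrakk>char k; y \<in> T k\<rbrakk> \<Longrightarrow> rh k y \<in> ctf k"
  unfolding char_def by blast

lemma rh_eqv: "\<lbrakk>char k; x \<in> T k; y \<in> T k\<rbrakk> \<Longrightarrow> rh k x = rh k y \<longleftrightarrow> eqv k x y"
  unfolding char_def by blast

lemma rh_conv: "\<lbrakk>char k; conv k ys y\<rbrakk> \<Longrightarrow> ctf_conv k (\<lambda>n. rh k (ys n)) (rh k y)"
  unfolding char_def by blast

lemma rh_conv_ex:
  assumes "char k" "\<And>n. cs n \<in> ctf k" "c \<in> ctf k" "ctf_conv k cs c"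
  obtains ys y where "conv k ys y" "\<And>n. rh k (ys n) = cs n" "rh k y = c"
  using assms unfolding char_def by blast

lemma small_ctf: "char k \<Longrightarrow> small (ctf k)"
  using small_image[OF small_subset[OF X.small_D], of "T k" k "rh k"] T_D unfolding char_def by auto

lemma v_app_eqv: "\<lbrakk>f \<in> T (Suc k); x \<in> T k; y \<in> T k; eqv k x y\<rbrakk> \<Longrightarrow> v (app f x) = v (app f y)"
  using r_v[OF T_appB T_appB T_appr T_appr, of f k x f k y] eqv_app[OF T_eqv, of f k x y] by blast

lemma rh_lam:
  assumes c: "char k" and h: "\<And>y. y \<in> T k \<Longrightarrow> h (rh k y) = v (app f y)"
  shows "rh (Suc k) f = lam (ctf k) h"
proof -
  have "(\<lambda>y. (rh k y, v (app f y))) ` T k = (\<lambda>a. (a, h a)) ` rh k ` T k"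
    unfolding image_image using h by (auto simp: image_iff)
  then show ?thesis using c by (simp add: lam_def char_def)
qed

text \<open>The graph in \<open>rho\<close> is single-valued because arguments with the same image
  are equivalent and receive the same real value; a chosen preimage turns it into a
  function.\<close>

lemma rh_app:
  assumes c: "char k" and f: "f \<in> T (Suc k)" and y: "y \<in> T k"
  shows "app (rh (Suc k) f) (rh k y) = v (app f y)"
proof -
  define h where "h = (\<lambda>c. v (app f (SOME y. y \<in> T k \<and> rh k y = c)))"
  have h: "h (rh k y) = v (app f y)" if y: "y \<in> T k" for y
  proof -
    define z where "z = (SOME z. z \<in> T k \<and> rh k z = rh k y)"
    have z: "z \<in> T k" "rh k z = rh k y" unfolding z_def using someI[of "\<lambda>z. z \<in> T k \<and> rh k z = rh k y" y] y by auto
    then have "eqv k z y" using rh_eqv[OF c z(1) y] by simp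
    then show ?thesis using v_app_eqv[OF f z(1) y] by (simp add: h_def z_def)
  qed
  show ?thesis
    using app_lam[OF small_ctf[OF c] rh_ctf[OF c y], of h] h[OF y] rh_lam[OF c h] by simp
qed

lemma rh_Suc_ctf:
  assumes ok: "conv_ok k" and c: "char k" and f: "f \<in> T (Suc k)"
  shows "rh (Suc k) f \<in> ctf (Suc k)"
proof -
  define h where "h = app (rh (Suc k) f)"
  have h: "h (rh k y) = v (app f y)" if "y \<in> T k" for y using rh_app[OF c f that] by (simp add: h_def)
  have "(\<lambda>n. h (cs n)) \<longlonglongrightarrow> h d" if cs: "\<And>n. cs n \<in> ctf k" "d \<in> ctf k" "ctf_conv k cs d" for cs d
  proof -
    obtain ys y where y: "conv k ys y" "\<And>n. rh k (ys n) = cs n" "rh k y = d"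
      using rh_conv_ex[OF c cs] by blast
    have t: "y \<in> T k" "\<And>n. ys n \<in> T k" using conv_T[OF y(1)] by auto
    have "L (\<lambda>n. app f (ys n)) (app f y)" using conv_app[OF conv_const_Suc[OF ok f] y(1)] .
    then have "(\<lambda>n. v (app f (ys n))) \<longlonglongrightarrow> v (app f y)" by (rule L_v) (use T_appB T_appr f t in blast)+
    then show ?thesis using h[OF t(1)] h[OF t(2)] y(2,3) by simp
  qed
  then show ?thesis using rh_lam[OF c h] by simp
qed

text \<open>Functionals on \<open>ctf k\<close> are pulled back along \<open>rho\<close> to
  extensional continuous functions on total objects and realised there.\<close>

lemma ctf_realize:
  assumes c: "char k" and p: "param_realizable k" and F: "\<And>n. Fs n \<in> ctf (Suc k)" "F \<in> ctf (Suc k)" "ctf_conv (Suc k) Fs F"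
  obtains fs f where "conv (Suc k) fs f" "\<And>n. rh (Suc k) (fs n) = Fs n" "rh (Suc k) f = F"
proof -
  have sc: "scont (conv k) (\<lambda>y. app G (rh k y))" if G: "G \<in> ctf (Suc k)" for G
    unfolding scont_def
  proof (intro allI impI)
    fix ys y assume y: "conv k ys y"
    obtain h where h: "G = lam (ctf k) h" "\<And>cs c. \<lbrakk>\<And>n. cs n \<in> ctf k; c \<in> ctf k; ctf_conv k cs c\<rbrakk> \<Longrightarrow> (\<lambda>n. h (cs n)) \<longlonglongrightarrow> h c"
      using G by auto
    have m: "rh k y \<in> ctf k" "\<And>n. rh k (ys n) \<in> ctf k" using rh_ctf[OF c] conv_T[OF y] by blast+
    then show "(\<lambda>n. app G (rh k (ys n))) \<longlonglongrightarrow> app G (rh k y)"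
      using h(2)[OF m(2,1) rh_conv[OF c y]] by (simp add: h(1) app_lam[OF small_ctf[OF c]])
  qed
  have lim: "(\<lambda>n. app (Fs (i n)) (rh k (ys n))) \<longlonglongrightarrow> app F (rh k y)"
    if y: "conv k ys y" and i: "filterlim i at_top sequentially" for ys y i
    using F(3) rh_ctf[OF c] conv_T[OF y] rh_conv[OF c y] i by auto
  have inv: "app G (rh k y) = app G (rh k z)" if "y \<in> T k" "z \<in> T k" "eqv k y z" for G y z
    using rh_eqv[OF c that(1,2)] that(3) by simp
  obtain fs f where fs: "conv (Suc k) fs f" "\<And>n y. y \<in> T k \<Longrightarrow> v (app (fs n) y) = app (Fs n) (rh k y)"
      "\<And>y. y \<in> T k \<Longrightarrow> v (app f y) = app F (rh k y)"
    using p[unfolded param_realizable_def, rule_format, of "\<lambda>n y. app (Fs n) (rh k y)" "\<lambda>y. app F (rh k y)"]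
      sc[OF F(1)] sc[OF F(2)] inv lim by blast
  have eq: "rh (Suc k) g = G" if g: "\<And>y. y \<in> T k \<Longrightarrow> v (app g y) = app G (rh k y)" and G: "G \<in> ctf (Suc k)" for g G
  proof -
    obtain h where h: "G = lam (ctf k) h" using G by auto
    have "h (rh k y) = v (app g y)" if "y \<in> T k" for y
      using g[OF that] app_lam[OF small_ctf[OF c] rh_ctf[OF c that]] h by simp
    then show ?thesis using rh_lam[OF c] h by blast
  qed
  show thesis using that[OF fs(1)] eq[OF fs(2) F(1)] eq[OF fs(3) F(2)] by blast
qed

text \<open>All assumptions are about level \<open>k\<close>, so that separation at level
  \<open>n\<close> determines the functionals of level \<open>n + 1\<close>. Surjectivity applies
  \<open>ctf_realize\<close> to constant sequences.\<close>

lemma rh_image: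
  assumes ok: "conv_ok k" and c: "char k" and p: "param_realizable k"
  shows "rh (Suc k) ` T (Suc k) = ctf (Suc k)"
proof
  show "rh (Suc k) ` T (Suc k) \<subseteq> ctf (Suc k)" using rh_Suc_ctf[OF ok c] by blast
  show "ctf (Suc k) \<subseteq> rh (Suc k) ` T (Suc k)"
  proof
    fix F assume F: "F \<in> ctf (Suc k)"
    obtain h where h: "F = lam (ctf k) h" "\<And>cs c. \<lbrakk>\<And>n. cs n \<in> ctf k; c \<in> ctf k; ctf_conv k cs c\<rbrakk> \<Longrightarrow> (\<lambda>n. h (cs n)) \<longlonglongrightarrow> h c"
      using F by auto
    have "ctf_conv (Suc k) (\<lambda>_. F) F" using h app_lam[OF small_ctf[OF c]] by simp
    then obtain fs f where "conv (Suc k) fs f" "rh (Suc k) f = F"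
      by (rule ctf_realize[OF c p F F])
    then show "F \<in> rh (Suc k) ` T (Suc k)" using conv_T by blast
  qed
qed

lemma char_Suc:
  assumes ok: "conv_ok k" and c: "char k" and p: "param_realizable k"
  shows "char (Suc k)"
  unfolding char_def
proof (intro conjI allI impI ballI)
  show "rh (Suc k) ` T (Suc k) = ctf (Suc k)" by (rule rh_image[OF assms])
  show "ctf_conv (Suc k) (\<lambda>n. rh (Suc k) (fs n)) (rh (Suc k) f)" if f: "conv (Suc k) fs f" for fs f
    unfolding ctf_conv.simps
  proof (intro allI impI)
    fix cs d i assume cs: "\<forall>n. cs n \<in> ctf k" "d \<in> ctf k" "ctf_conv k cs d"
      and i: "filterlim (i :: nat \<Rightarrow> nat) at_top sequentially"
    obtain ys y where y: "conv k ys y" "\<And>n. rh k (ys n) = cs n" "rh k y = d"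
      using rh_conv_ex[OF c _ cs(2,3)] cs(1) by blast
    have t: "y \<in> T k" "\<And>n. ys n \<in> T k" "f \<in> T (Suc k)" "\<And>n. fs n \<in> T (Suc k)"
      using conv_T[OF y(1)] conv_T[OF f] by auto
    have "L (\<lambda>n. app (fs (i n)) (ys n)) (app f y)" using f y(1) i by simp
    then have "(\<lambda>n. v (app (fs (i n)) (ys n))) \<longlonglongrightarrow> v (app f y)" by (rule L_v) (use T_appB T_appr t in blast)+
    then show "(\<lambda>n. app (rh (Suc k) (fs (i n))) (cs n)) \<longlonglongrightarrow> app (rh (Suc k) f) d"
      using rh_app[OF c t(3,1)] rh_app[OF c t(4,2)] y(2,3) by simp
  qed
  show "\<exists>fs f. conv (Suc k) fs f \<and> (\<forall>n. rh (Suc k) (fs n) = Fs n) \<and> rh (Suc k) f = F"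
    if "\<forall>n. Fs n \<in> ctf (Suc k)" "F \<in> ctf (Suc k)" "ctf_conv (Suc k) Fs F" for Fs F
  proof -
    show ?thesis by (rule ctf_realize[OF c p, of Fs F]) (use that in blast)+
  qed
  show "rh (Suc k) f = rh (Suc k) g \<longleftrightarrow> eqv (Suc k) f g" if f: "f \<in> T (Suc k)" and g: "g \<in> T (Suc k)" for f g
  proof
    assume eq: "rh (Suc k) f = rh (Suc k) g"
    show "eqv (Suc k) f g"
    proof (rule eqvI[OF f g])
      fix y assume y: "y \<in> T k"
      have "v (app f y) = v (app g y)" using rh_app[OF c f y] rh_app[OF c g y] eq by simp
      then show "r (app f y) (app g y)" using r_v T_appB T_appr f g y by blast
    qed
  next
    assume eq: "eqv (Suc k) f g"
    have "v (app f y) = v (app g y)" if y: "y \<in> T k" for y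
      using eqv_app[OF eq T_eqv[OF y] y y] r_v T_appB T_appr f g y by blast
    then have "(\<lambda>y. (rh k y, v (app f y))) ` T k = (\<lambda>y. (rh k y, v (app g y))) ` T k" by (auto simp: image_iff)
    then show "rh (Suc k) f = rh (Suc k) g" by simp
  qed
qed

end

interpretation ER: real_hier E0 "(\<subseteq>)" "E_principal ` E_base" E_dom "\<lambda>_ _. True" "\<lambda>_ _ _. False" E_eq0
  "\<lambda>xs x. (\<lambda>n. E_val (xs n)) \<longlonglongrightarrow> E_val x" "\<lambda>x. E_rep (E_val x)" "\<lambda>x. E_low (E_val x)" E_val
  by unfold_locales (auto simp: E_eq0_iff)

text \<open>No choice of digits is involved: the ideal of all intervals around a value represents it
  and depends on the value alone.\<close>

lemma E_param: "ER.param_realizable k"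
  unfolding ER.param_realizable_def
proof (intro allI impI)
  fix Gs :: "nat \<Rightarrow> _" and G assume Gs: "\<forall>n. scont (E.conv k) (Gs n)" and G: "scont (E.conv k) G"
    and inv: "\<forall>n. \<forall>y\<in>E.T k. \<forall>z\<in>E.T k. E.eqv k y z \<longrightarrow> Gs n y = Gs n z"
      "\<forall>y\<in>E.T k. \<forall>z\<in>E.T k. E.eqv k y z \<longrightarrow> G y = G z"
    and lim: "\<forall>ys y i. E.conv k ys y \<longrightarrow> filterlim i at_top sequentially \<longrightarrow> (\<lambda>n. Gs (i n) (ys n)) \<longlonglongrightarrow> G y"
  have cs: "E.cont k (\<lambda>y. E_rep (Gs n y))" for n
    using E_cont_rep[OF E_conv_ok, of k "Gs n"] Gs inv(1) by blast
  have c: "E.cont k (\<lambda>y. E_rep (G y))"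
    using E_cont_rep[OF E_conv_ok, of k G] G inv(2) by blast
  have l: "(\<lambda>n. E_val (E_rep (Gs (i n) (ys n)))) \<longlonglongrightarrow> E_val (E_rep (G y))"
    if "y \<in> E.T k" "\<And>n. ys n \<in> E.T k" "E.scv k ys y" "filterlim i at_top sequentially" for ys y i
    using lim E.scv_conv[OF E_conv_ok that(1-3)] that(4) by simp
  obtain fs f where f: "\<And>n. fs n \<in> E.T (Suc k)" "f \<in> E.T (Suc k)" "E.scv (Suc k) fs f"
    "\<And>n y. y \<in> E.T k \<Longrightarrow> E_eq0 (app (fs n) y) (E_rep (Gs n y))"
    "\<And>y. y \<in> E.T k \<Longrightarrow> E_eq0 (app f y) (E_rep (G y))"
    by (rule E.realize[OF E_dens cs c l]) (assumption | rule that)+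
  have "E.conv (Suc k) fs f" by (rule E.scv_conv[OF E_conv_ok f(2,1,3)])
  moreover have "\<forall>n. \<forall>y\<in>E.T k. E_val (app (fs n) y) = Gs n y" "\<forall>y\<in>E.T k. E_val (app f y) = G y"
    using f(4,5) by (auto simp: E_eq0_iff)
  ultimately show "\<exists>fs f. E.conv (Suc k) fs f \<and> (\<forall>n. \<forall>y\<in>E.T k. E_val (app (fs n) y) = Gs n y) \<and>
      (\<forall>y\<in>E.T k. E_val (app f y) = G y)" by blast
qed

lemma E_char: "ER.char k"
proof (induction k)
  case 0
  have T0: "Val (E_rep x) \<in> E.T 0" for x
    unfolding E_T0 using E_rep_E0 Inter_E_rep by (intro bexI[of _ "E_rep x"]) auto
  have rep: "\<exists>ys y. E.conv 0 ys y \<and> (\<forall>n. rho_E 0 (ys n) = cs n) \<and> rho_E 0 y = c"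
    if "\<forall>n. cs n \<in> range Val" "c \<in> range Val" "(\<lambda>n. val (cs n)) \<longlonglongrightarrow> val c" for cs c
    using that T0
    by (intro exI[of _ "\<lambda>n. Val (E_rep (val (cs n)))"] exI[of _ "Val (E_rep (val c))"]) (auto simp: image_iff; metis func.sel(1))
  show ?case
    unfolding ER.char_def
  proof (intro conjI allI impI ballI)
    show "rho_E 0 ` E.T 0 = ctf 0"
    proof
      show "ctf 0 \<subseteq> rho_E 0 ` E.T 0"
      proof
        fix c assume "c \<in> ctf 0"
        then obtain x where "c = Val x" by auto
        then show "c \<in> rho_E 0 ` E.T 0" using T0[of x] by (auto intro!: image_eqI[of _ _ "Val (E_rep x)"])
      qed
    qed auto
    show "rho_E 0 x = rho_E 0 y \<longleftrightarrow> E.eqv 0 x y" if "x \<in> E.T 0" "y \<in> E.T 0" for x y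
      using ER.r_v[of "val x" "val y"] that by (auto simp: tot_def)
  qed (use rep in auto)
next
  case (Suc k)
  then show "ER.char (Suc k)" by (rule ER.char_Suc[OF E_conv_ok _ E_param])
qed

lemma CtE_Suc: "CtE (Suc k) = ctf (Suc k)"
  unfolding CtE.simps by (rule ER.rh_image[OF E_conv_ok E_char E_param])

section \<open>Separation for the Kleene-Kreisel functionals\<close>

context hier
begin

text \<open>The chain of compact elements below \<open>y\<close> acts as a countable neighbourhood
  base. A total object above each of its members but outside \<open>u\<close> would give a sequence
  converging to \<open>y\<close>.\<close>

lemma compact_nbhd:
  assumes ok: "conv_ok k" and u: "\<And>ys. conv k ys y \<Longrightarrow> \<forall>\<^sub>F n in sequentially. u (ys n)" and y: "y \<in> T k"
  shows "\<exists>p\<in>K k. p \<sqsubseteq> y \<and> (\<forall>z\<in>T k. p \<sqsubseteq> z \<longrightarrow> u z)"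
proof (rule ccontr)
  assume "\<not> ?thesis"
  then have neg: "\<exists>z\<in>T k. p \<sqsubseteq> z \<and> \<not> u z" if "p \<in> K k" "p \<sqsubseteq> y" for p using that by blast
  obtain c :: "nat \<Rightarrow> _" where c: "\<And>n. c n \<in> K k" "\<And>n. c n \<sqsubseteq> y"
    "\<And>p. \<lbrakk>p \<in> K k; p \<sqsubseteq> y\<rbrakk> \<Longrightarrow> \<exists>m. \<forall>n\<ge>m. p \<sqsubseteq> c n"
    using X.chain_ex[OF T_D[OF y]] by metis
  obtain z where z: "\<And>n. z n \<in> T k" "\<And>n. c n \<sqsubseteq> z n" "\<And>n. \<not> u (z n)"
    using neg[OF c(1,2)] by metis
  have "scv k z y"
    unfolding scv_def
  proof (intro conjI allI ballI impI)
    fix p assume p: "p \<in> K k" "p \<sqsubseteq> y"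
    then obtain m where m: "\<forall>n\<ge>m. p \<sqsubseteq> c n" using c(3) by blast
    have "p \<sqsubseteq> z n" if "n \<ge> m" for n
      using X.transK[OF _ z(2) p(1)] m that X.K_D[OF c(1)] T_D[OF z(1)] by blast
    then show "\<forall>\<^sub>F n in sequentially. p \<sqsubseteq> z n" unfolding eventually_sequentially by blast
  qed (use y z T_D in auto)
  then have "conv k z y" by (rule scv_conv[OF ok y z(1)])
  then have "\<forall>\<^sub>F n in sequentially. u (z n)" by (rule u)
  then show False using z(3) by simp
qed

text \<open>Each member of the family is a union of neighbourhoods given by compact elements, of
  which there are only countably many; one member is chosen for each of them.\<close>

lemma lindelof:
  assumes ok: "conv_ok k" and ne: "\<U> \<noteq> {}"
    and u: "\<And>u ys y. \<lbrakk>u \<in> \<U>; conv k ys y; u y\<rbrakk> \<Longrightarrow> \<forall>\<^sub>F n in sequentially. u (ys n)"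
  obtains e :: "nat \<Rightarrow> 'b func \<Rightarrow> bool" where "\<And>i. e i \<in> \<U>" "\<And>u y. \<lbrakk>u \<in> \<U>; y \<in> T k; u y\<rbrakk> \<Longrightarrow> \<exists>i. e i y"
proof -
  define ch where "ch = (\<lambda>p. SOME u. u \<in> \<U> \<and> (\<forall>z\<in>T k. p \<sqsubseteq> z \<longrightarrow> u z))"
  define P where "P = {p \<in> K k. \<exists>u\<in>\<U>. \<forall>z\<in>T k. p \<sqsubseteq> z \<longrightarrow> u z}"
  have ch: "ch p \<in> \<U>" "\<And>z. \<lbrakk>z \<in> T k; p \<sqsubseteq> z\<rbrakk> \<Longrightarrow> ch p z" if "p \<in> P" for p
    using someI_ex[of "\<lambda>u. u \<in> \<U> \<and> (\<forall>z\<in>T k. p \<sqsubseteq> z \<longrightarrow> u z)"] that unfolding ch_def P_def by blast+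
  have cov: "\<exists>p\<in>P. ch p y" if "u \<in> \<U>" "y \<in> T k" "u y" for u y
  proof -
    have "\<exists>p\<in>K k. p \<sqsubseteq> y \<and> (\<forall>z\<in>T k. p \<sqsubseteq> z \<longrightarrow> u z)"
      by (rule compact_nbhd[OF ok _ that(2)]) (rule u[OF that(1) _ that(3)])
    then obtain p where p: "p \<in> K k" "p \<sqsubseteq> y" "\<forall>z\<in>T k. p \<sqsubseteq> z \<longrightarrow> u z" by blast
    then have "p \<in> P" using that(1) unfolding P_def by blast
    then show ?thesis using ch(2)[OF _ that(2) p(2)] by blast
  qed
  show thesis
  proof (cases "P = {}")
    case True
    obtain u where "u \<in> \<U>" using ne by blast
    then show thesis using that[of "\<lambda>_. u"] cov True by blast
  next
    case False
    have "countable P" unfolding P_def using X.countable_K by (auto intro: countable_subset)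
    then have r: "range (from_nat_into P) = P" using range_from_nat_into[OF False] by blast
    then have "\<exists>i. ch (from_nat_into P i) y" if "u \<in> \<U>" "y \<in> T k" "u y" for u y
      using cov[OF that] by (metis rangeE)
    then show thesis using that[of "\<lambda>i. ch (from_nat_into P i)"] ch(1) from_nat_into[OF False] by blast
  qed
qed

end

section \<open>The quotient topology and its functionally open sets\<close>

lemma openin_quotient_topology:
  assumes "equiv (topspace T) r"
  shows "openin (quotient_topology T r) U \<longleftrightarrow> U \<subseteq> topspace T // r \<and> openin T (\<Union>U)"
proof -
  have "istopology (\<lambda>U. U \<subseteq> topspace T // r \<and> openin T (\<Union>U))"
    unfolding istopology_def
  proof (intro conjI allI impI; (elim conjE)?)
    fix U V assume UV: "U \<subseteq> topspace T // r" "V \<subseteq> topspace T // r" "openin T (\<Union>U)" "openin T (\<Union>V)"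
    have "\<Union>(U \<inter> V) = \<Union>U \<inter> \<Union>V"
    proof
      show "\<Union>U \<inter> \<Union>V \<subseteq> \<Union>(U \<inter> V)"
      proof
        fix x assume "x \<in> \<Union>U \<inter> \<Union>V"
        then obtain A C where *: "A \<in> U" "C \<in> V" "x \<in> A" "x \<in> C" by blast
        then have "A = C" using quotient_disj[OF assms] UV(1,2) by blast
        then show "x \<in> \<Union>(U \<inter> V)" using * by blast
      qed
    qed auto
    then show "openin T (\<Union>(U \<inter> V))" using UV by auto
  next
    fix \<K> assume K: "\<forall>U\<in>\<K>. U \<subseteq> topspace T // r \<and> openin T (\<Union>U)"
    have "\<Union>(\<Union>\<K>) = (\<Union>U\<in>\<K>. \<Union>U)" by auto
    then show "openin T (\<Union>(\<Union>\<K>))" using K by auto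
  qed auto
  then show ?thesis by (simp add: quotient_topology_def topology_inverse')
qed

context
  fixes k :: nat
begin

definition N_class :: "nat option func \<Rightarrow> nat option func set" where
  "N_class y = {z \<in> N_bar k. N_eq k y z}"

lemma N_class_eq: "\<lbrakk>x \<in> N_bar k; y \<in> N_bar k\<rbrakk> \<Longrightarrow> N_class x = N_class y \<longleftrightarrow> N_eq k x y"
proof
  assume *: "x \<in> N_bar k" "y \<in> N_bar k" "N_class x = N_class y"
  then have "y \<in> N_class x" using N.T_eqv by (simp add: N_class_def)
  then show "N_eq k x y" by (simp add: N_class_def)
next
  assume "x \<in> N_bar k" "y \<in> N_bar k" "N_eq k x y"
  then show "N_class x = N_class y"
    unfolding N_class_def using N.eqv_trans[of k x y] N.eqv_trans[OF N.eqv_sym, of k x y] by blast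
qed

lemma N_class_self: "y \<in> N_bar k \<Longrightarrow> y \<in> N_class y"
  using N.T_eqv by (simp add: N_class_def)

lemma topspace_N_sub: "topspace (subtopology (scott (N_dom k) (func_le N_le)) (N_bar k)) = N_bar k"
  using N.T_D by auto

lemma openin_CtN: "openin (CtN k) U \<longleftrightarrow> U \<subseteq> N_class ` N_bar k \<and>
    openin (subtopology (scott (N_dom k) (func_le N_le)) (N_bar k)) (\<Union>U)"
proof -
  let ?r = "{(x, y). x \<in> N_bar k \<and> y \<in> N_bar k \<and> N_eq k x y}"
  have "equiv (N_bar k) ?r"
    unfolding equiv_def refl_on_def sym_def trans_def
    using N.T_eqv N.eqv_sym N.eqv_trans by blast
  moreover have "N_bar k // ?r = N_class ` N_bar k"
    by (auto simp: quotient_def N_class_def image_iff intro!: bexI)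
  ultimately show ?thesis
    unfolding CtN_def using openin_quotient_topology[of "subtopology (scott (N_dom k) (func_le N_le)) (N_bar k)" ?r]
      topspace_N_sub by simp
qed

lemma topspace_CtN: "topspace (CtN k) = N_class ` N_bar k"
proof -
  have "\<Union>(N_class ` N_bar k) = N_bar k" using N_class_self by (auto simp: N_class_def)
  then have "openin (CtN k) (N_class ` N_bar k)"
    unfolding openin_CtN using openin_topspace topspace_N_sub by (metis order_refl)
  then show ?thesis using openin_CtN by (metis openin_subset openin_topspace subset_antisym)
qed

lemma scont_N_eqv:
  assumes "scont (N.conv k) g" "x \<in> N_bar k" "y \<in> N_bar k" "N_eq k x y"
  shows "g x = g y"
  using scontD[OF assms(1), OF N_eqv_conv[OF N_conv_ok assms(4,2,3)]] by (simp add: LIMSEQ_const_iff)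

text \<open>A continuously convergent sequence has equivalent representatives that converge in the
  Scott topology, which quotient-open sets detect. Conversely \<open>compact_nbhd\<close> exhibits
  preimages of open sets as traces of Scott-open sets.\<close>

lemma continuous_CtN_iff: "continuous_map (CtN k) euclideanreal f \<longleftrightarrow> scont (N.conv k) (\<lambda>y. f (N_class y))"
proof
  assume f: "continuous_map (CtN k) euclideanreal f"
  show "scont (N.conv k) (\<lambda>y. f (N_class y))"
    unfolding scont_def
  proof (intro allI impI topological_tendstoI)
    fix ys y and S :: "real set" assume y: "N.conv k ys y" and S: "open S" "f (N_class y) \<in> S"
    have t: "y \<in> N_bar k" "\<And>n. ys n \<in> N_bar k" using N.conv_T[OF y] by auto
    obtain ys' y' where y': "y' \<in> N_bar k" "\<And>n. ys' n \<in> N_bar k" "N.scv k ys' y'"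
      "\<And>n. N.joinable k (ys n) (ys' n)" "N.joinable k y y'"
      by (rule N.conv_scv[OF N_conv_ok y], rule that)
    have eq: "N_class y = N_class y'" "\<And>n. N_class (ys n) = N_class (ys' n)"
      using N_class_eq N.joinable_eqv y' t by blast+
    let ?U = "{c \<in> topspace (CtN k). f c \<in> S}"
    have "openin (CtN k) ?U" using f S(1) unfolding continuous_map_def by simp
    then obtain V where V: "scott_open (N_dom k) (func_le N_le) V" "\<Union>?U = V \<inter> N_bar k"
      unfolding openin_CtN by (auto simp: openin_subtopology)
    have cl: "z \<in> \<Union>?U \<longleftrightarrow> f (N_class z) \<in> S" if z: "z \<in> N_bar k" for z
    proof
      assume "f (N_class z) \<in> S"
      then have "N_class z \<in> ?U" using z topspace_CtN by blast
      moreover have "z \<in> N_class z" using z N_class_self by blast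
      ultimately show "z \<in> \<Union>?U" by blast
    next
      assume "z \<in> \<Union>?U"
      then obtain c where "c \<in> ?U" "z \<in> c" by blast
      then obtain w where w: "w \<in> N_bar k" "c = N_class w" using topspace_CtN by auto
      then have "N_class w = N_class z" using N_class_eq[OF w(1) z] \<open>z \<in> c\<close> by (simp add: N_class_def)
      then show "f (N_class z) \<in> S" using \<open>c \<in> ?U\<close> w by simp
    qed
    have y'V: "y' \<in> V" using cl[OF y'(1)] S(2) eq(1) V(2) by auto
    have "{p \<in> N.K k. N.fle p y'} \<inter> V \<noteq> {}"
      using V(1) y'V N.X.below_directed[OF N.T_D[OF y'(1)]] N.X.below_lub[OF N.T_D[OF y'(1)]] N.X.K_sub[of k]
      unfolding scott_open_def by (metis (no_types, lifting) mem_Collect_eq subset_eq)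
    then obtain p where p: "p \<in> N.K k" "N.fle p y'" "p \<in> V" by blast
    have "\<forall>\<^sub>F n in sequentially. N.fle p (ys' n)" using y'(3) p unfolding N.scv_def by blast
    then show "\<forall>\<^sub>F n in sequentially. f (N_class (ys n)) \<in> S"
    proof eventually_elim
      case (elim n)
      then have "ys' n \<in> V" using V(1) p(3) N.T_D[OF y'(2)] unfolding scott_open_def by blast
      then show ?case using cl[OF y'(2)] V(2) y'(2) eq(2) by auto
    qed
  qed
next
  assume f: "scont (N.conv k) (\<lambda>y. f (N_class y))"
  show "continuous_map (CtN k) euclideanreal f"
    unfolding continuous_map_def
  proof (intro conjI allI impI)
    fix S :: "real set" assume "openin euclidean S"
    then have S: "open S" by simp
    let ?U = "{c \<in> topspace (CtN k). f c \<in> S}"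
    \<comment> \<open>An open set of the whole domain, partial elements included: whatever lies
      above a compact element all of whose total extensions have values in \<open>S\<close>.\<close>
    let ?V = "{x \<in> N_dom k. \<exists>p\<in>N.K k. N.fle p x \<and> (\<forall>z\<in>N_bar k. N.fle p z \<longrightarrow> f (N_class z) \<in> S)}"
    have "\<Union>?U = {z \<in> N_bar k. f (N_class z) \<in> S}"
    proof
      show "{z \<in> N_bar k. f (N_class z) \<in> S} \<subseteq> \<Union>?U"
      proof clarify
        fix z assume z: "z \<in> N_bar k" "f (N_class z) \<in> S"
        then have "N_class z \<in> ?U" "z \<in> N_class z" using topspace_CtN N_class_self by blast+
        then show "z \<in> \<Union>?U" by blast
      qed
      show "\<Union>?U \<subseteq> {z \<in> N_bar k. f (N_class z) \<in> S}"
      proof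
        fix z assume "z \<in> \<Union>?U"
        then obtain c where c: "c \<in> ?U" "z \<in> c" by blast
        then obtain w where w: "w \<in> N_bar k" "c = N_class w" using topspace_CtN by auto
        then have z: "z \<in> N_bar k" using c(2) by (simp add: N_class_def)
        then have "N_class w = N_class z" using N_class_eq[OF w(1) z] c(2) w by (simp add: N_class_def)
        then show "z \<in> {z \<in> N_bar k. f (N_class z) \<in> S}" using c(1) w z by simp
      qed
    qed
    also have "\<dots> = ?V \<inter> N_bar k"
    proof -
      have "\<exists>p\<in>N.K k. N.fle p z \<and> (\<forall>z\<in>N_bar k. N.fle p z \<longrightarrow> f (N_class z) \<in> S)"
        if z: "z \<in> N_bar k" "f (N_class z) \<in> S" for z
        by (rule N.compact_nbhd[OF N_conv_ok _ z(1)]) (use scontD[OF f] topological_tendstoD S z(2) in blast)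
      then show ?thesis using N.T_D by blast
    qed
    finally have eq: "\<Union>?U = ?V \<inter> N_bar k" .
    have "scott_open (N_dom k) (func_le N_le) ?V"
      unfolding scott_open_def
    proof (intro conjI allI impI ballI)
      fix x y assume "x \<in> ?V" "y \<in> N_dom k" "N.fle x y"
      then show "y \<in> ?V" using N.X.transK[of _ x y k] by blast
    next
      fix X s assume A: "X \<subseteq> N_dom k \<and> directed (func_le N_le) X \<and> is_lub (N_dom k) (func_le N_le) X s \<and> s \<in> ?V"
      then obtain p where p: "p \<in> N.K k" "N.fle p s" "\<forall>z\<in>N_bar k. N.fle p z \<longrightarrow> f (N_class z) \<in> S" by blast
      then obtain x where "x \<in> X" "N.fle p x" using N.X.compact_lub[of X k s p] A by blast
      then show "X \<inter> ?V \<noteq> {}" using p A by blast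
    qed blast
    then have "openin (subtopology (scott (N_dom k) (func_le N_le)) (N_bar k)) (\<Union>?U)"
      unfolding eq openin_subtopology openin_scott by blast
    moreover have "?U \<subseteq> N_class ` N_bar k" using topspace_CtN by blast
    ultimately show "openin (CtN k) ?U" unfolding openin_CtN by blast
  qed auto
qed

text \<open>For nonnegative \<open>g\<close>, the cozero set of \<open>g\<close> in the
  quotient.\<close>

definition N_pos :: "(nat option func \<Rightarrow> real) \<Rightarrow> nat option func set set" where
  "N_pos g = N_class ` {y \<in> N_bar k. g y > 0}"

lemma N_pos_iff: "\<lbrakk>scont (N.conv k) g; y \<in> N_bar k\<rbrakk> \<Longrightarrow> N_class y \<in> N_pos g \<longleftrightarrow> g y > 0"
proof
  assume g: "scont (N.conv k) g" and y: "y \<in> N_bar k" and "N_class y \<in> N_pos g"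
  then obtain z where z: "z \<in> N_bar k" "g z > 0" "N_class y = N_class z" unfolding N_pos_def by blast
  then have "N_eq k y z" using N_class_eq[OF y z(1)] by blast
  then show "g y > 0" using scont_N_eqv[OF g y z(1)] z(2) by simp
qed (auto simp: N_pos_def)

text \<open>An open set of reals is the set where the distance to its complement is positive, so
  preimages of open sets are exactly the cozero sets.\<close>

lemma preimage_open_CtN: "preimage_open (CtN k) U \<longleftrightarrow> (\<exists>g. scont (N.conv k) g \<and> (\<forall>y. 0 \<le> g y) \<and> U = N_pos g)"
proof
  assume "preimage_open (CtN k) U"
  then obtain f S where f: "scont (N.conv k) (\<lambda>y. f (N_class y))" "open S" "U = {x \<in> topspace (CtN k). f x \<in> S}"
    unfolding preimage_open_def continuous_CtN_iff by blast
  \<comment> \<open>\<open>infdist\<close> to the empty set is 0, so the whole line needs its own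
    case.\<close>
  define \<phi> where "\<phi> = (\<lambda>t. if S = UNIV then 1 else infdist t (- S))"
  have "continuous_on UNIV (\<lambda>t. infdist t (- S))" by (intro continuous_on_infdist continuous_on_id)
  then have \<phi>: "continuous_on UNIV \<phi>" unfolding \<phi>_def by (cases "S = UNIV") auto
  have "scont (N.conv k) (\<lambda>y. \<phi> (f (N_class y)))"
    unfolding scont_def using continuous_on_tendsto_compose[OF \<phi> scontD[OF f(1)]] by simp
  moreover have \<phi>0: "\<phi> t > 0 \<longleftrightarrow> t \<in> S" for t
  proof (cases "S = UNIV")
    case False
    have "t \<in> - S \<longleftrightarrow> infdist t (- S) = 0"
      by (rule in_closed_iff_infdist_zero) (use f(2) False in auto)
    then show ?thesis using False infdist_nonneg[of t "- S"] by (auto simp: \<phi>_def less_le)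
  qed (simp add: \<phi>_def)
  have "U = N_pos (\<lambda>y. \<phi> (f (N_class y)))"
    unfolding f(3) topspace_CtN N_pos_def \<phi>0 by blast
  moreover have "\<forall>t. 0 \<le> \<phi> t" by (simp add: \<phi>_def infdist_nonneg)
  ultimately show "\<exists>g. scont (N.conv k) g \<and> (\<forall>y. 0 \<le> g y) \<and> U = N_pos g" by blast
next
  assume "\<exists>g. scont (N.conv k) g \<and> (\<forall>y. 0 \<le> g y) \<and> U = N_pos g"
  then obtain g where g: "scont (N.conv k) g" "U = N_pos g" by blast
  define f where "f = (\<lambda>c. g (SOME y. y \<in> N_bar k \<and> N_class y = c))"
  have f: "f (N_class y) = g y" if y: "y \<in> N_bar k" for y
  proof -
    define z where "z = (SOME z. z \<in> N_bar k \<and> N_class z = N_class y)"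
    have z: "z \<in> N_bar k" "N_class z = N_class y"
      unfolding z_def using someI[of "\<lambda>z. z \<in> N_bar k \<and> N_class z = N_class y" y] y by auto
    then show ?thesis using scont_N_eqv[OF g(1) z(1) y] N_class_eq[OF z(1) y] by (simp add: f_def z_def)
  qed
  have "scont (N.conv k) (\<lambda>y. f (N_class y))"
    unfolding scont_def
  proof (intro allI impI)
    fix ys y assume y: "N.conv k ys y"
    note t = N.conv_T[OF y, THEN conjunct1] N.conv_T[OF y, THEN conjunct2]
    show "(\<lambda>n. f (N_class (ys n))) \<longlonglongrightarrow> f (N_class y)"
      unfolding f[OF t(1)] f[OF t(2)] by (rule scontD[OF g(1), OF y])
  qed
  then have "continuous_map (CtN k) euclideanreal f" by (rule continuous_CtN_iff[THEN iffD2])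
  moreover have "U = {x \<in> topspace (CtN k). f x \<in> {0<..}}"
    unfolding g(2) topspace_CtN N_pos_def using f by (auto simp: image_iff)
  ultimately show "preimage_open (CtN k) U"
    unfolding preimage_open_def by (intro exI[of _ f] exI[of _ "{0<..}"]) simp
qed

text \<open>Capping the terms by \<open>(1/2) ^ i\<close> gives a summable bound independent of the
  argument, so limits pass through the sum, while a positive term stays positive.\<close>

lemma scont_suminf:
  assumes g: "\<And>i. scont cv (g i)" "\<And>i y. 0 \<le> g i y"
  shows "scont cv (\<lambda>y. \<Sum>i. min (g i y) ((1/2) ^ i))"
    and "summable (\<lambda>i. min (g i y) ((1/2) ^ i))"
proof -
  have s: "summable (\<lambda>i. (1/2 :: real) ^ i)" by (rule summable_geometric) auto
  have b: "norm (min (g i y) ((1/2) ^ i)) \<le> (1/2) ^ i" for i y using g(2)[of i y] by (simp add: min_def)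
  show "scont cv (\<lambda>y. \<Sum>i. min (g i y) ((1/2) ^ i))"
    unfolding scont_def
  proof (intro allI impI)
    fix ys y assume y: "cv ys y"
    show "(\<lambda>n. \<Sum>i. min (g i (ys n)) ((1/2) ^ i)) \<longlonglongrightarrow> (\<Sum>i. min (g i y) ((1/2) ^ i))"
      by (rule tannerys_theorem[THEN conjunct2, THEN conjunct2, OF _ _ s])
        (use b scontD[OF g(1), OF y] in \<open>auto intro!: tendsto_min always_eventually\<close>)
  qed
  show "summable (\<lambda>i. min (g i y) ((1/2) ^ i))"
    by (rule summable_comparison_test'[OF s, of 0]) (use b in auto)
qed

text \<open>Cozero sets are closed under countable unions by summing the capped functions, and
  \<open>N.lindelof\<close> reduces arbitrary unions to countable ones.\<close>

lemma openin_R_top_CtN: "openin (R_top (CtN k)) = preimage_open (CtN k)"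
proof -
  have "istopology (preimage_open (CtN k))"
    unfolding istopology_def
  proof (intro conjI allI impI)
    fix U V assume "preimage_open (CtN k) U" "preimage_open (CtN k) V"
    then obtain g h where gh: "scont (N.conv k) g" "\<forall>y. 0 \<le> g y" "U = N_pos g"
      "scont (N.conv k) h" "\<forall>y. 0 \<le> h y" "V = N_pos h" using preimage_open_CtN by auto
    have "scont (N.conv k) (\<lambda>y. min (g y) (h y))"
      using gh(1,4) unfolding scont_def by (auto intro: tendsto_min)
    moreover have "U \<inter> V = N_pos (\<lambda>y. min (g y) (h y))"
    proof
      show "U \<inter> V \<subseteq> N_pos (\<lambda>y. min (g y) (h y))"
      proof
        fix c assume c: "c \<in> U \<inter> V"
        then obtain y where y: "y \<in> N_bar k" "c = N_class y" using gh(3) unfolding N_pos_def by blast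
        then have "g y > 0" "h y > 0" using c N_pos_iff gh by auto
        then show "c \<in> N_pos (\<lambda>y. min (g y) (h y))" using y unfolding N_pos_def by auto
      qed
    qed (use gh in \<open>auto simp: N_pos_def\<close>)
    ultimately show "preimage_open (CtN k) (U \<inter> V)" unfolding preimage_open_CtN using gh(2,5)
      by (intro exI[of _ "\<lambda>y. min (g y) (h y)"]) auto
  next
    fix \<K> assume K: "\<forall>U\<in>\<K>. preimage_open (CtN k) U"
    \<comment> \<open>The zero function contributes the empty set; it keeps the family nonempty when
      \<open>\<K>\<close> is empty.\<close>
    define G where "G = {g. scont (N.conv k) g \<and> (\<forall>y. 0 \<le> g y) \<and> (N_pos g \<in> \<K> \<or> g = (\<lambda>_. 0))}"
    have UK: "\<Union>\<K> = (\<Union>g\<in>G. N_pos g)"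
    proof
      show "\<Union>\<K> \<subseteq> (\<Union>g\<in>G. N_pos g)" 
      proof
        fix c assume "c \<in> \<Union>\<K>"
        then obtain U where U: "U \<in> \<K>" "c \<in> U" by blast
        then obtain g where "scont (N.conv k) g" "\<forall>y. 0 \<le> g y" "U = N_pos g"
          using K preimage_open_CtN by blast
        then have "g \<in> G" "c \<in> N_pos g" using U unfolding G_def by auto
        then show "c \<in> (\<Union>g\<in>G. N_pos g)" by blast
      qed
    qed (auto simp: G_def N_pos_def)
    have "(\<lambda>_. 0) \<in> G" by (simp add: G_def scont_def)
    then have "(\<lambda>g y. g y > 0) ` G \<noteq> {}" by blast
    then obtain e :: "nat \<Rightarrow> _" where e: "\<And>i. e i \<in> (\<lambda>g y. g y > 0) ` G"
      "\<And>u y. \<lbrakk>u \<in> (\<lambda>g y. g y > 0) ` G; y \<in> N_bar k; u y\<rbrakk> \<Longrightarrow> \<exists>i. e i y"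
    proof (rule N.lindelof[OF N_conv_ok])
      fix u ys y assume "u \<in> (\<lambda>g y. g y > 0) ` G" and y: "N.conv k ys y" "u y"
      then obtain g where g: "scont (N.conv k) g" "u = (\<lambda>y. g y > 0)" unfolding G_def by blast
      show "\<forall>\<^sub>F n in sequentially. u (ys n)"
        using order_tendstoD(1)[OF scontD[OF g(1), OF y(1)]] y(2) by (simp add: g(2))
    qed blast
    then have "\<forall>i. \<exists>g\<in>G. e i = (\<lambda>y. g y > 0)" by blast
    then obtain g where g: "\<And>i. g i \<in> G" "\<And>i. e i = (\<lambda>y. g i y > 0)" by metis
    have gs: "\<And>i. scont (N.conv k) (g i)" "\<And>i y. 0 \<le> g i y" using g(1) unfolding G_def by auto
    define s where "s = (\<lambda>y. \<Sum>i. min (g i y) ((1/2) ^ i))"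
    have sp: "s y > 0 \<longleftrightarrow> (\<exists>i. g i y > 0)" for y
    proof -
      have nn: "0 \<le> min (g i y) ((1/2) ^ i)" for i using gs(2)[of i y] by simp
      have "s y = 0 \<longleftrightarrow> (\<forall>i. min (g i y) ((1/2) ^ i) = 0)"
        unfolding s_def by (rule suminf_eq_zero_iff[OF scont_suminf(2)[OF gs] nn])
      moreover have "min (g i y) ((1/2) ^ i) = 0 \<longleftrightarrow> g i y = 0" for i
        using gs(2)[of i y] by (auto simp: min_def)
      moreover have "0 \<le> s y" unfolding s_def by (rule suminf_nonneg[OF scont_suminf(2)[OF gs] nn])
      ultimately show ?thesis using gs(2)[of _ y] by (metis less_le)
    qed
    have "N_pos s = (\<Union>g\<in>G. N_pos g)"
    proof
      show "N_pos s \<subseteq> (\<Union>g\<in>G. N_pos g)" using sp g(1) unfolding N_pos_def by blast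
      show "(\<Union>g\<in>G. N_pos g) \<subseteq> N_pos s"
      proof clarify
        fix c h assume h: "h \<in> G" "c \<in> N_pos h"
        then obtain y where y: "y \<in> N_bar k" "h y > 0" "c = N_class y" unfolding N_pos_def by blast
        then obtain i where "e i y" using e(2)[of "\<lambda>y. h y > 0" y] h by blast
        then show "c \<in> N_pos s" using g(2) sp y unfolding N_pos_def by auto
      qed
    qed
    moreover have "\<forall>y. 0 \<le> s y" unfolding s_def using gs scont_suminf(2)[OF gs] by (auto intro!: suminf_nonneg)
    ultimately show "preimage_open (CtN k) (\<Union>\<K>)"
      unfolding preimage_open_CtN UK
      using scont_suminf(1)[of "N.conv k" g, OF gs, folded s_def] by (intro exI[of _ s]) simp
  qed
  then show ?thesis by (simp add: R_top_def topology_inverse')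
qed

text \<open>The open sets \<open>g > 0\<close> and \<open>g < 1\<close> cover the space, so the
  clopen basic sets inside one of them do too, and countably many suffice. The first member of the
  enumeration that contains the argument is locally constant in the argument and decides which side
  to take.\<close>

lemma sepa_N:
  assumes "zero_dimensional (R_top (CtN k))"
  shows "sepa (N_bar k) (N.conv k)"
  unfolding sepa_def
proof (intro allI impI)
  fix g assume g: "scont (N.conv k) g"
  obtain \<B> where B: "\<And>B. B \<in> \<B> \<Longrightarrow> openin (R_top (CtN k)) B \<and> closedin (R_top (CtN k)) B"
    "openin (R_top (CtN k)) = arbitrary union_of (\<lambda>B. B \<in> \<B>)"
    using assms unfolding zero_dimensional_def by blast
  have top: "topspace (R_top (CtN k)) = N_class ` N_bar k"
  proof
    have "preimage_open (CtN k) (topspace (CtN k))"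
      unfolding preimage_open_def by (intro exI[of _ "\<lambda>_. 0"] exI[of _ UNIV]) auto
    then show "N_class ` N_bar k \<subseteq> topspace (R_top (CtN k))"
      using openin_R_top_CtN topspace_CtN by (metis openin_subset)
    have "preimage_open (CtN k) (topspace (R_top (CtN k)))" using openin_R_top_CtN by (metis openin_topspace)
    then show "topspace (R_top (CtN k)) \<subseteq> N_class ` N_bar k"
      unfolding preimage_open_def topspace_CtN by blast
  qed
  have ev: "\<forall>\<^sub>F n in sequentially. N_class (ys n) \<in> U"
    if U: "openin (R_top (CtN k)) U" and y: "N.conv k ys y" "N_class y \<in> U" for U ys y
  proof -
    have t: "y \<in> N_bar k" "\<And>n. ys n \<in> N_bar k" using N.conv_T[OF y(1)] by auto
    obtain h where h: "scont (N.conv k) h" "U = N_pos h" using U openin_R_top_CtN preimage_open_CtN by auto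
    then have "h y > 0" using N_pos_iff t y(2) by blast
    then have "\<forall>\<^sub>F n in sequentially. h (ys n) > 0" using scontD[OF h(1), OF y(1)] order_tendstoD(1) by blast
    then show ?thesis by (rule eventually_mono) (use h N_pos_iff t in blast)
  qed
  have disc: "sdisc (N.conv k) (\<lambda>y. N_class y \<in> b)" if b: "b \<in> \<B>" for b
    unfolding sdisc_def
  proof (intro allI impI)
    fix ys y assume y: "N.conv k ys y"
    have t: "y \<in> N_bar k" "\<And>n. ys n \<in> N_bar k" using N.conv_T[OF y] by auto
    have c: "openin (R_top (CtN k)) (topspace (R_top (CtN k)) - b)" using B(1)[OF b] by blast
    show "\<forall>\<^sub>F n in sequentially. (N_class (ys n) \<in> b) = (N_class y \<in> b)"
    proof (cases "N_class y \<in> b")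
      case True
      then show ?thesis using ev[OF conjunct1[OF B(1)[OF b]] y] by simp
    next
      case False
      then have "N_class y \<in> topspace (R_top (CtN k)) - b" using top t by blast
      then show ?thesis using ev[OF c y] False by (auto elim: eventually_mono)
    qed
  qed
  define P where "P = (\<lambda>b. (\<forall>y\<in>N_bar k. N_class y \<in> b \<longrightarrow> g y < 1) \<or> (\<forall>y\<in>N_bar k. N_class y \<in> b \<longrightarrow> g y > 0))"
  \<comment> \<open>The empty set ensures that the family to be enumerated is nonempty; it satisfies
    \<open>P\<close> vacuously.\<close>
  define \<U> where "\<U> = insert {} {b \<in> \<B>. P b}"
  have Ud: "sdisc (N.conv k) (\<lambda>y. N_class y \<in> b)" if "b \<in> \<U>" for b
    using disc that by (auto simp: \<U>_def sdisc_const)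
  have cov: "\<exists>b\<in>\<U>. N_class y \<in> b" if y: "y \<in> N_bar k" for y
  proof -
    have "\<exists>U. openin (R_top (CtN k)) U \<and> N_class y \<in> U \<and> P U"
    proof -
      have s: "scont (N.conv k) (\<lambda>y. max 0 (1 - g y))" "scont (N.conv k) (\<lambda>y. max 0 (g y))"
        using g unfolding scont_def by (auto intro!: tendsto_intros tendsto_max)
      have o: "openin (R_top (CtN k)) (N_pos h)" if "scont (N.conv k) h" "\<forall>y. 0 \<le> h y" for h
        using that openin_R_top_CtN preimage_open_CtN by auto
      have "P (N_pos (\<lambda>y. max 0 (1 - g y)))" "P (N_pos (\<lambda>y. max 0 (g y)))"
        unfolding P_def using N_pos_iff[OF s(1)] N_pos_iff[OF s(2)] by auto
      then show ?thesis using o[OF s(1)] o[OF s(2)] N_pos_iff[OF s(1) y] N_pos_iff[OF s(2) y]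
        by (cases "g y > 0") auto
    qed
    then obtain U where U: "openin (R_top (CtN k)) U" "N_class y \<in> U" "P U" by blast
    then obtain \<C> where "\<C> \<subseteq> \<B>" "\<Union>\<C> = U" using B(2) by (auto simp: union_of_def arbitrary_def)
    then obtain b where "b \<in> \<B>" "b \<subseteq> U" "N_class y \<in> b" using U(2) by blast
    moreover then have "P b" using U(3) unfolding P_def by blast
    ultimately show ?thesis unfolding \<U>_def by blast
  qed
  have "(\<lambda>b y. N_class y \<in> b) ` \<U> \<noteq> {}" unfolding \<U>_def by blast
  then obtain e :: "nat \<Rightarrow> _" where e: "\<And>i. e i \<in> (\<lambda>b y. N_class y \<in> b) ` \<U>"
    "\<And>u y. \<lbrakk>u \<in> (\<lambda>b y. N_class y \<in> b) ` \<U>; y \<in> N_bar k; u y\<rbrakk> \<Longrightarrow> \<exists>i. e i y"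
  proof (rule N.lindelof[OF N_conv_ok])
    fix u ys y assume u: "u \<in> (\<lambda>b y. N_class y \<in> b) ` \<U>" and y: "N.conv k ys y" "u y"
    then have "sdisc (N.conv k) u" using Ud by blast
    from sdiscD[OF this, OF y(1)] show "\<forall>\<^sub>F n in sequentially. u (ys n)" by (rule eventually_mono) (use y(2) in blast)
  qed blast
  have "\<forall>i. \<exists>b. b \<in> \<U> \<and> e i = (\<lambda>y. N_class y \<in> b)" using e(1) by blast
  then obtain b where b: "\<And>i. b i \<in> \<U>" "\<And>i. e i = (\<lambda>y. N_class y \<in> b i)" by metis
  have ex: "\<exists>i. N_class y \<in> b i" if y: "y \<in> N_bar k" for y
  proof -
    obtain c where "c \<in> \<U>" "N_class y \<in> c" using cov[OF y] by blast
    then have "\<exists>i. e i y" using e(2)[of "\<lambda>y. N_class y \<in> c" y] y by blast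
    then show ?thesis using b(2) by simp
  qed
  define m where "m = (\<lambda>y. LEAST i. N_class y \<in> b i)"
  have m: "N_class y \<in> b (m y)" if "y \<in> N_bar k" for y unfolding m_def using LeastI_ex[OF ex[OF that]] .
  have "sdisc (N.conv k) m"
    unfolding m_def by (rule sdisc_least[OF Ud[OF b(1)]]) (use ex N.conv_T in blast)
  then have "sdisc (N.conv k) (\<lambda>y. \<forall>z\<in>N_bar k. N_class z \<in> b (m y) \<longrightarrow> g z < 1)"
    by (rule sdisc_comp)
  moreover have "P (b i)" for i using b(1)[of i] unfolding \<U>_def P_def by blast
  then have "(g y \<le> 0 \<longrightarrow> (\<forall>z\<in>N_bar k. N_class z \<in> b (m y) \<longrightarrow> g z < 1)) \<and>
    ((\<forall>z\<in>N_bar k. N_class z \<in> b (m y) \<longrightarrow> g z < 1) \<longrightarrow> g y < 1)" if "y \<in> N_bar k" for y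
    using m[OF that] that unfolding P_def by (metis not_less)
  ultimately show "\<exists>u. sdisc (N.conv k) u \<and> (\<forall>x\<in>N_bar k. (g x \<le> 0 \<longrightarrow> u x) \<and> (u x \<longrightarrow> g x < 1))" by blast
qed

end

section \<open>Density in the smoothened hierarchy\<close>

lemma S_sim0_sym: "S_sim0 x y \<Longrightarrow> S_sim0 y x"
  unfolding S_sim0_def by metis

lemma S_sim_sym: "S_sim k x y \<Longrightarrow> S_sim k y x"
  by (induction k arbitrary: x y) (auto intro: S_sim0_sym)

text \<open>The values fitting a sequence form an intersection of intervals. If no value fits both
  sequences, \<open>interval_helly\<close> finds two disjoint intervals, one from each, and a linear
  function separates them.\<close>

lemma S_disjoint:
  assumes ab: "a \<in> S0" "b \<in> S0" "\<not> S_sim0 a b"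
  obtains \<phi> where "continuous_on UNIV \<phi>" "\<And>t. fits a t \<Longrightarrow> \<phi> t \<ge> (1 :: real)" "\<And>t. fits b t \<Longrightarrow> \<phi> t \<le> 0"
proof -
  let ?I = "{(z, j). z \<in> {a, b} \<and> z j \<noteq> None}"
  have "\<not> (\<exists>r. \<forall>i\<in>?I. pval (fst i) (snd i) - 1 / 2 ^ snd i \<le> r \<and> r \<le> pval (fst i) (snd i) + 1 / 2 ^ snd i)"
  proof
    assume "\<exists>r. \<forall>i\<in>?I. pval (fst i) (snd i) - 1 / 2 ^ snd i \<le> r \<and> r \<le> pval (fst i) (snd i) + 1 / 2 ^ snd i"
    then obtain r where r': "\<forall>i\<in>?I. pval (fst i) (snd i) - 1 / 2 ^ snd i \<le> r \<and> r \<le> pval (fst i) (snd i) + 1 / 2 ^ snd i" ..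
    have r: "pval z j - 1 / 2 ^ j \<le> r \<and> r \<le> pval z j + 1 / 2 ^ j" if "z \<in> {a, b}" "z j \<noteq> None" for z j
      using bspec[OF r', of "(z, j)"] that by simp
    have "fits z r" if "z \<in> {a, b}" for z
      unfolding fits_def using r[OF that] by (simp add: abs_le_iff algebra_simps)
    then show False using S_sim0_iff[OF ab(1,2)] ab(3) by blast
  qed
  then obtain i i' where i: "i \<in> ?I" "i' \<in> ?I" "\<not> pval (fst i) (snd i) - 1 / 2 ^ snd i \<le> pval (fst i') (snd i') + 1 / 2 ^ snd i'"
    using interval_helly[of ?I "\<lambda>i. pval (fst i) (snd i) - 1 / 2 ^ snd i" "\<lambda>i. pval (fst i) (snd i) + 1 / 2 ^ snd i"] by blast
  obtain z m w n where zw: "i = (z, m)" "i' = (w, n)" by (metis surj_pair)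
  define \<alpha> \<beta> where ab_def: "\<alpha> = pval z m - 1 / 2 ^ m" "\<beta> = pval w n + 1 / 2 ^ n"
  have m: "z \<in> {a, b}" "w \<in> {a, b}" "z m \<noteq> None" "w n \<noteq> None" "\<beta> < \<alpha>"
    using i zw by (auto simp: ab_def)
  have z: "\<alpha> \<le> t" if "fits z t" for t using that m(3) unfolding fits_def ab_def by (force simp: abs_le_iff)
  have w: "t \<le> \<beta>" if "fits w t" for t using that m(4) unfolding fits_def ab_def by (force simp: abs_le_iff)
  \<comment> \<open>Each sequence alone is fitted by some value, so the two disjoint intervals
    cannot come from the same sequence.\<close>
  have "\<exists>t. fits x t" if "x \<in> S0" for x
    using S0_ext[OF that] fits_mono[OF _ _ that] fits_max by metis
  then have "z \<noteq> w" using m(1) z w m(5) ab(1,2) by (metis insertE linorder_not_le order_trans singletonD)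
  show thesis
  proof (cases "z = a")
    case True
    then have "w = b" using m(2) \<open>z \<noteq> w\<close> by auto
    show thesis
      by (rule that[of "\<lambda>t. (t - \<beta>) / (\<alpha> - \<beta>)"])
        (use z w m(5) True \<open>w = b\<close> in \<open>auto simp: divide_le_0_iff le_divide_eq intro!: continuous_intros\<close>)
  next
    case False
    then have "z = b" "w = a" using m(1,2) \<open>z \<noteq> w\<close> by auto
    show thesis
      by (rule that[of "\<lambda>t. (\<alpha> - t) / (\<alpha> - \<beta>)"])
        (use z w m(5) \<open>z = b\<close> \<open>w = a\<close> in \<open>auto simp: divide_le_0_iff le_divide_eq intro!: continuous_intros\<close>)
  qed
qed

lemma S_T0: "y \<in> S.T 0 \<longleftrightarrow> (\<exists>x\<in>S0_max. y = Val x)"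
proof -
  have "S_eq0 x x \<longleftrightarrow> x \<in> S0_max" for x by (simp add: S_eq0_iff)
  then show ?thesis by (auto simp: tot_def S0_max_def)
qed

lemma S_app_max: "\<lbrakk>f \<in> S.T (Suc k); y \<in> S.T k\<rbrakk> \<Longrightarrow> app f y \<in> S0_max"
  using S.T_appr[of f k y] by (simp add: S_eq0_iff)

lemma S_app_eqv: "\<lbrakk>S.eqv (Suc k) f g; S.eqv k x y; x \<in> S.T k; y \<in> S.T k\<rbrakk> \<Longrightarrow> S_val (app f x) = S_val (app g y)"
  using S.eqv_app[of k f g x y] by (simp add: S_eq0_iff)

lemma S_val_tendsto:
  assumes "\<And>n. xs n \<in> S0_max" "x \<in> S0_max" "\<And>i. \<forall>\<^sub>F n in sequentially. xs n i = x i"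
  shows "(\<lambda>n. S_val (xs n)) \<longlonglongrightarrow> S_val x"
proof (rule tendstoI)
  fix e :: real assume "e > 0"
  then obtain m where m: "1 / 2 ^ m < e / 2" using half_power_less[of "e / 2"] by auto
  have "\<forall>\<^sub>F n in sequentially. \<forall>i\<in>{..m}. xs n i = x i"
    using assms(3) by (simp add: eventually_ball_finite_distrib)
  then show "\<forall>\<^sub>F n in sequentially. dist (S_val (xs n)) (S_val x) < e"
  proof eventually_elim
    case (elim n)
    then have "pval (xs n) m = pval x m" by (intro pval_cong) auto
    then show ?case
      using S_val_bound[OF assms(1), of n m] S_val_bound[OF assms(2), of m] m
      unfolding dist_real_def by linarith
  qed
qed

text \<open>Unrelated \<open>p\<close> and \<open>q\<close> take unrelated values at related
  arguments, already on finite prefixes and compact arguments. By density these extend to equivalent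
  total \<open>y1\<close> and \<open>y2\<close>, at which a total functional has one real value; it
  fits \<open>b\<close> above \<open>p\<close> and \<open>c\<close> above \<open>q\<close>. The
  first test reads this value and is extensional, the second reads digits and is locally
  constant.\<close>

lemma S_sim_test:
  assumes d: "\<And>j. j < k \<Longrightarrow> S.dens j" and pq: "p \<in> S.K k" "q \<in> S.K k" "\<not> S_sim k p q"
  shows "\<exists>w. scont (S.conv k) w \<and> (\<forall>y\<in>S.T k. \<forall>z\<in>S.T k. S.eqv k y z \<longrightarrow> w y = w z) \<and>
    (\<forall>y\<in>S.T k. (S.fle p y \<longrightarrow> w y \<ge> 1) \<and> (S.fle q y \<longrightarrow> w y \<le> (0 :: real)))"
    and "\<exists>w. sdisc (S.conv k) w \<and>
    (\<forall>y\<in>S.T k. (S.fle p y \<longrightarrow> w y) \<and> (S.fle q y \<longrightarrow> \<not> w y))"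
proof -
  \<comment> \<open>Puts level 0 and successor levels into one form: \<open>e\<close> and
    \<open>e'\<close> evaluate at two equivalent arguments, and at level 0 both read the object
    itself.\<close>
  have "\<exists>e e' b c. b \<in> S0_fin \<and> c \<in> S0 \<and> \<not> S_sim0 b c \<and>
    (\<forall>ys y i. S.conv k ys y \<longrightarrow> (\<forall>\<^sub>F n in sequentially. e (ys n) i = e y i)) \<and>
    (\<forall>y\<in>S.T k. e y \<in> S0_max \<and> e' y \<in> S0_max \<and> S_val (e' y) = S_val (e y)) \<and>
    (\<forall>y\<in>S.T k. \<forall>z\<in>S.T k. S.eqv k y z \<longrightarrow> S_val (e y) = S_val (e z)) \<and>
    (\<forall>y\<in>S.T k. (S.fle p y \<longrightarrow> b \<subseteq>\<^sub>m e y) \<and> (S.fle q y \<longrightarrow> c \<subseteq>\<^sub>m e' y))"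
  proof (cases k)
    case 0
    then obtain a b where ab: "p = Val a" "q = Val b" "a \<in> S0_fin" "b \<in> S0_fin" using pq by auto
    then have "\<not> S_sim0 a b" using pq(3) 0 by simp
    then show ?thesis
      using ab 0 by (intro exI[of _ val] exI[of _ a] exI[of _ b]) (auto simp: S_T0 S_eq0_iff)
  next
    case (Suc m)
    obtain x1 x2 where x: "x1 \<in> S_dom m" "x2 \<in> S_dom m" "S_sim m x1 x2" "\<not> S_sim0 (app p x1) (app q x2)"
      using pq(3) Suc by auto
    have D: "p \<in> S_dom (Suc m)" "q \<in> S_dom (Suc m)" using pq S.X.K_D Suc by blast+
    obtain b c where bc: "b \<in> S0_fin" "c \<in> S0_fin" "b \<subseteq>\<^sub>m app p x1" "c \<subseteq>\<^sub>m app q x2" "\<not> S_sim0 b c"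
      using S_sim0_closed[OF S.appB[OF D(1) x(1)] S.appB[OF D(2) x(2)]] x(4) by blast
    obtain c1 where c1: "c1 \<in> S.K m" "S.fle c1 x1" "b \<subseteq>\<^sub>m app p c1" using S.appI[OF D(1) x(1) bc(1)] bc(3) by blast
    obtain c2 where c2: "c2 \<in> S.K m" "S.fle c2 x2" "c \<subseteq>\<^sub>m app q c2" using S.appI[OF D(2) x(2) bc(2)] bc(4) by blast
    have "S_sim m c1 c2" using S.sim_down[OF x(3) S.X.K_D[OF c1(1)] S.X.K_D[OF c2(1)] x(1,2) c1(2) c2(2)] .
    then obtain y1 y2 where y: "y1 \<in> S.T m" "y2 \<in> S.T m" "S.fle c1 y1" "S.fle c2 y2" "S.eqv m y1 y2"
      using d[of m] Suc c1(1) c2(1) unfolding S.dens_def by blast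
    have ok: "S.conv_ok m" using d Suc by (intro S.conv_okI) auto
    have "\<forall>\<^sub>F n in sequentially. app (fs n) y1 i = app f y1 i" if "S.conv k fs f" for fs f i
      using S.conv_app[OF _ S.conv_const[OF ok y(1)]] that Suc by blast
    moreover have "app f y1 \<in> S0_max \<and> app f y2 \<in> S0_max \<and> S_val (app f y2) = S_val (app f y1)" if "f \<in> S.T k" for f
      using S_app_max S_app_eqv[OF S.T_eqv S.eqv_sym[OF y(5)] y(2,1)] y(1,2) that Suc by blast
    moreover have "S_val (app f y1) = S_val (app g y1)" if "S.eqv k f g" for f g
      using S_app_eqv[OF _ S.T_eqv[OF y(1)] y(1,1)] that Suc by blast
    moreover have "b \<subseteq>\<^sub>m app f y1" if "f \<in> S.T k" "S.fle p f" for f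
      using map_le_trans[OF c1(3) S.le_app[OF that(2) D(1) _ S.X.K_D[OF c1(1)] S.T_D[OF y(1)] y(3)]] S.T_D[OF that(1)] Suc by blast
    moreover have "c \<subseteq>\<^sub>m app f y2" if "f \<in> S.T k" "S.fle q f" for f
      using map_le_trans[OF c2(3) S.le_app[OF that(2) D(2) _ S.X.K_D[OF c2(1)] S.T_D[OF y(2)] y(4)]] S.T_D[OF that(1)] Suc by blast
    ultimately show ?thesis
      using bc by (intro exI[of _ "\<lambda>f. app f y1"] exI[of _ "\<lambda>f. app f y2"] exI[of _ b] exI[of _ c]) auto
  qed
  then obtain e e' b c where b': "b \<in> S0_fin" and b1: "c \<in> S0" "\<not> S_sim0 b c"
    and e1: "\<forall>ys y i. S.conv k ys y \<longrightarrow> (\<forall>\<^sub>F n in sequentially. e (ys n) i = e y i)"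
    and e2: "\<forall>y\<in>S.T k. e y \<in> S0_max \<and> e' y \<in> S0_max \<and> S_val (e' y) = S_val (e y)"
    and e3: "\<forall>y\<in>S.T k. \<forall>z\<in>S.T k. S.eqv k y z \<longrightarrow> S_val (e y) = S_val (e z)"
    and e4: "\<forall>y\<in>S.T k. (S.fle p y \<longrightarrow> b \<subseteq>\<^sub>m e y) \<and> (S.fle q y \<longrightarrow> c \<subseteq>\<^sub>m e' y)"
    by (elim exE conjE) (rule that)
  note b = conjunct1[OF b'[unfolded mem_Collect_eq]] conjunct2[OF b'[unfolded mem_Collect_eq]] b1
  have e: "\<And>ys y i. S.conv k ys y \<Longrightarrow> \<forall>\<^sub>F n in sequentially. e (ys n) i = e y i"
    "\<And>y. y \<in> S.T k \<Longrightarrow> e y \<in> S0_max" "\<And>y. y \<in> S.T k \<Longrightarrow> e' y \<in> S0_max"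
    "\<And>y. y \<in> S.T k \<Longrightarrow> S_val (e' y) = S_val (e y)"
    "\<And>y z. \<lbrakk>y \<in> S.T k; z \<in> S.T k; S.eqv k y z\<rbrakk> \<Longrightarrow> S_val (e y) = S_val (e z)"
    "\<And>y. \<lbrakk>y \<in> S.T k; S.fle p y\<rbrakk> \<Longrightarrow> b \<subseteq>\<^sub>m e y" "\<And>y. \<lbrakk>y \<in> S.T k; S.fle q y\<rbrakk> \<Longrightarrow> c \<subseteq>\<^sub>m e' y"
    using e1 e2 e3 e4 by simp_all
  have fb: "fits b (S_val (e y))" if "y \<in> S.T k" "b \<subseteq>\<^sub>m e y" for y
    using fits_mono[OF _ that(2) b(1)] fits_max[OF e(2)[OF that(1)]] by blast
  have fc: "fits c (S_val (e y))" if "y \<in> S.T k" "S.fle q y" for y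
    using fits_mono[OF _ e(7)[OF that] b(3)] fits_max[OF e(3)[OF that(1)]] e(4)[OF that(1)] by auto
  obtain \<phi> where \<phi>: "continuous_on UNIV \<phi>" "\<And>t. fits b t \<Longrightarrow> \<phi> t \<ge> (1 :: real)" "\<And>t. fits c t \<Longrightarrow> \<phi> t \<le> 0"
    using S_disjoint[OF b(1,3,4)] by blast
  have "scont (S.conv k) (\<lambda>y. \<phi> (S_val (e y)))"
    unfolding scont_def
  proof (intro allI impI)
    fix ys y assume y: "S.conv k ys y"
    have t: "y \<in> S.T k" "\<And>n. ys n \<in> S.T k" using S.conv_T[OF y] by auto
    have "(\<lambda>n. S_val (e (ys n))) \<longlonglongrightarrow> S_val (e y)" by (rule S_val_tendsto) (use t e(1)[OF y] e(2) in auto)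
    then show "(\<lambda>n. \<phi> (S_val (e (ys n)))) \<longlonglongrightarrow> \<phi> (S_val (e y))"
      using continuous_on_tendsto_compose[OF \<phi>(1)] by simp
  qed
  then show "\<exists>w. scont (S.conv k) w \<and> (\<forall>y\<in>S.T k. \<forall>z\<in>S.T k. S.eqv k y z \<longrightarrow> w y = w z) \<and>
    (\<forall>y\<in>S.T k. (S.fle p y \<longrightarrow> w y \<ge> 1) \<and> (S.fle q y \<longrightarrow> w y \<le> (0 :: real)))"
    using e(5) \<phi>(2)[OF fb] \<phi>(3)[OF fc] e(6) by (intro exI[of _ "\<lambda>y. \<phi> (S_val (e y))"]) auto
  have "sdisc (S.conv k) (\<lambda>y. b \<subseteq>\<^sub>m e y)"
    unfolding sdisc_def
  proof (intro allI impI)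
    fix ys y assume y: "S.conv k ys y"
    have "\<forall>\<^sub>F n in sequentially. \<forall>i\<in>dom b. e (ys n) i = e y i"
      using e(1)[OF y] b(2) by (simp add: eventually_ball_finite_distrib)
    then show "\<forall>\<^sub>F n in sequentially. (b \<subseteq>\<^sub>m e (ys n)) = (b \<subseteq>\<^sub>m e y)"
      by (rule eventually_mono) (auto simp: map_le_def)
  qed
  moreover have "\<not> b \<subseteq>\<^sub>m e y" if "y \<in> S.T k" "S.fle q y" for y
    using fb[OF that(1)] fc[OF that] b S_sim0_iff by blast
  ultimately show "\<exists>w. sdisc (S.conv k) w \<and>
    (\<forall>y\<in>S.T k. (S.fle p y \<longrightarrow> w y) \<and> (S.fle q y \<longrightarrow> \<not> w y))"
    using e(6) by blast
qed

lemma S0_incompatible: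
  assumes "x \<in> S0" "y \<in> S0" "\<not> (\<exists>z\<in>S0. x \<subseteq>\<^sub>m z \<and> y \<subseteq>\<^sub>m z)"
  shows "\<exists>i. x i \<noteq> None \<and> y i \<noteq> None \<and> x i \<noteq> y i"
proof (rule ccontr)
  assume "\<not> ?thesis"
  then have eq: "x i = y i" if "x i \<noteq> None" "y i \<noteq> None" for i using that by blast
  have "x \<subseteq>\<^sub>m y \<or> y \<subseteq>\<^sub>m x"
  proof (rule ccontr)
    assume "\<not> ?thesis"
    then obtain i j where "x i \<noteq> None" "x i \<noteq> y i" "y j \<noteq> None" "x j \<noteq> y j" unfolding map_le_def by (metis domIff)
    then show False using eq S0_down[OF assms(1), of i j] S0_down[OF assms(2), of j i] by (meson nle_le)
  qed
  then show False using assms by auto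
qed

text \<open>The supremum of two bounded base elements is one of them, so a pointwise supremum of two
  related functions respects \<open>S_sim\<close>.\<close>

lemma S_incompatible_at:
  assumes pq: "p \<in> S.K (Suc m)" "q \<in> S.K (Suc m)" "S_sim (Suc m) p q"
    and nub: "\<not> (\<exists>z\<in>S_dom (Suc m). S.fle p z \<and> S.fle q z)"
  shows "\<exists>x\<in>S.K m. \<exists>i. app p x i \<noteq> None \<and> app q x i \<noteq> None \<and> app p x i \<noteq> app q x i"
proof -
  have D: "p \<in> S_dom (Suc m)" "q \<in> S_dom (Suc m)" using pq S.X.K_D by blast+
  have ex: "\<exists>x\<in>S.K m. \<not> (\<exists>z\<in>S0. app p x \<subseteq>\<^sub>m z \<and> app q x \<subseteq>\<^sub>m z)"
  proof (rule S.incompatible_at[OF pq(1,2) nub])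
    fix x y i j assume x: "x \<in> S_dom m" "y \<in> S_dom m" "S_sim m x y" and ij: "i \<in> S0" "j \<in> S0"
      "\<And>z. z \<in> S0 \<Longrightarrow> (i \<subseteq>\<^sub>m z) = (app p x \<subseteq>\<^sub>m z \<and> app q x \<subseteq>\<^sub>m z)"
      "\<And>z. z \<in> S0 \<Longrightarrow> (j \<subseteq>\<^sub>m z) = (app p y \<subseteq>\<^sub>m z \<and> app q y \<subseteq>\<^sub>m z)"
    have one: "k = app p z \<or> k = app q z"
      if z: "z \<in> S_dom m" and k: "k \<in> S0" "\<And>w. w \<in> S0 \<Longrightarrow> (k \<subseteq>\<^sub>m w) = (app p z \<subseteq>\<^sub>m w \<and> app q z \<subseteq>\<^sub>m w)" for k z
    proof -
      have b: "app p z \<in> S0" "app q z \<in> S0" using S.appB D z by blast+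
      have le: "app p z \<subseteq>\<^sub>m k" "app q z \<subseteq>\<^sub>m k" using k(2)[OF k(1)] by auto
      then have "k \<subseteq>\<^sub>m app p z \<or> k \<subseteq>\<^sub>m app q z" using S0_comparable[OF b le] k(2) b by auto
      then show ?thesis using le map_le_antisym by blast
    qed
    have s: "S_sim0 (app p x) (app p y)" "S_sim0 (app q x) (app q y)"
      using S.appS[OF D(1) x] S.appS[OF D(2) x] .
    have "S_sim0 (app p x) (app q y)" "S_sim0 (app q x) (app p y)"
      using pq(3) x S_sim_sym[OF x(3)] S_sim0_sym by auto
    then show "S_sim0 i j" using one[OF x(1) ij(1,3)] one[OF x(2) ij(2,4)] s by auto
  qed
  then obtain x where x: "x \<in> S.K m" "\<not> (\<exists>z\<in>S0. app p x \<subseteq>\<^sub>m z \<and> app q x \<subseteq>\<^sub>m z)" by blast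
  show ?thesis
    using S0_incompatible[OF S.appB[OF D(1) S.X.K_D[OF x(1)]] S.appB[OF D(2) S.X.K_D[OF x(1)]] x(2)] x(1) by blast
qed

text \<open>Unrelated elements are covered by \<open>S_sim_test\<close>. Related ones without a
  common bound contradict each other in a digit at some compact argument, and that digit is read at
  a total argument above it. The test may distinguish equivalent objects.\<close>

lemma S_test:
  assumes d: "\<And>j. j < k \<Longrightarrow> S.dens j" and pq: "p \<in> S.K k" "q \<in> S.K k"
    "\<not> (\<exists>z\<in>S_dom k. S.fle p z \<and> S.fle q z)"
  shows "\<exists>w. sdisc (S.conv k) w \<and>
    (\<forall>y\<in>S.T k. (S.fle p y \<longrightarrow> w y) \<and> (S.fle q y \<longrightarrow> \<not> w y))"
proof (cases "S_sim k p q")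
  case False
  then show ?thesis using S_sim_test(2)[OF d pq(1,2)] by blast
next
  case sim: True
  show ?thesis
  proof (cases k)
    case 0
    then obtain a b where ab: "p = Val a" "q = Val b" "a \<in> S0" "b \<in> S0" using pq by auto
    then have "\<not> (\<exists>c\<in>S0. a \<subseteq>\<^sub>m c \<and> b \<subseteq>\<^sub>m c)" using pq(3) 0 by auto
    then obtain i where i: "a i \<noteq> None" "b i \<noteq> None" "a i \<noteq> b i" using S0_incompatible ab by blast
    have "sdisc (S.conv 0) (\<lambda>y. val y i = a i)"
      unfolding sdisc_def by (auto elim!: eventually_mono dest!: spec[of _ i])
    moreover have "val y i = a i" if "y \<in> S.T 0" "S.fle p y" for y
      using that ab(1) map_leD[of a "val y" i] i(1) by (auto simp: S_T0)
    moreover have "val y i \<noteq> a i" if "y \<in> S.T 0" "S.fle q y" for y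
      using that ab(2) map_leD[of b "val y" i] i by (auto simp: S_T0)
    ultimately show ?thesis unfolding 0 by (intro exI[of _ "\<lambda>y. val y i = a i"]) blast
  next
    case (Suc m)
    obtain x i where x: "x \<in> S.K m" "app p x i \<noteq> None" "app q x i \<noteq> None" "app p x i \<noteq> app q x i"
      using S_incompatible_at[of p m q] pq sim Suc by blast
    obtain y0 where y0: "y0 \<in> S.T m" "S.fle x y0" using d[of m] x(1) Suc unfolding S.dens_def by blast
    have ok: "S.conv_ok m" using d Suc by (intro S.conv_okI) auto
    have le: "app c x \<subseteq>\<^sub>m app f y0" if "c \<in> S.K k" "f \<in> S.T k" "S.fle c f" for c f
      using S.le_app[OF that(3)] S.X.K_D S.T_D that x y0 Suc by blast
    have "sdisc (S.conv k) (\<lambda>f. app f y0 i = app p x i)"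
      unfolding sdisc_def
    proof (intro allI impI)
      fix fs f assume "S.conv k fs f"
      then have "\<forall>\<^sub>F n in sequentially. app (fs n) y0 i = app f y0 i"
        using S.conv_app[OF _ S.conv_const[OF ok y0(1)]] Suc by blast
      then show "\<forall>\<^sub>F n in sequentially. (app (fs n) y0 i = app p x i) = (app f y0 i = app p x i)"
        by (rule eventually_mono) simp
    qed
    moreover have "app f y0 i = app p x i" if "f \<in> S.T k" "S.fle p f" for f
      using map_leD[OF le[OF pq(1) that] x(2)] .
    moreover have "app f y0 i \<noteq> app p x i" if "f \<in> S.T k" "S.fle q f" for f
      using map_leD[OF le[OF pq(2) that] x(3)] x(4) by simp
    ultimately show ?thesis by blast
  qed
qed

section \<open>Prescribed digits on finitely many neighbourhoods\<close>

text \<open>A continuous function which is constant near the multiples of \<open>2 ^ - N\<close>.\<close>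

definition flat1 :: "real \<Rightarrow> real" where
  "flat1 t = max (of_int \<lfloor>t\<rfloor>) (min (of_int \<lfloor>t\<rfloor> + 1) (2 * t - of_int \<lfloor>t\<rfloor> - 1/2))"

definition flat :: "nat \<Rightarrow> real \<Rightarrow> real" where
  "flat N t = flat1 (2 ^ N * t) / 2 ^ N"

lemma flat1_diff: "s \<le> t \<Longrightarrow> \<bar>flat1 t - flat1 s\<bar> \<le> 2 * (t - s)"
proof -
  assume st: "s \<le> t"
  define a b where ab: "a = \<lfloor>s\<rfloor>" "b = \<lfloor>t\<rfloor>"
  have f: "of_int a \<le> s" "s < of_int a + 1" "of_int b \<le> t" "t < of_int b + 1"
    unfolding ab by linarith+
  have "a = b \<or> of_int a + 1 \<le> (of_int b :: real)"
    using floor_mono[OF st] ab by linarith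
  then show ?thesis
    unfolding flat1_def ab[symmetric] using f st by (auto simp: max_def min_def)
qed

lemma continuous_flat: "continuous_on UNIV (flat N)"
proof -
  have "dist (flat1 s) (flat1 t) \<le> 2 * dist s t" for s t
    using flat1_diff[of s t] flat1_diff[of t s] by (cases "s \<le> t") (auto simp: dist_real_def abs_minus_commute)
  then have "2-lipschitz_on UNIV flat1" by (intro lipschitz_onI) auto
  then have "continuous_on UNIV flat1" by (rule lipschitz_on_continuous_on)
  then have "continuous_on UNIV (\<lambda>t. flat1 (2 ^ N * t))"
    by (rule continuous_on_compose2) (auto intro!: continuous_intros)
  then show ?thesis
    unfolding flat_def[abs_def] by (rule continuous_on_divide) auto
qed

text \<open>\<open>flat1\<close> is constant within \<open>1/4\<close> of every integer and has
  slope 2 in between. So a bound by a grid point that is violated by at most a quarter of the mesh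
  holds exactly after flattening.\<close>

lemma flat_bounds:
  fixes a :: int
  shows "(of_int a - 1/4) / 2 ^ N \<le> t \<Longrightarrow> of_int a / 2 ^ N \<le> flat N t"
    and "t \<le> (of_int a + 1/4) / 2 ^ N \<Longrightarrow> flat N t \<le> of_int a / 2 ^ N"
proof -
  have 1: "of_int a \<le> flat1 s" if "of_int a - 1/4 \<le> s" for s
  proof (cases "a \<le> \<lfloor>s\<rfloor>")
    case False
    then have "\<lfloor>s\<rfloor> = a - 1" using that by linarith
    then show ?thesis using that unfolding flat1_def by (simp add: max_def min_def)
  qed (simp add: flat1_def le_max_iff_disj)
  have 2: "flat1 s \<le> of_int a" if "s \<le> of_int a + 1/4" for s
  proof (cases "a \<le> \<lfloor>s\<rfloor>")
    case True
    then have "\<lfloor>s\<rfloor> = a" using that by linarith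
    then show ?thesis using that unfolding flat1_def by (simp add: max_def min_def)
  next
    case False
    then have "of_int \<lfloor>s\<rfloor> + 1 \<le> (of_int a :: real)" by linarith
    then show ?thesis unfolding flat1_def by (simp add: max_def min_def)
  qed
  show "(of_int a - 1/4) / 2 ^ N \<le> t \<Longrightarrow> of_int a / 2 ^ N \<le> flat N t"
    unfolding flat_def using 1[of "2 ^ N * t"] by (simp add: field_simps)
  show "t \<le> (of_int a + 1/4) / 2 ^ N \<Longrightarrow> flat N t \<le> of_int a / 2 ^ N"
    unfolding flat_def using 2[of "2 ^ N * t"] by (simp add: field_simps)
qed

text \<open>The intervals of successive prefixes are nested, since a digit moves the centre by at
  most the decrease of the radius; the last one decides.\<close>

lemma fits_last:
  assumes x: "x \<in> S0" "x m \<noteq> None" "x (Suc m) = None"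
  shows "fits x t \<longleftrightarrow> \<bar>t - pval x m\<bar> \<le> 1 / 2 ^ m"
proof
  assume m: "\<bar>t - pval x m\<bar> \<le> 1 / 2 ^ m"
  have "\<bar>t - pval x j\<bar> \<le> 1 / 2 ^ j" if "j \<le> m" for j
    using that
  proof (induction rule: inc_induct)
    case (step j)
    have "x (Suc j) \<noteq> None" using S0_down[OF x(1,2)] step by simp
    then obtain b where b: "x (Suc j) = Some b" by blast
    then have "\<bar>of_int b\<bar> \<le> (1 :: real)" using S0_digit[OF x(1) b] by auto
    then have "\<bar>of_int b / 2 ^ Suc j\<bar> \<le> (1 / 2 ^ Suc j :: real)" by (simp add: divide_right_mono)
    moreover have "pval x (Suc j) = pval x j + of_int b / 2 ^ Suc j" using b by (simp add: pval_def dval_Suc)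
    moreover have "(1 / 2 ^ j :: real) = 1 / 2 ^ Suc j + 1 / 2 ^ Suc j" by simp
    ultimately show ?case using step.IH by linarith
  qed (use m in simp)
  moreover have "j \<le> m" if "x j \<noteq> None" for j using S0_down[OF x(1) that, of "Suc m"] x(3) by fastforce
  ultimately show "fits x t" unfolding fits_def by blast
qed (use x in \<open>auto simp: fits_def\<close>)

lemma S0_fin_last:
  assumes "x \<in> S0" "finite (dom x)" "x \<noteq> Map.empty"
  obtains m where "x m \<noteq> None" "x (Suc m) = None"
proof -
  have ne: "dom x \<noteq> {}" using assms(3) by simp
  show thesis
  proof (rule that)
    show "x (Max (dom x)) \<noteq> None" using Max_in[OF assms(2) ne] by blast
    show "x (Suc (Max (dom x))) = None" using Max_ge[OF assms(2), of "Suc (Max (dom x))"] by (metis Suc_n_not_le_n domIff)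
  qed
qed

lemma pval_grid: "m \<le> N \<Longrightarrow> \<exists>a :: int. pval x m = of_int a / 2 ^ N"
proof -
  have "\<exists>a :: int. pval x m = of_int a / 2 ^ m" for m
  proof (induction m)
    case 0 then show ?case by (auto simp: pval_def dval_def)
  next
    case (Suc m)
    then obtain a :: int where "pval x m = of_int a / 2 ^ m" by blast
    then have "pval x (Suc m) = of_int (2 * a + the (x (Suc m))) / 2 ^ Suc m"
      by (simp add: pval_def dval_Suc add_divide_distrib)
    then show ?case by blast
  qed
  then obtain a :: int where a: "pval x m = of_int a / 2 ^ m" by blast
  assume "m \<le> N"
  then have "(2 :: real) ^ N = 2 ^ m * 2 ^ (N - m)" by (simp flip: power_add)
  then have "pval x m = of_int (a * 2 ^ (N - m)) / 2 ^ N" using a by simp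
  then show ?thesis by blast
qed

lemma fits_grid:
  assumes x: "x \<in> S0" "finite (dom x)" and N: "\<And>j. x j \<noteq> None \<Longrightarrow> j \<le> N"
    and ne: "x \<noteq> Map.empty"
  obtains a c :: int where "\<And>t. fits x t \<longleftrightarrow> of_int a / 2 ^ N \<le> t \<and> t \<le> of_int c / 2 ^ N"
proof -
  obtain m where m: "x m \<noteq> None" "x (Suc m) = None" using S0_fin_last[OF x ne] by blast
  obtain a :: int where a: "pval x m = of_int a / 2 ^ N" using pval_grid N m(1) by blast
  have "(2 :: real) ^ N = 2 ^ m * 2 ^ (N - m)" using N[OF m(1)] by (simp flip: power_add)
  then have e: "1 / 2 ^ m = (of_int (2 ^ (N - m)) / 2 ^ N :: real)" by simp
  have "fits x t \<longleftrightarrow> of_int (a - 2 ^ (N - m)) / 2 ^ N \<le> t \<and> t \<le> of_int (a + 2 ^ (N - m)) / 2 ^ N" for t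
    unfolding fits_last[OF x(1) m] a e by (auto simp: abs_le_iff diff_divide_distrib add_divide_distrib)
  then show thesis by (rule that)
qed

text \<open>Fitting a prescribed prefix is a closed condition on \<open>g y\<close>, while
  separation yields clopen sets only with some slack. Passing to \<open>flat N (g y)\<close> absorbs
  the slack, because the interval ends are multiples of \<open>1 / 2 ^ N\<close>. A prefix is then
  enforced on a clopen set that contains the required arguments and on which it still fits the new
  value.\<close>

lemma S_prefix_lift:
  assumes d: "\<And>j. j < k \<Longrightarrow> S.dens j" and sp: "sepa (S.T k) (S.conv k)"
    and u: "finite u" "u \<subseteq> S.K k \<times> S0_fin" "S.presents k u f"
    and g: "scont (S.conv k) g" "\<And>y z. \<lbrakk>y \<in> S.T k; z \<in> S.T k; S.eqv k y z\<rbrakk> \<Longrightarrow> g y = g z"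
      "\<And>p b y. \<lbrakk>(p, b) \<in> u; y \<in> S.T k; S.fle p y\<rbrakk> \<Longrightarrow> fits b (g y)"
    and N: "\<And>p b j. \<lbrakk>(p, b) \<in> u; b j \<noteq> None\<rbrakk> \<Longrightarrow> j \<le> N"
  shows "\<exists>F. S.cont k F \<and> (\<forall>y\<in>S.T k. S_val (F y) = flat N (g y)) \<and>
    (\<forall>(p, b)\<in>u. \<forall>y\<in>S.T k. S.fle p y \<longrightarrow> b \<subseteq>\<^sub>m F y)"
proof -
  have ok: "S.conv_ok k" by (rule S.conv_okI[OF d])
  have uK: "p \<in> S.K k" "b \<in> S0" "finite (dom b)" if "(p, b) \<in> u" for p b using u(2) that by auto
  let ?g1 = "\<lambda>y. flat N (g y)"
  have sg1: "scont (S.conv k) ?g1"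
    unfolding scont_def using continuous_on_tendsto_compose[OF continuous_flat scontD[OF g(1)]] by simp
  have "\<exists>U. sdisc (S.conv k) U \<and> (\<forall>y\<in>S.T k. (fits b (g y) \<longrightarrow> U y) \<and> (U y \<longrightarrow> fits b (?g1 y)))" if pb: "(p, b) \<in> u" for p b
  proof (cases "b = Map.empty")
    case True
    then show ?thesis by (intro exI[of _ "\<lambda>_. True"]) (auto simp: sdisc_const fits_def)
  next
    case False
    obtain a c :: int where ac: "\<And>t. fits b t \<longleftrightarrow> of_int a / 2 ^ N \<le> t \<and> t \<le> of_int c / 2 ^ N"
      using fits_grid[OF uK(2,3)[OF pb] N[OF pb] False] by blast
    \<comment> \<open>The amount by which \<open>g y\<close> leaves the interval of
      \<open>b\<close>; the slack \<open>1/4 / 2 ^ N\<close> is the one that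
      \<open>flat_bounds\<close> allows.\<close>
    let ?m = "\<lambda>y. max (of_int a / 2 ^ N - g y) (g y - of_int c / 2 ^ N)"
    have sm: "scont (S.conv k) ?m" using g(1) unfolding scont_def by (auto intro!: tendsto_max tendsto_intros)
    obtain U where U: "sdisc (S.conv k) U" "\<And>y. \<lbrakk>y \<in> S.T k; ?m y \<le> 0\<rbrakk> \<Longrightarrow> U y"
      "\<And>y. \<lbrakk>y \<in> S.T k; U y\<rbrakk> \<Longrightarrow> ?m y < 1/4 / 2 ^ N"
      by (rule sepa_between[OF sp sm, of 0 "1/4 / 2 ^ N"]) auto
    have "fits b (?g1 y)" if "y \<in> S.T k" "U y" for y
    proof -
      have "of_int a / 2 ^ N - g y < 1/4 / 2 ^ N" "g y - of_int c / 2 ^ N < 1/4 / 2 ^ N" using U(3)[OF that] by auto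
      then have "(of_int a - 1/4) / 2 ^ N \<le> g y" "g y \<le> (of_int c + 1/4) / 2 ^ N"
        unfolding diff_divide_distrib add_divide_distrib by linarith+
      then show ?thesis unfolding ac using flat_bounds by blast
    qed
    then show ?thesis using U(1,2) ac by (intro exI[of _ U]) auto
  qed
  note U_ex = this
  define RU where "RU = (\<lambda>i U. i \<in> u \<longrightarrow> sdisc (S.conv k) U \<and>
    (\<forall>y\<in>S.T k. (fits (snd i) (g y) \<longrightarrow> U y) \<and> (U y \<longrightarrow> fits (snd i) (?g1 y))))"
  have "\<exists>U. RU i U" for i unfolding RU_def using U_ex[of "fst i" "snd i"] by auto
  then obtain U where "\<And>i. RU i (U i)" by metis
  then have U: "\<And>i. i \<in> u \<Longrightarrow> sdisc (S.conv k) (U i)"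
    "\<And>i y. \<lbrakk>i \<in> u; y \<in> S.T k; fits (snd i) (g y)\<rbrakk> \<Longrightarrow> U i y" "\<And>i y. \<lbrakk>i \<in> u; y \<in> S.T k; U i y\<rbrakk> \<Longrightarrow> fits (snd i) (?g1 y)"
    unfolding RU_def by blast+
  let ?nub = "\<lambda>p q. \<not> (\<exists>z\<in>S_dom k. S.fle p z \<and> S.fle q z)"
  define R where "R = (\<lambda>p q w. p \<in> S.K k \<longrightarrow> q \<in> S.K k \<longrightarrow> ?nub p q \<longrightarrow> sdisc (S.conv k) w \<and>
    (\<forall>y\<in>S.T k. (S.fle p y \<longrightarrow> w y) \<and> (S.fle q y \<longrightarrow> \<not> w y)))"
  have "\<forall>p q. \<exists>w. R p q w" unfolding R_def using S_test[OF d] by blast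
  then obtain w where "\<And>p q. R p q (w p q)" by metis
  then have w: "\<And>p q. \<lbrakk>p \<in> S.K k; q \<in> S.K k; ?nub p q\<rbrakk> \<Longrightarrow> sdisc (S.conv k) (w p q)"
    "\<And>p q y. \<lbrakk>p \<in> S.K k; q \<in> S.K k; ?nub p q; y \<in> S.T k; S.fle p y\<rbrakk> \<Longrightarrow> w p q y"
    "\<And>p q y. \<lbrakk>p \<in> S.K k; q \<in> S.K k; ?nub p q; y \<in> S.T k; S.fle q y\<rbrakk> \<Longrightarrow> \<not> w p q y"
    unfolding R_def by blast+
  \<comment> \<open>Step \<open>i\<close> is enforced only where the tests favour it in both orders
    against every step with incompatible argument. So two such steps are never enforced at the same
    \<open>y\<close>, while all total arguments above \<open>fst i\<close> qualify.\<close>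
  define V where "V = (\<lambda>i y. U i y \<and> \<not> (\<exists>j\<in>{j \<in> u. ?nub (fst i) (fst j)}. \<not> (w (fst i) (fst j) y \<and> \<not> w (fst j) (fst i) y)))"
  have sV: "sdisc (S.conv k) (V i)" if i: "i \<in> u" for i
  proof -
    have "sdisc (S.conv k) (\<lambda>y. \<exists>j\<in>{j \<in> u. ?nub (fst i) (fst j)}. \<not> (w (fst i) (fst j) y \<and> \<not> w (fst j) (fst i) y))"
    proof (rule sdisc_ex)
      fix j assume "j \<in> {j \<in> u. ?nub (fst i) (fst j)}"
      then have j: "j \<in> u" "?nub (fst i) (fst j)" "?nub (fst j) (fst i)" by auto
      have K: "fst i \<in> S.K k" "fst j \<in> S.K k" using u(2) i j(1) by auto
      show "sdisc (S.conv k) (\<lambda>y. \<not> (w (fst i) (fst j) y \<and> \<not> w (fst j) (fst i) y))"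
        by (rule sdisc_comp2[OF w(1)[OF K j(2)] w(1)[OF K(2,1) j(3)]])
    qed (use u(1) in simp)
    then show ?thesis unfolding V_def by (rule sdisc_comp2[OF U(1)[OF i]])
  qed
  have comp: "b \<subseteq>\<^sub>m c \<or> c \<subseteq>\<^sub>m b" if i: "(p, b) \<in> u" "(q, c) \<in> u" "V (p, b) y" "V (q, c) y" for p b q c y
  proof -
    have "\<not> ?nub p q"
    proof
      assume n: "?nub p q"
      have "w p q y"
      proof (rule ccontr)
        assume no: "\<not> w p q y"
        have "(q, c) \<in> {j \<in> u. ?nub (fst (p, b)) (fst j)}" using i(2) n by simp
        moreover have "\<not> (w (fst (p, b)) (fst (q, c)) y \<and> \<not> w (fst (q, c)) (fst (p, b)) y)" using no by simp
        ultimately show False using i(3) unfolding V_def by blast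
      qed
      moreover have "\<not> w p q y"
      proof
        assume no: "w p q y"
        have "(p, b) \<in> {j \<in> u. ?nub (fst (q, c)) (fst j)}" using i(1) n by auto
        moreover have "\<not> (w (fst (q, c)) (fst (p, b)) y \<and> \<not> w (fst (p, b)) (fst (q, c)) y)" using no by simp
        ultimately show False using i(4) unfolding V_def by blast
      qed
      ultimately show False by blast
    qed
    then obtain z where z: "z \<in> S_dom k" "S.fle p z" "S.fle q z" by blast
    have fD: "f \<in> S_dom (Suc k)" using u(3) unfolding S.presents_def by blast
    have "b \<subseteq>\<^sub>m app f z"
      by (rule map_le_trans[OF S.presents_leS[OF u(3) i(1)] S.appM[OF fD S.X.K_D[OF uK(1)[OF i(1)]] z(1,2)]])
    moreover have "c \<subseteq>\<^sub>m app f z"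
      by (rule map_le_trans[OF S.presents_leS[OF u(3) i(2)] S.appM[OF fD S.X.K_D[OF uK(1)[OF i(2)]] z(1,3)]])
    ultimately show ?thesis using S0_comparable[OF uK(2)[OF i(1)] uK(2)[OF i(2)]] by blast
  qed
  \<comment> \<open>The union of the enforced prefixes, formed digit by digit; any enforced prefix
    defined at \<open>j\<close> gives the same digit, as enforced prefixes are comparable by
    \<open>comp\<close>.\<close>
  define sel :: "((nat \<Rightarrow> int option) func \<times> (nat \<Rightarrow> int option) \<Rightarrow> bool) \<Rightarrow> nat \<Rightarrow> int option" where
    "sel = (\<lambda>v j. if \<exists>i. v i \<and> snd i j \<noteq> None then snd (SOME i. v i \<and> snd i j \<noteq> None) j else None)"
  define s where "s = (\<lambda>y. sel (\<lambda>i. if i \<in> u then V i y else False))"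
  have s_eq: "s y j = b j" if "(p, b) \<in> u" "V (p, b) y" "b j \<noteq> None" for y j p b
  proof -
    let ?P = "\<lambda>i. (if i \<in> u then V i y else False) \<and> snd i j \<noteq> None"
    have ex: "\<exists>i. ?P i" using that by (intro exI[of _ "(p, b)"]) simp
    define i where "i = (SOME i. ?P i)"
    have i: "?P i" unfolding i_def using someI_ex[OF ex] .
    obtain q c where qc: "i = (q, c)" by force
    have "(q, c) \<in> u" "V (q, c) y" "c j \<noteq> None" using i qc by (auto split: if_splits)
    then have "c \<subseteq>\<^sub>m b \<or> b \<subseteq>\<^sub>m c" using comp that by blast
    then have "c j = b j" using map_leD[of c b j] map_leD[of b c j] that(3) \<open>c j \<noteq> None\<close> by auto
    moreover have "s y j = snd i j" unfolding s_def sel_def i_def using ex by (rule if_P)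
    ultimately show ?thesis using qc by simp
  qed
  have s_ex: "\<exists>p b. (p, b) \<in> u \<and> V (p, b) y \<and> b j \<noteq> None" if "s y j \<noteq> None" for y j
  proof -
    have "\<exists>i. (if i \<in> u then V i y else False) \<and> snd i j \<noteq> None"
      using that unfolding s_def sel_def by (meson if_not_P)
    then show ?thesis by (auto split: if_splits)
  qed
  have bs: "b \<subseteq>\<^sub>m s y" if "(p, b) \<in> u" "V (p, b) y" for p b y
    using s_eq[OF that] unfolding map_le_def by (metis domIff)
  have "\<exists>F. (\<forall>y\<in>S.T k. F y \<in> S0_max \<and> s y \<subseteq>\<^sub>m F y \<and> S_val (F y) = ?g1 y) \<and> (\<forall>j. sdisc (S.conv k) (\<lambda>y. F y j))"
  proof (rule lift[OF sp _ sg1, where c = 1 and s = s])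
    show "s y \<in> S0" if "y \<in> S.T k" for y
      unfolding S0_def mem_Collect_eq
    proof (intro conjI allI impI)
      fix i assume "s y (Suc i) \<noteq> None"
      then obtain p b where b: "(p, b) \<in> u" "V (p, b) y" "b (Suc i) \<noteq> None" using s_ex by blast
      then have "b i \<noteq> None" using S0_down[OF uK(2), of p b "Suc i" i] by simp
      then show "s y i \<noteq> None" using s_eq b by auto
    next
      fix i c assume c: "s y (Suc i) = Some c"
      then obtain p b where b: "(p, b) \<in> u" "V (p, b) y" "b (Suc i) \<noteq> None" using s_ex[of y "Suc i"] by auto
      then have "b (Suc i) = Some c" using s_eq c by auto
      then show "c \<in> {-1, 0, 1}" using S0_digit uK b by blast
    qed
    show "sdisc (S.conv k) (\<lambda>y. s y j)" for j
      unfolding s_def by (rule sdisc_fin[OF u(1) sV, where h = "\<lambda>v. sel v j"])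
    show "\<bar>?g1 y - pval (s y) j\<bar> \<le> 1 / 2 ^ j" if y: "y \<in> S.T k" and j: "s y j \<noteq> None" for y j
    proof -
      obtain p b where b: "(p, b) \<in> u" "V (p, b) y" "b j \<noteq> None" using s_ex[OF j] by blast
      have "pval (s y) j = pval b j" by (rule pval_map_le[OF uK(2)[OF b(1)] bs[OF b(1,2)] b(3)])
      moreover have "fits b (?g1 y)" using U(3)[OF b(1) y] b(2) unfolding V_def by simp
      ultimately show ?thesis using b(3) unfolding fits_def by simp
    qed
  next
    show "x \<in> S.T k" if "S.conv k xs x" for xs x using S.conv_T[OF that] by blast
  qed auto
  then obtain F where F: "\<And>y. y \<in> S.T k \<Longrightarrow> F y \<in> S0_max" "\<And>y. y \<in> S.T k \<Longrightarrow> s y \<subseteq>\<^sub>m F y"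
    "\<And>y. y \<in> S.T k \<Longrightarrow> S_val (F y) = ?g1 y" "\<And>j. sdisc (S.conv k) (\<lambda>y. F y j)" by blast
  have "S.cont k F"
    unfolding S.cont_def
  proof (intro conjI ballI allI impI)
    show "F y \<in> S0" if "y \<in> S.T k" for y using F(1)[OF that] by (simp add: S0_max_def)
    show "S_eq0 (F y) (F z)" if "y \<in> S.T k" "z \<in> S.T k" "S.eqv k y z" for y z
      using F(1,3) that g(2)[OF that] by (simp add: S_eq0_iff)
    show "\<forall>\<^sub>F n in sequentially. F (ys n) i = F y i"
      if "y \<in> S.T k" "\<forall>n. ys n \<in> S.T k" "S.scv k ys y" for ys y i
      using sdiscD[OF F(4), OF S.scv_conv[OF ok that(1) spec[OF that(2)] that(3)]] .
  qed
  moreover have "b \<subseteq>\<^sub>m F y" if pb: "(p, b) \<in> u" and y: "y \<in> S.T k" "S.fle p y" for p b y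
  proof -
    have "w p q y \<and> \<not> w q p y" if "(q, c) \<in> u" "?nub p q" for q c
      using w(2)[OF uK(1)[OF pb] uK(1)[OF that(1)] that(2) y] w(3)[OF uK(1)[OF that(1)] uK(1)[OF pb] _ y] that(2) by blast
    then have "V (p, b) y" unfolding V_def using U(2)[OF pb y(1)] g(3)[OF pb y] by auto
    then show ?thesis using map_le_trans[OF bs[OF pb] F(2)[OF y(1)]] by blast
  qed
  ultimately show ?thesis using F(3) by blast
qed

lemma S_dens_0: "S.dens 0"
proof -
  have "\<exists>y\<in>S.T 0. \<exists>z\<in>S.T 0. S.fle p y \<and> S.fle q z \<and> S.eqv 0 y z"
    if pq: "p \<in> S.K 0" "q \<in> S.K 0" "S_sim 0 p q" for p q
  proof -
    obtain a b where ab: "p = Val a" "q = Val b" using pq by auto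
    then have "S_sim0 a b" using pq(3) by simp
    then obtain y z where "y \<in> S0_max" "z \<in> S0_max" "a \<subseteq>\<^sub>m y" "b \<subseteq>\<^sub>m z" "S_val y = S_val z"
      unfolding S_sim0_def by blast
    then show ?thesis using ab by (intro bexI[of _ "Val y"] bexI[of _ "Val z"]) (auto simp: S_T0 S_eq0_iff)
  qed
  moreover have "\<exists>y\<in>S.T 0. S.fle p y" if p: "p \<in> S.K 0" for p
  proof -
    obtain a where a: "p = Val a" "a \<in> S0" using p by auto
    then obtain y where "y \<in> S0_max" "a \<subseteq>\<^sub>m y" using S0_ext by blast
    then show ?thesis using a by (intro bexI[of _ "Val y"]) (auto simp: S_T0)
  qed
  ultimately show ?thesis unfolding S.dens_def by blast
qed

text \<open>One extensional function \<open>h\<close> is chosen to meet the interval bounds of the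
  steps of both \<open>f\<close> and \<open>g\<close>. Lifting it twice with the same
  \<open>N\<close>, once along each set of steps, gives digit functions with the common value
  \<open>flat N (h y)\<close>, hence equivalent extensions.\<close>

lemma S_dens_Suc:
  assumes d: "\<And>j. j \<le> k \<Longrightarrow> S.dens j" and sp: "sepa (S.T k) (S.conv k)"
  shows "S.dens (Suc k)"
proof (rule S.dens_SucI)
  show "S.dens k" using d by blast
  have dj: "\<And>j. j < k \<Longrightarrow> S.dens j" using d by simp
  fix f g u w assume u: "finite u" "u \<subseteq> S.K k \<times> S0_fin" "S.presents k u f"
    and w: "finite w" "w \<subseteq> S.K k \<times> S0_fin" "S.presents k w g" and fg: "f = g \<or> S_sim (Suc k) f g"
  have fD: "f \<in> S_dom (Suc k)" "g \<in> S_dom (Suc k)" using u(3) w(3) unfolding S.presents_def by blast+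
  have ff: "S_sim (Suc k) h h" if "h \<in> S_dom (Suc k)" for h using S.appS[OF that] by auto
  have sim: "S_sim (Suc k) h h'" if "h \<in> {f, g}" "h' \<in> {f, g}" for h h'
    using that fg ff[OF fD(1)] ff[OF fD(2)] S_sim_sym[of "Suc k" f g] by blast
  have uw: "\<exists>h\<in>{f, g}. b \<subseteq>\<^sub>m app h p" "p \<in> S.K k" "b \<in> S0" "finite (dom b)" if "(p, b) \<in> u \<union> w" for p b
    using that u(2) w(2) S.presents_leS[OF u(3)] S.presents_leS[OF w(3)] by auto
  \<comment> \<open>Index of the last digit, whose interval decides by
    \<open>fits_last\<close>.\<close>
  define m where "m = (\<lambda>b :: nat \<Rightarrow> int option. SOME m. b m \<noteq> None \<and> b (Suc m) = None)"
  have m: "b (m b) \<noteq> None" "b (Suc (m b)) = None" if "b \<in> S0" "finite (dom b)" "b \<noteq> Map.empty" for b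
  proof -
    have "\<exists>m. b m \<noteq> None \<and> b (Suc m) = None" by (rule S0_fin_last[OF that]) blast
    then have "b (m b) \<noteq> None \<and> b (Suc (m b)) = None" unfolding m_def by (rule someI_ex)
    then show "b (m b) \<noteq> None" "b (Suc (m b)) = None" by blast+
  qed
  define I where "I = {(p, b) \<in> u \<union> w. b \<noteq> Map.empty}"
  have fb: "fits b t \<longleftrightarrow> pval b (m b) - 1 / 2 ^ m b \<le> t \<and> t \<le> pval b (m b) + 1 / 2 ^ m b" if "(p, b) \<in> I" for p b t
  proof -
    have b: "b \<in> S0" "finite (dom b)" "b \<noteq> Map.empty" using that uw(3,4)[of p b] unfolding I_def by auto
    show ?thesis unfolding fits_last[OF b(1) m[OF b]] by (auto simp: abs_le_iff)
  qed
  have "finite I" by (rule finite_subset[of _ "u \<union> w"]) (use u(1) w(1) in \<open>auto simp: I_def\<close>)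
  then have "\<exists>h. scont (S.conv k) h \<and> (\<forall>y y'. y \<in> S.T k \<and> y' \<in> S.T k \<and> S.eqv k y y' \<longrightarrow> h y = h y') \<and>
    (\<forall>i\<in>I. \<forall>y. y \<in> S.T k \<and> S.fle (fst i) y \<longrightarrow>
      pval (snd i) (m (snd i)) - 1 / 2 ^ m (snd i) \<le> h y \<and> h y \<le> pval (snd i) (m (snd i)) + 1 / 2 ^ m (snd i))"
  proof (rule lattice_select)
    fix i :: "(nat \<Rightarrow> int option) func \<times> (nat \<Rightarrow> int option)"
    have "(0 :: real) < 2 ^ m (snd i)" by simp
    then have "(0 :: real) \<le> 1 / 2 ^ m (snd i)" by simp
    then show "pval (snd i) (m (snd i)) - 1 / 2 ^ m (snd i) \<le> pval (snd i) (m (snd i)) + 1 / 2 ^ m (snd i)" by linarith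
  next
    fix i j assume ij: "i \<in> I" "j \<in> I"
      "pval (snd j) (m (snd j)) + 1 / 2 ^ m (snd j) < pval (snd i) (m (snd i)) - 1 / 2 ^ m (snd i)"
    obtain p b q c where pq: "i = (p, b)" "j = (q, c)" by (metis surj_pair)
    have i: "(p, b) \<in> u \<union> w" "(q, c) \<in> u \<union> w" using ij pq unfolding I_def by auto
    have K: "p \<in> S.K k" "q \<in> S.K k" using uw i by blast+
    \<comment> \<open>Conflicting bounds make the prescribed prefixes unrelated. As \<open>f\<close>
      and \<open>g\<close> are related to each other and to themselves, the step arguments must be
      unrelated too, and \<open>S_sim_test\<close> separates them.\<close>
    have "\<not> S_sim0 b c" using ij pq fb S_sim0_iff[of b c] uw i by fastforce
    moreover obtain h h' where h: "h \<in> {f, g}" "h' \<in> {f, g}" "b \<subseteq>\<^sub>m app h p" "c \<subseteq>\<^sub>m app h' q" using uw(1) i by blast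
    ultimately have "\<not> S_sim0 (app h p) (app h' q)"
      using map_le_trans unfolding S_sim0_def by blast
    then have "\<not> S_sim k p q" using sim[OF h(1,2)] S.X.K_D K by auto
    from S_sim_test(1)[OF dj K this]
    show "\<exists>w. scont (S.conv k) w \<and> (\<forall>y y'. y \<in> S.T k \<and> y' \<in> S.T k \<and> S.eqv k y y' \<longrightarrow> w y = w y') \<and>
      (\<forall>y. y \<in> S.T k \<and> S.fle (fst i) y \<longrightarrow> 1 \<le> w y) \<and>
      (\<forall>y. y \<in> S.T k \<and> S.fle (fst j) y \<longrightarrow> w y \<le> 0)"
      unfolding pq by auto
  qed
  then obtain h where h: "scont (S.conv k) h" "\<And>y y'. \<lbrakk>y \<in> S.T k; y' \<in> S.T k; S.eqv k y y'\<rbrakk> \<Longrightarrow> h y = h y'"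
    "\<And>p b y. \<lbrakk>(p, b) \<in> I; y \<in> S.T k; S.fle p y\<rbrakk> \<Longrightarrow>
      pval b (m b) - 1 / 2 ^ m b \<le> h y \<and> h y \<le> pval b (m b) + 1 / 2 ^ m b" by force
  have hf: "fits b (h y)" if "(p, b) \<in> u \<union> w" "y \<in> S.T k" "S.fle p y" for p b y
  proof (cases "b = Map.empty")
    case False
    then have "(p, b) \<in> I" using that(1) unfolding I_def by blast
    then show ?thesis using fb h(3) that by blast
  qed (simp add: fits_def)
  define N where "N = Max (insert 0 (\<Union>(p, b)\<in>u \<union> w. dom b))"
  have "finite (insert 0 (\<Union>(p, b)\<in>u \<union> w. dom b))" using u(1) w(1) uw(4) by auto
  then have N: "j \<le> N" if "(p, b) \<in> u \<union> w" "b j \<noteq> None" for p b j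
    unfolding N_def using that by (intro Max_ge) auto
  have "\<exists>F. S.cont k F \<and> (\<forall>y\<in>S.T k. S_val (F y) = flat N (h y)) \<and>
    (\<forall>(p, b)\<in>u. \<forall>y\<in>S.T k. S.fle p y \<longrightarrow> b \<subseteq>\<^sub>m F y)"
    by (rule S_prefix_lift[OF dj sp u h(1)]) (use h(2) hf N in blast)+
  then obtain F where F: "S.cont k F" "\<forall>y\<in>S.T k. S_val (F y) = flat N (h y)"
    "\<forall>(p, b)\<in>u. \<forall>y\<in>S.T k. S.fle p y \<longrightarrow> b \<subseteq>\<^sub>m F y" by blast
  have "\<exists>G. S.cont k G \<and> (\<forall>y\<in>S.T k. S_val (G y) = flat N (h y)) \<and>
    (\<forall>(p, b)\<in>w. \<forall>y\<in>S.T k. S.fle p y \<longrightarrow> b \<subseteq>\<^sub>m G y)"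
    by (rule S_prefix_lift[OF dj sp w h(1)]) (use h(2) hf N in blast)+
  then obtain G where G: "S.cont k G" "\<forall>y\<in>S.T k. S_val (G y) = flat N (h y)"
    "\<forall>(p, b)\<in>w. \<forall>y\<in>S.T k. S.fle p y \<longrightarrow> b \<subseteq>\<^sub>m G y" by blast
  have "S_eq0 (F y) (G y)" if "y \<in> S.T k" for y
    using F(2) G(2) S.contD[OF F(1) that] S.contD[OF G(1) that] that by (simp add: S_eq0_iff)
  then show "\<exists>F G. S.cont k F \<and> S.cont k G \<and> (\<forall>y\<in>S.T k. S_eq0 (F y) (G y)) \<and>
    (\<forall>(p, b)\<in>u. \<forall>y\<in>S.T k. S.fle p y \<longrightarrow> b \<subseteq>\<^sub>m F y) \<and>
    (\<forall>(p, b)\<in>w. \<forall>y\<in>S.T k. S.fle p y \<longrightarrow> b \<subseteq>\<^sub>m G y)"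
    using F G by blast
qed

section \<open>A retraction onto the extensional functionals\<close>

lemma S_joinable_app:
  assumes "f \<in> S.T (Suc k)" "S.joinable k x y" "x \<in> S.T k" "y \<in> S.T k"
  shows "app f x = app f y"
proof -
  obtain z where "z \<in> S0" "app f x \<subseteq>\<^sub>m z" "app f y \<subseteq>\<^sub>m z"
    using S.joinable_app[OF S.T_D[OF assms(1)] assms(2) S.T_D[OF assms(3)] S.T_D[OF assms(4)]] by blast
  then show ?thesis using S0_max_le S_app_max[OF assms(1)] assms(3,4) by metis
qed

text \<open>Compact approximations of related arguments extend, by density, to equivalent total
  arguments, where equivalent functionals have related values; \<open>S_sim0_closed\<close> collects
  what this says about all finite prefixes.\<close>

lemma S_eqv_sim:
  assumes d: "\<And>j. j < k \<Longrightarrow> S.dens j" and xy: "x \<in> S.T k" "y \<in> S.T k" "S.eqv k x y"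
  shows "S_sim k x y"
proof (cases k)
  case 0
  then show ?thesis using xy by (simp add: S_eq0_def)
next
  case (Suc m)
  have D: "x \<in> S_dom (Suc m)" "y \<in> S_dom (Suc m)" using xy S.T_D Suc by blast+
  have "S_sim0 (app x x1) (app y x2)" if x12: "x1 \<in> S_dom m" "x2 \<in> S_dom m" "S_sim m x1 x2" for x1 x2
  proof (rule S_sim0_closed[OF S.appB[OF D(1) x12(1)] S.appB[OF D(2) x12(2)]])
    fix b c assume bc: "b \<in> S0" "finite (dom b)" "c \<in> S0" "finite (dom c)" "b \<subseteq>\<^sub>m app x x1" "c \<subseteq>\<^sub>m app y x2"
    obtain c1 where c1: "c1 \<in> S.K m" "S.fle c1 x1" "b \<subseteq>\<^sub>m app x c1"
      using S.appI[OF D(1) x12(1), of b] bc by blast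
    obtain c2 where c2: "c2 \<in> S.K m" "S.fle c2 x2" "c \<subseteq>\<^sub>m app y c2"
      using S.appI[OF D(2) x12(2), of c] bc by blast
    have "S_sim m c1 c2"
      using S.sim_down[OF x12(3) S.X.K_D[OF c1(1)] S.X.K_D[OF c2(1)] x12(1,2) c1(2) c2(2)] .
    then obtain y1 y2 where y: "y1 \<in> S.T m" "y2 \<in> S.T m" "S.fle c1 y1" "S.fle c2 y2" "S.eqv m y1 y2"
      using d[of m] Suc c1(1) c2(1) unfolding S.dens_def by blast
    have "b \<subseteq>\<^sub>m app x y1" by (rule map_le_trans[OF c1(3) S.appM[OF D(1) S.X.K_D[OF c1(1)] S.T_D[OF y(1)] y(3)]])
    moreover have "c \<subseteq>\<^sub>m app y y2" by (rule map_le_trans[OF c2(3) S.appM[OF D(2) S.X.K_D[OF c2(1)] S.T_D[OF y(2)] y(4)]])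
    moreover have "S_sim0 (app x y1) (app y y2)"
      using S.eqv_app[of m x y y1 y2] xy(3) y Suc by (simp add: S_eq0_def)
    ultimately show "S_sim0 b c" unfolding S_sim0_def by (meson map_le_trans)
  qed
  then show ?thesis unfolding Suc by simp
qed

text \<open>A single step always respects \<open>S_sim\<close>: at any two arguments its values are
  below \<open>b\<close> and thus below a common maximal element.\<close>

lemma S_step:
  assumes p: "p \<in> S.K k" and b: "b \<in> S0" "finite (dom b)"
  obtains g where "g \<in> S.K (Suc k)" "S.presents k {(p, b)} g"
proof -
  have "\<exists>g. S.presents k {(p, b)} g"
  proof (rule S.presents_exS)
    show "\<exists>z\<in>S0. \<forall>(q, c)\<in>{(p, b)}. S.fle q x \<longrightarrow> c \<subseteq>\<^sub>m z" for x
      using b(1) by (intro bexI[of _ b]) simp_all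
    fix x y i j assume *: "i \<in> S0" "j \<in> S0" 
      "\<And>z. z \<in> S0 \<Longrightarrow> i \<subseteq>\<^sub>m z \<longleftrightarrow> (\<forall>(q, c)\<in>{(p, b)}. S.fle q x \<longrightarrow> c \<subseteq>\<^sub>m z)"
      "\<And>z. z \<in> S0 \<Longrightarrow> j \<subseteq>\<^sub>m z \<longleftrightarrow> (\<forall>(q, c)\<in>{(p, b)}. S.fle q y \<longrightarrow> c \<subseteq>\<^sub>m z)"
    have "i \<subseteq>\<^sub>m b" "j \<subseteq>\<^sub>m b" using *(3)[OF b(1)] *(4)[OF b(1)] by auto
    moreover obtain z where z: "z \<in> S0_max" "b \<subseteq>\<^sub>m z" using S0_ext[OF b(1)] by blast
    ultimately have "i \<subseteq>\<^sub>m z" "j \<subseteq>\<^sub>m z" using map_le_trans by blast+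
    then show "S_sim0 i j" unfolding S_sim0_def using z(1) by blast
  qed (use p b in auto)
  then obtain g where g: "S.presents k {(p, b)} g" by blast
  have "g \<in> S.K (Suc k)" unfolding S.K.simps using g p b by (intro CollectI exI[of _ "{(p, b)}"]) simp
  then show thesis using that g by blast
qed

text \<open>Compatible base elements form chains, so pairwise bounds suffice.\<close>

lemma S_coherent:
  assumes P: "finite P" "P \<subseteq> S.K (Suc k)"
    and bd: "\<And>p q. \<lbrakk>p \<in> P; q \<in> P\<rbrakk> \<Longrightarrow> \<exists>z\<in>S_dom (Suc k). S.fle p z \<and> S.fle q z"
  shows "\<exists>g\<in>S.K (Suc k). \<forall>p\<in>P. S.fle p g"
proof -
  have "\<forall>p\<in>P. \<exists>u. finite u \<and> u \<subseteq> S.K k \<times> S0_fin \<and> S.presents k u p" using P(2) by auto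
  from bchoice[OF this] obtain u where u: "\<And>p. p \<in> P \<Longrightarrow> finite (u p)" "\<And>p. p \<in> P \<Longrightarrow> u p \<subseteq> S.K k \<times> S0_fin"
    "\<And>p. p \<in> P \<Longrightarrow> S.presents k (u p) p" by blast
  define U where "U = (\<Union>p\<in>P. u p)"
  have PD: "p \<in> S_dom (Suc k)" if "p \<in> P" for p using that P(2) S.X.K_D by blast
  have U: "finite U" "U \<subseteq> S.K k \<times> S0_fin" unfolding U_def using P(1) u(1,2) by auto
  have Ule: "(\<forall>(c, b)\<in>U. S.fle c x \<longrightarrow> b \<subseteq>\<^sub>m z) \<longleftrightarrow> (\<forall>p\<in>P. app p x \<subseteq>\<^sub>m z)" if "x \<in> S_dom k" "z \<in> S0" for x z
  proof -
    have "(\<forall>p\<in>P. app p x \<subseteq>\<^sub>m z) \<longleftrightarrow> (\<forall>p\<in>P. \<forall>(c, b)\<in>u p. S.fle c x \<longrightarrow> b \<subseteq>\<^sub>m z)"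
      using S.presents_appS[OF u that] by blast
    then show ?thesis unfolding U_def by blast
  qed
  have comp: "app p x \<subseteq>\<^sub>m app q x \<or> app q x \<subseteq>\<^sub>m app p x" if pq: "p \<in> P" "q \<in> P" and x: "x \<in> S_dom k" for p q x
  proof -
    obtain z where z: "z \<in> S_dom (Suc k)" "S.fle p z" "S.fle q z" using bd[OF pq] by blast
    have "app p x \<subseteq>\<^sub>m app z x" "app q x \<subseteq>\<^sub>m app z x"
      using S.fleS[OF PD[OF pq(1)] z(1)] S.fleS[OF PD[OF pq(2)] z(1)] z x by blast+
    then show ?thesis using S0_comparable[OF S.appB[OF PD[OF pq(1)] x] S.appB[OF PD[OF pq(2)] x]] by blast
  qed
  \<comment> \<open>At every argument the values form a finite chain, whose largest element is the
    supremum. The condition on \<open>S_sim\<close> then concerns only two members of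
    \<open>P\<close>, and these have a common bound.\<close>
  have top: "\<exists>p\<in>P. \<forall>q\<in>P. app q x \<subseteq>\<^sub>m app p x" if x: "x \<in> S_dom k" and ne: "P \<noteq> {}" for x
  proof -
    have "\<exists>p\<in>Q. \<forall>q\<in>Q. app q x \<subseteq>\<^sub>m app p x" if "finite Q" "Q \<noteq> {}" "Q \<subseteq> P" for Q
      using that
    proof (induction Q rule: finite_ne_induct)
      case (insert q Q)
      then obtain p where p: "p \<in> Q" "\<forall>q\<in>Q. app q x \<subseteq>\<^sub>m app p x" by blast
      have "app p x \<subseteq>\<^sub>m app q x \<or> app q x \<subseteq>\<^sub>m app p x" by (rule comp) (use p insert.prems x in blast)+
      then show ?case
      proof
        assume "app p x \<subseteq>\<^sub>m app q x"
        then have "\<forall>r\<in>insert q Q. app r x \<subseteq>\<^sub>m app q x" using p(2) map_le_trans map_le_refl by blast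
        then show ?case by blast
      next
        assume "app q x \<subseteq>\<^sub>m app p x"
        then show ?case using p by blast
      qed
    qed auto
    then show ?thesis using P(1) ne by blast
  qed
  have "\<exists>g. S.presents k U g"
  proof (rule S.presents_exS[OF U])
    fix x assume x: "x \<in> S_dom k"
    show "\<exists>z\<in>S0. \<forall>(c, b)\<in>U. S.fle c x \<longrightarrow> b \<subseteq>\<^sub>m z"
    proof (cases "P = {}")
      case False
      then obtain p where "p \<in> P" "\<forall>q\<in>P. app q x \<subseteq>\<^sub>m app p x" using top[OF x] by blast
      then show ?thesis using Ule[OF x] S.appB[OF PD x] by blast
    qed (auto simp: U_def S0_def intro!: bexI[of _ Map.empty])
  next
    fix x y i j assume xy: "x \<in> S_dom k" "y \<in> S_dom k" "S_sim k x y" and ij: "i \<in> S0" "j \<in> S0"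
      "\<And>z. z \<in> S0 \<Longrightarrow> i \<subseteq>\<^sub>m z \<longleftrightarrow> (\<forall>(c, b)\<in>U. S.fle c x \<longrightarrow> b \<subseteq>\<^sub>m z)"
      "\<And>z. z \<in> S0 \<Longrightarrow> j \<subseteq>\<^sub>m z \<longleftrightarrow> (\<forall>(c, b)\<in>U. S.fle c y \<longrightarrow> b \<subseteq>\<^sub>m z)"
    show "S_sim0 i j"
    proof (cases "P = {}")
      case True
      then have "i \<subseteq>\<^sub>m Map.empty" "j \<subseteq>\<^sub>m Map.empty" using ij(3,4)[of Map.empty] by (auto simp: U_def S0_def)
      then show ?thesis using S0_ext[OF ij(1)] map_le_trans map_le_antisym unfolding S_sim0_def by (metis map_le_empty)
    next
      case False
      obtain p q where pq: "p \<in> P" "\<forall>r\<in>P. app r x \<subseteq>\<^sub>m app p x" "q \<in> P" "\<forall>r\<in>P. app r y \<subseteq>\<^sub>m app q y"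
        using top[OF xy(1) False] top[OF xy(2) False] by blast
      have i: "i \<subseteq>\<^sub>m app p x" using ij(3)[OF S.appB[OF PD[OF pq(1)] xy(1)]] Ule[OF xy(1) S.appB[OF PD[OF pq(1)] xy(1)]] pq(2) by blast
      have j: "j \<subseteq>\<^sub>m app q y" using ij(4)[OF S.appB[OF PD[OF pq(3)] xy(2)]] Ule[OF xy(2) S.appB[OF PD[OF pq(3)] xy(2)]] pq(4) by blast
      obtain z where z: "z \<in> S_dom (Suc k)" "S.fle p z" "S.fle q z" using bd[OF pq(1,3)] by blast
      have "app p x \<subseteq>\<^sub>m app z x" "app q y \<subseteq>\<^sub>m app z y"
        using S.fleS[OF PD[OF pq(1)] z(1)] S.fleS[OF PD[OF pq(3)] z(1)] z xy by blast+
      then show ?thesis using S.appS[OF z(1) xy] i j unfolding S_sim0_def by (meson map_le_trans)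
    qed
  qed
  then obtain g where g: "S.presents k U g" by blast
  have gD: "g \<in> S_dom (Suc k)" using g unfolding S.presents_def by blast
  have "S.fle p g" if p: "p \<in> P" for p
  proof -
    have "\<forall>(c, b)\<in>u p. b \<subseteq>\<^sub>m app g c" using S.presents_leS[OF g] p unfolding U_def by blast
    then show ?thesis using u(3)[OF p] gD unfolding S.presents_def by blast
  qed
  moreover have "g \<in> S.K (Suc k)" unfolding S.K.simps using U g by blast
  ultimately show ?thesis by blast
qed

text \<open>The digit functions to be retracted: every digit is locally constant, but equivalent
  arguments may receive different values. \<open>mext\<close> singles out those that come from a
  functional.\<close>

definition mcont :: "nat \<Rightarrow> ((nat \<Rightarrow> int option) func \<Rightarrow> nat \<Rightarrow> int option) \<Rightarrow> bool" where
  "mcont k H \<longleftrightarrow> (\<forall>y\<in>S.T k. H y \<in> S0_max) \<and> (\<forall>i. sdisc (S.conv k) (\<lambda>y. H y i))"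

definition mconv :: "nat \<Rightarrow> (nat \<Rightarrow> (nat \<Rightarrow> int option) func \<Rightarrow> nat \<Rightarrow> int option) \<Rightarrow>
    ((nat \<Rightarrow> int option) func \<Rightarrow> nat \<Rightarrow> int option) \<Rightarrow> bool" where
  "mconv k Hs H \<longleftrightarrow> (\<forall>ys y i j. S.conv k ys y \<longrightarrow> filterlim i at_top sequentially \<longrightarrow>
    (\<forall>\<^sub>F n in sequentially. Hs (i n) (ys n) j = H y j))"

definition mext where
  "mext k H \<longleftrightarrow> (\<forall>y\<in>S.T k. \<forall>z\<in>S.T k. S.eqv k y z \<longrightarrow> S_val (H y) = S_val (H z))"

lemma prefix_eventually:
  assumes "finite (dom b)" "b \<subseteq>\<^sub>m x" "\<And>j. \<forall>\<^sub>F n in sequentially. xs n j = x j"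
  shows "\<forall>\<^sub>F n in sequentially. b \<subseteq>\<^sub>m xs n"
proof -
  have "\<forall>\<^sub>F n in sequentially. \<forall>j\<in>dom b. xs n j = x j"
    using assms(1,3) by (simp add: eventually_ball_finite_distrib)
  then show ?thesis by (rule eventually_mono) (use assms(2) in \<open>auto simp: map_le_def\<close>)
qed

text \<open>The realisation agrees with \<open>H\<close> digit by digit, not only in value, because
  it lies above the maximal elements \<open>H y\<close>.\<close>

lemma mcont_realize:
  assumes d: "S.dens k" and ok: "S.conv_ok k" and H: "mcont k H" "mext k H"
  shows "\<exists>f\<in>S.T (Suc k). \<forall>y\<in>S.T k. app f y = H y"
proof -
  have "S.cont k H"
    unfolding S.cont_def
  proof (intro conjI ballI allI impI)
    show "H y \<in> S0" if "y \<in> S.T k" for y using H(1) that unfolding mcont_def S0_max_def by blast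
    show "S_eq0 (H y) (H z)" if "y \<in> S.T k" "z \<in> S.T k" "S.eqv k y z" for y z
      using H that unfolding mcont_def mext_def S_eq0_iff by blast
    have sd: "sdisc (S.conv k) (\<lambda>y. H y i)" for i using H(1) unfolding mcont_def by blast
    show "\<forall>\<^sub>F n in sequentially. H (ys n) i = H y i"
      if "y \<in> S.T k" "\<forall>n. ys n \<in> S.T k" "S.scv k ys y" for ys y i
      using sdiscD[OF sd, OF S.scv_conv[OF ok that(1) spec[OF that(2)] that(3)]] .
  qed
  then obtain f where f: "f \<in> S.T (Suc k)" "\<forall>y\<in>S.T k. H y \<subseteq>\<^sub>m app f y"
    using S.realize_one(1)[OF d] by blast
  then have "app f y = H y" if "y \<in> S.T k" for y
    using S0_max_le[of "H y" "app f y"] H(1) that S.T_appB[OF f(1) that] unfolding mcont_def by blast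
  then show ?thesis using f(1) by blast
qed

text \<open>That \<open>p\<close> lies below \<open>H\<close> on all total arguments involves
  infinitely many conditions on \<open>H\<close>. It is weakened to a condition \<open>A\<close> on
  finitely many digits of \<open>H\<close>, chosen so that incompatible \<open>p\<close> and
  \<open>q\<close> still exclude each other for extensional \<open>H\<close>: unrelated ones by
  prefixes at two equivalent arguments, related ones by contradicting digits at a single
  argument.\<close>

lemma S_separating:
  assumes d: "\<And>j. j \<le> k \<Longrightarrow> S.dens j" and pq: "p \<in> S.K (Suc k)" "q \<in> S.K (Suc k)"
    "\<not> (\<exists>z\<in>S_dom (Suc k). S.fle p z \<and> S.fle q z)"
  shows "\<exists>A A'. (\<forall>H. (\<forall>y\<in>S.T k. app p y \<subseteq>\<^sub>m H y) \<longrightarrow> A H) \<and> (\<forall>H. (\<forall>y\<in>S.T k. app q y \<subseteq>\<^sub>m H y) \<longrightarrow> A' H) \<and>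
    (\<forall>H. mcont k H \<longrightarrow> mext k H \<longrightarrow> \<not> (A H \<and> A' H)) \<and>
    (\<forall>Hs H. mconv k Hs H \<longrightarrow> (\<forall>\<^sub>F n in sequentially. A (Hs n) = A H \<and> A' (Hs n) = A' H))"
proof -
  have ok: "S.conv_ok k" by (rule S.conv_okI) (use d in simp)
  have D: "p \<in> S_dom (Suc k)" "q \<in> S_dom (Suc k)" using pq S.X.K_D by blast+
  have ev: "\<forall>\<^sub>F n in sequentially. Hs n y j = H y j" if "mconv k Hs H" "y \<in> S.T k" for Hs H y and j :: nat
    using that(1)[unfolded mconv_def, rule_format, OF S.conv_const[OF ok that(2)] filterlim_ident] .
  have evp: "\<forall>\<^sub>F n in sequentially. (b \<subseteq>\<^sub>m Hs n y) = (b \<subseteq>\<^sub>m H y)"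
    if "mconv k Hs H" "y \<in> S.T k" "finite (dom b)" for Hs H y b
  proof -
    have "\<forall>\<^sub>F n in sequentially. \<forall>j\<in>dom b. Hs n y j = H y j"
      using that(3) ev[OF that(1,2)] by (simp add: eventually_ball_finite_distrib)
    then show ?thesis by (rule eventually_mono) (auto simp: map_le_def)
  qed
  show ?thesis
  proof (cases "S_sim (Suc k) p q")
    case False
    then obtain x1 x2 where x: "x1 \<in> S_dom k" "x2 \<in> S_dom k" "S_sim k x1 x2" "\<not> S_sim0 (app p x1) (app q x2)"
      by auto
    obtain b c where bc: "b \<in> S0_fin" "c \<in> S0_fin" "b \<subseteq>\<^sub>m app p x1" "c \<subseteq>\<^sub>m app q x2" "\<not> S_sim0 b c"
      using S_sim0_closed[OF S.appB[OF D(1) x(1)] S.appB[OF D(2) x(2)]] x(4) by blast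
    obtain c1 where c1: "c1 \<in> S.K k" "S.fle c1 x1" "b \<subseteq>\<^sub>m app p c1" using S.appI[OF D(1) x(1) bc(1)] bc(3) by blast
    obtain c2 where c2: "c2 \<in> S.K k" "S.fle c2 x2" "c \<subseteq>\<^sub>m app q c2" using S.appI[OF D(2) x(2) bc(2)] bc(4) by blast
    have "S_sim k c1 c2" using S.sim_down[OF x(3) S.X.K_D[OF c1(1)] S.X.K_D[OF c2(1)] x(1,2) c1(2) c2(2)] .
    then obtain y1 y2 where y: "y1 \<in> S.T k" "y2 \<in> S.T k" "S.fle c1 y1" "S.fle c2 y2" "S.eqv k y1 y2"
      using d[of k] c1(1) c2(1) unfolding S.dens_def by blast
    have p: "b \<subseteq>\<^sub>m app p y1" by (rule map_le_trans[OF c1(3) S.appM[OF D(1) S.X.K_D[OF c1(1)] S.T_D[OF y(1)] y(3)]])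
    have q: "c \<subseteq>\<^sub>m app q y2" by (rule map_le_trans[OF c2(3) S.appM[OF D(2) S.X.K_D[OF c2(1)] S.T_D[OF y(2)] y(4)]])
    have "\<not> (b \<subseteq>\<^sub>m H y1 \<and> c \<subseteq>\<^sub>m H y2)" if H: "mcont k H" "mext k H" for H
    proof -
      have "H y1 \<in> S0_max" "H y2 \<in> S0_max" using H(1) y(1,2) unfolding mcont_def by blast+
      moreover have "S_val (H y1) = S_val (H y2)" using H(2) y(1,2,5) unfolding mext_def by blast
      ultimately show ?thesis using bc(5) unfolding S_sim0_def by blast
    qed
    moreover have "\<forall>\<^sub>F n in sequentially. (b \<subseteq>\<^sub>m Hs n y1) = (b \<subseteq>\<^sub>m H y1) \<and> (c \<subseteq>\<^sub>m Hs n y2) = (c \<subseteq>\<^sub>m H y2)"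
      if "mconv k Hs H" for Hs H
      using evp[OF that y(1), of b] evp[OF that y(2), of c] bc(1,2) by (auto intro: eventually_conj)
    moreover have "b \<subseteq>\<^sub>m H y1" if "\<forall>y\<in>S.T k. app p y \<subseteq>\<^sub>m H y" for H
      by (rule map_le_trans[OF p bspec[OF that y(1)]])
    moreover have "c \<subseteq>\<^sub>m H y2" if "\<forall>y\<in>S.T k. app q y \<subseteq>\<^sub>m H y" for H
      by (rule map_le_trans[OF q bspec[OF that y(2)]])
    ultimately show ?thesis
      by (intro exI[of _ "\<lambda>H. b \<subseteq>\<^sub>m H y1"] exI[of _ "\<lambda>H. c \<subseteq>\<^sub>m H y2"] conjI allI impI)
  next
    case True
    obtain x i where x: "x \<in> S.K k" "app p x i \<noteq> None" "app q x i \<noteq> None" "app p x i \<noteq> app q x i"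
      using S_incompatible_at[OF pq(1,2) True pq(3)] by blast
    obtain y0 where y0: "y0 \<in> S.T k" "S.fle x y0" using d[of k] x(1) unfolding S.dens_def by blast
    have le: "app c x i = H y0 i" if "c \<in> {p, q}" "\<forall>y\<in>S.T k. app c y \<subseteq>\<^sub>m H y" for c H
    proof -
      have c: "c \<in> S_dom (Suc k)" "app c x i \<noteq> None" using that(1) D x by auto
      have "app c x \<subseteq>\<^sub>m H y0"
        by (rule map_le_trans[OF S.appM[OF c(1) S.X.K_D[OF x(1)] S.T_D[OF y0(1)] y0(2)] bspec[OF that(2) y0(1)]])
      then show ?thesis using map_leD c(2) by metis
    qed
    have "\<forall>\<^sub>F n in sequentially. (app p x i = Hs n y0 i) = (app p x i = H y0 i) \<and> (app q x i = Hs n y0 i) = (app q x i = H y0 i)"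
      if "mconv k Hs H" for Hs H
      using ev[OF that y0(1), of i] by (rule eventually_mono) simp
    moreover have "\<not> (app p x i = H y0 i \<and> app q x i = H y0 i)" for H :: "_ \<Rightarrow> nat \<Rightarrow> int option"
      using x(4) by argo
    ultimately show ?thesis
      using le[of p] le[of q]
      by (intro exI[of _ "\<lambda>H. app p x i = H y0 i"] exI[of _ "\<lambda>H. app q x i = H y0 i"]) blast
  qed
qed

lemma mcont_nbhd:
  assumes ok: "S.conv_ok k" and H: "mcont k H" and y: "y \<in> S.T k" and b: "finite (dom b)" "b \<subseteq>\<^sub>m H y"
  obtains p where "p \<in> S.K k" "S.fle p y" "\<And>z. \<lbrakk>z \<in> S.T k; S.fle p z\<rbrakk> \<Longrightarrow> b \<subseteq>\<^sub>m H z"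
proof -
  have sd: "sdisc (S.conv k) (\<lambda>y. H y i)" for i using H(1) unfolding mcont_def by blast
  have "\<exists>p\<in>S.K k. S.fle p y \<and> (\<forall>z\<in>S.T k. S.fle p z \<longrightarrow> b \<subseteq>\<^sub>m H z)"
  proof (rule S.compact_nbhd[OF ok _ y])
    fix ys assume "S.conv k ys y"
    from sdiscD[OF sd, OF this] show "\<forall>\<^sub>F n in sequentially. b \<subseteq>\<^sub>m H (ys n)"
      by (intro prefix_eventually[OF b])
  qed
  then show thesis using that by blast
qed

text \<open>The neighbourhood and the index bound have to be found together: otherwise arguments
  approaching \<open>y\<close>, with indices tending to infinity, would violate
  \<open>mconv\<close>. This is what the reindexing in its definition is for.\<close>

lemma mconv_nbhd:
  assumes ok: "S.conv_ok k" and H: "mconv k Hs H" and y: "y \<in> S.T k" and b: "finite (dom b)" "b \<subseteq>\<^sub>m H y"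
  shows "\<exists>p\<in>S.K k. S.fle p y \<and> (\<exists>m. \<forall>z\<in>S.T k. \<forall>n\<ge>m. S.fle p z \<longrightarrow> b \<subseteq>\<^sub>m Hs n z)"
proof (rule ccontr)
  assume no: "\<not> ?thesis"
  have neg: "\<exists>z\<in>S.T k. \<exists>n\<ge>m. S.fle p z \<and> \<not> b \<subseteq>\<^sub>m Hs n z" if "p \<in> S.K k" "S.fle p y" for p m
    using no that by blast
  obtain c :: "nat \<Rightarrow> _" where c: "\<And>n. c n \<in> S.K k" "\<And>n. S.fle (c n) y"
    "\<And>p. \<lbrakk>p \<in> S.K k; S.fle p y\<rbrakk> \<Longrightarrow> \<exists>m. \<forall>n\<ge>m. S.fle p (c n)"
    by (rule S.X.chain_ex[OF S.T_D[OF y]]) blast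
  have "\<forall>n. \<exists>z i. z \<in> S.T k \<and> i \<ge> n \<and> S.fle (c n) z \<and> \<not> b \<subseteq>\<^sub>m Hs i z"
    using neg[OF c(1,2)] by blast
  then obtain z i where z: "\<And>n. z n \<in> S.T k" "\<And>n. i n \<ge> n" "\<And>n. S.fle (c n) (z n)"
    "\<And>n. \<not> b \<subseteq>\<^sub>m Hs (i n) (z n)" by metis
  have "S.scv k z y"
    unfolding S.scv_def
  proof (intro conjI allI ballI impI)
    fix p assume p: "p \<in> S.K k" "S.fle p y"
    then obtain m where m: "\<forall>n\<ge>m. S.fle p (c n)" using c(3) by blast
    have "S.fle p (z n)" if "n \<ge> m" for n
      using S.X.transK[OF _ z(3) p(1)] m that S.X.K_D[OF c(1)] S.T_D[OF z(1)] by blast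
    then show "\<forall>\<^sub>F n in sequentially. S.fle p (z n)" unfolding eventually_sequentially by blast
  qed (use y z S.T_D in auto)
  then have cv: "S.conv k z y" by (rule S.scv_conv[OF ok y z(1)])
  have i: "filterlim i at_top sequentially"
    using filterlim_at_top_mono[OF filterlim_ident, of i] z(2) by simp
  have "\<forall>\<^sub>F n in sequentially. b \<subseteq>\<^sub>m Hs (i n) (z n)"
    by (rule prefix_eventually[OF b]) (rule H[unfolded mconv_def, rule_format, OF cv i])
  then show False using z(4) by simp
qed

text \<open>The compact functions below \<open>H\<close> are collected until two of them have no upper bound, which
  happens exactly if \<open>H\<close> is not extensional; in that case \<open>\<xi> H\<close> is a fixed total extension of those
  collected before. Being below \<open>H\<close> is replaced by the finitely many conditions of
  \<open>S_separating\<close>, as these are locally constant in \<open>H\<close>.\<close>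

lemma S_retraction:
  assumes d: "\<And>j. j \<le> Suc k \<Longrightarrow> S.dens j"
  shows "\<exists>\<xi>. (\<forall>H. mcont k H \<longrightarrow> \<xi> H \<in> S.T (Suc k)) \<and>
    (\<forall>H. mcont k H \<longrightarrow> mext k H \<longrightarrow> (\<forall>y\<in>S.T k. app (\<xi> H) y = H y)) \<and>
    (\<forall>Hs H. (\<forall>n. mcont k (Hs n)) \<longrightarrow> mcont k H \<longrightarrow> mconv k Hs H \<longrightarrow> S.conv (Suc k) (\<lambda>n. \<xi> (Hs n)) (\<xi> H))"
proof -
  have dk: "\<And>j. j \<le> k \<Longrightarrow> S.dens j" "S.dens k" using d by auto
  have ok: "S.conv_ok k" by (rule S.conv_okI) (use dk in simp)
  define nub where "nub p q \<longleftrightarrow> \<not> (\<exists>z\<in>S_dom (Suc k). S.fle p z \<and> S.fle q z)" for p q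
  have nub_sym: "nub p q \<Longrightarrow> nub q p" for p q unfolding nub_def by blast
  define below where "below p H \<longleftrightarrow> (\<forall>y\<in>S.T k. app p y \<subseteq>\<^sub>m H y)" for p and H :: "_ \<Rightarrow> nat \<Rightarrow> int option"
  define e where "e = from_nat_into (S.K (Suc k))"
  have Kne: "S.K (Suc k) \<noteq> {}" using S.X.bot_ex by blast
  have eK: "e l \<in> S.K (Suc k)" for l unfolding e_def by (rule from_nat_into[OF Kne])
  have e_surj: "\<exists>l. e l = p" if "p \<in> S.K (Suc k)" for p
    unfolding e_def using from_nat_into_surj[OF S.X.countable_K that] by blast
  define sep where "sep p q A A' \<longleftrightarrow> (\<forall>H. below p H \<longrightarrow> A H) \<and> (\<forall>H. below q H \<longrightarrow> A' H) \<and>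
    (\<forall>H. mcont k H \<longrightarrow> mext k H \<longrightarrow> \<not> (A H \<and> A' H)) \<and>
    (\<forall>Hs H. mconv k Hs H \<longrightarrow> (\<forall>\<^sub>F n in sequentially. A (Hs n) = A H \<and> A' (Hs n) = A' H))" for p q A A'
  have "\<exists>A A'. sep (e l) (e l') A A'" if "nub (e l) (e l')" for l l'
    unfolding sep_def below_def by (rule S_separating[OF dk(1) eK eK that[unfolded nub_def]])
  then obtain A A' where A: "nub (e l) (e l') \<Longrightarrow> sep (e l) (e l') (A l l') (A' l l')" for l l' by metis
  \<comment> \<open>\<open>e l\<close> occurs in the first and in the second place of a pair and has
    to satisfy the necessary conditions from both.\<close>
  define t where "t l l' H \<longleftrightarrow> (nub (e l) (e l') \<longrightarrow> A l l' H \<and> A' l' l H)" for l l' H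
  have t1: "t l l' H" if "below (e l) H" for l l' H
    using A[of l l'] A[of l' l] nub_sym that unfolding t_def sep_def by blast
  have t2: "\<not> nub (e l) (e l')" if "mcont k H" "mext k H" "t l l' H" "t l' l H" for l l' H
    using A[of l l'] nub_sym that unfolding t_def sep_def by blast
  have t3: "\<forall>\<^sub>F n in sequentially. t l l' (Hs n) = t l l' H" if "mconv k Hs H" for l l' Hs H
  proof (cases "nub (e l) (e l')")
    case True
    have "\<forall>\<^sub>F n in sequentially. A l l' (Hs n) = A l l' H \<and> A' l l' (Hs n) = A' l l' H"
      using A[OF True] that unfolding sep_def by blast
    moreover have "\<forall>\<^sub>F n in sequentially. A l' l (Hs n) = A l' l H \<and> A' l' l (Hs n) = A' l' l H"
      using A[OF nub_sym[OF True]] that unfolding sep_def by blast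
    ultimately show ?thesis by eventually_elim (simp add: t_def)
  qed (simp add: t_def)
  \<comment> \<open>The candidates among the first \<open>m\<close> compact functions that pass all
    tests against these \<open>m\<close>; membership depends on finitely many locally constant
    conditions.\<close>
  define lm where "lm H m = {l. l < m \<and> (\<forall>l'<m. t l l' H)}" for H and m :: nat
  define bad where "bad H m \<longleftrightarrow> (\<exists>l\<in>lm H m. \<exists>l'\<in>lm H m. nub (e l) (e l'))" for H m
  have ev: "\<forall>\<^sub>F n in sequentially. \<forall>j\<le>m. lm (Hs n) j = lm H j \<and> bad (Hs n) j = bad H j" if "mconv k Hs H" for m Hs H
  proof -
    have "\<forall>\<^sub>F n in sequentially. \<forall>l\<in>{..<m}. \<forall>l'\<in>{..<m}. t l l' (Hs n) = t l l' H"
      using t3[OF that] by (simp add: eventually_ball_finite_distrib)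
    then show ?thesis
    proof eventually_elim
      case (elim n)
      have "lm (Hs n) j = lm H j" if "j \<le> m" for j
        unfolding lm_def using elim that by fastforce
      then show ?case unfolding bad_def by simp
    qed
  qed
  have good: "\<not> bad H m" if "mcont k H" "mext k H" for H m
    using t2[OF that] unfolding bad_def lm_def by blast
  have step_below: "below g H" if "S.presents k {(p, b)} g" "p \<in> S.K k" "b \<in> S0_fin"
    "\<And>z. \<lbrakk>z \<in> S.T k; S.fle p z\<rbrakk> \<Longrightarrow> b \<subseteq>\<^sub>m H z" "\<And>z. z \<in> S.T k \<Longrightarrow> H z \<in> S0" for g p b H
    unfolding below_def
  proof
    fix z assume z: "z \<in> S.T k"
    show "app g z \<subseteq>\<^sub>m H z"
      using S.presents_appS[OF _ _ that(1) S.T_D[OF z] that(5)[OF z]] that(2,3,4) z by simp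
  qed
  have step_app: "b \<subseteq>\<^sub>m app z y" if "S.presents k {(p, b)} g" "p \<in> S.K k" "S.fle p y" "y \<in> S_dom k"
    "z \<in> S_dom (Suc k)" "S.fle g z" for b g p y z
  proof -
    have g: "g \<in> S_dom (Suc k)" using that(1) unfolding S.presents_def by blast
    have "b \<subseteq>\<^sub>m app g p" using S.presents_leS[OF that(1), of p b] by simp
    moreover have "app g p \<subseteq>\<^sub>m app g y" by (rule S.appM[OF g S.X.K_D[OF that(2)] that(4,3)])
    moreover have "app g y \<subseteq>\<^sub>m app z y" using S.fleS[OF g that(5)] that(4,6) by blast
    ultimately show ?thesis using map_le_trans by blast
  qed
  \<comment> \<open>Unrelated prefixes of \<open>H\<close> at equivalent arguments give two single
    steps below \<open>H\<close> with no common bound, since a bound would have related values there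
    by \<open>S_eqv_sim\<close>.\<close>
  have bad: "\<exists>m. bad H m" if H: "mcont k H" "\<not> mext k H" for H
  proof -
    have max: "H y \<in> S0_max" if "y \<in> S.T k" for y using H(1) that unfolding mcont_def by blast
    then have H0: "H y \<in> S0" if "y \<in> S.T k" for y using that unfolding S0_max_def by blast
    obtain y z where y: "y \<in> S.T k" "z \<in> S.T k" "S.eqv k y z" "S_val (H y) \<noteq> S_val (H z)"
      using H(2) unfolding mext_def by blast
    have "\<not> S_sim0 (H y) (H z)"
      using max[OF y(1)] max[OF y(2)] y(4) S_eq0_def S_eq0_iff by blast
    then obtain b c where bc: "b \<in> S0" "finite (dom b)" "c \<in> S0" "finite (dom c)" "b \<subseteq>\<^sub>m H y" "c \<subseteq>\<^sub>m H z" "\<not> S_sim0 b c"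
      using S_sim0_closed[OF H0[OF y(1)] H0[OF y(2)]] by blast
    obtain p where p: "p \<in> S.K k" "S.fle p y" "\<And>z. \<lbrakk>z \<in> S.T k; S.fle p z\<rbrakk> \<Longrightarrow> b \<subseteq>\<^sub>m H z"
      by (rule mcont_nbhd[OF ok H(1) y(1) bc(2,5)]) blast
    obtain q where q: "q \<in> S.K k" "S.fle q z" "\<And>y. \<lbrakk>y \<in> S.T k; S.fle q y\<rbrakk> \<Longrightarrow> c \<subseteq>\<^sub>m H y"
      by (rule mcont_nbhd[OF ok H(1) y(2) bc(4,6)]) blast
    obtain g where g: "g \<in> S.K (Suc k)" "S.presents k {(p, b)} g" by (rule S_step[OF p(1) bc(1,2)])
    obtain h where h: "h \<in> S.K (Suc k)" "S.presents k {(q, c)} h" by (rule S_step[OF q(1) bc(3,4)])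
    obtain l l' where l: "e l = g" "e l' = h" using e_surj g(1) h(1) by blast
    have below: "below (e l) H" "below (e l') H"
      unfolding l by (rule step_below[OF g(2) p(1)]; use bc p(3) H0 in simp)
        (rule step_below[OF h(2) q(1)]; use bc q(3) H0 in simp)
    have "nub g h"
      unfolding nub_def
    proof
      assume "\<exists>w\<in>S_dom (Suc k). S.fle g w \<and> S.fle h w"
      then obtain w where w: "w \<in> S_dom (Suc k)" "S.fle g w" "S.fle h w" by blast
      have "b \<subseteq>\<^sub>m app w y" "c \<subseteq>\<^sub>m app w z"
        using step_app[OF g(2) p(1,2) S.T_D[OF y(1)] w(1,2)] step_app[OF h(2) q(1,2) S.T_D[OF y(2)] w(1,3)] .
      moreover have "S_sim0 (app w y) (app w z)"
        by (rule S.appS[OF w(1) S.T_D[OF y(1)] S.T_D[OF y(2)]], rule S_eqv_sim[OF _ y(1-3)]) (simp add: dk)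
      ultimately have "S_sim0 b c" unfolding S_sim0_def using map_le_trans by blast
      then show False using bc(7) by blast
    qed
    moreover have "l \<in> lm H (Suc (max l l'))" "l' \<in> lm H (Suc (max l l'))"
      using t1[OF below(1)] t1[OF below(2)] unfolding lm_def by auto
    ultimately show ?thesis unfolding bad_def l[symmetric] by blast
  qed
  \<comment> \<open>The extension depends only on the set of collected indices, so that
    \<open>\<xi>\<close> is locally constant where a conflict occurs.\<close>
  define G where "G L = (SOME y. y \<in> S.T (Suc k) \<and> (\<forall>l\<in>L. S.fle (e l) y))" for L
  define R where "R H = (SOME f. f \<in> S.T (Suc k) \<and> (\<forall>y\<in>S.T k. app f y = H y))" for H
  define M where "M H = (LEAST m. bad H m)" for H
  \<comment> \<open>\<open>M H - 1\<close> is the last stage before the first conflict; it precedes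
    \<open>M H\<close> because stage 0 collects nothing.\<close>
  define \<xi> where "\<xi> H = (if \<exists>m. bad H m then G (lm H (M H - 1)) else R H)" for H
  have G: "G (lm H m) \<in> S.T (Suc k) \<and> (\<forall>l\<in>lm H m. S.fle (e l) (G (lm H m)))" if nb: "\<not> bad H m" for H m
  proof -
    have "\<exists>g\<in>S.K (Suc k). \<forall>p\<in>e ` lm H m. S.fle p g"
    proof (rule S_coherent)
      show "finite (e ` lm H m)" unfolding lm_def by simp
      show "e ` lm H m \<subseteq> S.K (Suc k)" using eK by blast
      fix p q assume "p \<in> e ` lm H m" "q \<in> e ` lm H m"
      then show "\<exists>z\<in>S_dom (Suc k). S.fle p z \<and> S.fle q z" using nb unfolding bad_def nub_def by blast
    qed
    then obtain g where g: "g \<in> S.K (Suc k)" "\<forall>l\<in>lm H m. S.fle (e l) g" by blast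
    obtain y where y: "y \<in> S.T (Suc k)" "S.fle g y" using d[of "Suc k"] g(1) unfolding S.dens_def by blast
    have "S.fle (e l) y" if "l \<in> lm H m" for l
      by (rule S.X.transK[OF bspec[OF g(2) that] y(2) eK S.X.K_D[OF g(1)] S.T_D[OF y(1)]])
    then have "\<exists>y. y \<in> S.T (Suc k) \<and> (\<forall>l\<in>lm H m. S.fle (e l) y)" using y(1) by blast
    then show ?thesis unfolding G_def by (rule someI_ex)
  qed
  have M: "bad H (M H)" "\<not> bad H m" if "\<exists>m. bad H m" "m < M H" for H m
    using LeastI_ex[OF that(1)] not_less_Least[of m "bad H"] that(2) unfolding M_def by blast+
  have M0: "M H - 1 < M H" if "\<exists>m. bad H m" for H
  proof -
    have "bad H (M H)" using LeastI_ex[OF that] unfolding M_def .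
    moreover have "\<not> bad H 0" unfolding bad_def lm_def by simp
    ultimately show ?thesis by (cases "M H") auto
  qed
  have \<xi>_bad: "\<xi> H \<in> S.T (Suc k)" "l \<in> lm H (M H - 1) \<Longrightarrow> S.fle (e l) (\<xi> H)" if "\<exists>m. bad H m" for H l
    using G[OF M(2)[OF that M0[OF that]]] that unfolding \<xi>_def by auto
  have \<xi>_good: "\<xi> H \<in> S.T (Suc k) \<and> (\<forall>y\<in>S.T k. app (\<xi> H) y = H y)" if H: "mcont k H" "\<not> (\<exists>m. bad H m)" for H
  proof -
    have "\<exists>f. f \<in> S.T (Suc k) \<and> (\<forall>y\<in>S.T k. app f y = H y)"
      using mcont_realize[OF dk(2) ok H(1)] bad[OF H(1)] H(2) by blast
    then have "R H \<in> S.T (Suc k) \<and> (\<forall>y\<in>S.T k. app (R H) y = H y)" unfolding R_def by (rule someI_ex)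
    then show ?thesis unfolding \<xi>_def using H(2) by presburger
  qed
  have \<xi>T: "\<xi> H \<in> S.T (Suc k)" if "mcont k H" for H using \<xi>_bad(1) \<xi>_good[OF that] by blast
  have "S.conv (Suc k) (\<lambda>n. \<xi> (Hs n)) (\<xi> H)" if Hs: "\<And>n. mcont k (Hs n)" and H: "mcont k H" and cv: "mconv k Hs H" for Hs H
  proof (cases "\<exists>m. bad H m")
    case True
    have "\<forall>\<^sub>F n in sequentially. \<xi> (Hs n) = \<xi> H"
      using ev[OF cv, of "M H"]
    proof eventually_elim
      case (elim n)
      have Hn: "bad (Hs n) (M H)" using elim LeastI_ex[OF True] unfolding M_def by simp
      have "(LEAST m. bad (Hs n) m) = M H"
      proof (rule Least_equality)
        show "bad (Hs n) (M H)" by (rule Hn)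
        fix j assume j: "bad (Hs n) j"
        show "M H \<le> j"
        proof (rule ccontr)
          assume "\<not> M H \<le> j"
          then show False using elim M(2)[OF True, of j] j by simp
        qed
      qed
      then have "M (Hs n) = M H" unfolding M_def[of "Hs n"] .
      then show ?case using True Hn elim unfolding \<xi>_def by auto
    qed
    note eq = this
    show ?thesis
      unfolding S.conv.simps(2)
    proof (intro conjI allI impI)
      show "\<xi> H \<in> S.T (Suc k)" "\<xi> (Hs n) \<in> S.T (Suc k)" for n using \<xi>T H Hs by blast+
      fix ys y j and i :: "nat \<Rightarrow> nat" assume y: "S.conv k ys y" and i: "filterlim i at_top sequentially"
      have "\<forall>\<^sub>F n in sequentially. app (\<xi> H) (ys n) j = app (\<xi> H) y j"
        using S.conv_app[OF S.conv_const_Suc[OF ok \<xi>T[OF H]] y] by blast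
      then show "\<forall>\<^sub>F n in sequentially. app (\<xi> (Hs (i n))) (ys n) j = app (\<xi> H) y j"
        using eventually_compose_filterlim[OF eq i] by eventually_elim simp
    qed
  next
    case False
    have f: "\<xi> H \<in> S.T (Suc k)" "\<And>y. y \<in> S.T k \<Longrightarrow> app (\<xi> H) y = H y" using \<xi>_good[OF H False] by blast+
    show ?thesis
      unfolding S.conv.simps(2)
    proof (intro conjI allI impI)
      show "\<xi> H \<in> S.T (Suc k)" "\<xi> (Hs n) \<in> S.T (Suc k)" for n using \<xi>T H Hs by blast+
      fix ys y j and i :: "nat \<Rightarrow> nat" assume y: "S.conv k ys y" and i: "filterlim i at_top sequentially"
      obtain ys' y' where y': "y' \<in> S.T k" "\<And>n. ys' n \<in> S.T k" "S.scv k ys' y'"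
        "\<And>n. S.joinable k (ys n) (ys' n)" "S.joinable k y y'"
        by (rule S.conv_scv[OF ok y], rule that)
      have yT: "y \<in> S.T k" "\<And>n. ys n \<in> S.T k" using S.conv_T[OF y] by auto
      define b where "b = H y' |` {..<Suc j}"
      have Hy: "H y' \<in> S0" "H y' j \<noteq> None" using H y'(1) unfolding mcont_def S0_max_iff by blast+
      have b: "b \<in> S0" "finite (dom b)" "b \<subseteq>\<^sub>m H y'" "b j = H y' j"
        unfolding b_def using S0_restrict[OF Hy(1)] by (auto simp: map_le_def)
      obtain p m where p: "p \<in> S.K k" "S.fle p y'"
        "\<And>z n. \<lbrakk>z \<in> S.T k; n \<ge> m; S.fle p z\<rbrakk> \<Longrightarrow> b \<subseteq>\<^sub>m Hs n z"
        using mconv_nbhd[OF ok cv y'(1) b(2,3)] by blast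
      obtain g where g: "g \<in> S.K (Suc k)" "S.presents k {(p, b)} g" by (rule S_step[OF p(1) b(1,2)])
      obtain l where l: "e l = g" using e_surj g(1) by blast
      have "\<forall>\<^sub>F n in sequentially. \<forall>z\<in>S.T k. S.fle p z \<longrightarrow> b \<subseteq>\<^sub>m app (\<xi> (Hs n)) z"
        using ev[OF cv, of "Suc l"] eventually_ge_at_top[of m]
      proof eventually_elim
        case (elim n)
        have Hn0: "Hs n z \<in> S0" if "z \<in> S.T k" for z using Hs[of n] that unfolding mcont_def S0_max_def by blast
        have "below (e l) (Hs n)"
          unfolding l by (rule step_below[OF g(2) p(1)]; use b(1,2) p(3)[OF _ elim(2)] Hn0 in simp)
        then have lm: "l \<in> lm (Hs n) j" if "l < j" for j using t1 that unfolding lm_def by blast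
        show ?case
        proof (cases "\<exists>j. bad (Hs n) j")
          case True
          \<comment> \<open>The limit has no conflict, so for large \<open>n\<close> none occurs in
            \<open>Hs n\<close> up to stage \<open>Suc l\<close>. The step \<open>g\<close> has then
            been collected before the conflict, and \<open>\<xi> (Hs n)\<close> extends it.\<close>
          have "\<not> M (Hs n) \<le> Suc l"
            using elim(1) False LeastI_ex[OF True] unfolding M_def[symmetric] by blast
          then have "S.fle g (\<xi> (Hs n))" using \<xi>_bad(2)[OF True, of l] lm[of "M (Hs n) - 1"] l by simp
          then show ?thesis using step_app[OF g(2) p(1) _ S.T_D S.T_D[OF \<xi>T[OF Hs[of n]]]] by blast
        next
          case nb: False
          then show ?thesis using \<xi>_good[OF Hs nb] p(3)[OF _ elim(2)] by simp
        qed
      qed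
      then have "\<forall>\<^sub>F n in sequentially. \<forall>z\<in>S.T k. S.fle p z \<longrightarrow> b \<subseteq>\<^sub>m app (\<xi> (Hs (i n))) z"
        by (rule eventually_compose_filterlim[OF _ i])
      moreover have "\<forall>\<^sub>F n in sequentially. S.fle p (ys' n)"
        using y'(3) p(1,2) unfolding S.scv_def by blast
      ultimately show "\<forall>\<^sub>F n in sequentially. app (\<xi> (Hs (i n))) (ys n) j = app (\<xi> H) y j"
      proof eventually_elim
        case (elim n)
        have "b \<subseteq>\<^sub>m app (\<xi> (Hs (i n))) (ys' n)" using elim y'(2) by blast
        also have "app (\<xi> (Hs (i n))) (ys' n) = app (\<xi> (Hs (i n))) (ys n)"
          using S_joinable_app[OF \<xi>T[OF Hs] y'(4) yT(2) y'(2)] by simp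
        finally have "app (\<xi> (Hs (i n))) (ys n) j = b j" by (rule map_leD) (use b(4) Hy(2) in simp)
        also have "b j = app (\<xi> H) y' j" using b(4) f(2)[OF y'(1)] by simp
        also have "app (\<xi> H) y' = app (\<xi> H) y" using S_joinable_app[OF f(1) y'(5) yT(1) y'(1)] by simp
        finally show ?case .
      qed
    qed
  qed
  then show ?thesis
    using \<xi>T \<xi>_good good by (intro exI[of _ \<xi>]) blast
qed

section \<open>Retracts of the Kleene-Kreisel functionals\<close>

definition N_real :: "nat \<Rightarrow> (nat option func \<Rightarrow> nat) \<Rightarrow> nat option func" where
  "N_real k F = (SOME f. f \<in> N.T (Suc k) \<and> (\<forall>y\<in>N.T k. app f y = Some (F y)))"

lemma N_real:
  assumes F: "sdisc (N.conv k) F"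
  shows "N_real k F \<in> N.T (Suc k)" "y \<in> N.T k \<Longrightarrow> app (N_real k F) y = Some (F y)"
proof -
  have eq: "F y = F z" if "y \<in> N.T k" "z \<in> N.T k" "N.eqv k y z" for y z
    using sdiscD[OF F, OF N_eqv_conv[OF N_conv_ok that(3,1,2)]] by simp
  have "N.cont k (\<lambda>y. Some (F y))"
    unfolding N.cont_def
  proof (intro conjI ballI allI impI)
    show "N_eq0 (Some (F y)) (Some (F z))" if "y \<in> N.T k" "z \<in> N.T k" "N.eqv k y z" for y z
      using eq[OF that] by (simp add: N_eq0_def)
    show "\<forall>\<^sub>F n in sequentially. Some (F (ys n)) = Some (F y)"
      if "y \<in> N.T k" "\<forall>n. ys n \<in> N.T k" "N.scv k ys y" for ys y
      using sdiscD[OF F, OF N.scv_conv[OF N_conv_ok that(1) spec[OF that(2)] that(3)]] by simp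
  qed simp
  then obtain f where f: "f \<in> N.T (Suc k)" "\<forall>y\<in>N.T k. N_eq0 (app f y) (Some (F y))"
    using N.realize_one(1)[OF N_dens] by blast
  then have "f \<in> N.T (Suc k) \<and> (\<forall>y\<in>N.T k. app f y = Some (F y))" by (auto simp: N_eq0_def)
  then have "N_real k F \<in> N.T (Suc k) \<and> (\<forall>y\<in>N.T k. app (N_real k F) y = Some (F y))"
    unfolding N_real_def by (rule someI)
  then show "N_real k F \<in> N.T (Suc k)" "y \<in> N.T k \<Longrightarrow> app (N_real k F) y = Some (F y)" by blast+
qed

lemma N_real_conv:
  assumes F: "\<And>n. sdisc (N.conv k) (Fs n)" "sdisc (N.conv k) F"
    and lim: "\<And>ys y i. \<lbrakk>N.conv k ys y; filterlim i at_top sequentially\<rbrakk> \<Longrightarrow>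
      \<forall>\<^sub>F n in sequentially. Fs (i n) (ys n) = F y"
  shows "N.conv (Suc k) (\<lambda>n. N_real k (Fs n)) (N_real k F)"
  unfolding N.conv.simps(2)
proof (intro conjI allI impI)
  show "N_real k F \<in> N.T (Suc k)" "N_real k (Fs n) \<in> N.T (Suc k)" for n using N_real(1) F by blast+
  fix ys y and i :: "nat \<Rightarrow> nat" assume y: "N.conv k ys y" and i: "filterlim i at_top sequentially"
  have "y \<in> N.T k" "ys n \<in> N.T k" for n using N.conv_T[OF y] by auto
  then show "\<forall>\<^sub>F n in sequentially. app (N_real k (Fs (i n))) (ys n) = app (N_real k F) y"
    using lim[OF y i] N_real(2)[OF F(1)] N_real(2)[OF F(2)] by simp
qed

definition nv :: "nat option func \<Rightarrow> nat option func \<Rightarrow> nat" where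
  "nv f y = the (app f y)"

lemma nv: "\<lbrakk>f \<in> N.T (Suc k); y \<in> N.T k\<rbrakk> \<Longrightarrow> app f y = Some (nv f y)"
  using N.T_appr[of f k y] unfolding nv_def N_eq0_def by auto

lemma nv_real: "\<lbrakk>sdisc (N.conv k) F; y \<in> N.T k\<rbrakk> \<Longrightarrow> nv (N_real k F) y = F y"
  using N_real(2)[of k F y] by (simp add: nv_def)

lemma nv_conv: "\<lbrakk>N.conv (Suc k) fs f; N.conv k ys y; filterlim i at_top sequentially\<rbrakk> \<Longrightarrow>
    \<forall>\<^sub>F n in sequentially. nv (fs (i n)) (ys n) = nv f y"
  unfolding N.conv.simps(2) nv_def by (auto elim!: allE elim: eventually_mono)

lemma nv_sdisc: "f \<in> N.T (Suc k) \<Longrightarrow> sdisc (N.conv k) (nv f)"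
  unfolding sdisc_def using nv_conv[OF N.conv_const[OF N_conv_ok] _ filterlim_ident] by blast

lemma N_ext_conv:
  assumes f: "f \<in> N.T (Suc k)" "g \<in> N.T (Suc k)" "\<And>y. y \<in> N.T k \<Longrightarrow> nv g y = nv f y"
  shows "N.conv (Suc k) (\<lambda>_. g) f"
  unfolding N.conv.simps(2)
proof (intro conjI allI impI)
  fix ys y and i :: "nat \<Rightarrow> nat" assume y: "N.conv k ys y" and i: "filterlim i at_top sequentially"
  have t: "y \<in> N.T k" "ys n \<in> N.T k" for n using N.conv_T[OF y] by auto
  show "\<forall>\<^sub>F n in sequentially. app g (ys n) = app f y"
    using N.conv_app[OF N.conv_const[OF N_conv_ok f(1)] y] nv[OF f(1) t(2)] nv[OF f(2) t(2)] f(3)[OF t(2)] by simp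
qed (use f in auto)

text \<open>Inverse only up to equivalence: that \<open>r (e x)\<close> represents the same point as
  \<open>x\<close> is expressed by convergence of the constant sequence.\<close>

definition retracts :: "'a set \<Rightarrow> ((nat \<Rightarrow> 'a) \<Rightarrow> 'a \<Rightarrow> bool) \<Rightarrow> 'b set \<Rightarrow> ((nat \<Rightarrow> 'b) \<Rightarrow> 'b \<Rightarrow> bool) \<Rightarrow>
    ('a \<Rightarrow> 'b) \<Rightarrow> ('b \<Rightarrow> 'a) \<Rightarrow> bool" where
  "retracts X cX Y cY e r \<longleftrightarrow> (\<forall>x\<in>X. e x \<in> Y) \<and> (\<forall>y\<in>Y. r y \<in> X) \<and>
    (\<forall>xs x. cX xs x \<longrightarrow> cY (\<lambda>n. e (xs n)) (e x)) \<and> (\<forall>ys y. cY ys y \<longrightarrow> cX (\<lambda>n. r (ys n)) (r y)) \<and>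
    (\<forall>x\<in>X. cX (\<lambda>_. r (e x)) x)"

lemma retractsI:
  assumes "\<And>x. x \<in> X \<Longrightarrow> e x \<in> Y" "\<And>y. y \<in> Y \<Longrightarrow> r y \<in> X"
    "\<And>xs x. cX xs x \<Longrightarrow> cY (\<lambda>n. e (xs n)) (e x)" "\<And>ys y. cY ys y \<Longrightarrow> cX (\<lambda>n. r (ys n)) (r y)"
    "\<And>x. x \<in> X \<Longrightarrow> cX (\<lambda>_. r (e x)) x"
  shows "retracts X cX Y cY e r"
  unfolding retracts_def using assms by blast

lemma retractsD:
  assumes "retracts X cX Y cY e r"
  shows "x \<in> X \<Longrightarrow> e x \<in> Y" "y \<in> Y \<Longrightarrow> r y \<in> X"
    "cX xs x \<Longrightarrow> cY (\<lambda>n. e (xs n)) (e x)" "cY ys y \<Longrightarrow> cX (\<lambda>n. r (ys n)) (r y)"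
    "x \<in> X \<Longrightarrow> cX (\<lambda>_. r (e x)) x"
  using assms unfolding retracts_def by blast+

text \<open>The function is pulled back along \<open>r\<close> and the clopen set along
  \<open>e\<close>; continuous real functions cannot tell \<open>r (e x)\<close> from
  \<open>x\<close>.\<close>

lemma sepa_retract:
  assumes sp: "sepa Y cY" and ret: "retracts X cX Y cY e r"
  shows "sepa X cX"
  unfolding sepa_def
proof (intro allI impI)
  note e = retractsD[OF ret]
  fix g assume g: "scont cX g"
  have "scont cY (\<lambda>y. g (r y))" unfolding scont_def using g e(4) unfolding scont_def by blast
  then obtain u where u: "sdisc cY u" "\<forall>y\<in>Y. (g (r y) \<le> 0 \<longrightarrow> u y) \<and> (u y \<longrightarrow> g (r y) < 1)"
    using sp unfolding sepa_def by blast
  have "g (r (e x)) = g x" if "x \<in> X" for x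
    using scontD[OF g, OF e(5)[OF that]] by (simp add: LIMSEQ_const_iff)
  moreover have "sdisc cX (\<lambda>x. u (e x))" unfolding sdisc_def using u(1) e(3) unfolding sdisc_def by blast
  ultimately show "\<exists>u. sdisc cX u \<and> (\<forall>x\<in>X. (g x \<le> 0 \<longrightarrow> u x) \<and> (u x \<longrightarrow> g x < 1))"
    using u(2) e(1) by (intro exI[of _ "\<lambda>x. u (e x)"]) fastforce
qed

text \<open>The usual embedding of a pure type in the next: numbers become constant functions, with
  evaluation at 0 as the inverse, and at higher levels functionals are composed with the previous
  pair.\<close>

lemma N_up_down: "\<exists>up down. retracts (N.T k) (N.conv k) (N.T (Suc k)) (N.conv (Suc k)) up down"
proof (induction k)
  case 0
  define up :: "nat option func \<Rightarrow> nat option func" where "up x = N_real 0 (\<lambda>_. the (val x))" for x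
  define down :: "nat option func \<Rightarrow> nat option func" where "down G = Val (Some (nv G (Val (Some 0))))" for G
  have z: "Val (Some i) \<in> N.T 0" for i by (simp add: N_T0)
  show ?case
  proof (rule exI[of _ up], rule exI[of _ down], rule retractsI)
    show "up x \<in> N.T (Suc 0)" for x unfolding up_def by (rule N_real(1)[OF sdisc_const])
    show "down G \<in> N.T 0" for G unfolding down_def by (rule z)
    show "N.conv (Suc 0) (\<lambda>n. up (xs n)) (up x)" if x: "N.conv 0 xs x" for xs x
      unfolding up_def
    proof (rule N_real_conv[OF sdisc_const sdisc_const])
      fix i :: "nat \<Rightarrow> nat" assume "filterlim i at_top sequentially"
      moreover have "\<forall>\<^sub>F n in sequentially. the (val (xs n)) = the (val x)" using x by (auto elim: eventually_mono)
      ultimately show "\<forall>\<^sub>F n in sequentially. the (val (xs (i n))) = the (val x)" by (rule eventually_compose_filterlim[rotated])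
    qed
    show "N.conv 0 (\<lambda>n. down (Gs n)) (down G)" if "N.conv (Suc 0) Gs G" for Gs G
      using nv_conv[OF that N.conv_const[OF N_conv_ok z] filterlim_ident] unfolding down_def by (simp add: z)
    show "N.conv 0 (\<lambda>_. down (up x)) x" if x: "x \<in> N.T 0" for x
    proof -
      have "down (up x) = Val (Some (the (val x)))" unfolding down_def up_def by (simp add: nv_real[OF sdisc_const z])
      moreover have "Val (Some (the (val x))) = x" using x by (auto simp: N_T0)
      ultimately have "down (up x) = x" by simp
      then show ?thesis using N.conv_const[OF N_conv_ok x] by (simp only:)
    qed
  qed
next
  case (Suc k)
  then obtain up0 down0 where "retracts (N.T k) (N.conv k) (N.T (Suc k)) (N.conv (Suc k)) up0 down0" by blast
  note u = retractsD[OF this]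
  define up where "up f = N_real (Suc k) (\<lambda>z. nv f (down0 z))" for f
  define down where "down G = N_real k (\<lambda>y. nv G (up0 y))" for G
  have su: "sdisc (N.conv (Suc k)) (\<lambda>z. nv f (down0 z))" if "f \<in> N.T (Suc k)" for f
    unfolding sdisc_def using nv_sdisc[OF that] u(4) unfolding sdisc_def by blast
  have sd: "sdisc (N.conv k) (\<lambda>y. nv G (up0 y))" if "G \<in> N.T (Suc (Suc k))" for G
    unfolding sdisc_def using nv_sdisc[OF that] u(3) unfolding sdisc_def by blast
  show ?case
  proof (rule exI[of _ up], rule exI[of _ down], rule retractsI)
    show "up f \<in> N.T (Suc (Suc k))" if "f \<in> N.T (Suc k)" for f
      unfolding up_def by (rule N_real(1)[OF su[OF that]])
    show "down G \<in> N.T (Suc k)" if "G \<in> N.T (Suc (Suc k))" for G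
      unfolding down_def by (rule N_real(1)[OF sd[OF that]])
    show "N.conv (Suc (Suc k)) (\<lambda>n. up (fs n)) (up f)" if f: "N.conv (Suc k) fs f" for fs f
    proof -
      have t: "f \<in> N.T (Suc k)" "fs n \<in> N.T (Suc k)" for n using N.conv_T[OF f] by blast+
      show ?thesis unfolding up_def
        by (rule N_real_conv[OF su[OF t(2)] su[OF t(1)]], rule nv_conv[OF f u(4)])
    qed
    show "N.conv (Suc k) (\<lambda>n. down (Gs n)) (down G)" if G: "N.conv (Suc (Suc k)) Gs G" for Gs G
    proof -
      have t: "G \<in> N.T (Suc (Suc k))" "Gs n \<in> N.T (Suc (Suc k))" for n using N.conv_T[OF G] by blast+
      show ?thesis unfolding down_def
        by (rule N_real_conv[OF sd[OF t(2)] sd[OF t(1)]], rule nv_conv[OF G u(3)])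
    qed
    show "N.conv (Suc k) (\<lambda>_. down (up f)) f" if f: "f \<in> N.T (Suc k)" for f
    proof -
      have uf: "up f \<in> N.T (Suc (Suc k))" unfolding up_def by (rule N_real(1)[OF su[OF f]])
      show ?thesis
      proof (rule N_ext_conv[OF f])
        show "down (up f) \<in> N.T (Suc k)" unfolding down_def by (rule N_real(1)[OF sd[OF uf]])
        fix y assume y: "y \<in> N.T k"
        have "nv (down (up f)) y = nv (up f) (up0 y)" unfolding down_def by (rule nv_real[OF sd[OF uf] y])
        also have "\<dots> = nv f (down0 (up0 y))" unfolding up_def by (rule nv_real[OF su[OF f] u(1)[OF y]])
        also have "\<dots> = nv f y" using sdiscD[OF nv_sdisc[OF f], OF u(5)[OF y]] by simp
        finally show "nv (down (up f)) y = nv f y" .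
      qed
    qed
  qed
qed

lemma sepa_N_down:
  assumes "k \<le> n" and sp: "sepa (N.T n) (N.conv n)"
  shows "sepa (N.T k) (N.conv k)"
  using assms(1)
proof (induction rule: inc_induct)
  case (step k)
  then show ?case using sepa_retract N_up_down[of k] by blast
qed (rule sp)

section \<open>Coding the smoothened hierarchy in the Kleene-Kreisel functionals\<close>

lemma S_conv_0: "S.conv 0 xs x \<longleftrightarrow> x \<in> S.T 0 \<and> (\<forall>n. xs n \<in> S.T 0) \<and> (\<forall>i. \<forall>\<^sub>F n in sequentially. val (xs n) i = val x i)"
  by simp

text \<open>If every cylinder around \<open>x\<close> contained points with \<open>g \<ge> 1\<close>
  and points with \<open>g \<le> 0\<close>, both kinds would converge to \<open>x\<close>. So some
  cylinder avoids one of them; the least such length is locally constant, and its cylinder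
  decides.\<close>

lemma sepa_S0: "sepa (S.T 0) (S.conv 0)"
  unfolding sepa_def
proof (intro allI impI)
  fix g assume g: "scont (S.conv 0) g"
  define cyl where "cyl x m = {x'\<in>S.T 0. \<forall>i<m. val x' i = val x i}" for x :: "(nat \<Rightarrow> int option) func" and m :: nat
  define q where "q m x \<longleftrightarrow> (\<forall>x'\<in>cyl x m. g x' < 1) \<or> (\<forall>x'\<in>cyl x m. g x' > 0)" for m x
  have cyl: "\<forall>\<^sub>F n in sequentially. cyl (xs n) m = cyl x m" if "S.conv 0 xs x" for m xs x
  proof -
    have "\<forall>\<^sub>F n in sequentially. \<forall>i\<in>{..<m}. val (xs n) i = val x i"
      using that by (simp add: eventually_ball_finite_distrib)
    then show ?thesis by eventually_elim (auto simp: cyl_def)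
  qed
  have sq: "sdisc (S.conv 0) (q m)" for m
    unfolding sdisc_def
  proof (intro allI impI)
    fix xs x assume "S.conv 0 xs x"
    from cyl[OF this, of m] show "\<forall>\<^sub>F n in sequentially. q m (xs n) = q m x"
      by eventually_elim (simp add: q_def)
  qed
  have ex: "\<exists>m. q m x" if x: "x \<in> S.T 0" for x
  proof (rule ccontr)
    assume no: "\<not> (\<exists>m. q m x)"
    then have "\<forall>m. \<exists>y z. y \<in> cyl x m \<and> z \<in> cyl x m \<and> g y \<ge> 1 \<and> g z \<le> 0" unfolding q_def by (meson not_le)
    then obtain y z where yz: "\<And>m. y m \<in> cyl x m" "\<And>m. z m \<in> cyl x m" "\<And>m. g (y m) \<ge> 1" "\<And>m. g (z m) \<le> 0" by metis
    have "S.conv 0 w x" if "\<And>m. w m \<in> cyl x m" for w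
      unfolding S_conv_0
    proof (intro conjI allI x)
      show "w m \<in> S.T 0" for m using that unfolding cyl_def by blast
      show "\<forall>\<^sub>F m in sequentially. val (w m) i = val x i" for i
        using eventually_gt_at_top[of i] by eventually_elim (use that in \<open>auto simp: cyl_def\<close>)
    qed
    then have "(\<lambda>m. g (y m)) \<longlonglongrightarrow> g x" "(\<lambda>m. g (z m)) \<longlonglongrightarrow> g x" using g yz(1,2) unfolding scont_def by blast+
    then have "1 \<le> g x" "g x \<le> 0" using yz(3,4) by (auto intro: LIMSEQ_le_const LIMSEQ_le_const2)
    then show False by simp
  qed
  define M where "M x = (LEAST m. q m x)" for x
  have M: "q (M x) x" if "x \<in> S.T 0" for x unfolding M_def using LeastI_ex[OF ex[OF that]] .
  have sM: "sdisc (S.conv 0) M"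
    unfolding M_def[abs_def] by (rule sdisc_least[OF sq]) (use ex in \<open>auto\<close>)
  define u where "u x \<longleftrightarrow> (\<forall>x'\<in>cyl x (M x). g x' < 1)" for x
  have self: "x \<in> cyl x m" if "x \<in> S.T 0" for x m using that unfolding cyl_def by blast
  have "sdisc (S.conv 0) u"
    unfolding sdisc_def
  proof (intro allI impI)
    fix xs x assume x: "S.conv 0 xs x"
    from sdiscD[OF sM, OF x] cyl[OF x, of "M x"] show "\<forall>\<^sub>F n in sequentially. u (xs n) = u x"
      by eventually_elim (simp add: u_def)
  qed
  moreover have "u x" if "x \<in> S.T 0" "g x \<le> 0" for x
    using M[OF that(1)] self[OF that(1), of "M x"] that(2) unfolding q_def u_def by fastforce
  moreover have "g x < 1" if "x \<in> S.T 0" "u x" for x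
    using that self[OF that(1)] unfolding u_def by blast
  ultimately show "\<exists>u. sdisc (S.conv 0) u \<and> (\<forall>x\<in>S.T 0. (g x \<le> 0 \<longrightarrow> u x) \<and> (u x \<longrightarrow> g x < 1))" by blast
qed

text \<open>Replaces illegal digits by 0, so that arbitrary integers decode to a maximal sequence.
  Index 0 carries the integer part, where every value is legal.\<close>

definition clip :: "nat \<Rightarrow> int \<Rightarrow> int" where
  "clip i d = (if i = 0 \<or> d \<in> {-1, 0, 1} then d else 0)"

lemma clip_max: "(\<lambda>i. Some (clip i (h i))) \<in> S0_max"
  by (simp add: S0_max_iff S0_def clip_def)

lemma clip_id: "x \<in> S0_max \<Longrightarrow> Some (clip i (the (x i))) = x i"
  by (cases i) (auto simp: S0_max_iff S0_def clip_def)

definition dg :: "(nat \<Rightarrow> int option) func \<Rightarrow> (nat \<Rightarrow> int option) func \<Rightarrow> nat \<Rightarrow> int" where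
  "dg f y i = the (app f y i)"

lemma dg_conv:
  assumes "S.conv (Suc k) fs f" "S.conv k ys y" "filterlim i at_top sequentially"
  shows "\<forall>\<^sub>F n in sequentially. dg (fs (i n)) (ys n) j = dg f y j"
proof -
  have "\<forall>\<^sub>F n in sequentially. app (fs (i n)) (ys n) j = app f y j"
    using assms unfolding S.conv.simps(2) by blast
  then show ?thesis by (rule eventually_mono) (simp add: dg_def)
qed

text \<open>The retraction carries a spare natural number j, which \<open>\<iota>\<close> recovers.\<close>

definition S_ret :: "nat \<Rightarrow> (nat \<Rightarrow> (nat \<Rightarrow> int option) func \<Rightarrow> nat option func) \<Rightarrow> (nat option func \<Rightarrow> nat) \<Rightarrow>
    (nat option func \<Rightarrow> (nat \<Rightarrow> int option) func) \<Rightarrow> bool" where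
  "S_ret k e \<iota> \<rho> \<longleftrightarrow> (\<forall>j. retracts (S.T k) (S.conv k) (N.T k) (N.conv k) (e j) \<rho>) \<and>
    sdisc (N.conv k) \<iota> \<and> (\<forall>j. \<forall>f\<in>S.T k. \<iota> (e j f) = j)"

text \<open>The retraction decodes a Kleene-Kreisel functional to a digit function
  \<open>H G\<close>, which may fail to be extensional, and applies the map of
  \<open>S_retraction\<close>. On codes, \<open>H\<close> returns the digits of the coded functional
  and is extensional, so that map reproduces the functional.\<close>

lemma S_retI:
  assumes d: "\<And>j. j \<le> Suc k \<Longrightarrow> S.dens j"
    and e: "\<And>j f. f \<in> S.T (Suc k) \<Longrightarrow> e j f \<in> N.T (Suc k)"
      "\<And>j fs f. S.conv (Suc k) fs f \<Longrightarrow> N.conv (Suc k) (\<lambda>n. e j (fs n)) (e j f)"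
    and \<iota>: "sdisc (N.conv (Suc k)) \<iota>" "\<And>j f. f \<in> S.T (Suc k) \<Longrightarrow> \<iota> (e j f) = j"
    and H: "\<And>G. G \<in> N.T (Suc k) \<Longrightarrow> mcont k (H G)" "\<And>Gs G. N.conv (Suc k) Gs G \<Longrightarrow> mconv k (\<lambda>n. H (Gs n)) (H G)"
      "\<And>j f y. \<lbrakk>f \<in> S.T (Suc k); y \<in> S.T k\<rbrakk> \<Longrightarrow> H (e j f) y = app f y"
  shows "\<exists>\<rho>. S_ret (Suc k) e \<iota> \<rho>"
proof -
  have ok: "S.conv_ok k" by (rule S.conv_okI) (use d in simp)
  obtain \<xi> where \<xi>: "\<forall>H. mcont k H \<longrightarrow> \<xi> H \<in> S.T (Suc k)"
    "\<forall>H. mcont k H \<longrightarrow> mext k H \<longrightarrow> (\<forall>y\<in>S.T k. app (\<xi> H) y = H y)"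
    "\<forall>Hs H. (\<forall>n. mcont k (Hs n)) \<longrightarrow> mcont k H \<longrightarrow> mconv k Hs H \<longrightarrow> S.conv (Suc k) (\<lambda>n. \<xi> (Hs n)) (\<xi> H)"
    by (rule exE[OF S_retraction[of k]], rule d, assumption) (elim conjE, rule that)
  have "retracts (S.T (Suc k)) (S.conv (Suc k)) (N.T (Suc k)) (N.conv (Suc k)) (e j) (\<lambda>G. \<xi> (H G))" for j
  proof (rule retractsI)
    show "S.conv (Suc k) (\<lambda>n. \<xi> (H (Gs n))) (\<xi> (H G))" if G: "N.conv (Suc k) Gs G" for Gs G
    proof -
      have "G \<in> N.T (Suc k)" "Gs n \<in> N.T (Suc k)" for n using N.conv_T[OF G] by blast+
      then show ?thesis by (intro \<xi>(3)[rule_format] H(1) H(2)[OF G])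
    qed
    show "S.conv (Suc k) (\<lambda>_. \<xi> (H (e j f))) f" if f: "f \<in> S.T (Suc k)" for f
    proof -
      have m: "mcont k (H (e j f))" by (rule H(1)[OF e(1)[OF f]])
      moreover have "mext k (H (e j f))"
        unfolding mext_def using H(3)[OF f] S_app_eqv[OF S.T_eqv[OF f]] by simp
      ultimately have eq: "app (\<xi> (H (e j f))) y = app f y" if "y \<in> S.T k" for y
        using \<xi>(2) H(3)[OF f that] that by metis
      show ?thesis
        unfolding S.conv.simps(2)
      proof (intro conjI allI impI)
        show "f \<in> S.T (Suc k)" "\<xi> (H (e j f)) \<in> S.T (Suc k)" using f \<xi>(1) m by blast+
        fix ys y l and i :: "nat \<Rightarrow> nat" assume y: "S.conv k ys y"
        have "\<forall>\<^sub>F n in sequentially. app f (ys n) l = app f y l"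
          using S.conv_app[OF S.conv_const_Suc[OF ok f] y] by blast
        then show "\<forall>\<^sub>F n in sequentially. app (\<xi> (H (e j f))) (ys n) l = app f y l"
          using eq S.conv_T[OF y] by simp
      qed
    qed
  qed (use e H \<xi>(1) in blast)+
  then show ?thesis unfolding S_ret_def using \<iota> by blast
qed

text \<open>The code of \<open>f\<close> sends \<open>z\<close> to a digit of \<open>f\<close> at
  the argument that \<open>z\<close> codes, with the digit index taken from the spare number of
  \<open>z\<close>. Argument and index are thus passed as one argument of level \<open>k\<close>,
  and the code stays at level \<open>k + 1\<close>.\<close>

lemma S_ret_Suc:
  assumes d: "\<And>j. j \<le> Suc k \<Longrightarrow> S.dens j" and ret: "S_ret k e \<iota> \<rho>"
  shows "\<exists>e \<iota> \<rho>. S_ret (Suc k) e \<iota> \<rho>"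
proof -
  have ok: "S.conv_ok k" by (rule S.conv_okI) (use d in simp)
  have "\<And>j. retracts (S.T k) (S.conv k) (N.T k) (N.conv k) (e j) \<rho>" using ret unfolding S_ret_def by blast
  note r = retractsD[OF this]
  have \<iota>: "sdisc (N.conv k) \<iota>" "\<And>j f. f \<in> S.T k \<Longrightarrow> \<iota> (e j f) = j" using ret unfolding S_ret_def by blast+
  define h where "h j f z = to_nat (j :: nat, dg f (\<rho> z) (\<iota> z))" for j f z
  define e' where "e' j f = N_real k (h j f)" for j f
  \<comment> \<open>Digit \<open>i\<close> at \<open>y\<close> is asked for at the code of
    \<open>y\<close> that carries \<open>i\<close>.\<close>
  define H where "H G y i = Some (clip i (snd (from_nat (nv G (e i y)) :: nat \<times> int)))" for G y i
  \<comment> \<open>Every answer carries the spare number \<open>j\<close>, so any fixed total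
    argument recovers it.\<close>
  obtain z0 where z0: "z0 \<in> N.T k" using N_dens[of k] N.X.bot_ex[of k] unfolding N.dens_def by blast
  define \<iota>' where "\<iota>' G = fst (from_nat (nv G z0) :: nat \<times> int)" for G
  have hc: "\<forall>\<^sub>F n in sequentially. h j (fs (i n)) (zs n) = h j f z"
    if "S.conv (Suc k) fs f" "N.conv k zs z" "filterlim i at_top sequentially" for j fs f zs z i
    using dg_conv[OF that(1) r(4)[OF that(2)] that(3), of "\<iota> z"] sdiscD[OF \<iota>(1), OF that(2)]
    by eventually_elim (simp add: h_def)
  have hs: "sdisc (N.conv k) (h j f)" if f: "f \<in> S.T (Suc k)" for j f
    unfolding sdisc_def using hc[OF S.conv_const_Suc[OF ok f] _ filterlim_ident] by blast
  have nv: "nv (e' j f) z = h j f z" if "f \<in> S.T (Suc k)" "z \<in> N.T k" for j f z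
    unfolding e'_def by (rule nv_real[OF hs[OF that(1)] that(2)])
  have eT: "e' j f \<in> N.T (Suc k)" if "f \<in> S.T (Suc k)" for j f unfolding e'_def by (rule N_real(1)[OF hs[OF that]])
  have Hc: "\<forall>\<^sub>F n in sequentially. H (Gs (i n)) (ys n) l = H G y l"
    if "N.conv (Suc k) Gs G" "S.conv k ys y" "filterlim i at_top sequentially" for Gs G ys y i l
    using nv_conv[OF that(1) r(3)[OF that(2), of l] that(3)] by eventually_elim (simp add: H_def)
  have "\<exists>\<rho>. S_ret (Suc k) e' \<iota>' \<rho>"
  proof (rule S_retI[OF d, where H = H])
    show "N.conv (Suc k) (\<lambda>n. e' j (fs n)) (e' j f)" if f: "S.conv (Suc k) fs f" for j fs f
    proof -
      have "f \<in> S.T (Suc k)" "fs n \<in> S.T (Suc k)" for n using S.conv_T[OF f] by blast+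
      then show ?thesis unfolding e'_def by (intro N_real_conv hs hc[OF f])
    qed
    show "sdisc (N.conv (Suc k)) \<iota>'"
      unfolding sdisc_def
    proof (intro allI impI)
      fix Gs G assume "N.conv (Suc k) Gs G"
      from nv_conv[OF this N.conv_const[OF N_conv_ok z0] filterlim_ident]
      show "\<forall>\<^sub>F n in sequentially. \<iota>' (Gs n) = \<iota>' G" by eventually_elim (simp add: \<iota>'_def)
    qed
    show "\<iota>' (e' j f) = j" if "f \<in> S.T (Suc k)" for j f
      unfolding \<iota>'_def nv[OF that z0] h_def by simp
    show "mcont k (H G)" if "G \<in> N.T (Suc k)" for G
      unfolding mcont_def
    proof (intro conjI ballI allI)
      show "H G y \<in> S0_max" for y unfolding H_def[abs_def] by (rule clip_max)
      show "sdisc (S.conv k) (\<lambda>y. H G y i)" for i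
        unfolding sdisc_def using Hc[OF N.conv_const[OF N_conv_ok that] _ filterlim_ident] by blast
    qed
    show "mconv k (\<lambda>n. H (Gs n)) (H G)" if "N.conv (Suc k) Gs G" for Gs G
      unfolding mconv_def using Hc[OF that] by blast
    show "H (e' j f) y = app f y" if f: "f \<in> S.T (Suc k)" and y: "y \<in> S.T k" for j f y
    proof
      fix i
      have "dg f (\<rho> (e i y)) i = dg f y i"
        using dg_conv[OF S.conv_const_Suc[OF ok f] r(5)[OF y, of i] filterlim_ident, of i] by simp
      then have "nv (e' j f) (e i y) = to_nat (j, dg f y i)"
        using nv[OF f r(1)[OF y]] \<iota>(2)[OF y] unfolding h_def by simp
      then show "H (e' j f) y i = app f y i"
        unfolding H_def dg_def by (simp add: clip_id[OF S_app_max[OF f y]])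
    qed
  qed (use eT in blast)+
  then show ?thesis by blast
qed

text \<open>With the integer part fixed, the entries come from a finite set, so the sequences lie in
  a compact product; convergence of integer entries is eventual equality.\<close>

lemma cylinder_compact:
  assumes x: "\<And>n. x n \<in> S0_max" "\<And>n. x n 0 = Some a"
  obtains \<sigma> y where "strict_mono (\<sigma> :: nat \<Rightarrow> nat)" "y \<in> S0_max" "y 0 = Some a"
    "\<And>i. \<forall>\<^sub>F n in sequentially. x (\<sigma> n) i = y i"
proof -
  define K where "K = PiE (UNIV :: nat set) (\<lambda>_. {real_of_int a, -1, 0, 1})"
  define w where "w n i = real_of_int (the (x n i))" for n i
  have "the (x n i) \<in> {a, -1, 0, 1}" for n i
  proof (cases i)
    case (Suc j)
    then obtain b where "x n i = Some b" using x(1)[of n] unfolding S0_max_iff by blast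
    then show ?thesis using x(1)[of n] Suc unfolding S0_max_iff S0_def by auto
  qed (simp add: x(2))
  then have "w n i \<in> {real_of_int a, -1, 0, 1}" for n i
    unfolding w_def by (metis (no_types, opaque_lifting) insert_iff of_int_0 of_int_1 of_int_minus singletonD)
  then have wK: "w n \<in> K" for n unfolding K_def by (simp only: PiE_UNIV_domain Pi_iff) blast
  have "compact K"
    unfolding K_def compactin_euclidean_iff[symmetric] euclidean_product_topology[symmetric] compactin_PiE
    by (simp add: finite_imp_compact)
  then obtain l \<sigma> where l: "l \<in> K" "strict_mono \<sigma>" "(w \<circ> \<sigma>) \<longlonglongrightarrow> l"
    using wK unfolding compact_eq_seq_compact_metric seq_compact_def by blast
  define y where "y i = Some \<lfloor>l i\<rfloor>" for i
  have ly: "l i = real_of_int \<lfloor>l i\<rfloor>" for i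
  proof -
    have "l i \<in> {real_of_int a, -1, 0, 1}" using l(1) unfolding K_def by blast
    then show ?thesis by auto
  qed
  have ev: "\<forall>\<^sub>F n in sequentially. x (\<sigma> n) i = y i" for i
  proof -
    have "(\<lambda>n. w (\<sigma> n) i) \<longlonglongrightarrow> l i"
      using continuous_on_tendsto_compose[OF continuous_on_product_coordinates[of i] l(3)] by (simp add: o_def)
    then have "\<forall>\<^sub>F n in sequentially. dist (w (\<sigma> n) i) (l i) < 1" by (rule tendstoD) simp
    then show ?thesis
    proof eventually_elim
      case (elim n)
      then have "\<bar>real_of_int (the (x (\<sigma> n) i) - \<lfloor>l i\<rfloor>)\<bar> < 1"
        using ly[of i] unfolding w_def dist_real_def by simp
      then have "the (x (\<sigma> n) i) = \<lfloor>l i\<rfloor>" by linarith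
      moreover have "x (\<sigma> n) i \<noteq> None" using x(1) unfolding S0_max_iff by blast
      ultimately show ?case unfolding y_def by force
    qed
  qed
  have yd: "\<exists>n. x (\<sigma> n) i = y i" for i
    using eventually_happens'[OF sequentially_bot ev[of i]] .
  have "b \<in> {-1, 0, 1}" if b: "y (Suc i) = Some b" for i b
  proof -
    obtain n where "x (\<sigma> n) (Suc i) = Some b" using yd[of "Suc i"] b by metis
    moreover have "x (\<sigma> n) \<in> S0" using x(1) unfolding S0_max_iff by blast
    ultimately show ?thesis unfolding S0_def by blast
  qed
  then have "y \<in> S0_max" unfolding S0_max_iff S0_def by (simp add: y_def)
  moreover have "y 0 = Some a" using yd[of 0] x(2) by metis
  ultimately show thesis using that[OF l(2) _ _ ev] by blast
qed

text \<open>A continuous function on a cylinder is determined by a modulus and by the values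
  at finite sequences continued by zeros.\<close>

definition pad :: "int list \<Rightarrow> nat \<Rightarrow> int option" where
  "pad q = (\<lambda>i. Some (clip i (if i < length q then q ! i else 0)))"

definition prefix :: "(nat \<Rightarrow> int option) \<Rightarrow> nat \<Rightarrow> int list" where
  "prefix x m = map (\<lambda>i. the (x i)) [0..<m]"

definition modulus :: "(nat \<Rightarrow> int option) func \<Rightarrow> int \<Rightarrow> nat \<Rightarrow> nat \<Rightarrow> bool" where
  "modulus f a i m \<longleftrightarrow> (\<forall>x\<in>S0_max. x 0 = Some a \<longrightarrow> dg f (Val x) i = dg f (Val (pad (prefix x m))) i)"

lemma pad_max: "pad q \<in> S0_max"
  unfolding pad_def by (rule clip_max)

lemma pad_prefix: "\<lbrakk>x \<in> S0_max; i < m\<rbrakk> \<Longrightarrow> pad (prefix x m) i = x i"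
  by (simp add: pad_def prefix_def clip_id)

lemma S_conv_Val: "S.conv 0 (\<lambda>n. Val (xs n)) (Val x) \<longleftrightarrow> x \<in> S0_max \<and> (\<forall>n. xs n \<in> S0_max) \<and>
    (\<forall>i. \<forall>\<^sub>F n in sequentially. xs n i = x i)"
  by (simp add: S_T0)

lemma prefix_conv:
  assumes "\<And>i. \<forall>\<^sub>F n in sequentially. xs n i = x i"
  shows "\<forall>\<^sub>F n in sequentially. prefix (xs n) m = prefix x m"
proof -
  have "\<forall>\<^sub>F n in sequentially. \<forall>i\<in>{..<m}. xs n i = x i"
    using assms by (simp add: eventually_ball_finite_distrib)
  then show ?thesis by eventually_elim (simp add: prefix_def)
qed

text \<open>If \<open>m\<close> is a modulus of \<open>f\<close> but fails for infinitely many
  \<open>fs n\<close>, compactness gives a convergent subsequence of counterexamples, whose limit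
  contradicts the modulus of \<open>f\<close>. If \<open>m\<close> fails for \<open>f\<close>, a
  single counterexample persists.\<close>

lemma modulus_conv:
  assumes f: "S.conv (Suc 0) fs f"
  shows "\<forall>\<^sub>F n in sequentially. modulus (fs n) a i m = modulus f a i m"
proof (cases "modulus f a i m")
  case True
  have "\<forall>\<^sub>F n in sequentially. modulus (fs n) a i m"
  proof (rule ccontr)
    assume "\<not> ?thesis"
    then obtain r :: "nat \<Rightarrow> nat" where r: "strict_mono r" "\<And>n. \<not> modulus (fs (r n)) a i m"
      using not_eventually_sequentiallyD by blast
    then have "\<forall>n. \<exists>x. x \<in> S0_max \<and> x 0 = Some a \<and> dg (fs (r n)) (Val x) i \<noteq> dg (fs (r n)) (Val (pad (prefix x m))) i"
      unfolding modulus_def by blast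
    then obtain x where x: "\<And>n. x n \<in> S0_max" "\<And>n. x n 0 = Some a"
      "\<And>n. dg (fs (r n)) (Val (x n)) i \<noteq> dg (fs (r n)) (Val (pad (prefix (x n) m))) i" by metis
    obtain \<sigma> y where \<sigma>: "strict_mono \<sigma>" "y \<in> S0_max" "y 0 = Some a" "\<And>i. \<forall>\<^sub>F n in sequentially. x (\<sigma> n) i = y i"
      by (rule cylinder_compact[of x, OF x(1,2)]) blast
    have lim: "filterlim (\<lambda>n. r (\<sigma> n)) at_top sequentially"
      using filterlim_subseq[OF strict_mono_o[OF r(1) \<sigma>(1)]] by (simp add: o_def)
    have "\<forall>\<^sub>F n in sequentially. dg (fs (r (\<sigma> n))) (Val (x (\<sigma> n))) i = dg f (Val y) i"
      by (rule dg_conv[OF f _ lim, of "\<lambda>n. Val (x (\<sigma> n))"]) (use x(1) \<sigma>(2,4) in \<open>simp only: S_conv_Val\<close>, blast)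
    moreover have "\<forall>\<^sub>F n in sequentially. dg (fs (r (\<sigma> n))) (Val (pad (prefix (x (\<sigma> n)) m))) i = dg f (Val (pad (prefix y m))) i"
    proof (rule dg_conv[OF f _ lim, of "\<lambda>n. Val (pad (prefix (x (\<sigma> n)) m))"])
      have "\<forall>\<^sub>F n in sequentially. pad (prefix (x (\<sigma> n)) m) l = pad (prefix y m) l" for l
        using prefix_conv[of "\<lambda>n. x (\<sigma> n)" y m, OF \<sigma>(4)] by eventually_elim simp
      then show "S.conv 0 (\<lambda>n. Val (pad (prefix (x (\<sigma> n)) m))) (Val (pad (prefix y m)))"
        unfolding S_conv_Val using pad_max by blast
    qed
    ultimately have "\<forall>\<^sub>F n in sequentially. False"
    proof eventually_elim
      case (elim n)
      then show ?case using x(3)[of "\<sigma> n"] True \<sigma>(2,3) unfolding modulus_def by metis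
    qed
    then show False by simp
  qed
  then show ?thesis using True by simp
next
  case False
  then obtain x where x: "x \<in> S0_max" "x 0 = Some a" "dg f (Val x) i \<noteq> dg f (Val (pad (prefix x m))) i"
    unfolding modulus_def by blast
  have c: "S.conv 0 (\<lambda>_. Val z) (Val z)" if "z \<in> S0_max" for z using that unfolding S_conv_Val by simp
  from dg_conv[OF f c[OF x(1)] filterlim_ident, of i] dg_conv[OF f c[OF pad_max[of "prefix x m"]] filterlim_ident, of i]
  show ?thesis
  proof eventually_elim
    case (elim n)
    then have "\<not> modulus (fs n) a i m" unfolding modulus_def using x by metis
    then show ?case using False by simp
  qed
qed

text \<open>Uniform continuity on a compact cylinder: a limit point of counterexamples for growing
  \<open>m\<close> would contradict continuity there.\<close>

lemma modulus_ex:
  assumes f: "f \<in> S.T (Suc 0)"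
  shows "\<exists>m. modulus f a i m"
proof (rule ccontr)
  assume "\<not> ?thesis"
  then have "\<forall>m. \<exists>x. x \<in> S0_max \<and> x 0 = Some a \<and> dg f (Val x) i \<noteq> dg f (Val (pad (prefix x m))) i"
    unfolding modulus_def by blast
  then obtain x where x: "\<And>n. x n \<in> S0_max" "\<And>n. x n 0 = Some a"
    "\<And>n. dg f (Val (x n)) i \<noteq> dg f (Val (pad (prefix (x n) n))) i" by metis
  obtain \<sigma> y where \<sigma>: "strict_mono \<sigma>" "y \<in> S0_max" "y 0 = Some a" "\<And>i. \<forall>\<^sub>F n in sequentially. x (\<sigma> n) i = y i"
    by (rule cylinder_compact[of x, OF x(1,2)]) blast
  have cf: "S.conv (Suc 0) (\<lambda>_. f) f" by (rule S.conv_const_Suc[OF S.conv_ok_0 f])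
  have "\<forall>\<^sub>F n in sequentially. dg f (Val (x (\<sigma> n))) i = dg f (Val y) i"
    by (rule dg_conv[OF cf _ filterlim_ident, of "\<lambda>n. Val (x (\<sigma> n))"])
      (use x(1) \<sigma>(2,4) in \<open>simp only: S_conv_Val\<close>, blast)
  moreover have "\<forall>\<^sub>F n in sequentially. dg f (Val (pad (prefix (x (\<sigma> n)) (\<sigma> n)))) i = dg f (Val y) i"
  proof (rule dg_conv[OF cf _ filterlim_ident, of "\<lambda>n. Val (pad (prefix (x (\<sigma> n)) (\<sigma> n)))"])
    have "\<forall>\<^sub>F n in sequentially. pad (prefix (x (\<sigma> n)) (\<sigma> n)) l = y l" for l
      using \<sigma>(4)[of l] eventually_gt_at_top[of l]
    proof eventually_elim
      case (elim n)
      then have "l < \<sigma> n" using seq_suble[OF \<sigma>(1), of n] by simp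
      then show ?case using elim(1) pad_prefix[OF x(1)] by simp
    qed
    then show "S.conv 0 (\<lambda>n. Val (pad (prefix (x (\<sigma> n)) (\<sigma> n)))) (Val y)"
      unfolding S_conv_Val using pad_max \<sigma>(2) by blast
  qed
  ultimately have "\<forall>\<^sub>F n in sequentially. False"
    by eventually_elim (use x(3) in metis)
  then show False by simp
qed

text \<open>A functional of level 1 is coded by a sequence of numbers that answers two kinds of
  questions: the least modulus for digit \<open>i\<close> on the cylinder with integer part
  \<open>a\<close>, and digit \<open>i\<close> at a finite sequence continued by zeros. A digit at
  an arbitrary argument is found by asking for the modulus and then at the prefix of that length.
  The construction of \<open>S_ret_Suc\<close> cannot start at level 0, since digit sequences are no
  retract of the naturals.\<close>

lemma S_ret_1:
  assumes d: "\<And>j. j \<le> Suc 0 \<Longrightarrow> S.dens j"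
  shows "\<exists>e \<iota> \<rho>. S_ret (Suc 0) e \<iota> \<rho>"
proof -
  define V where "V f s = (case s of Inl (a, i) \<Rightarrow> int (LEAST m. modulus f a i m) | Inr (q, i) \<Rightarrow> dg f (Val (pad q)) i)"
    for f and s :: "int \<times> nat + int list \<times> nat"
  define h where "h j f z = to_nat (j :: nat, V f (from_nat (the (val z))))" for j f and z :: "nat option func"
  define e where "e j f = N_real 0 (h j f)" for j f
  define ask where "ask G s = (from_nat (nv G (Val (Some (to_nat s)))) :: nat \<times> int)"
    for G and s :: "int \<times> nat + int list \<times> nat"
  define mo where "mo G x i = nat (snd (ask G (Inl (the (x 0), i))))" for G i and x :: "nat \<Rightarrow> int option"
  define H where "H G y i = Some (clip i (snd (ask G (Inr (prefix (val y) (mo G (val y) i), i)))))"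
    for G i and y :: "(nat \<Rightarrow> int option) func"
  define s0 :: "int \<times> nat + int list \<times> nat" where "s0 = Inl (0, 0)"
  define \<iota> where "\<iota> G = fst (ask G s0)" for G
  have z: "Val (Some i) \<in> N.T 0" for i by (simp add: N_T0)
  have Vc: "\<forall>\<^sub>F n in sequentially. V (fs n) s = V f s" if f: "S.conv (Suc 0) fs f" for fs f s
  proof (cases s)
    case (Inl p)
    obtain a i where p: "p = (a, i)" by fastforce
    have fT: "f \<in> S.T (Suc 0)" using S.conv_T[OF f] by blast
    \<comment> \<open>The least modulus is stable along the sequence because only the finitely many
      candidates up to it have to be compared.\<close>
    define M where "M = (LEAST m. modulus f a i m)"
    have "\<forall>\<^sub>F n in sequentially. \<forall>m\<in>{..M}. modulus (fs n) a i m = modulus f a i m"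
      using modulus_conv[OF f] by (simp add: eventually_ball_finite_distrib)
    then show ?thesis
    proof eventually_elim
      case (elim n)
      have "modulus f a i M" unfolding M_def by (rule LeastI_ex[OF modulus_ex[OF fT]])
      then have "(LEAST m. modulus (fs n) a i m) = M"
        using elim not_less_Least[of _ "modulus f a i"] unfolding M_def[symmetric]
        by (intro Least_equality) (auto simp: not_less[symmetric])
      then show ?case unfolding V_def Inl p M_def by simp
    qed
  next
    case (Inr p)
    obtain q i where p: "p = (q, i)" by fastforce
    have "S.conv 0 (\<lambda>_. Val (pad q)) (Val (pad q))" unfolding S_conv_Val using pad_max by simp
    from dg_conv[OF f this filterlim_ident, of i] show ?thesis by eventually_elim (simp add: V_def Inr p)
  qed
  have hs: "sdisc (N.conv 0) (h j f)" for j f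
    unfolding sdisc_def
  proof (intro allI impI)
    fix zs z assume "N.conv 0 zs z"
    then have "\<forall>\<^sub>F n in sequentially. val (zs n) = val z" by simp
    then show "\<forall>\<^sub>F n in sequentially. h j f (zs n) = h j f z" by eventually_elim (simp add: h_def)
  qed
  have ask: "ask (e j f) s = (j, V f s)" for j f s
    unfolding ask_def e_def nv_real[OF hs z] h_def by simp
  have askc: "\<forall>\<^sub>F n in sequentially. ask (Gs (i n)) s = ask G s"
    if "N.conv (Suc 0) Gs G" "filterlim i at_top sequentially" for Gs G s i
    using nv_conv[OF that(1) N.conv_const[OF N_conv_ok z] that(2), of "to_nat s"]
    by eventually_elim (simp add: ask_def)
  have Hc: "\<forall>\<^sub>F n in sequentially. H (Gs (i n)) (ys n) l = H G y l"
    if G: "N.conv (Suc 0) Gs G" and y: "S.conv 0 ys y" and i: "filterlim i at_top sequentially" for Gs G ys y i l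
  proof -
    have d: "\<forall>\<^sub>F n in sequentially. val (ys n) i = val y i" for i using y unfolding S_conv_0 by blast
    have "\<forall>\<^sub>F n in sequentially. mo (Gs (i n)) (val (ys n)) l = mo G (val y) l"
      using d[of 0] askc[OF G i, of "Inl (the (val y 0), l)"] by eventually_elim (simp add: mo_def)
    then show ?thesis
      using askc[OF G i, of "Inr (prefix (val y) (mo G (val y) l), l)"] prefix_conv[of "\<lambda>n. val (ys n)" "val y" "mo G (val y) l", OF d]
      by eventually_elim (simp add: H_def)
  qed
  have "\<exists>\<rho>. S_ret (Suc 0) e \<iota> \<rho>"
  proof (rule S_retI[OF d, where H = H])
    show "e j f \<in> N.T (Suc 0)" for j f unfolding e_def by (rule N_real(1)[OF hs])
    show "N.conv (Suc 0) (\<lambda>n. e j (fs n)) (e j f)" if f: "S.conv (Suc 0) fs f" for j fs f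
      unfolding e_def
    proof (rule N_real_conv[OF hs hs])
      fix zs z and i :: "nat \<Rightarrow> nat" assume z: "N.conv 0 zs z" and i: "filterlim i at_top sequentially"
      have "\<forall>\<^sub>F n in sequentially. val (zs n) = val z" using z by simp
      then show "\<forall>\<^sub>F n in sequentially. h j (fs (i n)) (zs n) = h j f z"
        using eventually_compose_filterlim[OF Vc[OF f, of "from_nat (the (val z))"] i]
        by eventually_elim (simp add: h_def)
    qed
    show "sdisc (N.conv (Suc 0)) \<iota>"
      unfolding sdisc_def
    proof (intro allI impI)
      fix Gs G assume "N.conv (Suc 0) Gs G"
      from askc[OF this filterlim_ident, of s0]
      show "\<forall>\<^sub>F n in sequentially. \<iota> (Gs n) = \<iota> G" by eventually_elim (simp add: \<iota>_def)
    qed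
    show "\<iota> (e j f) = j" for j f unfolding \<iota>_def ask by simp
    show "mcont 0 (H G)" if "G \<in> N.T (Suc 0)" for G
      unfolding mcont_def
    proof (intro conjI ballI allI)
      show "H G y \<in> S0_max" for y unfolding H_def[abs_def] by (rule clip_max)
      show "sdisc (S.conv 0) (\<lambda>y. H G y i)" for i
        unfolding sdisc_def using Hc[OF N.conv_const[OF N_conv_ok that] _ filterlim_ident] by blast
    qed
    show "mconv 0 (\<lambda>n. H (Gs n)) (H G)" if "N.conv (Suc 0) Gs G" for Gs G
      unfolding mconv_def using Hc[OF that] by blast
    show "H (e j f) y = app f y" if f: "f \<in> S.T (Suc 0)" and y: "y \<in> S.T 0" for j f y
    proof
      fix i
      obtain x where x: "y = Val x" "x \<in> S0_max" using y unfolding S_T0 by blast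
      obtain a where a: "x 0 = Some a" using x(2) unfolding S0_max_iff by blast
      define M where "M = (LEAST m. modulus f a i m)"
      have "modulus f a i M" unfolding M_def by (rule LeastI_ex[OF modulus_ex[OF f]])
      then have "dg f y i = dg f (Val (pad (prefix x M))) i" unfolding modulus_def using x a by blast
      moreover have "mo (e j f) x i = M" unfolding mo_def ask a V_def M_def by simp
      ultimately have "H (e j f) y i = Some (clip i (dg f y i))" unfolding H_def ask x(1) V_def by simp
      then show "H (e j f) y i = app f y i" unfolding dg_def by (simp add: clip_id[OF S_app_max[OF f y]])
    qed
  qed
  then show ?thesis by blast
qed

text \<open>Separation at level \<open>k\<close> gives density at level \<open>k + 1\<close>,
  density gives the retraction there, and the retraction transports separation from the
  Kleene-Kreisel functionals of level \<open>k + 1\<close>. The condition \<open>k > 0\<close>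
  reflects that level 0 has no retraction.\<close>

lemma S_dens_sepa:
  assumes sp: "sepa (N.T n) (N.conv n)"
  shows "k \<le> n \<Longrightarrow> (\<forall>j\<le>k. S.dens j) \<and> sepa (S.T k) (S.conv k) \<and> (k > 0 \<longrightarrow> (\<exists>e \<iota> \<rho>. S_ret k e \<iota> \<rho>))"
proof (induction k)
  case 0
  then show ?case using S_dens_0 sepa_S0 by (simp del: S.conv.simps)
next
  case (Suc k)
  then have IH: "\<And>j. j \<le> k \<Longrightarrow> S.dens j" "sepa (S.T k) (S.conv k)" "k > 0 \<Longrightarrow> \<exists>e \<iota> \<rho>. S_ret k e \<iota> \<rho>" by auto
  have d: "\<And>j. j \<le> Suc k \<Longrightarrow> S.dens j" using IH(1) S_dens_Suc[OF IH(1,2)] le_Suc_eq by blast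
  have ex: "\<exists>e \<iota> \<rho>. S_ret (Suc k) e \<iota> \<rho>"
  proof (cases "k = 0")
    case True
    then show ?thesis using S_ret_1 d by blast
  next
    case False
    then show ?thesis using IH(3) S_ret_Suc[OF d] by blast
  qed
  then obtain e \<iota> \<rho> where "S_ret (Suc k) e \<iota> \<rho>" by blast
  then have "retracts (S.T (Suc k)) (S.conv (Suc k)) (N.T (Suc k)) (N.conv (Suc k)) (e 0) \<rho>"
    unfolding S_ret_def by blast
  then have "sepa (S.T (Suc k)) (S.conv (Suc k))"
    by (rule sepa_retract[OF sepa_N_down[OF Suc.prems sp]])
  then show ?case using d ex by blast
qed

section \<open>The smoothened hierarchy represents the continuous functionals\<close>

interpretation SR: real_hier S0 "(\<subseteq>\<^sub>m)" S0_fin S_dom S_sim0 S_sim S_eq0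
  "\<lambda>xs x. \<forall>i. \<forall>\<^sub>F n in sequentially. xs n i = x i" "\<lambda>x. x" "\<lambda>x. x" S_val
proof unfold_locales
  fix xs :: "nat \<Rightarrow> nat \<Rightarrow> int option" and x
  assume "\<forall>i. \<forall>\<^sub>F n in sequentially. xs n i = x i" "S_eq0 x x" "\<And>n. S_eq0 (xs n) (xs n)"
  then show "(\<lambda>n. S_val (xs n)) \<longlonglongrightarrow> S_val x" by (intro S_val_tendsto) (auto simp: S_eq0_iff)
qed (auto simp: S_eq0_iff)

text \<open>Digits for all members of the sequence are chosen together by \<open>lift_param\<close>,
  so that convergence of the values becomes convergence digit by digit, as \<open>S.realize\<close>
  requires.\<close>

lemma S_param:
  assumes d: "\<And>j. j \<le> k \<Longrightarrow> S.dens j" and sp: "sepa (S.T k) (S.conv k)"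
  shows "SR.param_realizable k"
  unfolding SR.param_realizable_def
proof (intro allI impI)
  have ok: "S.conv_ok k" by (rule S.conv_okI) (use d in simp)
  fix Gs :: "nat \<Rightarrow> _" and G assume Gs: "\<forall>n. scont (S.conv k) (Gs n)" and G: "scont (S.conv k) G"
    and inv: "\<forall>n. \<forall>y\<in>S.T k. \<forall>z\<in>S.T k. S.eqv k y z \<longrightarrow> Gs n y = Gs n z"
      "\<forall>y\<in>S.T k. \<forall>z\<in>S.T k. S.eqv k y z \<longrightarrow> G y = G z"
    and lim: "\<forall>ys y i. S.conv k ys y \<longrightarrow> filterlim i at_top sequentially \<longrightarrow> (\<lambda>n. Gs (i n) (ys n)) \<longlonglongrightarrow> G y"
  have conv: "y \<in> S.T k" "ys n \<in> S.T k" if "S.conv k ys y" for ys y n using S.conv_T[OF that] by auto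
  obtain Fs F where F: "\<And>n y. y \<in> S.T k \<Longrightarrow> Fs n y \<in> S0_max" "\<And>y. y \<in> S.T k \<Longrightarrow> F y \<in> S0_max"
    "\<And>n y. y \<in> S.T k \<Longrightarrow> S_val (Fs n y) = Gs n y" "\<And>y. y \<in> S.T k \<Longrightarrow> S_val (F y) = G y"
    "\<And>n j. sdisc (S.conv k) (\<lambda>y. Fs n y j)" "\<And>j. sdisc (S.conv k) (\<lambda>y. F y j)"
    "\<And>ys y i j. \<lbrakk>S.conv k ys y; filterlim i at_top sequentially\<rbrakk> \<Longrightarrow> \<forall>\<^sub>F n in sequentially. Fs (i n) (ys n) j = F y j"
    by (rule lift_param[where cv = "S.conv k" and X = "S.T k" and gs = Gs and g = G, OF sp],
      erule conv(1), erule conv(2), rule spec[OF Gs], rule G, rule lim[rule_format], assumption, assumption)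
      (assumption | rule that)+
  have c: "S.cont k H" if H: "\<And>y. y \<in> S.T k \<Longrightarrow> H y \<in> S0_max" "\<And>j. sdisc (S.conv k) (\<lambda>y. H y j)"
    "\<And>y z. \<lbrakk>y \<in> S.T k; z \<in> S.T k; S.eqv k y z\<rbrakk> \<Longrightarrow> S_val (H y) = S_val (H z)" for H
    unfolding S.cont_def
  proof (intro conjI ballI allI impI)
    show "H y \<in> S0" if "y \<in> S.T k" for y using H(1)[OF that] unfolding S0_max_def by blast
    show "S_eq0 (H y) (H z)" if "y \<in> S.T k" "z \<in> S.T k" "S.eqv k y z" for y z
      using H(1)[OF that(1)] H(1)[OF that(2)] H(3)[OF that] unfolding S_eq0_iff by blast
    show "\<forall>\<^sub>F n in sequentially. H (ys n) i = H y i"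
      if "y \<in> S.T k" "\<forall>n. ys n \<in> S.T k" "S.scv k ys y" for ys y i
      using sdiscD[OF H(2), OF S.scv_conv[OF ok that(1) spec[OF that(2)] that(3)]] .
  qed
  have cs: "S.cont k (Fs n)" for n by (rule c[OF F(1) F(5)], assumption) (simp only: F(3), rule inv(1)[rule_format])
  have c0: "S.cont k F" by (rule c[OF F(2) F(6)], assumption) (simp only: F(4), rule inv(2)[rule_format])
  have l: "\<forall>j. \<forall>\<^sub>F n in sequentially. Fs (i n) (ys n) j = F y j"
    if "y \<in> S.T k" "\<And>n. ys n \<in> S.T k" "S.scv k ys y" "filterlim i at_top sequentially" for ys y i
    using F(7)[OF S.scv_conv[OF ok that(1-3)] that(4)] by blast
  obtain fs f where f: "\<And>n. fs n \<in> S.T (Suc k)" "f \<in> S.T (Suc k)" "S.scv (Suc k) fs f"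
    "\<And>n y. y \<in> S.T k \<Longrightarrow> S_eq0 (app (fs n) y) (Fs n y)" "\<And>y. y \<in> S.T k \<Longrightarrow> S_eq0 (app f y) (F y)"
    by (rule S.realize[OF d cs c0 l, OF order_refl]) (assumption | rule that)+
  have "S.conv (Suc k) fs f" by (rule S.scv_conv_Suc[OF ok f(2,1,3)])
  moreover have "\<forall>n. \<forall>y\<in>S.T k. S_val (app (fs n) y) = Gs n y" "\<forall>y\<in>S.T k. S_val (app f y) = G y"
    using f(4,5) F(3,4) by (auto simp: S_eq0_iff)
  ultimately show "\<exists>fs f. S.conv (Suc k) fs f \<and> (\<forall>n. \<forall>y\<in>S.T k. S_val (app (fs n) y) = Gs n y) \<and>
      (\<forall>y\<in>S.T k. S_val (app f y) = G y)" by blast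
qed

text \<open>This is \<open>lift_param\<close> over a one-point space. The digits have to be chosen
  for the whole sequence, since convergence of values does not make arbitrary digit representations
  converge.\<close>

lemma S_rep_conv:
  assumes x: "xs \<longlonglongrightarrow> x"
  obtains ds d where "\<And>n. ds n \<in> S0_max" "d \<in> S0_max" "\<And>n. S_val (ds n) = xs n" "S_val d = x"
    "\<And>i. \<forall>\<^sub>F n in sequentially. ds n i = d i"
proof -
  let ?cv = "\<lambda>(ys :: nat \<Rightarrow> unit) (y :: unit). True"
  have sp: "sepa UNIV ?cv"
    unfolding sepa_def
  proof (intro allI impI)
    fix g :: "unit \<Rightarrow> real"
    show "\<exists>u. sdisc ?cv u \<and> (\<forall>x\<in>UNIV. (g x \<le> 0 \<longrightarrow> u x) \<and> (u x \<longrightarrow> g x < 1))"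
      by (intro exI[of _ "\<lambda>x. g x \<le> 0"]) (auto simp: sdisc_def)
  qed
  have c: "scont ?cv (\<lambda>_. a)" for a by (simp add: scont_def)
  have l: "(\<lambda>n. xs (i n)) \<longlonglongrightarrow> x" if "filterlim i at_top sequentially" for i
    using filterlim_compose[OF x that] .
  obtain Fs F where F: "\<And>n y. y \<in> (UNIV :: unit set) \<Longrightarrow> Fs n y \<in> S0_max" "\<And>y. y \<in> (UNIV :: unit set) \<Longrightarrow> F y \<in> S0_max"
    "\<And>n y. y \<in> (UNIV :: unit set) \<Longrightarrow> S_val (Fs n y) = xs n" "\<And>y. y \<in> (UNIV :: unit set) \<Longrightarrow> S_val (F y) = x"
    "\<And>n j. sdisc ?cv (\<lambda>y. Fs n y j)" "\<And>j. sdisc ?cv (\<lambda>y. F y j)"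
    "\<And>ys y i j. \<lbrakk>?cv ys y; filterlim i at_top sequentially\<rbrakk> \<Longrightarrow> \<forall>\<^sub>F n in sequentially. Fs (i n) (ys n) j = F y j"
    by (rule lift_param[where cv = ?cv and X = UNIV and gs = "\<lambda>n _. xs n" and g = "\<lambda>_. x", OF sp _ _ c c l]) auto
  show thesis
    by (rule that[of "\<lambda>n. Fs n ()" "F ()"]) (use F(1-4) F(7)[OF TrueI filterlim_ident] in auto)
qed

lemma S_char_0: "SR.char 0"
  unfolding SR.char_def
proof (intro conjI allI impI ballI)
  have T0: "Val x \<in> S.T 0" if "x \<in> S0_max" for x using that by (simp add: S_T0)
  have vT: "val y \<in> S0_max" if "y \<in> S.T 0" for y using that by (auto simp: S_T0)
  show "rho_S 0 ` S.T 0 = ctf 0"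
  proof
    show "ctf 0 \<subseteq> rho_S 0 ` S.T 0"
    proof
      fix c assume "c \<in> ctf 0"
      then obtain t where c: "c = Val t" by auto
      obtain ds d where "d \<in> S0_max" "S_val d = t" by (rule S_rep_conv[OF tendsto_const[of t]])
      then show "c \<in> rho_S 0 ` S.T 0" using T0[of d] c by (auto intro!: image_eqI[of _ _ "Val d"])
    qed
  qed auto
  show "rho_S 0 x = rho_S 0 y \<longleftrightarrow> S.eqv 0 x y" if "x \<in> S.T 0" "y \<in> S.T 0" for x y
    using vT[OF that(1)] vT[OF that(2)] by (simp add: S_eq0_iff)
  show "ctf_conv 0 (\<lambda>n. rho_S 0 (ys n)) (rho_S 0 y)" if "S.conv 0 ys y" for ys y
  proof -
    have y: "y \<in> S.T 0" "ys n \<in> S.T 0" "\<forall>\<^sub>F n in sequentially. val (ys n) i = val y i" for n i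
      using that unfolding S_conv_0 by blast+
    show ?thesis using S_val_tendsto[OF vT[OF y(2)] vT[OF y(1)] y(3)] by simp
  qed
  show "\<exists>ys y. S.conv 0 ys y \<and> (\<forall>n. rho_S 0 (ys n) = cs n) \<and> rho_S 0 y = c"
    if c: "\<forall>n. cs n \<in> ctf 0" "c \<in> ctf 0" "ctf_conv 0 cs c" for cs c
  proof -
    have v: "cs n = Val (val (cs n))" "c = Val (val c)" for n using c(1,2) by (metis ctf.simps(1) func.sel(1) image_iff)+
    have "(\<lambda>n. val (cs n)) \<longlonglongrightarrow> val c" using c(3) by simp
    then obtain ds d where d: "\<And>n. ds n \<in> S0_max" "d \<in> S0_max" "\<And>n. S_val (ds n) = val (cs n)" "S_val d = val c"
      "\<And>i. \<forall>\<^sub>F n in sequentially. ds n i = d i" by (rule S_rep_conv) blast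
    have "S.conv 0 (\<lambda>n. Val (ds n)) (Val d)" using d(1,2,5) unfolding S_conv_Val by blast
    moreover have "\<forall>n. rho_S 0 (Val (ds n)) = cs n" "rho_S 0 (Val d) = c" using d(3,4) v by simp_all
    ultimately show ?thesis by blast
  qed
qed

lemma S_char:
  assumes sp: "sepa (N.T n) (N.conv n)"
  shows "k \<le> n \<Longrightarrow> SR.char k"
proof (induction k)
  case (Suc k)
  then have k: "k \<le> n" by simp
  have d: "\<And>j. j \<le> k \<Longrightarrow> S.dens j" "sepa (S.T k) (S.conv k)" using S_dens_sepa[OF sp k] by blast+
  show ?case
    by (rule SR.char_Suc[OF S.conv_okI Suc.IH[OF k] S_param[OF d]]) (use d(1) in auto)
qed (rule S_char_0)

theorem theorem4p18:
  fixes n :: nat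
  assumes "zero_dimensional (R_top (CtN n))"
  shows "CtS (Suc n) = CtE (Suc n)"
proof -
  have sp: "sepa (N.T n) (N.conv n)" by (rule sepa_N[OF assms])
  have d: "\<And>j. j \<le> n \<Longrightarrow> S.dens j" "sepa (S.T n) (S.conv n)" using S_dens_sepa[OF sp order_refl] by blast+
  have "CtS (Suc n) = ctf (Suc n)"
    unfolding CtS.simps
    by (rule SR.rh_image[OF S.conv_okI S_char[OF sp order_refl] S_param[OF d]]) (use d(1) in auto)
  then show ?thesis using CtE_Suc by simp
qed

end
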